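(* Let $\Omega\subset\mathbb C^n$ be a bounded strongly convex domain, and let $$\widetilde\omega_\Omega(z)=\Vert e^{\langle z,\cdot\rangle}\Vert^{-2}_{L^2(\sigma_\Omega)}(dd^cH_\Omega)^n(z),\qquad \nu_\Omega(z)=e^{-2H_\Omega(z)}\Vert z\Vert^{n-\frac12}(dd^cH_\Omega)^n(z),\qquad z\in\mathbb C^n .$$ Then the identity map is a normed space isomorphism between $A^2(\mathbb C^n,\widetilde\omega_\Omega)$ and $A^2(\mathbb C^n,\nu_\Omega)$.
   Context: $\langle\zeta,z\rangle=\zeta_1z_1+\cdots+\zeta_nz_n$. $d=\partial+\overline\partial$, $d^c=\frac{i}{4\pi}(\overline\partial-\partial)$. $\sigma_\Omega$ is the Euclidean surface area measure on $b\Omega$. $H_\Omega(z)=\sup_{\zeta\in\Omega}\operatorname{Re}\langle\zeta,z\rangle$ is the support function, and $(dd^cH_\Omega)^n$ is its Bedford--Taylor Monge--Ampère measure on $\mathbb C^n$. A strongly convex domain is one with $\mathcal C^2$-smooth boundary all of whose principal curvatures are positive. For a measure $\omega$ on $\mathbb C^n$, $A^2(\mathbb C^n,\omega)$ is the space of entire functions $F$ on $\mathbb C^n$ with $\Vert F\Vert_\omega^2=\int_{\mathbb C^n}|F|^2d\omega<\infty$, normed by $\Vert\cdot\Vert_\omega$. "The identity map is a normed space isomorphism" means the two spaces coincide as sets and have equivalent norms. *)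

theory Defs
  imports "HOL-Analysis.Analysis"
begin

section \<open>Regularity\<close>

(* For open S this is C^k-regularity on S. *)
primrec cont_diff_on ::
    "nat \<Rightarrow> ('a::euclidean_space \<Rightarrow> 'b::real_normed_vector) \<Rightarrow> 'a set \<Rightarrow> bool" where
  "cont_diff_on 0 f S \<longleftrightarrow> continuous_on S f"
| "cont_diff_on (Suc k) f S \<longleftrightarrow>
     (\<forall>x\<in>S. f differentiable (at x)) \<and>
     (\<forall>v. cont_diff_on k (\<lambda>x. frechet_derivative f (at x) v) S)"

definition gradient :: "('a::euclidean_space \<Rightarrow> real) \<Rightarrow> 'a \<Rightarrow> 'a" where
  "gradient r x = (\<Sum>b\<in>Basis. frechet_derivative r (at x) b *\<^sub>R b)"

definition entire :: "(complex^'n \<Rightarrow> complex) \<Rightarrow> bool" where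
  "entire F \<longleftrightarrow>
     (\<forall>z. \<exists>F'. (F has_derivative F') (at z) \<and> (\<forall>c v. F' (c *s v) = c * F' v))"


section \<open>Strongly convex domains\<close>

definition local_defining_function ::
    "'a::euclidean_space set \<Rightarrow> 'a \<Rightarrow> 'a set \<Rightarrow> ('a \<Rightarrow> real) \<Rightarrow> bool" where
  "local_defining_function \<Omega> p U r \<longleftrightarrow>
     open U \<and> p \<in> U \<and> cont_diff_on 2 r U \<and> (\<forall>x\<in>U. gradient r x \<noteq> 0) \<and>
     \<Omega> \<inter> U = {x \<in> U. r x < 0}"

definition C2_boundary :: "'a::euclidean_space set \<Rightarrow> bool" where
  "C2_boundary \<Omega> \<longleftrightarrow> (\<forall>p\<in>frontier \<Omega>. \<exists>U r. local_defining_function \<Omega> p U r)"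

(* Eigenvalues of the Weingarten map v |-> D_v N on the tangent space at p, where N = grad r / |grad r|
   is the outward unit normal; spheres bounding balls have positive curvatures. On tangent vectors the
   Weingarten map does not depend on the choice of r. *)
definition principal_curvature :: "'a::euclidean_space set \<Rightarrow> 'a \<Rightarrow> real \<Rightarrow> bool" where
  "principal_curvature \<Omega> p \<kappa> \<longleftrightarrow>
     (\<exists>U r v. local_defining_function \<Omega> p U r \<and> v \<noteq> 0 \<and> gradient r p \<bullet> v = 0 \<and>
        frechet_derivative (\<lambda>x. sgn (gradient r x)) (at p) v = \<kappa> *\<^sub>R v)"

(* For bounded \<Omega>, geometric convexity need not be required: it follows from connectedness and the
   sign of the curvatures. *)
definition strongly_convex_domain :: "'a::euclidean_space set \<Rightarrow> bool" where
  "strongly_convex_domain \<Omega> \<longleftrightarrow>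
     open \<Omega> \<and> connected \<Omega> \<and> \<Omega> \<noteq> {} \<and> C2_boundary \<Omega> \<and>
     (\<forall>p\<in>frontier \<Omega>. \<forall>\<kappa>. principal_curvature \<Omega> p \<kappa> \<longrightarrow> \<kappa> > 0)"


section \<open>Surface measure\<close>

(* Hausdorff measure in dimension m > 0, with the normalization that agrees with Lebesgue measure
   on R^m, so that for m = DIM('a) - 1 it restricts to surface area on C^1 hypersurfaces. *)
definition hausdorff_premeasure :: "nat \<Rightarrow> real \<Rightarrow> 'a::metric_space set \<Rightarrow> ennreal" where
  "hausdorff_premeasure m \<delta> A =
     Inf {(\<Sum>i. ennreal (unit_ball_vol (real m) * (diameter (U i) / 2) ^ m)) | U :: nat \<Rightarrow> 'a set.
            A \<subseteq> (\<Union>i. U i) \<and> (\<forall>i. bounded (U i) \<and> diameter (U i) \<le> \<delta>)}"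

definition hausdorff_measure :: "nat \<Rightarrow> 'a::metric_space measure" where
  "hausdorff_measure m =
     measure_of UNIV (sets borel) (\<lambda>A. SUP \<delta>\<in>{0<..}. hausdorff_premeasure m \<delta> A)"

definition surface_measure :: "'a::euclidean_space set \<Rightarrow> 'a measure" where
  "surface_measure \<Omega> = restrict_space (hausdorff_measure (DIM('a) - 1)) (frontier \<Omega>)"


section \<open>The Monge--Ampere measure\<close>

definition test_functions :: "('a::topological_space \<Rightarrow> complex) set" where
  "test_functions =
     {f. continuous_on UNIV f \<and> (\<exists>K. compact K \<and> (\<forall>z. z \<notin> K \<longrightarrow> f z = 0))}"

definition smooth_test_functions :: "('a::euclidean_space \<Rightarrow> complex) set" where
  "smooth_test_functions = {f \<in> test_functions. \<forall>k. cont_diff_on k f UNIV}"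

(* Integration against a complex Radon measure. *)
definition order_zero :: "(('a::topological_space \<Rightarrow> complex) \<Rightarrow> complex) \<Rightarrow> bool" where
  "order_zero L \<longleftrightarrow>
     (\<forall>f\<in>test_functions. \<forall>g\<in>test_functions. L (\<lambda>z. f z + g z) = L f + L g) \<and>
     (\<forall>c. \<forall>f\<in>test_functions. L (\<lambda>z. c * f z) = c * L f) \<and>
     (\<forall>K. compact K \<longrightarrow>
        (\<exists>C. \<forall>f\<in>test_functions. \<forall>B. (\<forall>z. z \<notin> K \<longrightarrow> f z = 0) \<longrightarrow>
               (\<forall>z. cmod (f z) \<le> B) \<longrightarrow> cmod (L f) \<le> C * B))"

definition dz :: "'n::finite \<Rightarrow> (complex^'n \<Rightarrow> complex) \<Rightarrow> complex^'n \<Rightarrow> complex" where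
  "dz p f z = (frechet_derivative f (at z) (axis p 1)
               - \<i> * frechet_derivative f (at z) (axis p \<i>)) / 2"

definition dzbar :: "'n::finite \<Rightarrow> (complex^'n \<Rightarrow> complex) \<Rightarrow> complex^'n \<Rightarrow> complex" where
  "dzbar q f z = (frechet_derivative f (at z) (axis q 1)
                  + \<i> * frechet_derivative f (at z) (axis q \<i>)) / 2"

(* A current S of bidimension (m,m) with measure coefficients is encoded by its values
     S [j1,...,jm] [l1,...,lm] f
       = < S, f (i/2 pi) dz_j1 /\ dzbar_l1 /\ ... /\ (i/2 pi) dz_jm /\ dzbar_lm >.
   Only index lists of length m are meaningful. *)
type_synonym 'n current = "'n list \<Rightarrow> 'n list \<Rightarrow> (complex^'n \<Rightarrow> complex) \<Rightarrow> complex"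

(* The current of integration over C^n: (i/2) dz_j /\ dzbar_j is the area form of the j-th coordinate
   and these 2-forms commute, so for ls = map \<pi> js only sign \<pi> / pi^n times Lebesgue measure is left. *)
definition integration_current :: "'n::finite current" where
  "integration_current js ls f =
     (\<Sum>\<pi> | \<pi> permutes (UNIV :: 'n set).
         if distinct js \<and> ls = map \<pi> js then of_int (sign \<pi>) else 0)
     / of_real (pi ^ CARD('n)) * (LINT z|lborel. f z)"

(* S = dd^c (u T) where S has bidimension (m,m), that is < S, \<phi> > = < u T, dd^c \<phi> > for smooth \<phi>.
   With d^c = (i/4 pi)(dbar - d) one has dd^c f = (i/2 pi) (sum over p, q) f_{p qbar} dz_p /\ dzbar_q.
   Order zero determines S from its values on smooth test forms and makes u S meaningful
   for continuous u. *)
definition ddc_product ::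
    "nat \<Rightarrow> (complex^'n::finite \<Rightarrow> real) \<Rightarrow> 'n current \<Rightarrow> 'n current \<Rightarrow> bool" where
  "ddc_product m u T S \<longleftrightarrow>
     (\<forall>js ls. length js = m \<and> length ls = m \<longrightarrow>
        order_zero (S js ls) \<and>
        (\<forall>f\<in>smooth_test_functions.
           S js ls f =
             (\<Sum>p\<in>UNIV. \<Sum>q\<in>UNIV.
                T (p # js) (q # ls) (\<lambda>z. of_real (u z) * dz p (dzbar q f) z))))"

(* Bedford--Taylor: (dd^c u)^(k+1) = dd^c (u (dd^c u)^k), starting from (dd^c u)^0 = 1, for a continuous
   plurisubharmonic u. There the currents (dd^c u)^k are positive, hence of order zero. *)
definition is_monge_ampere :: "(complex^'n::finite \<Rightarrow> real) \<Rightarrow> (complex^'n) measure \<Rightarrow> bool" where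
  "is_monge_ampere u \<mu> \<longleftrightarrow>
     sets \<mu> = sets borel \<and>
     (\<exists>T :: nat \<Rightarrow> 'n current.
        T 0 = integration_current \<and>
        (\<forall>k < CARD('n). ddc_product (CARD('n) - Suc k) u (T k) (T (Suc k))) \<and>
        (\<forall>f\<in>test_functions. integrable \<mu> f \<and> (LINT z|\<mu>. f z) = T CARD('n) [] [] f))"

definition monge_ampere :: "(complex^'n::finite \<Rightarrow> real) \<Rightarrow> (complex^'n) measure" where
  "monge_ampere u = (THE \<mu>. is_monge_ampere u \<mu>)"


section \<open>The weighted spaces\<close>

definition cpair :: "complex^'n \<Rightarrow> complex^'n \<Rightarrow> complex" where
  "cpair \<zeta> z = (\<Sum>i\<in>UNIV. \<zeta> $ i * z $ i)"

definition support_function :: "(complex^'n) set \<Rightarrow> complex^'n \<Rightarrow> real" where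
  "support_function \<Omega> z = (SUP \<zeta>\<in>\<Omega>. Re (cpair \<zeta> z))"

definition L2_norm :: "'a measure \<Rightarrow> ('a \<Rightarrow> complex) \<Rightarrow> real" where
  "L2_norm \<mu> f = sqrt (LINT x|\<mu>. (cmod (f x))\<^sup>2)"

definition omega_tilde :: "(complex^'n::finite) set \<Rightarrow> (complex^'n) measure" where
  "omega_tilde \<Omega> =
     density (monge_ampere (support_function \<Omega>))
       (\<lambda>z. ennreal (1 / (L2_norm (surface_measure \<Omega>) (\<lambda>\<zeta>. exp (cpair z \<zeta>)))\<^sup>2))"

definition nu :: "(complex^'n::finite) set \<Rightarrow> (complex^'n) measure" where
  "nu \<Omega> =
     density (monge_ampere (support_function \<Omega>))
       (\<lambda>z. ennreal (exp (- 2 * support_function \<Omega> z) * norm z powr (real CARD('n) - 1 / 2)))"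

definition A2 :: "(complex^'n::finite) measure \<Rightarrow> (complex^'n \<Rightarrow> complex) set" where
  "A2 \<omega> = {F. entire F \<and> integrable \<omega> (\<lambda>z. (cmod (F z))\<^sup>2)}"

definition identity_isomorphism ::
    "(complex^'n::finite) measure \<Rightarrow> (complex^'n) measure \<Rightarrow> bool" where
  "identity_isomorphism \<omega>\<^sub>1 \<omega>\<^sub>2 \<longleftrightarrow>
     A2 \<omega>\<^sub>1 = A2 \<omega>\<^sub>2 \<and>
     (\<exists>c>0. \<exists>C>0. \<forall>F\<in>A2 \<omega>\<^sub>1.
        c * L2_norm \<omega>\<^sub>1 F \<le> L2_norm \<omega>\<^sub>2 F \<and> L2_norm \<omega>\<^sub>2 F \<le> C * L2_norm \<omega>\<^sub>1 F)"

end

theory Submission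
  imports Defs "HOL-Complex_Analysis.Complex_Analysis"
begin

text \<open>
  Strong convexity makes balls roll inside and outside the boundary, so near the boundary point where \<open>Re \<langle>\<zeta>, z\<rangle>\<close> is
  maximal the function \<open>H(z) - Re \<langle>\<zeta>, z\<rangle>\<close> is comparable to \<open>\<bar>z\<bar>\<close> times the squared distance. Covering the boundary by
  shells of width \<open>\<bar>z\<bar>\<^sup>-\<^sup>1\<^sup>/\<^sup>2\<close> shows that the squared norm of the exponential is comparable to
  \<open>exp (2 H(z))\<close> times \<open>\<bar>z\<bar>\<close> to the power \<open>1/2 - n\<close> when \<open>\<bar>z\<bar> \<ge> 1\<close>. So the two weights are comparable off the unit ball; on it the
  first one is bounded, while the second may degenerate.

  The support function is homogeneous of degree one and, by the inverse function theorem applied to the Gauss map, \<open>C\<^sup>2\<close>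
  off the origin with positive definite complex Hessian. Its Monge--Ampere measure is therefore a density
  that is continuous and positive off the origin: the singularity at the origin is removable by cutoffs, and
  iterating \<open>dd\<^sup>c\<close> reduces to classical integrations by parts. For an entire \<open>F\<close> the mean value property then bounds \<open>\<bar>F\<bar>\<^sup>2\<close>
  on the unit ball by its integral over an annulus, where all weights and densities are bounded below, and this controls the
  contribution of the unit ball to the norm.
\<close>

section \<open>Differential calculus\<close>

text \<open>Convexity is not among the hypotheses, so it has to be extracted from the signs of the
  curvatures. The boundary is only C^2: the inverse Gauss map \<open>pt\<close> is C^1, and the
  integrations by parts meet factors that are merely C^1. \<open>surface_measure\<close> is a
  Hausdorff measure and is estimated without charts: from above by a Lipschitz image of a cube
  boundary, from below by comparing volumes of swept sets. The exponent n - 1/2 is half the real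
  dimension 2n - 1 of the boundary, because a cap of radius |z|^(-1/2) has area comparable to
  |z|^(-(2n-1)/2). By homogeneity the real Hessian of the support function annihilates the radial
  direction; the complex Hessian adds its values at v and i v, which cannot both be real multiples
  of one vector. Finally, \<open>monge_ampere\<close> is a definite description, so besides a
  measure with the required chain of currents a uniqueness proof is needed; it rests on order zero
  and on the density of smooth test functions.\<close>

lemma second_difference_mvt:
  fixes f :: "'a::real_normed_vector \<Rightarrow> real"
  assumes t: "t > 0" and U: "cball x (t * (norm v + norm w)) \<subseteq> U"
    and f: "\<And>y. y \<in> U \<Longrightarrow> (f has_derivative f' y) (at y)"
    and A: "\<And>y. y \<in> U \<Longrightarrow> ((\<lambda>y. f' y v) has_derivative A y) (at y)"
  shows "\<exists>\<xi>. dist x \<xi> \<le> t * (norm v + norm w) \<and>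
      f (x + t *\<^sub>R v + t *\<^sub>R w) - f (x + t *\<^sub>R v) - f (x + t *\<^sub>R w) + f x = t\<^sup>2 * A \<xi> w"
proof -
  have inU: "x + a *\<^sub>R v + b *\<^sub>R w \<in> U" "dist x (x + a *\<^sub>R v + b *\<^sub>R w) \<le> t * (norm v + norm w)"
    if "0 \<le> a" "a \<le> t" "0 \<le> b" "b \<le> t" for a b
  proof -
    have "dist x (x + a *\<^sub>R v + b *\<^sub>R w) = norm (a *\<^sub>R v + b *\<^sub>R w)"
      by (metis add.assoc add_diff_cancel_left' dist_commute dist_norm)
    also have "\<dots> \<le> norm (a *\<^sub>R v) + norm (b *\<^sub>R w)" by (rule norm_triangle_ineq)
    also have "\<dots> \<le> t * norm v + t * norm w"
      using that by (intro add_mono) (auto intro!: mult_right_mono)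
    finally show *: "dist x (x + a *\<^sub>R v + b *\<^sub>R w) \<le> t * (norm v + norm w)" by (simp add: algebra_simps)
    then show "x + a *\<^sub>R v + b *\<^sub>R w \<in> U" using U by auto
  qed
  define g where "g s = f (x + s *\<^sub>R v + t *\<^sub>R w) - f (x + s *\<^sub>R v)" for s
  have lin: "f' y (c *\<^sub>R z) = c * f' y z" if "y \<in> U" for y c z
    using has_derivative_bounded_linear[OF f[OF that]] by (simp add: bounded_linear.linear linear_scale)
  have linA: "A y (c *\<^sub>R z) = c * A y z" if "y \<in> U" for y c z
    using has_derivative_bounded_linear[OF A[OF that]] by (simp add: bounded_linear.linear linear_scale)
  have "DERIV g s :> f' (x + s *\<^sub>R v + t *\<^sub>R w) v - f' (x + s *\<^sub>R v) v" if s: "0 \<le> s" "s \<le> t" for s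
  proof -
    have u1: "x + s *\<^sub>R v + t *\<^sub>R w \<in> U" and u2: "x + s *\<^sub>R v \<in> U"
      using inU(1)[of s t] inU(1)[of s 0] s t by auto
    have "((\<lambda>s. f (x + s *\<^sub>R v + t *\<^sub>R w)) has_derivative (\<lambda>h. f' (x + s *\<^sub>R v + t *\<^sub>R w) (h *\<^sub>R v))) (at s)"
      by (rule has_derivative_compose[where g=f and f="\<lambda>s. x + s *\<^sub>R v + t *\<^sub>R w", OF _ f[OF u1]]) (auto intro!: derivative_eq_intros)
    moreover have "((\<lambda>s. f (x + s *\<^sub>R v)) has_derivative (\<lambda>h. f' (x + s *\<^sub>R v) (h *\<^sub>R v))) (at s)"
      by (rule has_derivative_compose[where g=f and f="\<lambda>s. x + s *\<^sub>R v", OF _ f[OF u2]]) (auto intro!: derivative_eq_intros)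
    ultimately have "(g has_derivative (\<lambda>h. f' (x + s *\<^sub>R v + t *\<^sub>R w) (h *\<^sub>R v) - f' (x + s *\<^sub>R v) (h *\<^sub>R v))) (at s)"
      unfolding g_def by (rule has_derivative_diff)
    then show ?thesis unfolding has_field_derivative_def
      by (rule has_derivative_eq_rhs) (use lin[OF u1] lin[OF u2] in \<open>auto simp: algebra_simps\<close>)
  qed
  then obtain s where s: "0 < s" "s < t" and gs: "g t - g 0 = (t - 0) * (f' (x + s *\<^sub>R v + t *\<^sub>R w) v - f' (x + s *\<^sub>R v) v)"
    using MVT2[OF t, of g "\<lambda>s. f' (x + s *\<^sub>R v + t *\<^sub>R w) v - f' (x + s *\<^sub>R v) v"] by auto
  have "DERIV (\<lambda>r. f' (x + s *\<^sub>R v + r *\<^sub>R w) v) r :> A (x + s *\<^sub>R v + r *\<^sub>R w) w" if r: "0 \<le> r" "r \<le> t" for r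
  proof -
    have u: "x + s *\<^sub>R v + r *\<^sub>R w \<in> U" using inU(1)[of s r] s r by auto
    have "((\<lambda>r. f' (x + s *\<^sub>R v + r *\<^sub>R w) v) has_derivative (\<lambda>h. A (x + s *\<^sub>R v + r *\<^sub>R w) (h *\<^sub>R w))) (at r)"
      by (rule has_derivative_compose[where g="\<lambda>y. f' y v" and f="\<lambda>r. x + s *\<^sub>R v + r *\<^sub>R w", OF _ A[OF u]]) (auto intro!: derivative_eq_intros)
    then show ?thesis unfolding has_field_derivative_def
      by (rule has_derivative_eq_rhs) (use linA[OF u] in \<open>auto simp: algebra_simps\<close>)
  qed
  then obtain r where r: "0 < r" "r < t" and gr: "f' (x + s *\<^sub>R v + t *\<^sub>R w) v - f' (x + s *\<^sub>R v + 0 *\<^sub>R w) v = (t - 0) * A (x + s *\<^sub>R v + r *\<^sub>R w) w"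
    using MVT2[OF t, of "\<lambda>r. f' (x + s *\<^sub>R v + r *\<^sub>R w) v" "\<lambda>r. A (x + s *\<^sub>R v + r *\<^sub>R w) w"] by auto
  have "f (x + t *\<^sub>R v + t *\<^sub>R w) - f (x + t *\<^sub>R v) - f (x + t *\<^sub>R w) + f x = t\<^sup>2 * A (x + s *\<^sub>R v + r *\<^sub>R w) w"
    using gs gr by (simp add: g_def power2_eq_square algebra_simps)
  then show ?thesis using inU(2)[of s r] r s by (intro exI[of _ "x + s *\<^sub>R v + r *\<^sub>R w"]) auto
qed

text \<open>The second difference of f is symmetric in v and w, and
  \<open>second_difference_mvt\<close> writes it as a value of either mixed derivative at some point
  near x. Letting the step tend to 0, continuity of both mixed derivatives identifies them at
  x.\<close>

lemma symmetric_second_derivative: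
  fixes f :: "'a::real_normed_vector \<Rightarrow> real"
  assumes U: "open U" "x \<in> U"
    and f: "\<And>y. y \<in> U \<Longrightarrow> (f has_derivative f' y) (at y)"
    and A: "\<And>y. y \<in> U \<Longrightarrow> ((\<lambda>y. f' y v) has_derivative A y) (at y)"
    and B: "\<And>y. y \<in> U \<Longrightarrow> ((\<lambda>y. f' y w) has_derivative B y) (at y)"
    and cA: "continuous_on U (\<lambda>y. A y w)" and cB: "continuous_on U (\<lambda>y. B y v)"
  shows "A x w = B x v"
proof -
  obtain e where e: "e > 0" "cball x e \<subseteq> U" using U open_contains_cball by blast
  \<comment> \<open>The summand 1 only keeps the divisor positive when v and w both vanish.\<close>
  define K where "K = norm v + norm w + 1"
  have K: "K > 0" by (simp add: K_def add_nonneg_pos)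
  define t where "t k = e / K / real (Suc k)" for k
  have t0: "t k > 0" for k using e K by (auto simp: t_def intro!: divide_pos_pos)
  have tle: "t k * (norm v + norm w) \<le> e" for k
  proof -
    have "t k \<le> e / K" unfolding t_def using e K mult_left_mono[of 1 "real (Suc k)" "e / K"]
        by (subst pos_divide_le_eq) auto
    then have "t k * (norm v + norm w) \<le> e / K * K"
      using e K t0[of k] by (intro mult_mono) (auto simp: K_def)
    then show ?thesis using K by simp
  qed
  have sub: "cball x (t k * (norm v + norm w)) \<subseteq> U" for k
    using tle[of k] e by (meson order_trans subset_cball)
  have "\<forall>k. \<exists>\<xi> \<eta>. dist x \<xi> \<le> t k * (norm v + norm w) \<and> dist x \<eta> \<le> t k * (norm v + norm w) \<and> A \<xi> w = B \<eta> v"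
  proof
    fix k
    obtain \<xi> where \<xi>: "dist x \<xi> \<le> t k * (norm v + norm w)"
      "f (x + t k *\<^sub>R v + t k *\<^sub>R w) - f (x + t k *\<^sub>R v) - f (x + t k *\<^sub>R w) + f x = (t k)\<^sup>2 * A \<xi> w"
      using second_difference_mvt[OF t0 sub f A] by blast
    have sub': "cball x (t k * (norm w + norm v)) \<subseteq> U" using sub by (simp add: add.commute)
    obtain \<eta> where \<eta>: "dist x \<eta> \<le> t k * (norm w + norm v)"
      "f (x + t k *\<^sub>R w + t k *\<^sub>R v) - f (x + t k *\<^sub>R w) - f (x + t k *\<^sub>R v) + f x = (t k)\<^sup>2 * B \<eta> v"
      using second_difference_mvt[OF t0 sub' f B] by blast
    have "(t k)\<^sup>2 * A \<xi> w = (t k)\<^sup>2 * B \<eta> v" using \<xi>(2) \<eta>(2) by (simp add: algebra_simps)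
    then have "A \<xi> w = B \<eta> v" using t0[of k] by simp
    then show "\<exists>\<xi> \<eta>. dist x \<xi> \<le> t k * (norm v + norm w) \<and> dist x \<eta> \<le> t k * (norm v + norm w) \<and> A \<xi> w = B \<eta> v"
      using \<xi>(1) \<eta>(1) by (auto simp: add.commute)
  qed
  then obtain \<xi> \<eta> where \<xi>: "\<And>k. dist x (\<xi> k) \<le> t k * (norm v + norm w)"
    and \<eta>: "\<And>k. dist x (\<eta> k) \<le> t k * (norm v + norm w)" and eq: "\<And>k. A (\<xi> k) w = B (\<eta> k) v" by metis
  have "t \<longlonglongrightarrow> 0"
    unfolding t_def by (rule LIMSEQ_Suc[OF lim_const_over_n])
  then have t': "(\<lambda>k. t k * (norm v + norm w)) \<longlonglongrightarrow> 0" by (rule tendsto_mult_left_zero)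
  have lim: "z \<longlonglongrightarrow> x" if "\<And>k. dist x (z k) \<le> t k * (norm v + norm w)" for z
  proof (rule tendsto_dist_iff[THEN iffD2], rule tendsto_sandwich[OF _ _ tendsto_const t'])
    show "\<forall>\<^sub>F n in sequentially. 0 \<le> dist (z n) x" by simp
    show "\<forall>\<^sub>F n in sequentially. dist (z n) x \<le> t n * (norm v + norm w)"
      using that by (simp add: dist_commute)
  qed
  have inU: "z \<in> U" if "dist x z \<le> t k * (norm v + norm w)" for z k using sub[of k] that by auto
  have \<xi>U: "\<xi> k \<in> U" and \<eta>U: "\<eta> k \<in> U" for k using inU[OF \<xi>] inU[OF \<eta>] by auto
  have "(\<lambda>k. A (\<xi> k) w) \<longlonglongrightarrow> A x w"
    using continuous_on_tendsto_compose[OF cA lim[OF \<xi>] U(2)] \<xi>U by (simp add: eventuallyI)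
  moreover have "(\<lambda>k. B (\<eta> k) v) \<longlonglongrightarrow> B x v"
    using continuous_on_tendsto_compose[OF cB lim[OF \<eta>] U(2)] \<eta>U by (simp add: eventuallyI)
  ultimately show ?thesis using eq LIMSEQ_unique by simp
qed

text \<open>Implicit differentiation: for continuous g the expansion of f at \<open>g y\<close>
  bounds the error of \<open>L (h' v)\<close> by a small multiple of the increment of g plus that of
  the argument. Absorbing the increment of g first yields a Lipschitz bound at y and then the
  derivative. In the application g is \<open>pt\<close>, whose continuity is already known, so no
  inverse function has to be constructed.\<close>

lemma has_derivative_left_invertible:
  fixes f :: "'b::real_normed_vector \<Rightarrow> 'c::real_normed_vector" and g :: "'a::real_normed_vector \<Rightarrow> 'b"
  assumes f: "(f has_derivative f') (at (g y))" and fg: "((\<lambda>x. f (g x)) has_derivative h') (at y)"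
    and L: "bounded_linear L" "\<And>v. L (f' v) = v" and g: "isCont g y"
  shows "(g has_derivative (\<lambda>v. L (h' v))) (at y)"
proof -
  interpret L: bounded_linear L by fact
  obtain K where K: "K > 0" "\<And>v. norm (L v) \<le> norm v * K" using L.pos_bounded by blast
  have bl: "bounded_linear h'" using fg by (rule has_derivative_bounded_linear)
  obtain H where H: "H > 0" "\<And>v. norm (h' v) \<le> norm v * H" using bounded_linear.pos_bounded[OF bl] by blast
  define M where "M = 2 * (K * H + 1)"
  have M: "M > 0" using K H by (simp add: M_def add_nonneg_pos)
  have main: "\<exists>d>0. \<forall>x. norm (x - y) < d \<longrightarrow> norm (g x - g y - L (h' (x - y))) \<le> e * norm (x - y)"
    if e: "e > 0" for e
  proof -
    \<comment> \<open>The first entry gives the final bound by e; the second makes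
      \<open>K * e1\<close> at most 1/2, so that the increment \<open>D\<close> can be absorbed on
      the left.\<close>
    define e1 where "e1 = min (e / (2 * K * (M + 1))) (1 / (2 * K * (M + 1)))"
    have e1: "e1 > 0" using e K M by (auto simp: e1_def)
    have Kpos: "0 < 2 * K * (M + 1)" using K M by (auto intro!: mult_pos_pos)
    have e1e: "K * e1 * (M + 1) \<le> e / 2"
    proof -
      have "e1 \<le> e / (2 * K * (M + 1))" by (simp add: e1_def)
      then have "e1 * (2 * K * (M + 1)) \<le> e" using Kpos by (simp add: pos_le_divide_eq)
      then show ?thesis by (simp add: algebra_simps)
    qed
    have e1h: "K * e1 * (M + 1) \<le> 1 / 2"
    proof -
      have "e1 \<le> 1 / (2 * K * (M + 1))" by (simp add: e1_def)
      then have "e1 * (2 * K * (M + 1)) \<le> 1" using Kpos by (simp add: pos_le_divide_eq)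
      then show ?thesis by (simp add: algebra_simps)
    qed
    have Ke1: "K * e1 \<ge> 0" using K e1 by simp
    have Ke1h: "K * e1 \<le> 1/2"
      using e1h Ke1 M mult_left_mono[of 1 "M + 1" "K * e1"] by simp
    obtain d1 where d1: "d1 > 0" "\<And>z. norm (z - g y) < d1 \<Longrightarrow> norm (f z - f (g y) - f' (z - g y)) \<le> e1 * norm (z - g y)"
      using f e1 unfolding has_derivative_at_alt by blast
    obtain d2 where d2: "d2 > 0" "\<And>x. norm (x - y) < d2 \<Longrightarrow> norm (f (g x) - f (g y) - h' (x - y)) \<le> e1 * norm (x - y)"
      using fg e1 unfolding has_derivative_at_alt by blast
    obtain d3 where d3: "d3 > 0" "\<And>x. norm (x - y) < d3 \<Longrightarrow> norm (g x - g y) < d1"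
      using g d1(1) unfolding continuous_at_eps_delta dist_norm by blast
    show ?thesis
    proof (intro exI[of _ "min d2 d3"] conjI allI impI)
      show "min d2 d3 > 0" using d2 d3 by simp
      fix x assume x: "norm (x - y) < min d2 d3"
      define D where "D = g x - g y"
      have a1: "norm (f (g x) - f (g y) - f' D) \<le> e1 * norm D" using d1(2)[OF d3(2)] x by (simp add: D_def)
      have a2: "norm (f (g x) - f (g y) - h' (x - y)) \<le> e1 * norm (x - y)" using d2(2) x by simp
      have "norm (f' D - h' (x - y)) \<le> e1 * norm D + e1 * norm (x - y)"
      proof -
        have "f' D - h' (x - y) = (f (g x) - f (g y) - h' (x - y)) - (f (g x) - f (g y) - f' D)" by simp
        then show ?thesis using a1 a2 norm_triangle_ineq4[of "f (g x) - f (g y) - h' (x - y)" "f (g x) - f (g y) - f' D"]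
          by simp
      qed
      then have "norm (L (f' D - h' (x - y))) \<le> (e1 * norm D + e1 * norm (x - y)) * K"
        using K(2)[of "f' D - h' (x - y)"] K(1) by (meson mult_right_mono order.strict_implies_order order_trans)
      then have b: "norm (D - L (h' (x - y))) \<le> K * e1 * (norm D + norm (x - y))"
        by (simp add: L.diff L(2) algebra_simps)
      have "norm D \<le> norm (D - L (h' (x - y))) + norm (L (h' (x - y)))"
        by (metis add.commute diff_add_cancel norm_triangle_ineq)
      also have "norm (L (h' (x - y))) \<le> norm (x - y) * H * K"
        using K(2)[of "h' (x - y)"] H(2)[of "x - y"] K(1) by (meson mult_right_mono order.strict_implies_order order_trans)
      also have "norm (D - L (h' (x - y))) \<le> 1/2 * norm D + 1/2 * norm (x - y)"
        using b mult_right_mono[OF Ke1h, of "norm D + norm (x - y)"] by (simp add: algebra_simps)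
      finally have "norm D \<le> 2 * (norm (x - y) * H * K) + norm (x - y)" by simp
      then have "norm D \<le> M * norm (x - y)"
        using norm_ge_zero[of "x - y"] unfolding M_def by (simp only: algebra_simps)
      then have "norm D + norm (x - y) \<le> (M + 1) * norm (x - y)" by (simp add: algebra_simps)
      then have "K * e1 * (norm D + norm (x - y)) \<le> K * e1 * ((M + 1) * norm (x - y))"
        using Ke1 by (rule mult_left_mono)
      then have "norm (D - L (h' (x - y))) \<le> (K * e1 * (M + 1)) * norm (x - y)" using b by simp
      also have "\<dots> \<le> e / 2 * norm (x - y)" using e1e by (rule mult_right_mono) simp
      also have "\<dots> \<le> e * norm (x - y)" using e by (intro mult_right_mono) auto
      finally show "norm (g x - g y - L (h' (x - y))) \<le> e * norm (x - y)" by (simp add: D_def)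
    qed
  qed
  show ?thesis unfolding has_derivative_at_alt
    using main bounded_linear_compose[OF L(1) bl] by blast
qed

lemma has_derivative_sgn:
  fixes x :: "'a::real_inner"
  assumes "x \<noteq> 0"
  shows "(sgn has_derivative (\<lambda>v. (v - (sgn x \<bullet> v) *\<^sub>R sgn x) /\<^sub>R norm x)) (at x)"
proof -
  have n: "(norm has_derivative (\<lambda>v. v \<bullet> sgn x)) (at x)" using assms by (rule has_derivative_norm)
  have "((\<lambda>x. x /\<^sub>R norm x) has_derivative (\<lambda>v. (v - (sgn x \<bullet> v) *\<^sub>R sgn x) /\<^sub>R norm x)) (at x)"
    using assms by (auto intro!: derivative_eq_intros n simp: fun_eq_iff sgn_div_norm algebra_simps power2_eq_square inner_commute[of _ x])
  then show ?thesis by (simp add: sgn_div_norm[abs_def])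
qed

lemma frechet_derivative_eqI: "(f has_derivative f') (at x) \<Longrightarrow> frechet_derivative f (at x) = f'"
  by (rule frechet_derivative_at[symmetric])

lemma gradient_has_derivative:
  assumes "r differentiable (at x)"
  shows "(r has_derivative (\<lambda>v. gradient r x \<bullet> v)) (at x)"
proof -
  have d: "(r has_derivative frechet_derivative r (at x)) (at x)"
    using assms frechet_derivative_works by blast
  interpret linear "frechet_derivative r (at x)" using assms by (rule linear_frechet_derivative)
  have "frechet_derivative r (at x) v = gradient r x \<bullet> v" for v
  proof -
    have "frechet_derivative r (at x) v = frechet_derivative r (at x) (\<Sum>b\<in>Basis. (v \<bullet> b) *\<^sub>R b)"
      by (simp add: euclidean_representation)
    also have "\<dots> = (\<Sum>b\<in>Basis. (v \<bullet> b) * frechet_derivative r (at x) b)" by (simp add: sum scale)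
    also have "\<dots> = gradient r x \<bullet> v"
      unfolding gradient_def inner_sum_left by (intro sum.cong) (auto simp: inner_commute[of _ v])
    finally show ?thesis .
  qed
  then have "frechet_derivative r (at x) = (\<lambda>v. gradient r x \<bullet> v)" by (rule ext)
  then show ?thesis using d by simp
qed

text \<open>\<open>cont_diff_on\<close> speaks of iterated directional derivatives only. Here it is
  repackaged as a differentiable gradient whose derivative, the Hessian, is continuous and
  symmetric.\<close>

lemma C2_gradient:
  fixes r :: "'a::euclidean_space \<Rightarrow> real"
  assumes "cont_diff_on 2 r U" "open U"
  defines "H \<equiv> \<lambda>x. frechet_derivative (gradient r) (at x)"
  shows "\<And>x. x \<in> U \<Longrightarrow> (r has_derivative (\<lambda>v. gradient r x \<bullet> v)) (at x)"
    "\<And>x. x \<in> U \<Longrightarrow> (gradient r has_derivative H x) (at x)"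
    "\<And>v. continuous_on U (\<lambda>x. H x v)"
    "\<And>x v w. x \<in> U \<Longrightarrow> H x v \<bullet> w = v \<bullet> H x w"
proof -
  define D where "D v x = frechet_derivative r (at x) v" for v x
  have c: "\<And>x. x \<in> U \<Longrightarrow> r differentiable (at x)" "\<And>v x. x \<in> U \<Longrightarrow> D v differentiable (at x)"
     "\<And>v w. continuous_on U (\<lambda>x. frechet_derivative (D v) (at x) w)"
    using assms(1) unfolding D_def numeral_2_eq_2 cont_diff_on.simps by blast+
  have r: "\<And>x. x \<in> U \<Longrightarrow> (r has_derivative (\<lambda>v. gradient r x \<bullet> v)) (at x)"
    using gradient_has_derivative c(1) by blast
  have Dd: "(D v has_derivative frechet_derivative (D v) (at x)) (at x)" if "x \<in> U" for v x
    using c(2)[OF that] frechet_derivative_works by blast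
  define S where "S x v = (\<Sum>b\<in>Basis. frechet_derivative (D b) (at x) v *\<^sub>R b)" for x v
  have g: "gradient r = (\<lambda>x. \<Sum>b\<in>Basis. D b x *\<^sub>R b)" by (simp add: fun_eq_iff gradient_def D_def)
  have S: "(gradient r has_derivative S x) (at x)" if "x \<in> U" for x
    unfolding g S_def[abs_def] using Dd[OF that] by (auto intro!: derivative_eq_intros)
  have cS: "continuous_on U (\<lambda>x. S x v)" for v
    unfolding S_def using c(3) by (intro continuous_intros)
  have sym: "S x v \<bullet> w = v \<bullet> S x w" if "x \<in> U" for x v w
  proof -
    have A: "((\<lambda>y. gradient r y \<bullet> a) has_derivative (\<lambda>b. S y b \<bullet> a)) (at y)" if "y \<in> U" for y a
      using S[OF that] by (auto intro!: derivative_eq_intros)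
    have "(\<lambda>b. S x b \<bullet> w) v = (\<lambda>b. S x b \<bullet> v) w"
      by (rule symmetric_second_derivative[OF assms(2) that r, where v=w and w=v])
         (use A cS in \<open>auto intro!: continuous_intros\<close>)
    then show ?thesis by (simp add: inner_commute)
  qed
  have H: "H x = S x" if "x \<in> U" for x unfolding H_def using S[OF that] by (rule frechet_derivative_eqI)
  show "(r has_derivative (\<lambda>v. gradient r x \<bullet> v)) (at x)" if "x \<in> U" for x using r that .
  show "(gradient r has_derivative H x) (at x)" if "x \<in> U" for x using S[OF that] H[OF that] by simp
  show "continuous_on U (\<lambda>x. H x v)" for v using cS[of v] H by (simp cong: continuous_on_cong)
  show "H x v \<bullet> w = v \<bullet> H x w" if "x \<in> U" for x v w using sym[OF that] H[OF that] by simp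
qed

section \<open>Principal curvatures and defining functions\<close>

text \<open>First-order condition at the minimum t = 0. A nonzero A is refuted at t = - A / D, where
  D exceeds both 0 and B.\<close>

lemma quadratic_nonneg_imp_zero:
  fixes A B :: real
  assumes "\<And>t. 2 * t * A + t\<^sup>2 * B \<ge> 0"
  shows "A = 0"
proof (rule ccontr)
  assume A: "A \<noteq> 0"
  define D where "D = \<bar>B\<bar> + 1"
  have D: "D > 0" "B < D" by (auto simp: D_def)
  have "0 \<le> 2 * (- A / D) * A + (- A / D)\<^sup>2 * B" by (rule assms)
  also have "\<dots> = A\<^sup>2 / D\<^sup>2 * (B - 2 * D)" using D by (simp add: power2_eq_square field_simps)
  also have "\<dots> < 0" using D A by (intro mult_pos_neg) auto
  finally show False by simp
qed

text \<open>The minimum of the quadratic form over the unit sphere of the hyperplane is an eigenvalue of the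
  compression of \<open>S\<close> to that hyperplane.\<close>

lemma hyperplane_form_coercive:
  fixes S :: "'a::euclidean_space \<Rightarrow> 'a"
  assumes S: "linear S" and sym: "\<And>v w. S v \<bullet> w = v \<bullet> S w" and n: "norm n = 1"
    and ev: "\<And>v \<kappa>. v \<noteq> 0 \<Longrightarrow> n \<bullet> v = 0 \<Longrightarrow> S v - (n \<bullet> S v) *\<^sub>R n = \<kappa> *\<^sub>R v \<Longrightarrow> \<kappa> > 0"
  shows "\<exists>c>0. \<forall>v. n \<bullet> v = 0 \<longrightarrow> c * (norm v)\<^sup>2 \<le> v \<bullet> S v"
proof (cases "\<exists>v. v \<noteq> 0 \<and> n \<bullet> v = 0")
  \<comment> \<open>In dimension one the hyperplane is the origin, the unit sphere in it is empty,
    and any constant will do.\<close>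
  case False
  then have "v = 0" if "n \<bullet> v = 0" for v using that by blast
  then have "1 * (norm v)\<^sup>2 \<le> v \<bullet> S v" if "n \<bullet> v = 0" for v using that linear_0[OF S] by force
  then show ?thesis by (intro exI[of _ "1::real"] conjI allI impI zero_less_one)
next
  case True
  define K where "K = {v. norm v = 1 \<and> n \<bullet> v = 0}"
  have "compact K"
  proof -
    have "K = sphere 0 1 \<inter> {v. n \<bullet> v = 0}" by (auto simp: K_def)
    then show ?thesis by (metis compact_Int_closed compact_sphere closed_hyperplane)
  qed
  moreover have "K \<noteq> {}"
  proof -
    from True obtain v where "v \<noteq> 0" "n \<bullet> v = 0" by blast
    then have "sgn v \<in> K" by (simp add: K_def norm_sgn sgn_div_norm)
    then show ?thesis by blast
  qed
  moreover have "continuous_on K (\<lambda>v. v \<bullet> S v)"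
    using S by (intro continuous_intros linear_continuous_on) (simp add: linear_linear)
  ultimately obtain v0 where v0: "v0 \<in> K" "\<And>v. v \<in> K \<Longrightarrow> v0 \<bullet> S v0 \<le> v \<bullet> S v"
    using continuous_attains_inf[of K "\<lambda>v. v \<bullet> S v"] by blast
  define m where "m = v0 \<bullet> S v0"
  have scale: "m * (norm v)\<^sup>2 \<le> v \<bullet> S v" if "n \<bullet> v = 0" for v
  proof (cases "v = 0")
    case False
    then have "sgn v \<in> K" using that by (simp add: K_def norm_sgn sgn_div_norm)
    then have "m \<le> sgn v \<bullet> S (sgn v)" using v0 by (simp add: m_def)
    also have "\<dots> = (v \<bullet> S v) / (norm v)\<^sup>2"
      using S by (simp add: sgn_div_norm linear_scale power2_eq_square divide_simps)
    finally show ?thesis using False by (simp add: field_simps)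
  qed (simp add: linear_0[OF S])
  have nv0: "norm v0 = 1" "n \<bullet> v0 = 0" using v0 by (auto simp: K_def)
  \<comment> \<open>\<open>v0\<close> minimises the form minus m times the squared norm on the
    hyperplane, with minimum 0, so the first variation vanishes in every direction of the
    hyperplane.\<close>
  have first: "w \<bullet> (S v0 - m *\<^sub>R v0) = 0" if w: "n \<bullet> w = 0" for w
  proof (rule quadratic_nonneg_imp_zero)
    fix t
    have "n \<bullet> (v0 + t *\<^sub>R w) = 0" using w nv0 by (simp add: inner_add_right)
    then have "m * (norm (v0 + t *\<^sub>R w))\<^sup>2 \<le> (v0 + t *\<^sub>R w) \<bullet> S (v0 + t *\<^sub>R w)" by (rule scale)
    moreover have "(norm (v0 + t *\<^sub>R w))\<^sup>2 = 1 + 2 * t * (w \<bullet> v0) + t\<^sup>2 * (w \<bullet> w)"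
    proof -
      have "v0 \<bullet> v0 = 1" using nv0(1) by (simp add: norm_eq_1)
      then show ?thesis unfolding power2_norm_eq_inner
        by (simp add: inner_add_left inner_add_right inner_commute power2_eq_square)
    qed
    moreover have "(v0 + t *\<^sub>R w) \<bullet> S (v0 + t *\<^sub>R w) = m + 2 * t * (w \<bullet> S v0) + t\<^sup>2 * (w \<bullet> S w)"
      using sym[of w v0] S
      by (simp add: inner_add_left inner_add_right linear_add linear_scale m_def power2_eq_square inner_commute[of v0 "S w"])
    ultimately have "m * (1 + 2 * t * (w \<bullet> v0) + t\<^sup>2 * (w \<bullet> w)) \<le> m + 2 * t * (w \<bullet> S v0) + t\<^sup>2 * (w \<bullet> S w)"
      by simp
    then show "0 \<le> 2 * t * (w \<bullet> (S v0 - m *\<^sub>R v0)) + t\<^sup>2 * (w \<bullet> S w - m * (w \<bullet> w))"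
      by (simp add: inner_diff_right algebra_simps)
  qed
  \<comment> \<open>The residue of the eigenvalue equation for the compressed map. It lies in the
    hyperplane, so it may be inserted into \<open>first\<close> and turns out to be orthogonal to
    itself.\<close>
  define w where "w = S v0 - (n \<bullet> S v0) *\<^sub>R n - m *\<^sub>R v0"
  have nn: "n \<bullet> n = 1" using n by (simp add: norm_eq_1)
  have nw: "n \<bullet> w = 0" using nv0 nn by (simp add: w_def inner_diff_right)
  have "w \<bullet> w = w \<bullet> (S v0 - m *\<^sub>R v0) - (n \<bullet> S v0) * (w \<bullet> n)"
    by (subst (2) w_def) (simp add: inner_diff_right)
  then have "w = 0" using first[OF nw] nw by (simp add: inner_commute)
  then have "m > 0" using nv0 by (intro ev[of v0 m]) (auto simp: w_def)
  then show ?thesis using scale by blast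
qed

text \<open>A form that is positive on the hyperplane orthogonal to g becomes positive everywhere
  after adding a large multiple of the square of g: split v into a tangential and a normal part and
  absorb the mixed term. The factor 2 K is the one that appears in the Hessian of r + K r^2 at a
  zero of r.\<close>

lemma finsler_coercive:
  fixes S :: "'a::euclidean_space \<Rightarrow> 'a"
  assumes S: "linear S" and sym: "\<And>v w. S v \<bullet> w = v \<bullet> S w" and g: "g \<noteq> 0"
    and c: "c > 0" "\<And>v. g \<bullet> v = 0 \<Longrightarrow> c * (norm v)\<^sup>2 \<le> v \<bullet> S v"
  shows "\<exists>K\<ge>0. \<forall>v. c / 2 * (norm v)\<^sup>2 \<le> v \<bullet> S v + 2 * K * (g \<bullet> v)\<^sup>2"
proof -
  obtain B where B: "B > 0" "\<And>v. norm (S v) \<le> B * norm v" using linear_bounded_pos[OF S] by blast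
  define n where "n = sgn g"
  have n: "norm n = 1" using g by (simp add: n_def norm_sgn)
  have nn: "n \<bullet> n = 1" using n by (simp add: norm_eq_1)
  have gn: "g = norm g *\<^sub>R n" using g by (simp add: n_def sgn_div_norm)
  \<comment> \<open>The three summands pay for the wanted coercivity in the normal direction, for
    the mixed term after the inequality between arithmetic and geometric mean, and for the purely
    normal entry of the form.\<close>
  define E where "E = c / 2 + 2 * B\<^sup>2 / c + B"
  define K where "K = E / (2 * (norm g)\<^sup>2)"
  have "K \<ge> 0" using B c by (simp add: K_def E_def)
  moreover have "c / 2 * (norm v)\<^sup>2 \<le> v \<bullet> S v + 2 * K * (g \<bullet> v)\<^sup>2" for v
  proof -
    define s where "s = n \<bullet> v"
    define t where "t = v - s *\<^sub>R n"
    have v: "v = t + s *\<^sub>R n" by (simp add: t_def)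
    have nt: "n \<bullet> t = 0" by (simp add: t_def inner_diff_right nn s_def)
    have gt: "g \<bullet> t = 0" using nt by (subst gn) simp
    have nv: "(norm v)\<^sup>2 = (norm t)\<^sup>2 + s\<^sup>2"
      unfolding power2_norm_eq_inner v using nt nn
      by (simp add: inner_add_left inner_add_right inner_commute power2_eq_square)
    have gv: "(g \<bullet> v)\<^sup>2 = (norm g)\<^sup>2 * s\<^sup>2" unfolding s_def by (subst gn) (simp add: power_mult_distrib)
    have "v \<bullet> S v = t \<bullet> S t + 2 * s * (t \<bullet> S n) + s\<^sup>2 * (n \<bullet> S n)"
      using sym[of t n] S
      by (simp add: v inner_add_left inner_add_right linear_add linear_scale power2_eq_square inner_commute[of n "S t"])
    moreover have "c * (norm t)\<^sup>2 \<le> t \<bullet> S t" using c(2) gt by simp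
    moreover have "\<bar>t \<bullet> S n\<bar> \<le> norm t * B"
      using Cauchy_Schwarz_ineq2[of t "S n"] B(2)[of n] n mult_left_mono[of "norm (S n)" B "norm t"] by simp
    moreover have "\<bar>n \<bullet> S n\<bar> \<le> B"
      using Cauchy_Schwarz_ineq2[of n "S n"] B(2)[of n] n by simp
    moreover have "2 * \<bar>s\<bar> * (norm t * B) \<le> c / 2 * (norm t)\<^sup>2 + 2 * B\<^sup>2 / c * s\<^sup>2"
    proof -
      have "0 \<le> (c * norm t - 2 * B * \<bar>s\<bar>)\<^sup>2 / (2 * c)" using c by simp
      also have "\<dots> = c / 2 * (norm t)\<^sup>2 + 2 * B\<^sup>2 / c * s\<^sup>2 - 2 * \<bar>s\<bar> * (norm t * B)"
        using c by (simp add: power2_eq_square field_simps)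
      finally show ?thesis by simp
    qed
    moreover have "2 * s * (t \<bullet> S n) \<ge> - (2 * \<bar>s\<bar> * (norm t * B))"
    proof -
      have "\<bar>2 * s * (t \<bullet> S n)\<bar> \<le> 2 * \<bar>s\<bar> * (norm t * B)"
        using \<open>\<bar>t \<bullet> S n\<bar> \<le> norm t * B\<close> by (simp add: abs_mult mult_left_mono)
      then show ?thesis by linarith
    qed
    moreover have "s\<^sup>2 * (n \<bullet> S n) \<ge> - (B * s\<^sup>2)"
      using \<open>\<bar>n \<bullet> S n\<bar> \<le> B\<close> mult_left_mono[of "-B" "n \<bullet> S n" "s\<^sup>2"] by (simp add: mult.commute)
    ultimately have "v \<bullet> S v \<ge> c / 2 * (norm t)\<^sup>2 - (2 * B\<^sup>2 / c + B) * s\<^sup>2"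
      by (simp add: algebra_simps)
    moreover have "2 * K * (g \<bullet> v)\<^sup>2 = E * s\<^sup>2" using g by (simp add: K_def gv)
    ultimately show ?thesis by (simp add: E_def nv algebra_simps)
  qed
  ultimately show ?thesis by blast
qed

text \<open>Continuity at each fixed vector upgrades to continuity in operator norm because finitely
  many basis vectors control a linear map.\<close>

lemma linear_family_continuous:
  fixes A :: "'a::metric_space \<Rightarrow> 'b::euclidean_space \<Rightarrow> 'c::real_normed_vector"
  assumes U: "open U" "p \<in> U" and A: "\<And>x. x \<in> U \<Longrightarrow> linear (A x)"
    and c: "\<And>v. continuous_on U (\<lambda>x. A x v)" and e: "e > 0"
  shows "\<exists>d>0. ball p d \<subseteq> U \<and> (\<forall>x\<in>ball p d. \<forall>v. norm (A x v - A p v) \<le> e * norm v)"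
proof -
  have "continuous_on U (\<lambda>x. \<Sum>b\<in>Basis. norm (A x b - A p b))" by (intro continuous_intros c)
  then have "isCont (\<lambda>x. \<Sum>b\<in>Basis. norm (A x b - A p b)) p" using U continuous_on_eq_continuous_at by blast
  then obtain d1 where d1: "d1 > 0" "\<And>x. dist x p < d1 \<Longrightarrow> (\<Sum>b\<in>Basis. norm (A x b - A p b)) < e"
    using e unfolding continuous_at_eps_delta dist_norm by fastforce
  obtain d2 where d2: "d2 > 0" "ball p d2 \<subseteq> U" using U open_contains_ball by blast
  have "norm (A x v - A p v) \<le> e * norm v" if x: "x \<in> ball p (min d1 d2)" for x v
  proof -
    have xU: "x \<in> U" using x d2 by auto
    have rep: "A y v = (\<Sum>b\<in>Basis. (v \<bullet> b) *\<^sub>R A y b)" if "y \<in> U" for y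
      by (subst (1) euclidean_representation[of v, symmetric]) (simp add: linear_sum[OF A[OF that]] linear_scale[OF A[OF that]])
    have "A x v - A p v = (\<Sum>b\<in>Basis. (v \<bullet> b) *\<^sub>R (A x b - A p b))"
      by (simp add: rep[OF xU] rep[OF U(2)] scaleR_diff_right sum_subtractf)
    also have "norm \<dots> \<le> (\<Sum>b\<in>Basis. norm ((v \<bullet> b) *\<^sub>R (A x b - A p b)))" by (rule norm_sum)
    also have "\<dots> \<le> (\<Sum>b\<in>Basis. norm v * norm (A x b - A p b))"
      by (intro sum_mono) (simp add: mult_right_mono Basis_le_norm)
    also have "\<dots> = norm v * (\<Sum>b\<in>Basis. norm (A x b - A p b))" by (simp add: sum_distrib_left)
    also have "\<dots> \<le> norm v * e" using d1(2)[of x] x by (intro mult_left_mono) (auto simp: dist_commute)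
    finally show ?thesis by (simp add: mult.commute)
  qed
  then show ?thesis using d1 d2 by (intro exI[of _ "min d1 d2"]) auto
qed

text \<open>Taylor's formula along the segment from x to y. With the remainder in Lagrange form,
  bounds on A over V are all that is needed afterwards.\<close>

lemma segment_taylor2:
  fixes f :: "'a::real_inner \<Rightarrow> real"
  assumes f: "\<And>z. z \<in> V \<Longrightarrow> (f has_derivative (\<lambda>v. g z \<bullet> v)) (at z)"
    and g: "\<And>z. z \<in> V \<Longrightarrow> (g has_derivative A z) (at z)"
    and V: "convex V" "x \<in> V" "y \<in> V"
  shows "\<exists>z\<in>V. f y = f x + g x \<bullet> (y - x) + (A z (y - x) \<bullet> (y - x)) / 2"
proof -
  define d where "d = y - x"
  define D where "D m t = (if m = 0 then f (x + t *\<^sub>R d) else if m = 1 then g (x + t *\<^sub>R d) \<bullet> d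
     else A (x + t *\<^sub>R d) d \<bullet> d)" for m :: nat and t :: real
  have inV: "x + t *\<^sub>R d \<in> V" if "0 \<le> t" "t \<le> 1" for t
    using that V convexD_alt[of V x y t] by (simp add: d_def algebra_simps)
  have "DERIV (D m) t :> D (Suc m) t" if "m < 2" "0 \<le> t" "t \<le> 1" for m t
  proof -
    note z = inV[OF that(2,3)]
    have 1: "((\<lambda>t. f (x + t *\<^sub>R d)) has_derivative (\<lambda>h. g (x + t *\<^sub>R d) \<bullet> (h *\<^sub>R d))) (at t)"
      by (rule has_derivative_compose[where g=f and f="\<lambda>t. x + t *\<^sub>R d", OF _ f[OF z]]) (auto intro!: derivative_eq_intros)
    have 2: "((\<lambda>t. g (x + t *\<^sub>R d)) has_derivative (\<lambda>h. A (x + t *\<^sub>R d) (h *\<^sub>R d))) (at t)"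
      by (rule has_derivative_compose[where g=g and f="\<lambda>t. x + t *\<^sub>R d", OF _ g[OF z]]) (auto intro!: derivative_eq_intros)
    have l: "A (x + t *\<^sub>R d) (h *\<^sub>R d) = h *\<^sub>R A (x + t *\<^sub>R d) d" for h
      using g[OF z] by (meson has_derivative_bounded_linear bounded_linear.linear linear_scale)
    have 3: "((\<lambda>t. g (x + t *\<^sub>R d) \<bullet> d) has_derivative (\<lambda>h. A (x + t *\<^sub>R d) (h *\<^sub>R d) \<bullet> d)) (at t)"
      using 2 by (auto intro!: derivative_eq_intros)
    from \<open>m < 2\<close> consider "m = 0" | "m = 1" by linarith
    then show ?thesis
    proof cases
      case 1 then show ?thesis using \<open>((\<lambda>t. f (x + t *\<^sub>R d)) has_derivative _) _\<close>
        unfolding has_field_derivative_def D_def by (auto elim!: has_derivative_eq_rhs simp: fun_eq_iff)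
    next
      case 2 then show ?thesis using 3 unfolding has_field_derivative_def D_def
        by (auto elim!: has_derivative_eq_rhs simp: fun_eq_iff l)
    qed
  qed
  then obtain t where t: "0 < t" "t < 1" "D 0 1 = (\<Sum>m<2. D m 0 / fact m * 1 ^ m) + D 2 t / fact 2 * 1 ^ 2"
    using Maclaurin[of 1 2 D "D 0"] by auto
  then have "f y = f x + g x \<bullet> d + (A (x + t *\<^sub>R d) d \<bullet> d) / 2"
    by (simp add: D_def d_def numeral_2_eq_2)
  then show ?thesis using inV[of t] t by (auto simp: d_def)
qed

text \<open>The definition prescribes the sign of r on \<Omega> itself. The set where r is positive
  is open and misses \<Omega>, hence also its closure; on the frontier r cannot be negative either,
  since an open set misses its frontier.\<close>

lemma defining_function_signs:
  assumes "local_defining_function \<Omega> p U r" "open \<Omega>" "continuous_on U r"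
  shows "\<And>y. y \<in> closure \<Omega> \<Longrightarrow> y \<in> U \<Longrightarrow> r y \<le> 0"
    and "\<And>y. y \<in> frontier \<Omega> \<Longrightarrow> y \<in> U \<Longrightarrow> r y = 0"
proof -
  have U: "open U" and \<Omega>U: "\<Omega> \<inter> U = {x \<in> U. r x < 0}"
    using assms(1) by (auto simp: local_defining_function_def)
  show le: "r y \<le> 0" if "y \<in> closure \<Omega>" "y \<in> U" for y
  proof (rule ccontr)
    assume "\<not> r y \<le> 0"
    have "open {x \<in> U. r x > 0}"
      using continuous_open_preimage[OF assms(3) U open_greaterThan[of 0]] by (simp add: vimage_def Int_def)
    then have "{x \<in> U. r x > 0} \<inter> \<Omega> \<noteq> {}"
      using that \<open>\<not> r y \<le> 0\<close> open_Int_closure_eq_empty[of "{x \<in> U. r x > 0}" \<Omega>] by auto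
    then obtain z where "z \<in> U" "r z > 0" "z \<in> \<Omega>" by blast
    then have "z \<in> \<Omega> \<inter> U" "\<not> r z < 0" by auto
    then show False unfolding \<Omega>U by blast
  qed
  show "r y = 0" if "y \<in> frontier \<Omega>" "y \<in> U" for y
  proof -
    have "y \<notin> \<Omega>" "y \<in> closure \<Omega>" using that assms(2) by (auto simp: frontier_def interior_open)
    then show ?thesis using le[of y] that \<Omega>U by (smt (verit) IntE mem_Collect_eq)
  qed
qed

section \<open>Local and global strict convexity\<close>

text \<open>Near \<open>x\<close>, the set \<open>\<Omega>\<close> contains a ball of radius \<open>1 / (2 C)\<close> and lies in a ball of radius \<open>1 / (2 c)\<close>, both
  touching the boundary at \<open>x\<close> with outer unit normal \<open>N\<close>.\<close>

definition rolling_at :: "'a::euclidean_space set \<Rightarrow> real \<Rightarrow> real \<Rightarrow> real \<Rightarrow> 'a \<Rightarrow> 'a \<Rightarrow> bool" where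
  "rolling_at \<Omega> e c C x N \<longleftrightarrow> norm N = 1 \<and>
     (\<forall>y\<in>ball x e. (y \<in> closure \<Omega> \<longrightarrow> c * (dist x y)\<^sup>2 \<le> N \<bullet> (x - y)) \<and>
       (C * (dist x y)\<^sup>2 < N \<bullet> (x - y) \<longrightarrow> y \<in> \<Omega>))"

lemma rolling_at_mono:
  assumes "rolling_at \<Omega> e c C x N" "e' \<le> e" "c' \<le> c" "C \<le> C'"
  shows "rolling_at \<Omega> e' c' C' x N"
  unfolding rolling_at_def
proof (intro conjI ballI impI)
  show "norm N = 1" using assms(1) by (simp add: rolling_at_def)
  fix y assume y: "y \<in> ball x e'"
  then have y': "y \<in> ball x e" using assms(2) by auto
  show "c' * (dist x y)\<^sup>2 \<le> N \<bullet> (x - y)" if "y \<in> closure \<Omega>"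
    using assms(1,3) y' that mult_right_mono[OF assms(3), of "(dist x y)\<^sup>2"] unfolding rolling_at_def by force
  show "y \<in> \<Omega>" if "C' * (dist x y)\<^sup>2 < N \<bullet> (x - y)"
    using assms(1,4) y' that mult_right_mono[OF assms(4), of "(dist x y)\<^sup>2"] unfolding rolling_at_def by force
qed

lemma weingarten_derivative:
  fixes G :: "'a::euclidean_space \<Rightarrow> 'a"
  assumes "(G has_derivative S) (at x)" "G x \<noteq> 0"
  shows "((\<lambda>x. sgn (G x)) has_derivative (\<lambda>v. (S v - (sgn (G x) \<bullet> S v) *\<^sub>R sgn (G x)) /\<^sub>R norm (G x))) (at x)"
  using has_derivative_compose[OF assms(1) has_derivative_sgn[OF assms(2)]] by simp

text \<open>An eigenvalue of the Hessian compressed to the tangent space, divided by the length of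
  the gradient, is an eigenvalue of the Weingarten map, hence a principal curvature. So positivity
  of the curvatures feeds \<open>hyperplane_form_coercive\<close>. The constant still depends on the
  point.\<close>

lemma tangent_form_coercive:
  assumes ldf: "local_defining_function \<Omega> p U r"
    and S: "(gradient r has_derivative S) (at p)" and sym: "\<And>v w. S v \<bullet> w = v \<bullet> S w"
    and curv: "\<And>\<kappa>. principal_curvature \<Omega> p \<kappa> \<Longrightarrow> \<kappa> > 0"
  shows "\<exists>c>0. \<forall>v. gradient r p \<bullet> v = 0 \<longrightarrow> c * (norm v)\<^sup>2 \<le> v \<bullet> S v"
proof -
  have g: "gradient r p \<noteq> 0" using ldf by (auto simp: local_defining_function_def)
  define n where "n = sgn (gradient r p)"
  have lin: "linear S" using S by (meson has_derivative_bounded_linear bounded_linear.linear)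
  have gn: "gradient r p = norm (gradient r p) *\<^sub>R n" using g by (simp add: n_def sgn_div_norm)
  have ng: "n \<bullet> v = 0 \<longleftrightarrow> gradient r p \<bullet> v = 0" for v
    by (subst gn) (use g in simp)
  have fd: "frechet_derivative (\<lambda>x. sgn (gradient r x)) (at p) = (\<lambda>v. (S v - (n \<bullet> S v) *\<^sub>R n) /\<^sub>R norm (gradient r p))"
    unfolding n_def by (rule frechet_derivative_eqI[OF weingarten_derivative[OF S g]])
  have "\<exists>c>0. \<forall>v. n \<bullet> v = 0 \<longrightarrow> c * (norm v)\<^sup>2 \<le> v \<bullet> S v"
  proof (rule hyperplane_form_coercive[OF lin sym])
    show "norm n = 1" using g by (simp add: n_def norm_sgn)
    fix v \<kappa> assume v: "v \<noteq> 0" "n \<bullet> v = 0" "S v - (n \<bullet> S v) *\<^sub>R n = \<kappa> *\<^sub>R v"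
    have "frechet_derivative (\<lambda>x. sgn (gradient r x)) (at p) v = (\<kappa> / norm (gradient r p)) *\<^sub>R v"
      unfolding fd v(3) by (simp add: divide_inverse mult.commute)
    then have "principal_curvature \<Omega> p (\<kappa> / norm (gradient r p))"
      unfolding principal_curvature_def using ldf v ng by blast
    then have "\<kappa> / norm (gradient r p) > 0" by (rule curv)
    then show "\<kappa> > 0" using g by (simp add: zero_less_divide_iff)
  qed
  then show ?thesis by (simp add: ng)
qed

text \<open>Locally \<open>\<rho> = r + K r\<^sup>2\<close> is a strictly convex defining function for large \<open>K\<close>; its second order Taylor
  expansion at boundary points gives both inequalities.\<close>

lemma local_rolling:
  fixes \<Omega> :: "'a::euclidean_space set"
  assumes op: "open \<Omega>" and p: "p \<in> frontier \<Omega>" and ldf: "local_defining_function \<Omega> p U r"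
    and curv: "\<And>\<kappa>. principal_curvature \<Omega> p \<kappa> \<Longrightarrow> \<kappa> > 0"
  shows "\<exists>e>0. \<exists>c>0. \<exists>C>0. \<forall>x\<in>frontier \<Omega> \<inter> ball p e. \<exists>N. rolling_at \<Omega> e c C x N"
proof -
  have U: "open U" "p \<in> U" and C2: "cont_diff_on 2 r U" and gnz: "\<And>x. x \<in> U \<Longrightarrow> gradient r x \<noteq> 0"
    and \<Omega>U: "\<Omega> \<inter> U = {x \<in> U. r x < 0}"
    using ldf by (auto simp: local_defining_function_def)
  define G where "G = gradient r"
  define S where "S x = frechet_derivative (gradient r) (at x)" for x
  have r: "\<And>x. x \<in> U \<Longrightarrow> (r has_derivative (\<lambda>v. G x \<bullet> v)) (at x)"
    and S: "\<And>x. x \<in> U \<Longrightarrow> (G has_derivative S x) (at x)"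
    and cS: "\<And>v. continuous_on U (\<lambda>x. S x v)"
    and sym: "\<And>x v w. x \<in> U \<Longrightarrow> S x v \<bullet> w = v \<bullet> S x w"
    unfolding G_def S_def by (fact C2_gradient[OF C2 U(1)])+
  have linS: "linear (S x)" if "x \<in> U" for x using S[OF that] by (meson has_derivative_bounded_linear bounded_linear.linear)
  have cG: "continuous_on U G" using S U by (meson continuous_at_imp_continuous_on has_derivative_continuous)
  have cr: "continuous_on U r" using r U by (meson continuous_at_imp_continuous_on has_derivative_continuous)
  note sgns = defining_function_signs[OF ldf op cr]
  have Gp: "G p \<noteq> 0" using gnz U by (simp add: G_def)
  obtain c0 where c0: "c0 > 0" "\<And>v. G p \<bullet> v = 0 \<Longrightarrow> c0 * (norm v)\<^sup>2 \<le> v \<bullet> S p v"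
    using tangent_form_coercive[OF ldf S[OF U(2), unfolded G_def] sym[OF U(2)] curv] by (auto simp: G_def)
  obtain K where K: "K \<ge> 0" "\<And>v. c0 / 2 * (norm v)\<^sup>2 \<le> v \<bullet> S p v + 2 * K * (G p \<bullet> v)\<^sup>2"
    using finsler_coercive[OF linS[OF U(2)] sym[OF U(2)] Gp c0] by blast
  \<comment> \<open>The derivative of \<open>(1 + 2 * K * r x) *\<^sub>R G x\<close>, that is, the
    Hessian of r + K r^2.\<close>
  define A where "A x v = (1 + 2 * K * r x) *\<^sub>R S x v + (2 * K * (G x \<bullet> v)) *\<^sub>R G x" for x v
  have linA: "linear (A x)" if "x \<in> U" for x
    using linS[OF that] unfolding A_def
    by (intro linearI) (auto simp: linear_add linear_scale inner_add_right algebra_simps scaleR_add_left)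
  have cA: "continuous_on U (\<lambda>x. A x v)" for v
    unfolding A_def by (intro continuous_intros cS cr cG)
  obtain B where B: "B > 0" "\<And>v. norm (A p v) \<le> B * norm v" using linear_bounded_pos[OF linA[OF U(2)]] by blast
  have rp: "r p = 0" using sgns(2) p U by blast
  have Ap: "c0 / 2 * (norm v)\<^sup>2 \<le> v \<bullet> A p v" for v
    using K(2)[of v] by (simp add: A_def rp inner_add_right power2_eq_square inner_commute algebra_simps)
  have "c0 / 4 > 0" using c0 by simp
  from linear_family_continuous[OF U linA cA this]
  obtain d1 where d1: "d1 > 0" "ball p d1 \<subseteq> U" "\<And>x v. x \<in> ball p d1 \<Longrightarrow> norm (A x v - A p v) \<le> c0 / 4 * norm v"
    by blast
  have A_low: "c0 / 4 * (norm v)\<^sup>2 \<le> A x v \<bullet> v" and A_up: "A x v \<bullet> v \<le> (B + c0 / 4) * (norm v)\<^sup>2" if "x \<in> ball p d1" for x v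
  proof -
    have "\<bar>(A x v - A p v) \<bullet> v\<bar> \<le> norm (A x v - A p v) * norm v" by (rule Cauchy_Schwarz_ineq2)
    also have "\<dots> \<le> c0 / 4 * norm v * norm v" using d1(3)[OF that, of v] by (intro mult_right_mono) auto
    finally have 1: "\<bar>A x v \<bullet> v - A p v \<bullet> v\<bar> \<le> c0 / 4 * (norm v)\<^sup>2" by (simp add: inner_diff_left power2_eq_square)
    have "\<bar>A p v \<bullet> v\<bar> \<le> B * norm v * norm v"
      using Cauchy_Schwarz_ineq2[of "A p v" v] mult_right_mono[OF B(2)[of v], of "norm v"] by simp
    then have 2: "A p v \<bullet> v \<le> B * (norm v)\<^sup>2" by (simp add: power2_eq_square)
    show "c0 / 4 * (norm v)\<^sup>2 \<le> A x v \<bullet> v"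
    proof -
      have "A p v \<bullet> v - c0 / 4 * (norm v)\<^sup>2 \<le> A x v \<bullet> v" using 1 by linarith
      then show ?thesis using Ap[of v] inner_commute[of v "A p v"] by linarith
    qed
    show "A x v \<bullet> v \<le> (B + c0 / 4) * (norm v)\<^sup>2"
    proof -
      have "A x v \<bullet> v \<le> A p v \<bullet> v + c0 / 4 * (norm v)\<^sup>2" using 1 by linarith
      then show ?thesis using 2 by (simp add: distrib_right)
    qed
  qed
  \<comment> \<open>These two radii keep the gradient length within a factor 2 of its value at p and
    the factor 1 + K r positive, so that \<open>\<rho>\<close> and r have the same sign.\<close>
  have "isCont (\<lambda>x. norm (G x)) p" "isCont (\<lambda>x. K * r x) p"
    using cG cr U by (auto intro!: continuous_intros simp: continuous_on_eq_continuous_at)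
  then obtain d2 d3 where d2: "d2 > 0" "\<And>x. dist x p < d2 \<Longrightarrow> \<bar>norm (G x) - norm (G p)\<bar> < norm (G p) / 2"
    and d3: "d3 > 0" "\<And>x. dist x p < d3 \<Longrightarrow> \<bar>K * r x - K * r p\<bar> < 1/2"
    unfolding continuous_at_eps_delta dist_real_def
    using Gp half_gt_zero[of "norm (G p)"] half_gt_zero[of "1::real"] by (metis zero_less_norm_iff zero_less_one)
  define g where "g = norm (G p)"
  have g: "g > 0" using Gp by (simp add: g_def)
  define d where "d = min d1 (min d2 d3)"
  have d: "d > 0" using d1 d2 d3 by (simp add: d_def)
  have dU: "ball p d \<subseteq> U" using d1(2) by (auto simp: d_def)
  define \<rho> where "\<rho> x = r x + K * (r x)\<^sup>2" for x
  have \<rho>: "(\<rho> has_derivative (\<lambda>v. ((1 + 2 * K * r z) *\<^sub>R G z) \<bullet> v)) (at z)" if "z \<in> ball p d" for z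
    unfolding \<rho>_def using r[of z] dU that
    by (auto intro!: derivative_eq_intros simp: fun_eq_iff algebra_simps)
  have d\<rho>: "((\<lambda>z. (1 + 2 * K * r z) *\<^sub>R G z) has_derivative A z) (at z)" if "z \<in> ball p d" for z
    unfolding A_def[abs_def] using r[of z] S[of z] dU that
    by (auto intro!: derivative_eq_intros simp: fun_eq_iff algebra_simps)
  define M where "M = B + c0 / 4"
  have M: "M > 0" using B c0 by (simp add: M_def)
  \<comment> \<open>Taylor's formula gives \<open>c0 / 8\<close> in the outer and
    \<open>M / 2\<close> in the inner estimate, both for the unnormalised gradient. Dividing by its
    length, which lies between g/2 and 2 g, turns them into \<open>c0 / (16 * g)\<close> and
    \<open>M / g\<close>.\<close>
  have roll: "rolling_at \<Omega> (d / 2) (c0 / (16 * g)) (M / g) x (sgn (G x))" if x: "x \<in> frontier \<Omega>" "x \<in> ball p (d / 2)" for x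
  proof -
    have xd: "x \<in> ball p d" using x d by auto
    have rx: "r x = 0" using sgns(2)[OF x(1)] xd dU by blast
    have Gx: "g / 2 < norm (G x)" "norm (G x) < 2 * g"
    proof -
      have "\<bar>norm (G x) - g\<bar> < g / 2" using d2(2)[of x] xd by (auto simp: d_def dist_commute g_def)
      then show "g / 2 < norm (G x)" "norm (G x) < 2 * g" using g by linarith+
    qed
    then have Gx0: "norm (G x) > 0" using g by linarith
    have sg: "norm (G x) * (sgn (G x) \<bullet> w) = G x \<bullet> w" for w using Gx0 by (simp add: sgn_div_norm)
    have tay: "\<exists>z\<in>ball p d. \<rho> y = - (G x \<bullet> (x - y)) + (A z (y - x) \<bullet> (y - x)) / 2" if y: "y \<in> ball p d" for y
      using segment_taylor2[OF \<rho> d\<rho> convex_ball xd y] rx by (auto simp: \<rho>_def inner_diff_right)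
    show ?thesis unfolding rolling_at_def
    proof (intro conjI ballI impI)
      show "norm (sgn (G x)) = 1" using Gx0 by (simp add: norm_sgn)
      fix y assume y: "y \<in> ball x (d / 2)"
      have yd: "y \<in> ball p d" using x(2) y dist_triangle[of p y x] by (simp add: dist_commute)
      have yU: "y \<in> U" using yd dU by blast
      have "\<bar>K * r y\<bar> < 1/2" using d3(2)[of y] yd rp by (simp add: d_def dist_commute)
      then have fac: "1 + K * r y > 0" by (simp add: abs_less_iff)
      have \<rho>f: "\<rho> y = r y * (1 + K * r y)" by (simp add: \<rho>_def power2_eq_square algebra_simps)
      obtain z where z: "z \<in> ball p d" "\<rho> y = - (G x \<bullet> (x - y)) + (A z (y - x) \<bullet> (y - x)) / 2" using tay[OF yd] by blast
      have zd1: "z \<in> ball p d1" using z by (auto simp: d_def)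
      define D where "D = (dist x y)\<^sup>2"
      have D0: "D \<ge> 0" by (simp add: D_def)
      have low: "c0 / 4 * D \<le> A z (y - x) \<bullet> (y - x)" and up: "A z (y - x) \<bullet> (y - x) \<le> M * D"
        using A_low[OF zd1, of "y - x"] A_up[OF zd1, of "y - x"] by (simp_all add: D_def M_def dist_norm norm_minus_commute)
      show "c0 / (16 * g) * (dist x y)\<^sup>2 \<le> sgn (G x) \<bullet> (x - y)" if "y \<in> closure \<Omega>"
      proof -
        have "r y \<le> 0" using sgns(1)[OF that yU] .
        then have "\<rho> y \<le> 0" using fac by (simp add: \<rho>f mult_le_0_iff)
        then have 1: "c0 / 8 * D \<le> G x \<bullet> (x - y)" using z low by simp
        have "c0 / (16 * g) * D * norm (G x) \<le> c0 / (16 * g) * D * (2 * g)"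
          using Gx g c0 D0 by (intro mult_left_mono) auto
        also have "\<dots> = c0 / 8 * D" using g by simp
        finally have "norm (G x) * (c0 / (16 * g) * D) \<le> norm (G x) * (sgn (G x) \<bullet> (x - y))"
          using 1 unfolding sg by (simp add: mult.commute)
        then show ?thesis using Gx0 by (simp only: mult_le_cancel_left_pos D_def)
      qed
      show "y \<in> \<Omega>" if "M / g * (dist x y)\<^sup>2 < sgn (G x) \<bullet> (x - y)"
      proof -
        have "M / 2 * D = g / 2 * (M / g * D)" using g by simp
        also have "\<dots> \<le> norm (G x) * (M / g * D)" using Gx g M D0 by (intro mult_right_mono) auto
        also have "\<dots> < norm (G x) * (sgn (G x) \<bullet> (x - y))" using that Gx0 unfolding D_def by (rule mult_strict_left_mono)
        finally have "M / 2 * D < G x \<bullet> (x - y)" unfolding sg .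
        then have "\<rho> y < 0" using z up by simp
        then have "r y < 0" using fac by (simp add: \<rho>f mult_less_0_iff)
        then show ?thesis using \<Omega>U yU by blast
      qed
    qed
  qed
  have "d / 2 > 0" "c0 / (16 * g) > 0" "M / g > 0" using d c0 g M by auto
  then show ?thesis using roll by blast
qed

text \<open>Compactness of the frontier of a bounded set: finitely many balls suffice, and the
  smallest radius, the smallest c and the largest C serve for all of them by
  \<open>rolling_at_mono\<close>.\<close>

lemma uniform_local_rolling:
  fixes \<Omega> :: "'a::euclidean_space set"
  assumes bd: "bounded \<Omega>" and sc: "strongly_convex_domain \<Omega>"
  shows "\<exists>e>0. \<exists>c>0. \<exists>C>0. \<forall>x\<in>frontier \<Omega>. \<exists>N. rolling_at \<Omega> e c C x N"
proof -
  have op: "open \<Omega>" using sc by (simp add: strongly_convex_domain_def)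
  have "\<forall>p\<in>frontier \<Omega>. \<exists>e c C. e > 0 \<and> c > 0 \<and> C > 0 \<and> (\<forall>x\<in>frontier \<Omega> \<inter> ball p e. \<exists>N. rolling_at \<Omega> e c C x N)"
  proof
    fix p assume p: "p \<in> frontier \<Omega>"
    then obtain U r where "local_defining_function \<Omega> p U r"
      using sc unfolding strongly_convex_domain_def C2_boundary_def by blast
    from local_rolling[OF op p this] sc p
    show "\<exists>e c C. e > 0 \<and> c > 0 \<and> C > 0 \<and> (\<forall>x\<in>frontier \<Omega> \<inter> ball p e. \<exists>N. rolling_at \<Omega> e c C x N)"
      unfolding strongly_convex_domain_def by blast
  qed
  then obtain e c C where ecC: "\<And>p. p \<in> frontier \<Omega> \<Longrightarrow> e p > 0 \<and> c p > 0 \<and> C p > 0 \<and>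
      (\<forall>x\<in>frontier \<Omega> \<inter> ball p (e p). \<exists>N. rolling_at \<Omega> (e p) (c p) (C p) x N)"
    by metis
  have "compact (frontier \<Omega>)" using bd by (rule compact_frontier_bounded)
  moreover have "frontier \<Omega> \<subseteq> (\<Union>p\<in>frontier \<Omega>. ball p (e p))" using ecC by force
  ultimately obtain T where T: "T \<subseteq> frontier \<Omega>" "finite T" "frontier \<Omega> \<subseteq> (\<Union>p\<in>T. ball p (e p))"
    using compactE_image[of "frontier \<Omega>" "frontier \<Omega>" "\<lambda>p. ball p (e p)"] by auto
  \<comment> \<open>Inserting 1 keeps the extrema meaningful for an empty T and makes their signs
    immediate.\<close>
  define e' c' C' where "e' = Min (insert 1 (e ` T))" and "c' = Min (insert 1 (c ` T))" and "C' = Max (insert 1 (C ` T))"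
  have "e' > 0" "c' > 0" using T ecC by (auto simp: e'_def c'_def)
  moreover have "C' \<ge> 1" using T by (simp add: C'_def)
  moreover have "\<exists>N. rolling_at \<Omega> e' c' C' x N" if x: "x \<in> frontier \<Omega>" for x
  proof -
    obtain p where p: "p \<in> T" "x \<in> ball p (e p)" using T x by blast
    then obtain N where "rolling_at \<Omega> (e p) (c p) (C p) x N" using ecC[of p] T x by blast
    then have "rolling_at \<Omega> e' c' C' x N"
      by (rule rolling_at_mono) (use T p in \<open>auto simp: e'_def c'_def C'_def\<close>)
    then show ?thesis by blast
  qed
  moreover have "C' > 0" using calculation(3) by linarith
  ultimately show ?thesis by blast
qed

text \<open>The pairs of points whose segment stays in \<open>\<Omega>\<close> form an open and closed subset of \<open>\<Omega> \<times> \<Omega>\<close>: a limit segment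
  touching the boundary would touch it at an interior point of the segment, against local strict convexity.\<close>

lemma convex_if_rolling:
  fixes \<Omega> :: "'a::euclidean_space set"
  assumes op: "open \<Omega>" and con: "connected \<Omega>" and e: "e > 0" "c > 0"
    and roll: "\<And>x. x \<in> frontier \<Omega> \<Longrightarrow> \<exists>N. rolling_at \<Omega> e c C x N"
  shows "convex \<Omega>"
proof (cases "\<Omega> = {}")
  case False
  define A where "A = {z \<in> \<Omega> \<times> \<Omega>. closed_segment (fst z) (snd z) \<subseteq> \<Omega>}"
  have "open A"
    unfolding open_contains_ball
  proof
    fix z assume z: "z \<in> A"
    obtain x y where xy: "z = (x, y)" by fastforce
    have seg: "closed_segment x y \<subseteq> \<Omega>" using z by (simp add: A_def xy)
    obtain d where d: "d > 0" "(\<Union>w\<in>closed_segment x y. ball w d) \<subseteq> \<Omega>"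
      using compact_subset_open_imp_ball_epsilon_subset[OF compact_segment op seg] by blast
    have "ball z d \<subseteq> A"
    proof
      fix z' assume z': "z' \<in> ball z d"
      obtain x' y' where xy': "z' = (x', y')" by fastforce
      have dx: "dist x x' < d" and dy: "dist y y' < d"
        using z' dist_fst_le[of z z'] dist_snd_le[of z z'] by (auto simp: xy xy')
      have "closed_segment x' y' \<subseteq> \<Omega>"
      proof
        fix w assume "w \<in> closed_segment x' y'"
        then obtain u where u: "0 \<le> u" "u \<le> 1" "w = (1 - u) *\<^sub>R x' + u *\<^sub>R y'" by (auto simp: in_segment)
        define v where "v = (1 - u) *\<^sub>R x + u *\<^sub>R y"
        have "v - w = (1 - u) *\<^sub>R (x - x') + u *\<^sub>R (y - y')" by (simp add: v_def u algebra_simps)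
        then have "norm (v - w) \<le> (1 - u) * dist x x' + u * dist y y'"
          using norm_triangle_ineq[of "(1 - u) *\<^sub>R (x - x')" "u *\<^sub>R (y - y')"] u by (simp add: dist_norm)
        also have "\<dots> < d"
          using convex_bound_lt[OF dx dy, of "1 - u" u] u by simp
        finally have "w \<in> ball v d" by (simp add: dist_norm)
        moreover have "v \<in> closed_segment x y" using u by (auto simp: in_segment v_def)
        ultimately show "w \<in> \<Omega>" using d by blast
      qed
      then show "z' \<in> A" by (auto simp: A_def xy')
    qed
    then show "\<exists>d>0. ball z d \<subseteq> A" using d by blast
  qed
  moreover have "closedin (top_of_set (\<Omega> \<times> \<Omega>)) A"
  proof -
    have "z \<in> A" if z: "z \<in> \<Omega> \<times> \<Omega>" and lim: "z islimpt A" for z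
    proof -
      obtain f where f: "\<And>n. f n \<in> A" "f \<longlonglongrightarrow> z" using lim unfolding islimpt_sequential by blast
      have incl: "(1 - u) *\<^sub>R fst z + u *\<^sub>R snd z \<in> closure \<Omega>" if u: "0 \<le> u" "u \<le> 1" for u
      proof (rule closed_sequentially[OF closed_closure])
        show "(\<lambda>n. (1 - u) *\<^sub>R fst (f n) + u *\<^sub>R snd (f n)) \<longlonglongrightarrow> (1 - u) *\<^sub>R fst z + u *\<^sub>R snd z"
          using f(2) by (intro tendsto_intros)
        fix n
        have "(1 - u) *\<^sub>R fst (f n) + u *\<^sub>R snd (f n) \<in> closed_segment (fst (f n)) (snd (f n))"
          using u by (auto simp: in_segment)
        then show "(1 - u) *\<^sub>R fst (f n) + u *\<^sub>R snd (f n) \<in> closure \<Omega>"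
          using f(1)[of n] closure_subset by (auto simp: A_def)
      qed
      have "w \<in> \<Omega>" if w: "w \<in> closed_segment (fst z) (snd z)" for w
      proof (rule ccontr)
        assume nw: "w \<notin> \<Omega>"
        obtain u where u: "0 \<le> u" "u \<le> 1" "w = (1 - u) *\<^sub>R fst z + u *\<^sub>R snd z" using w by (auto simp: in_segment)
        have "w \<in> closure \<Omega>" using incl u by blast
        then have wf: "w \<in> frontier \<Omega>" using nw op by (simp add: frontier_def interior_open)
        have u01: "0 < u" "u < 1" using u nw z by (auto simp: mem_Times_iff le_less)
        define d where "d = snd z - fst z"
        have d0: "d \<noteq> 0" using nw u z unfolding d_def by (auto simp: algebra_simps mem_Times_iff)
        obtain N where N: "rolling_at \<Omega> e c C w N" using roll[OF wf] by blast
        \<comment> \<open>Small enough for both w - s d and w + s d to stay on the segment and in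
          the ball where the rolling estimate holds. Both points lie in the closure, so the estimate
          makes the inner products of N with d and with - d positive at the same time.\<close>
        define s where "s = min (min u (1 - u)) (e / (2 * norm d))"
        have s: "s > 0" "s \<le> u" "s \<le> 1 - u" using u01 e d0 by (auto simp: s_def)
        have "s * norm d \<le> e / (2 * norm d) * norm d" by (intro mult_right_mono) (auto simp: s_def)
        also have "\<dots> < e" using d0 e by simp
        finally have se: "s * norm d < e" .
        have pos: "0 < N \<bullet> (a *\<^sub>R d)" if a: "a = s \<or> a = - s" for a
        proof -
          have "w - a *\<^sub>R d = (1 - (u - a)) *\<^sub>R fst z + (u - a) *\<^sub>R snd z" by (simp add: u d_def algebra_simps)
          then have "w - a *\<^sub>R d \<in> closure \<Omega>" using incl[of "u - a"] a s by auto
          moreover have "w - a *\<^sub>R d \<in> ball w e" using a s se by (auto simp: dist_norm)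
          ultimately have "c * (dist w (w - a *\<^sub>R d))\<^sup>2 \<le> N \<bullet> (w - (w - a *\<^sub>R d))"
            using N unfolding rolling_at_def by blast
          moreover have "c * (dist w (w - a *\<^sub>R d))\<^sup>2 > 0" using a s d0 e(2) by (auto simp: dist_norm)
          ultimately show ?thesis by (simp add: dist_norm)
        qed
        show False using pos[of s] pos[of "- s"] by simp
      qed
      then show "z \<in> A" using z by (auto simp: A_def)
    qed
    then show ?thesis unfolding closedin_limpt by (auto simp: A_def)
  qed
  moreover have "openin (top_of_set (\<Omega> \<times> \<Omega>)) A" using \<open>open A\<close> by (intro open_subset) (auto simp: A_def)
  moreover have "connected (\<Omega> \<times> \<Omega>)" using con by (intro connected_Times)
  moreover have "A \<noteq> {}"
  proof -
    obtain x where "x \<in> \<Omega>" using False by blast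
    then have "(x, x) \<in> A" by (simp add: A_def)
    then show ?thesis by blast
  qed
  ultimately have eq: "A = \<Omega> \<times> \<Omega>" unfolding connected_clopen by blast
  have "closed_segment x y \<subseteq> \<Omega>" if "x \<in> \<Omega>" "y \<in> \<Omega>" for x y
  proof -
    have "(x, y) \<in> A" unfolding eq using that by simp
    then show ?thesis by (simp add: A_def)
  qed
  then show ?thesis unfolding convex_contains_segment by blast
qed simp

text \<open>Convexity spreads the local estimate over the body: a far point y is replaced by the
  point of the segment from x to y at distance e/2 from x, and the height over the tangent plane
  scales linearly along the segment. The resulting linear lower bound becomes quadratic on dividing
  by a bound R for the diameter.\<close>

lemma global_rolling:
  fixes \<Omega> :: "'a::euclidean_space set"
  assumes cv: "convex \<Omega>" and bd: "bounded \<Omega>" and e: "e > 0" "c > 0"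
    and roll: "\<And>x. x \<in> frontier \<Omega> \<Longrightarrow> \<exists>N. rolling_at \<Omega> e c C x N"
  shows "\<exists>c'>0. \<forall>x\<in>frontier \<Omega>. \<forall>N. rolling_at \<Omega> e c C x N \<longrightarrow> (\<forall>y\<in>closure \<Omega>. c' * (dist x y)\<^sup>2 \<le> N \<bullet> (x - y))"
proof -
  obtain R where R: "R > 0" "\<And>x y. x \<in> closure \<Omega> \<Longrightarrow> y \<in> closure \<Omega> \<Longrightarrow> dist x y \<le> R"
  proof -
    have "bounded (closure \<Omega>)" using bd by (rule bounded_closure)
    then obtain B where B: "B > 0" "\<And>x. x \<in> closure \<Omega> \<Longrightarrow> norm x \<le> B" using bounded_pos by blast
    show thesis
    proof (rule that[of "2 * B"])
      fix x y assume "x \<in> closure \<Omega>" "y \<in> closure \<Omega>"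
      then show "dist x y \<le> 2 * B" using B(2)[of x] B(2)[of y] norm_triangle_ineq4[of x y] by (simp add: dist_norm)
    qed (use B in simp)
  qed
  define c' where "c' = min c (c * e / (2 * R))"
  have c': "c' > 0" using e R by (simp add: c'_def)
  have "c' * (dist x y)\<^sup>2 \<le> N \<bullet> (x - y)"
    if x: "x \<in> frontier \<Omega>" and N: "rolling_at \<Omega> e c C x N" and y: "y \<in> closure \<Omega>" for x N y
  proof (cases "dist x y < e")
    case True
    then have "c * (dist x y)\<^sup>2 \<le> N \<bullet> (x - y)" using N y unfolding rolling_at_def by simp
    moreover have "c' * (dist x y)\<^sup>2 \<le> c * (dist x y)\<^sup>2" by (intro mult_right_mono) (auto simp: c'_def)
    ultimately show ?thesis by linarith
  next
    case False
    define D where "D = dist x y"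
    have D: "D \<ge> e" "D > 0" using False e by (auto simp: D_def)
    define t where "t = e / (2 * D)"
    have t: "0 < t" "t \<le> 1" using D e by (auto simp: t_def divide_simps)
    define y' where "y' = x + t *\<^sub>R (y - x)"
    have xc: "x \<in> closure \<Omega>" using x by (simp add: frontier_def)
    have "y' \<in> closure \<Omega>"
      using convexD_alt[OF convex_closure[OF cv] xc y, of t] t by (simp add: y'_def algebra_simps)
    moreover have d': "dist x y' = e / 2" using D t e by (simp add: y'_def dist_norm t_def D_def norm_minus_commute)
    moreover have "y' \<in> ball x e" using d' e by simp
    ultimately have "c * (dist x y')\<^sup>2 \<le> N \<bullet> (x - y')" using N unfolding rolling_at_def by blast
    then have "c * (e / 2)\<^sup>2 \<le> N \<bullet> (x - y')" unfolding d' .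
    also have "\<dots> = t * (N \<bullet> (x - y))" by (simp add: y'_def inner_diff_right algebra_simps)
    finally have "c * (e / 2)\<^sup>2 / t \<le> N \<bullet> (x - y)" using t by (simp add: pos_divide_le_eq mult.commute)
    then have 1: "c * e / 2 * D \<le> N \<bullet> (x - y)" using D e by (simp add: t_def power2_eq_square mult_ac)
    have "c' * D\<^sup>2 \<le> (c * e / (2 * R)) * (R * D)"
      using R(2)[OF xc y] D c' e R by (intro mult_mono) (auto simp: c'_def D_def power2_eq_square)
    also have "\<dots> = c * e / 2 * D" using R by simp
    finally show ?thesis using 1 by (simp add: D_def)
  qed
  then show ?thesis using c' by blast
qed

section \<open>The support function and its boundary points\<close>

text \<open>A half-space determines its normal. If w had a component u orthogonal to N, the vector -
  u, tilted slightly towards N, would lie in the open half-space and pair negatively with w.\<close>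

lemma sgn_eq_if_halfspace:
  fixes N w :: "'a::real_inner"
  assumes "N \<noteq> 0" "w \<noteq> 0" and h: "\<And>v. N \<bullet> v > 0 \<Longrightarrow> w \<bullet> v \<ge> 0"
  shows "sgn w = sgn N"
proof -
  define n where "n = sgn N"
  have nn: "n \<bullet> n = 1" using assms(1) by (simp add: n_def norm_sgn flip: norm_eq_1)
  have Nn: "N = norm N *\<^sub>R n" using assms(1) by (simp add: n_def sgn_div_norm)
  have h': "w \<bullet> v \<ge> 0" if "n \<bullet> v > 0" for v
  proof (rule h)
    show "N \<bullet> v > 0" by (subst Nn) (use that assms(1) in simp)
  qed
  define u where "u = w - (n \<bullet> w) *\<^sub>R n"
  have nu: "n \<bullet> u = 0" by (simp add: u_def inner_diff_right nn)
  have wu: "w \<bullet> u = u \<bullet> u"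
  proof -
    have "w = u + (n \<bullet> w) *\<^sub>R n" by (simp add: u_def)
    then have "w \<bullet> u = (u + (n \<bullet> w) *\<^sub>R n) \<bullet> u" by simp
    then show ?thesis using nu by (simp add: inner_add_left)
  qed
  have "u = 0"
  proof (rule ccontr)
    assume "u \<noteq> 0"
    then have uu: "u \<bullet> u > 0" by simp
    \<comment> \<open>Tilt small enough that its contribution along n recovers at most half of the
      loss \<open>u \<bullet> u\<close>.\<close>
    define \<epsilon> where "\<epsilon> = (u \<bullet> u) / (2 * (\<bar>w \<bullet> n\<bar> + 1))"
    have \<epsilon>: "\<epsilon> > 0" using uu by (simp add: \<epsilon>_def)
    have "w \<bullet> (\<epsilon> *\<^sub>R n - u) \<ge> 0" by (rule h') (simp add: inner_diff_right nn nu \<epsilon>)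
    then have "u \<bullet> u \<le> \<epsilon> * (w \<bullet> n)" by (simp add: inner_diff_right wu)
    also have "\<dots> \<le> \<epsilon> * (\<bar>w \<bullet> n\<bar> + 1)" using \<epsilon> by (intro mult_left_mono) auto
    also have "\<dots> = (u \<bullet> u) / 2" by (simp add: \<epsilon>_def field_simps)
    finally show False using uu by simp
  qed
  then have w: "w = (n \<bullet> w) *\<^sub>R n" by (simp add: u_def)
  have "w \<bullet> n \<ge> 0" by (rule h') (simp add: nn)
  then have "n \<bullet> w > 0" using w assms(2) by (metis inner_commute less_eq_real_def scaleR_zero_left)
  then have "sgn w = sgn n" by (subst w) (simp add: sgn_scaleR)
  then show ?thesis using assms(1) by (simp add: n_def sgn_div_norm)
qed

lemma has_derivative_lipschitz_bound:
  fixes f :: "'a::real_normed_vector \<Rightarrow> 'b::real_normed_vector"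
  assumes f: "(f has_derivative f') (at x)" and d: "d > 0"
    and L: "\<And>y. dist x y < d \<Longrightarrow> norm (f y - f x) \<le> L * norm (y - x)"
  shows "norm (f' v) \<le> L * norm v"
proof (cases "v = 0")
  case True
  then show ?thesis using f has_derivative_bounded_linear bounded_linear.linear linear_0 by fastforce
next
  case False
  have "norm (f' v) \<le> L * norm v + \<epsilon> * norm v" if \<epsilon>: "\<epsilon> > 0" for \<epsilon>
  proof -
    obtain d1 where d1: "d1 > 0" "\<And>y. norm (y - x) < d1 \<Longrightarrow> norm (f y - f x - f' (y - x)) \<le> \<epsilon> * norm (y - x)"
      using f \<epsilon> unfolding has_derivative_at_alt by blast
    define t where "t = min d d1 / (2 * norm v)"
    have t: "t > 0" using d d1 False by (simp add: t_def)
    have tv: "norm (t *\<^sub>R v) < min d d1" using t False d d1 by (auto simp: t_def min_def)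
    have "norm (t *\<^sub>R f' v) = norm (f' (t *\<^sub>R v))"
      using f by (metis has_derivative_bounded_linear bounded_linear.linear linear_scale)
    also have "\<dots> \<le> norm (f (x + t *\<^sub>R v) - f x) + norm (f (x + t *\<^sub>R v) - f x - f' (t *\<^sub>R v))"
      using norm_triangle_ineq4[of "f (x + t *\<^sub>R v) - f x" "f (x + t *\<^sub>R v) - f x - f' (t *\<^sub>R v)"] by simp
    also have "\<dots> \<le> L * norm (t *\<^sub>R v) + \<epsilon> * norm (t *\<^sub>R v)"
      using L[of "x + t *\<^sub>R v"] d1(2)[of "x + t *\<^sub>R v"] tv by (intro add_mono) (auto simp: dist_norm)
    finally have "t * norm (f' v) \<le> t * (L * norm v + \<epsilon> * norm v)" using t by (simp add: algebra_simps)
    then show ?thesis using t by simp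
  qed
  then have "norm (f' v) \<le> L * norm v + \<epsilon>" if "\<epsilon> > 0" for \<epsilon>
    using that False by (metis divide_pos_pos nonzero_eq_divide_eq norm_eq_zero zero_less_norm_iff)
  then show ?thesis by (rule field_le_epsilon)
qed

text \<open>The geometric output of the curvature assumption: a global outer estimate and an inner
  one within distance e, with one pair of constants for all boundary points. The area and Laplace
  estimates use the boundary only through these; local defining functions return once, for the
  differentiability of \<open>pt\<close>.\<close>

locale smooth_convex_body =
  fixes \<Omega> :: "'a::euclidean_space set" and nv :: "'a \<Rightarrow> 'a" and c C e :: real
  assumes bd: "bounded \<Omega>" and sc: "strongly_convex_domain \<Omega>"
    and c: "c > 0" and C: "C > 0" and e: "e > 0"
    and nv: "\<And>x. x \<in> frontier \<Omega> \<Longrightarrow> norm (nv x) = 1"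
    and outer: "\<And>x y. x \<in> frontier \<Omega> \<Longrightarrow> y \<in> closure \<Omega> \<Longrightarrow> c * (dist x y)\<^sup>2 \<le> nv x \<bullet> (x - y)"
    and inner: "\<And>x y. x \<in> frontier \<Omega> \<Longrightarrow> dist x y < e \<Longrightarrow> C * (dist x y)\<^sup>2 < nv x \<bullet> (x - y) \<Longrightarrow> y \<in> \<Omega>"
    and cvx: "convex \<Omega>"
begin

lemma op: "open \<Omega>" and ne: "\<Omega> \<noteq> {}"
  using sc by (auto simp: strongly_convex_domain_def)

definition hsup :: "'a \<Rightarrow> real" where "hsup w = (SUP \<zeta>\<in>\<Omega>. \<zeta> \<bullet> w)"

text \<open>The point where the linear functional w is maximal on the closure: the inverse of the
  Gauss map for nonzero w, and at the same time the gradient of \<open>hsup\<close>. At w = 0 it is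
  some point of the closure.\<close>

definition pt :: "'a \<Rightarrow> 'a" where "pt w = (SOME x. x \<in> closure \<Omega> \<and> (\<forall>y\<in>closure \<Omega>. y \<bullet> w \<le> x \<bullet> w))"

lemma pt: "pt w \<in> closure \<Omega>" "y \<in> closure \<Omega> \<Longrightarrow> y \<bullet> w \<le> pt w \<bullet> w"
proof -
  have "compact (closure \<Omega>)" using bd by simp
  then have "\<exists>x\<in>closure \<Omega>. \<forall>y\<in>closure \<Omega>. y \<bullet> w \<le> x \<bullet> w"
    using ne by (intro continuous_attains_sup continuous_intros) auto
  then have "pt w \<in> closure \<Omega> \<and> (\<forall>y\<in>closure \<Omega>. y \<bullet> w \<le> pt w \<bullet> w)"
    unfolding pt_def
    using someI_ex[of "\<lambda>x. x \<in> closure \<Omega> \<and> (\<forall>y\<in>closure \<Omega>. y \<bullet> w \<le> x \<bullet> w)"] by blast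
  then show "pt w \<in> closure \<Omega>" "y \<in> closure \<Omega> \<Longrightarrow> y \<bullet> w \<le> pt w \<bullet> w" by auto
qed

lemma hsup_eq: "hsup w = pt w \<bullet> w"
proof (rule antisym)
  show "hsup w \<le> pt w \<bullet> w" unfolding hsup_def
    using ne pt(2) closure_subset by (intro cSUP_least) auto
  have bdd: "bdd_above ((\<lambda>\<zeta>. \<zeta> \<bullet> w) ` \<Omega>)" using pt(2) closure_subset by (intro bdd_aboveI2) auto
  have "closed {y. y \<bullet> w \<le> hsup w}" by (intro closed_Collect_le continuous_intros)
  moreover have "\<Omega> \<subseteq> {y. y \<bullet> w \<le> hsup w}" unfolding hsup_def using bdd by (auto intro: cSUP_upper)
  ultimately show "pt w \<bullet> w \<le> hsup w" using pt(1) closure_minimal by blast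
qed

lemma frontier_closure: "x \<in> frontier \<Omega> \<longleftrightarrow> x \<in> closure \<Omega> \<and> x \<notin> \<Omega>"
  using op by (simp add: frontier_def interior_open)

lemma pt_frontier: assumes "w \<noteq> 0" shows "pt w \<in> frontier \<Omega>"
proof -
  have "pt w \<notin> \<Omega>"
  proof
    assume "pt w \<in> \<Omega>"
    then obtain d where d: "d > 0" "cball (pt w) d \<subseteq> \<Omega>" using op open_contains_cball by blast
    have "pt w + d *\<^sub>R sgn w \<in> cball (pt w) d" using assms d by (simp add: dist_norm norm_sgn)
    then have "(pt w + d *\<^sub>R sgn w) \<bullet> w \<le> pt w \<bullet> w" using d pt(2) closure_subset by blast
    then have "d * (sgn w \<bullet> w) \<le> 0" by (simp add: inner_add_left)
    moreover have "sgn w \<bullet> w > 0" using assms by (simp add: sgn_div_norm)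
    ultimately show False using d by (simp add: mult_le_0_iff)
  qed
  then show ?thesis using pt(1) frontier_closure by blast
qed

lemma small_step:
  fixes v :: "'b::real_normed_vector" and a K e' :: real
  assumes "a > 0" "e' > 0"
  shows "\<exists>t>0. norm (t *\<^sub>R v) < e' \<and> K * (norm (t *\<^sub>R v))\<^sup>2 < t * a"
proof -
  define D where "D = \<bar>K\<bar> * (norm v)\<^sup>2 + 1"
  have D: "D > 0" by (simp add: D_def add_nonneg_pos)
  define q where "q = norm v + 1"
  define t where "t = min (e' / (2 * q)) (a / (2 * D))"
  have nv0: "q > 0" by (simp add: q_def add_nonneg_pos)
  have t: "t > 0" using assms D nv0 by (simp add: t_def)
  have "t * norm v \<le> t * q" using t by (simp add: q_def)
  also have "\<dots> \<le> e' / (2 * q) * q"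
    using nv0 by (intro mult_right_mono) (auto simp: t_def)
  also have "\<dots> = e' / 2" using nv0 by simp
  finally have 1: "norm (t *\<^sub>R v) < e'" using t assms by simp
  have "K * (norm (t *\<^sub>R v))\<^sup>2 = t * (t * (K * (norm v)\<^sup>2))" using t by (simp add: power2_eq_square)
  also have "\<dots> \<le> t * (t * D)" using t by (intro mult_left_mono) (auto simp: D_def intro: order_trans[OF mult_right_mono[OF abs_ge_self]])
  also have "t * D \<le> a / (2 * D) * D" using D by (intro mult_right_mono) (auto simp: t_def)
  also have "\<dots> < a" using D assms by simp
  finally have "K * (norm (t *\<^sub>R v))\<^sup>2 < t * a" using t by simp
  with 1 t show ?thesis by blast
qed

text \<open>The inner estimate says that - v points into \<Omega> whenever v has positive product
  with the normal; maximality at \<open>pt w\<close> then gives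
  \<open>w \<bullet> v \<ge> 0\<close>, and \<open>sgn_eq_if_halfspace\<close> applies.\<close>

lemma nv_pt: assumes "w \<noteq> 0" shows "nv (pt w) = sgn w"
proof -
  note fr = pt_frontier[OF assms]
  have "sgn w = sgn (nv (pt w))"
  proof (rule sgn_eq_if_halfspace[OF _ assms])
    show "nv (pt w) \<noteq> 0" using nv[OF fr] by auto
    fix v assume v: "nv (pt w) \<bullet> v > 0"
    obtain t where t: "t > 0" "norm (t *\<^sub>R v) < e" "C * (norm (t *\<^sub>R v))\<^sup>2 < t * (nv (pt w) \<bullet> v)"
      using small_step[OF v e] by blast
    have "pt w - t *\<^sub>R v \<in> \<Omega>" by (rule inner[OF fr]) (use t in \<open>auto simp: dist_norm\<close>)
    then have "(pt w - t *\<^sub>R v) \<bullet> w \<le> pt w \<bullet> w" using pt(2) closure_subset by blast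
    then show "w \<bullet> v \<ge> 0" using t(1) by (simp add: inner_diff_left inner_commute[of w v] zero_le_mult_iff)
  qed
  then show ?thesis using nv[OF fr] by (simp add: sgn_div_norm)
qed

lemma gap_eq: assumes "w \<noteq> 0" shows "hsup w - y \<bullet> w = norm w * (nv (pt w) \<bullet> (pt w - y))"
  unfolding hsup_eq nv_pt[OF assms] using assms by (simp add: sgn_div_norm inner_diff_right inner_commute)

text \<open>With \<open>gap_upper\<close>, the two-sided quadratic comparison on which Laplace's
  method rests. The lower bound holds on the whole closure, the upper one only within distance e and
  outside \<Omega>, which includes the boundary points.\<close>

lemma gap_lower:
  assumes "w \<noteq> 0" "y \<in> closure \<Omega>" shows "c * norm w * (dist (pt w) y)\<^sup>2 \<le> hsup w - y \<bullet> w"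
proof -
  have "norm w * (c * (dist (pt w) y)\<^sup>2) \<le> norm w * (nv (pt w) \<bullet> (pt w - y))"
    by (intro mult_left_mono outer pt_frontier assms) simp
  then show ?thesis by (simp add: gap_eq[OF assms(1)] mult_ac)
qed

lemma gap_upper:
  assumes "w \<noteq> 0" "y \<notin> \<Omega>" "dist (pt w) y < e" shows "hsup w - y \<bullet> w \<le> C * norm w * (dist (pt w) y)\<^sup>2"
proof -
  have "nv (pt w) \<bullet> (pt w - y) \<le> C * (dist (pt w) y)\<^sup>2"
    using inner[OF pt_frontier[OF assms(1)] assms(3)] assms(2) by force
  then have "norm w * (nv (pt w) \<bullet> (pt w - y)) \<le> norm w * (C * (dist (pt w) y)\<^sup>2)"
    by (rule mult_left_mono) simp
  then show ?thesis by (simp add: gap_eq[OF assms(1)] mult_ac)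
qed

text \<open>Adding \<open>gap_lower\<close> at w for the point \<open>pt w'\<close> to the
  maximality of \<open>pt w'\<close> for w' gives strong monotonicity of \<open>pt\<close>, and
  Cauchy-Schwarz cancels one factor. The constant involves w alone, so w' is arbitrary.\<close>

lemma pt_lipschitz:
  assumes "w \<noteq> 0" shows "norm (pt w' - pt w) \<le> 1 / (c * norm w) * norm (w' - w)"
proof -
  define d where "d = norm (pt w' - pt w)"
  have dd: "dist (pt w) (pt w') = d" by (simp add: d_def dist_norm norm_minus_commute)
  have 1: "c * norm w * d\<^sup>2 \<le> hsup w - pt w' \<bullet> w" using gap_lower[OF assms pt(1), of w'] by (simp add: dd)
  have 2: "0 \<le> hsup w' - pt w \<bullet> w'" using pt(2)[OF pt(1)] by (simp add: hsup_eq)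
  have "c * norm w * d\<^sup>2 \<le> (pt w' - pt w) \<bullet> (w' - w)"
    using 1 2 by (simp add: hsup_eq inner_diff_left inner_diff_right)
  also have "\<dots> \<le> d * norm (w' - w)" unfolding d_def by (rule norm_cauchy_schwarz)
  finally have 3: "d * (c * norm w * d) \<le> d * norm (w' - w)" by (simp add: power2_eq_square mult_ac)
  have cw: "c * norm w > 0" using assms c by simp
  have "c * norm w * d \<le> norm (w' - w)"
  proof (cases "d = 0")
    case False
    then have "d > 0" by (simp add: d_def)
    then show ?thesis using 3 by (simp only: mult_le_cancel_left_pos)
  qed simp
  then show ?thesis using cw unfolding d_def by (simp add: field_simps)
qed

lemma pt_cont: assumes "w \<noteq> 0" shows "isCont pt w"
  unfolding isCont_def
proof (rule LIM_zero_cancel, rule Lim_null_comparison)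
  show "\<forall>\<^sub>F w' in at w. norm (pt w' - pt w) \<le> 1 / (c * norm w) * norm (w' - w)"
    using pt_lipschitz[OF assms] by simp
  have "((\<lambda>w'. 1 / (c * norm w) * norm (w' - w)) \<longlongrightarrow> 1 / (c * norm w) * norm (w - w)) (at w)"
    by (intro tendsto_intros)
  then show "((\<lambda>w'. 1 / (c * norm w) * norm (w' - w)) \<longlongrightarrow> 0) (at w)" by simp
qed

lemma hsup_bound: "\<exists>R>0. (\<forall>w. norm (pt w) \<le> R) \<and> (\<forall>w w'. \<bar>hsup w - hsup w'\<bar> \<le> R * norm (w - w'))"
proof -
  obtain R where R: "R > 0" "\<And>x. x \<in> closure \<Omega> \<Longrightarrow> norm x \<le> R"
    using bounded_closure[OF bd] bounded_pos by blast
  have pR: "norm (pt w) \<le> R" for w using R pt(1) by blast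
  have "hsup w - hsup w' \<le> R * norm (w - w')" for w w'
  proof -
    have "hsup w - hsup w' \<le> pt w \<bullet> (w - w')"
      using pt(2)[OF pt(1), of w w'] by (simp add: hsup_eq inner_diff_right)
    also have "\<dots> \<le> norm (pt w) * norm (w - w')" by (rule norm_cauchy_schwarz)
    also have "\<dots> \<le> R * norm (w - w')" using pR by (intro mult_right_mono) auto
    finally show ?thesis .
  qed
  from this this have "\<bar>hsup w - hsup w'\<bar> \<le> R * norm (w - w')" for w w'
    by (smt (verit) norm_minus_commute)
  then show ?thesis using R pR by blast
qed

text \<open>Envelope argument: maximality at both ends traps the increment of \<open>hsup\<close>
  between the pairings of y - w with \<open>pt w\<close> and with \<open>pt y\<close>, and these
  differ by O(|y - w|^2) by \<open>pt_lipschitz\<close>.\<close>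

lemma hsup_has_derivative: assumes "w \<noteq> 0" shows "(hsup has_derivative (\<lambda>v. pt w \<bullet> v)) (at w)"
  unfolding has_derivative_at_alt
proof (intro conjI allI impI)
  show "bounded_linear (\<lambda>v. pt w \<bullet> v)" by (rule bounded_linear_inner_right)
  fix \<epsilon> :: real assume \<epsilon>: "\<epsilon> > 0"
  define L where "L = 1 / (c * norm w)"
  have L: "L > 0" using c assms by (simp add: L_def)
  show "\<exists>d>0. \<forall>y. norm (y - w) < d \<longrightarrow> norm (hsup y - hsup w - pt w \<bullet> (y - w)) \<le> \<epsilon> * norm (y - w)"
  proof (intro exI[of _ "\<epsilon> / L"] conjI allI impI)
    show "\<epsilon> / L > 0" using \<epsilon> L by simp
    fix y assume y: "norm (y - w) < \<epsilon> / L"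
    have 1: "0 \<le> hsup y - hsup w - pt w \<bullet> (y - w)"
      using pt(2)[OF pt(1), of w y] by (simp add: hsup_eq inner_diff_right)
    have "hsup y - hsup w - pt w \<bullet> (y - w) \<le> (pt y - pt w) \<bullet> (y - w)"
      using pt(2)[OF pt(1), of y w] by (simp add: hsup_eq inner_diff_right inner_diff_left)
    also have "\<dots> \<le> norm (pt y - pt w) * norm (y - w)" by (rule norm_cauchy_schwarz)
    also have "\<dots> \<le> (L * norm (y - w)) * norm (y - w)"
      using pt_lipschitz[OF assms, of y] by (intro mult_right_mono) (auto simp: L_def)
    also have "\<dots> \<le> \<epsilon> * norm (y - w)" using y L by (intro mult_right_mono) (auto simp: field_simps)
    finally show "norm (hsup y - hsup w - pt w \<bullet> (y - w)) \<le> \<epsilon> * norm (y - w)" using 1 by simp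
  qed
qed

text \<open>The first-order condition at a maximum, for an arbitrary local defining function: moving
  against any v that increases r enters \<Omega>, where the functional w is no larger.\<close>

lemma gradient_at_pt:
  assumes w: "w \<noteq> 0" and ldf: "local_defining_function \<Omega> p U r" and x: "pt w \<in> U"
  shows "sgn (gradient r (pt w)) = sgn w"
proof -
  have U: "open U" and C2: "cont_diff_on 2 r U" and G0: "gradient r (pt w) \<noteq> 0" and \<Omega>U: "\<Omega> \<inter> U = {x \<in> U. r x < 0}"
    using ldf x by (auto simp: local_defining_function_def)
  note r = C2_gradient[OF C2 U]
  have cr: "continuous_on U r" using r(1) by (meson continuous_at_imp_continuous_on has_derivative_continuous)
  have r0: "r (pt w) = 0" using defining_function_signs(2)[OF ldf op cr pt_frontier[OF w] x] .
  have "sgn w = sgn (gradient r (pt w))"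
  proof (rule sgn_eq_if_halfspace[OF G0 w])
    fix v assume v: "gradient r (pt w) \<bullet> v > 0"
    have "((\<lambda>t. r (pt w - t *\<^sub>R v)) has_derivative (\<lambda>h. gradient r (pt w - 0 *\<^sub>R v) \<bullet> (- (h *\<^sub>R v)))) (at 0)"
      by (rule has_derivative_compose[where g=r and f="\<lambda>t. pt w - t *\<^sub>R v"])
         (use r(1)[OF x] in \<open>auto intro!: derivative_eq_intros\<close>)
    then have "DERIV (\<lambda>t. r (pt w - t *\<^sub>R v)) 0 :> - (gradient r (pt w) \<bullet> v)"
      unfolding has_field_derivative_def by (rule has_derivative_eq_rhs) (auto simp: fun_eq_iff)
    from DERIV_neg_dec_right[OF this] v
    obtain d where d: "d > 0" "\<And>h. h > 0 \<Longrightarrow> h < d \<Longrightarrow> r (pt w - h *\<^sub>R v) < 0" by (auto simp: r0)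
    obtain \<delta> where \<delta>: "\<delta> > 0" "ball (pt w) \<delta> \<subseteq> U" using U x open_contains_ball by blast
    define q where "q = norm v + 1"
    define t where "t = min (d / 2) (\<delta> / (2 * q))"
    have nv0: "q > 0" by (simp add: q_def add_nonneg_pos)
    have t: "t > 0" "t < d" using d \<delta> nv0 by (auto simp: t_def min_def)
    have "t * norm v \<le> \<delta> / (2 * q) * q"
      using \<delta> nv0 t by (intro mult_mono) (auto simp: t_def q_def)
    also have "\<dots> < \<delta>" using nv0 \<delta> by simp
    finally have "pt w - t *\<^sub>R v \<in> U" using t \<delta> by (auto simp: dist_norm)
    then have "pt w - t *\<^sub>R v \<in> \<Omega>" using d(2)[OF t] \<Omega>U by blast
    then have "(pt w - t *\<^sub>R v) \<bullet> w \<le> pt w \<bullet> w" using pt(2) closure_subset by blast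
    then show "w \<bullet> v \<ge> 0" using t(1) by (simp add: inner_diff_left inner_commute[of w v] zero_le_mult_iff)
  qed
  then show ?thesis by simp
qed

end

text \<open>Near a boundary point the equation \<open>sgn (\<nabla>r x) + r x *\<^sub>R n = sgn w\<close> has \<open>x = pt w\<close> as a solution, and its
  linearisation in \<open>x\<close> is invertible because the curvatures are positive.\<close>

lemma weingarten_injective:
  fixes S :: "'a::euclidean_space \<Rightarrow> 'a"
  assumes S: "linear S" and g: "g \<noteq> 0" and n: "n = sgn g"
    and c: "c > 0" "\<And>v. g \<bullet> v = 0 \<Longrightarrow> c * (norm v)\<^sup>2 \<le> v \<bullet> S v"
  defines "A \<equiv> \<lambda>v. (S v - (n \<bullet> S v) *\<^sub>R n) /\<^sub>R norm g + (g \<bullet> v) *\<^sub>R n"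
  shows "linear A" "inj A" "\<And>v. n \<bullet> A v = g \<bullet> v" "\<And>v. n \<bullet> A v = 0 \<Longrightarrow> c / norm g * (norm v)\<^sup>2 \<le> v \<bullet> A v"
proof -
  have nn: "n \<bullet> n = 1" using g by (simp add: n norm_sgn flip: norm_eq_1)
  have gn: "g = norm g *\<^sub>R n" using g by (simp add: n sgn_div_norm)
  show lin: "linear A" unfolding A_def using S
    by (intro linearI) (auto simp: linear_add linear_scale inner_add_right algebra_simps scaleR_add_left)
  show nA: "n \<bullet> A v = g \<bullet> v" for v by (simp add: A_def inner_add_right inner_diff_right nn)
  show co: "c / norm g * (norm v)\<^sup>2 \<le> v \<bullet> A v" if "n \<bullet> A v = 0" for v
  proof -
    have gv: "g \<bullet> v = 0" using that nA by simp
    then have nv: "v \<bullet> n = 0" using g by (simp add: n sgn_div_norm inner_commute)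
    have "v \<bullet> A v = (v \<bullet> S v) / norm g" by (simp add: A_def gv nv inner_add_right inner_diff_right divide_inverse mult.commute)
    moreover have "c * (norm v)\<^sup>2 / norm g \<le> (v \<bullet> S v) / norm g" using c(2)[OF gv] by (intro divide_right_mono) auto
    ultimately show ?thesis by simp
  qed
  show "inj A" unfolding linear_injective_0[OF lin]
  proof (intro allI impI)
    fix v assume "A v = 0"
    then have "c / norm g * (norm v)\<^sup>2 \<le> 0" using co[of v] by simp
    then show "v = 0" using c(1) g by (auto simp: mult_le_0_iff divide_le_0_iff)
  qed
qed

context smooth_convex_body begin

text \<open>\<open>A w\<close> is the linearised equation at \<open>pt w\<close>. The clauses are
  what the later facts consume: continuity in w for that of the derivative, injectivity for its
  existence, and coercivity on vectors whose image is tangential for its positivity.\<close>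

lemma pt_local_equation:
  assumes w0: "w0 \<noteq> 0"
  shows "\<exists>V A. open V \<and> w0 \<in> V \<and> 0 \<notin> V \<and> (\<forall>v. continuous_on V (\<lambda>w. A w v)) \<and>
    (\<forall>w\<in>V. linear (A w) \<and> inj (A w) \<and>
      (\<exists>k>0. \<forall>v. sgn w \<bullet> A w v = 0 \<longrightarrow> k * (norm v)\<^sup>2 \<le> v \<bullet> A w v \<and> sgn w \<bullet> v = 0) \<and>
      (\<exists>P. (pt has_derivative P) (at w) \<and> (\<forall>v. A w (P v) = (v - (sgn w \<bullet> v) *\<^sub>R sgn w) /\<^sub>R norm w)))"
proof -
  obtain U r where ldf0: "local_defining_function \<Omega> (pt w0) U r"
    using sc pt_frontier[OF w0] unfolding strongly_convex_domain_def C2_boundary_def by blast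
  have U: "open U" "pt w0 \<in> U" and C2: "cont_diff_on 2 r U" and gnz: "\<And>x. x \<in> U \<Longrightarrow> gradient r x \<noteq> 0"
    using ldf0 by (auto simp: local_defining_function_def)
  have ldf: "local_defining_function \<Omega> p U r" if "p \<in> U" for p
    using ldf0 that by (auto simp: local_defining_function_def)
  define G where "G = gradient r"
  define S where "S x = frechet_derivative (gradient r) (at x)" for x
  have r: "\<And>x. x \<in> U \<Longrightarrow> (r has_derivative (\<lambda>v. G x \<bullet> v)) (at x)"
    and S: "\<And>x. x \<in> U \<Longrightarrow> (G has_derivative S x) (at x)"
    and cS: "\<And>v. continuous_on U (\<lambda>x. S x v)"
    and sym: "\<And>x v w. x \<in> U \<Longrightarrow> S x v \<bullet> w = v \<bullet> S x w"
    unfolding G_def S_def by (fact C2_gradient[OF C2 U(1)])+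
  have linS: "linear (S x)" if "x \<in> U" for x using S[OF that] by (meson has_derivative_bounded_linear bounded_linear.linear)
  have cG: "continuous_on U G" using S U by (meson continuous_at_imp_continuous_on has_derivative_continuous)
  have cr: "continuous_on U r" using r U by (meson continuous_at_imp_continuous_on has_derivative_continuous)
  have G0: "G x \<noteq> 0" if "x \<in> U" for x using gnz that by (simp add: G_def)
  define V where "V = {w. w \<noteq> 0 \<and> pt w \<in> U}"
  have cpt: "continuous_on (- {0}) pt" using pt_cont by (simp add: continuous_at_imp_continuous_on)
  have oV: "open V"
  proof -
    have "open ((- {0}) \<inter> pt -` U)" by (rule continuous_open_preimage[OF cpt _ U(1)]) auto
    moreover have "(- {0}) \<inter> pt -` U = V" by (auto simp: V_def)
    ultimately show ?thesis by simp
  qed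
  define A where "A w v = (S (pt w) v - (sgn (G (pt w)) \<bullet> S (pt w) v) *\<^sub>R sgn (G (pt w))) /\<^sub>R norm (G (pt w))
      + (G (pt w) \<bullet> v) *\<^sub>R sgn (G (pt w))" for w v
  have cptV: "continuous_on V pt" using cpt by (rule continuous_on_subset) (auto simp: V_def)
  have comp: "continuous_on V (\<lambda>w. f (pt w))" if "continuous_on U f" for f :: "'a \<Rightarrow> 'a"
    using continuous_on_compose2[OF that cptV] by (auto simp: V_def)
  have cA: "continuous_on V (\<lambda>w. A w v)" for v
    unfolding A_def sgn_div_norm using comp[OF cS] comp[OF cG] G0
    by (intro continuous_intros) (auto simp: V_def)
  have main: "linear (A w) \<and> inj (A w) \<and>
      (\<exists>k>0. \<forall>v. sgn w \<bullet> A w v = 0 \<longrightarrow> k * (norm v)\<^sup>2 \<le> v \<bullet> A w v \<and> sgn w \<bullet> v = 0) \<and>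
      (\<exists>P. (pt has_derivative P) (at w) \<and> (\<forall>v. A w (P v) = (v - (sgn w \<bullet> v) *\<^sub>R sgn w) /\<^sub>R norm w))"
    if w: "w \<in> V" for w
  proof -
    have w0': "w \<noteq> 0" and xU: "pt w \<in> U" using w by (auto simp: V_def)
    have sg: "sgn (G (pt w)) = sgn w" using gradient_at_pt[OF w0' ldf[OF xU] xU] by (simp add: G_def)
    have "\<exists>c>0. \<forall>v. gradient r (pt w) \<bullet> v = 0 \<longrightarrow> c * (norm v)\<^sup>2 \<le> v \<bullet> S (pt w) v"
      using sc pt_frontier[OF w0'] unfolding strongly_convex_domain_def
      by (intro tangent_form_coercive[OF ldf[OF xU]] S[OF xU, unfolded G_def] sym[OF xU]) blast
    then obtain k where k: "k > 0" "\<And>v. G (pt w) \<bullet> v = 0 \<Longrightarrow> k * (norm v)\<^sup>2 \<le> v \<bullet> S (pt w) v"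
      unfolding G_def by blast
    note inj = weingarten_injective[OF linS[OF xU] G0[OF xU] refl k, folded A_def]
    have i1: "linear (A w)" and i2: "inj (A w)" using inj(1,2) by (simp_all add: A_def[abs_def])
    have i3: "sgn w \<bullet> A w v = G (pt w) \<bullet> v" for v using inj(3)[of v] by (simp add: sg)
    have i4: "k / norm (G (pt w)) * (norm v)\<^sup>2 \<le> v \<bullet> A w v" if "sgn w \<bullet> A w v = 0" for v
      using inj(4)[of v] that by (simp add: sg)
    have i5: "sgn w \<bullet> v = 0" if "sgn w \<bullet> A w v = 0" for v
    proof -
      have "G (pt w) \<bullet> v = 0" using that i3 by simp
      then have "sgn (G (pt w)) \<bullet> v = 0" by (simp add: sgn_div_norm)
      then show ?thesis by (simp add: sg)
    qed
    obtain L where L: "linear L" "L \<circ> A w = id" using linear_injective_left_inverse[OF i1 i2] by blast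
    \<comment> \<open>The Gauss map alone takes values in the sphere, so its derivative misses the
      normal direction; the term with r supplies it. On the boundary r vanishes, which is why
      \<open>f (pt w')\<close> is still \<open>sgn w'\<close>.\<close>
    define f where "f y = sgn (G y) + r y *\<^sub>R sgn (G (pt w))" for y
    have f: "(f has_derivative A w) (at (pt w))"
      unfolding f_def A_def[abs_def]
      by (intro has_derivative_add weingarten_derivative S xU G0 has_derivative_scaleR_left r)
    have fpt: "f (pt w') = sgn w'" if "w' \<in> V" for w'
    proof -
      have "w' \<noteq> 0" "pt w' \<in> U" using that by (auto simp: V_def)
      then show ?thesis
        using gradient_at_pt[OF \<open>w' \<noteq> 0\<close> ldf] defining_function_signs(2)[OF ldf op cr pt_frontier]
        by (simp add: f_def G_def)
    qed
    have h: "((\<lambda>w'. f (pt w')) has_derivative (\<lambda>v. (v - (sgn w \<bullet> v) *\<^sub>R sgn w) /\<^sub>R norm w)) (at w)"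
      by (rule has_derivative_transform_within_open[OF has_derivative_sgn[OF w0'] oV w]) (simp add: fpt)
    have P: "(pt has_derivative (\<lambda>v. L ((v - (sgn w \<bullet> v) *\<^sub>R sgn w) /\<^sub>R norm w))) (at w)"
      by (rule has_derivative_left_invertible[OF f h])
         (use L pt_cont[OF w0'] in \<open>auto simp: linear_linear o_def fun_eq_iff\<close>)
    have "((\<lambda>w'. f (pt w')) has_derivative (\<lambda>v. A w (L ((v - (sgn w \<bullet> v) *\<^sub>R sgn w) /\<^sub>R norm w)))) (at w)"
      by (rule has_derivative_compose[OF P f])
    from has_derivative_unique[OF this h]
    have "A w (L ((v - (sgn w \<bullet> v) *\<^sub>R sgn w) /\<^sub>R norm w)) = (v - (sgn w \<bullet> v) *\<^sub>R sgn w) /\<^sub>R norm w" for v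
      by (simp add: fun_eq_iff)
    moreover have "k / norm (G (pt w)) > 0" using k G0[OF xU] by simp
    ultimately show ?thesis using i1 i2 i4 i5 P by blast
  qed
  have "w0 \<in> V" "0 \<notin> V" using w0 U by (auto simp: V_def)
  then show ?thesis using oV cA main by blast
qed

definition dpt :: "'a \<Rightarrow> 'a \<Rightarrow> 'a" where "dpt w = frechet_derivative pt (at w)"

lemma pt_has_derivative: assumes "w \<noteq> 0" shows "(pt has_derivative dpt w) (at w)"
proof -
  obtain P where "(pt has_derivative P) (at w)" using pt_local_equation[OF assms] by blast
  then show ?thesis unfolding dpt_def by (simp add: frechet_derivative_eqI)
qed

lemma dpt_linear: assumes "w \<noteq> 0" shows "linear (dpt w)"
  using pt_has_derivative[OF assms] by (meson has_derivative_bounded_linear bounded_linear.linear)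

lemma dpt_bound: assumes "w \<noteq> 0" shows "norm (dpt w v) \<le> 1 / (c * norm w) * norm v"
  by (rule has_derivative_lipschitz_bound[OF pt_has_derivative[OF assms] zero_less_one])
     (rule pt_lipschitz[OF assms])

text \<open>The derivative solves \<open>A w (dpt w v) = t w\<close> with a right-hand side
  continuous in w. Applying a left inverse of the fixed map \<open>A w0\<close> bounds the
  difference of two solutions by the change of A on a bounded vector, see \<open>dpt_bound\<close>,
  plus the change of t.\<close>

lemma dpt_cont: "continuous_on (- {0}) (\<lambda>w. dpt w v)"
proof (rule continuous_at_imp_continuous_on, rule ballI)
  fix w0 :: 'a assume "w0 \<in> - {0}"
  then have w0: "w0 \<noteq> 0" by simp
  obtain V A where V: "open V" "w0 \<in> V" "0 \<notin> V" and cA: "\<And>v. continuous_on V (\<lambda>w. A w v)"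
    and lin: "\<And>w. w \<in> V \<Longrightarrow> linear (A w)" and inj: "\<And>w. w \<in> V \<Longrightarrow> inj (A w)"
    and P: "\<And>w. w \<in> V \<Longrightarrow> \<exists>P. (pt has_derivative P) (at w) \<and> (\<forall>v. A w (P v) = (v - (sgn w \<bullet> v) *\<^sub>R sgn w) /\<^sub>R norm w)"
    using pt_local_equation[OF w0] by metis
  define t where "t w = (v - (sgn w \<bullet> v) *\<^sub>R sgn w) /\<^sub>R norm w" for w
  have At: "A w (dpt w v) = t w" if w: "w \<in> V" for w
  proof -
    obtain Q where Q: "(pt has_derivative Q) (at w)" "\<forall>v. A w (Q v) = (v - (sgn w \<bullet> v) *\<^sub>R sgn w) /\<^sub>R norm w"
      using P[OF w] by blast
    have "w \<noteq> 0" using w V by auto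
    then have "Q = dpt w" using has_derivative_unique[OF Q(1) pt_has_derivative] by blast
    then show ?thesis using Q(2) by (simp add: t_def)
  qed
  obtain L where L: "linear L" "L \<circ> A w0 = id" using linear_injective_left_inverse[OF lin[OF V(2)] inj[OF V(2)]] by blast
  obtain K where K: "K > 0" "\<And>v. norm (L v) \<le> K * norm v" using linear_bounded_pos[OF L(1)] by blast
  define E where "E w = (\<Sum>b\<in>Basis. norm (A w0 b - A w b))" for w
  have V0: "w \<noteq> 0" if "w \<in> V" for w using that V(3) by auto
  have main: "norm (dpt w v - dpt w0 v) \<le> K * (1 / (c * norm w) * norm v * E w + norm (t w - t w0))" if w: "w \<in> V" for w
  proof -
    define a where "a = dpt w v"
    have rep: "A x a = (\<Sum>b\<in>Basis. (a \<bullet> b) *\<^sub>R A x b)" if "x \<in> V" for x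
      by (subst (1) euclidean_representation[of a, symmetric]) (simp add: linear_sum[OF lin[OF that]] linear_scale[OF lin[OF that]])
    have "A w0 a - A w a = (\<Sum>b\<in>Basis. (a \<bullet> b) *\<^sub>R (A w0 b - A w b))"
      by (simp add: rep[OF w] rep[OF V(2)] scaleR_diff_right sum_subtractf)
    also have "norm \<dots> \<le> (\<Sum>b\<in>Basis. norm ((a \<bullet> b) *\<^sub>R (A w0 b - A w b)))" by (rule norm_sum)
    also have "\<dots> \<le> (\<Sum>b\<in>Basis. norm a * norm (A w0 b - A w b))"
      by (intro sum_mono) (simp add: mult_right_mono Basis_le_norm)
    also have "\<dots> = norm a * E w" by (simp add: sum_distrib_left E_def)
    also have "\<dots> \<le> 1 / (c * norm w) * norm v * E w"
      using dpt_bound[OF V0[OF w], of v] by (intro mult_right_mono) (auto simp: a_def E_def sum_nonneg)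
    finally have 1: "norm (A w0 a - A w a) \<le> 1 / (c * norm w) * norm v * E w" .
    have "dpt w v - dpt w0 v = L (A w0 (a - dpt w0 v))" using L(2) by (simp add: fun_eq_iff a_def)
    then have "norm (dpt w v - dpt w0 v) \<le> K * norm (A w0 (a - dpt w0 v))" using K(2) by simp
    also have "A w0 (a - dpt w0 v) = (A w0 a - A w a) + (t w - t w0)"
      using At[OF w] At[OF V(2)] by (simp add: linear_diff[OF lin[OF V(2)]] a_def)
    also have "K * norm \<dots> \<le> K * (norm (A w0 a - A w a) + norm (t w - t w0))"
      using K(1) by (intro mult_left_mono norm_triangle_ineq) auto
    also have "\<dots> \<le> K * (1 / (c * norm w) * norm v * E w + norm (t w - t w0))"
      using K(1) 1 by (intro mult_left_mono) auto
    finally show ?thesis .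
  qed
  have cE: "isCont E w0" unfolding E_def
    using cA V by (intro continuous_intros) (auto simp: continuous_on_eq_continuous_at)
  have ct: "isCont t w0" unfolding t_def sgn_div_norm using w0 by (intro continuous_intros) auto
  have "isCont (\<lambda>w. K * (1 / (c * norm w) * norm v * E w + norm (t w - t w0))) w0"
    using cE ct w0 c by (intro continuous_intros) auto
  then have lim: "((\<lambda>w. K * (1 / (c * norm w) * norm v * E w + norm (t w - t w0))) \<longlongrightarrow> 0) (at w0)"
    unfolding isCont_def by (simp add: E_def)
  show "isCont (\<lambda>w. dpt w v) w0" unfolding isCont_def
  proof (rule LIM_zero_cancel, rule Lim_null_comparison[OF _ lim])
    show "\<forall>\<^sub>F w in at w0. norm (dpt w v - dpt w0 v) \<le> K * (1 / (c * norm w) * norm v * E w + norm (t w - t w0))"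
      using V(1,2) main by (auto simp: eventually_at_topological)
  qed
qed

text \<open>\<open>dpt\<close> is the Hessian of \<open>hsup\<close>, whose gradient is
  \<open>pt\<close>.\<close>

lemma dpt_symmetric: assumes "w \<noteq> 0" shows "dpt w u \<bullet> v = dpt w v \<bullet> u"
proof -
  have d: "((\<lambda>y. pt y \<bullet> a) has_derivative (\<lambda>b. dpt y b \<bullet> a)) (at y)" if "y \<in> - {0}" for y a
    using pt_has_derivative[of y] that by (auto intro!: derivative_eq_intros)
  have o: "open (- {0::'a})" "w \<in> - {0}" using assms by auto
  have "(\<lambda>b. dpt w b \<bullet> u) v = (\<lambda>b. dpt w b \<bullet> v) u"
    by (rule symmetric_second_derivative[where f=hsup and f'="\<lambda>y v. pt y \<bullet> v" and A="\<lambda>w b. dpt w b \<bullet> u" and B="\<lambda>w b. dpt w b \<bullet> v", OF o])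
       (use d hsup_has_derivative dpt_cont in \<open>auto intro!: continuous_intros\<close>)
  then show ?thesis by simp
qed

text \<open>With a = \<open>dpt w v\<close> the form equals |w| times
  \<open>a \<bullet> A w a\<close>, which is coercive in a because \<open>A w a\<close> is
  tangential. It vanishes only for a = 0, and then v itself has no tangential part: the kernel of
  the Hessian is at most the radial line.\<close>

lemma dpt_positive:
  assumes w: "w \<noteq> 0"
  shows "dpt w v \<bullet> v \<ge> 0" "dpt w v \<bullet> v = 0 \<Longrightarrow> v = (sgn w \<bullet> v) *\<^sub>R sgn w"
proof -
  obtain V A where V: "w \<in> V"
    and "\<forall>w\<in>V. linear (A w) \<and> inj (A w) \<and>
      (\<exists>k>0. \<forall>v. sgn w \<bullet> A w v = 0 \<longrightarrow> k * (norm v)\<^sup>2 \<le> v \<bullet> A w v \<and> sgn w \<bullet> v = 0) \<and>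
      (\<exists>P. (pt has_derivative P) (at w) \<and> (\<forall>v. A w (P v) = (v - (sgn w \<bullet> v) *\<^sub>R sgn w) /\<^sub>R norm w))"
    using pt_local_equation[OF w] by blast
  then obtain k P where lin: "linear (A w)" and k: "k > 0" "\<And>v. sgn w \<bullet> A w v = 0 \<Longrightarrow> k * (norm v)\<^sup>2 \<le> v \<bullet> A w v \<and> sgn w \<bullet> v = 0"
    and P: "(pt has_derivative P) (at w)" "\<And>v. A w (P v) = (v - (sgn w \<bullet> v) *\<^sub>R sgn w) /\<^sub>R norm w" by meson
  have Pd: "P = dpt w" using has_derivative_unique[OF P(1) pt_has_derivative[OF w]] .
  define a where "a = dpt w v"
  have Aa: "A w a = (v - (sgn w \<bullet> v) *\<^sub>R sgn w) /\<^sub>R norm w" using P(2)[of v] by (simp add: Pd a_def)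
  have nn: "sgn w \<bullet> sgn w = 1" using w by (simp add: norm_sgn flip: norm_eq_1)
  have nA: "sgn w \<bullet> A w a = 0" by (simp add: Aa inner_diff_right nn)
  note k2 = k(2)[OF nA]
  have "a \<bullet> A w a = (a \<bullet> v) / norm w"
    using k2 by (simp add: Aa inner_diff_right inner_commute[of a "sgn w"] divide_inverse mult.commute)
  then have av: "dpt w v \<bullet> v = norm w * (a \<bullet> A w a)" using w by (simp add: a_def)
  have "a \<bullet> A w a \<ge> 0" using k2 k(1) by (meson order_trans zero_le_power2 mult_nonneg_nonneg less_imp_le)
  then show "dpt w v \<bullet> v \<ge> 0" unfolding av by simp
  show "v = (sgn w \<bullet> v) *\<^sub>R sgn w" if "dpt w v \<bullet> v = 0"
  proof -
    have "a \<bullet> A w a = 0" using that w unfolding av by simp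
    then have "k * (norm a)\<^sup>2 \<le> 0" using k2 by simp
    then have "a = 0" using k(1) by (auto simp: mult_le_0_iff)
    then have "A w a = 0" using linear_0[OF lin] by simp
    then show ?thesis using w by (simp add: Aa)
  qed
qed

end

section \<open>Hausdorff measure\<close>

text \<open>Caratheodory's criterion. \<open>A k\<close> collects the points of X at distance at
  least 1/(k+1) from F, so f is additive on it and F. The part of X - F that is missed lies in the
  later rings \<open>R j\<close>; rings of equal parity are separated from each other, hence the sum
  over all rings is finite and its tails tend to 0.\<close>

lemma metric_outer_measure_closed:
  fixes f :: "'a::metric_space set \<Rightarrow> ennreal"
  assumes f0: "f {} = 0" and mono: "\<And>A B. A \<subseteq> B \<Longrightarrow> f A \<le> f B"
    and sub: "\<And>A :: nat \<Rightarrow> 'a set. f (\<Union>i. A i) \<le> (\<Sum>i. f (A i))"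
    and met: "\<And>A B d. d > 0 \<Longrightarrow> (\<And>a b. a \<in> A \<Longrightarrow> b \<in> B \<Longrightarrow> d \<le> dist a b) \<Longrightarrow> f A + f B \<le> f (A \<union> B)"
    and F: "closed F"
  shows "f (F \<inter> X) + f (X - F) \<le> f X"
proof (cases "F = {} \<or> f X = \<infinity>")
  case True
  then show ?thesis using f0 by (auto simp: top_greatest)
next
  case False
  then have Fne: "F \<noteq> {}" and fin: "f X < \<infinity>" by (auto simp: top.not_eq_extremum)
  define A where "A k = {x \<in> X - F. 1 / real (Suc k) \<le> infdist x F}" for k
  define R where "R k = A (Suc k) - A k" for k
  have AX: "A k \<subseteq> X" and RX: "R k \<subseteq> X" for k by (auto simp: A_def R_def)
  have sep: "f (F \<inter> X) + f (A k) \<le> f X" for k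
  proof -
    have "f (F \<inter> X) + f (A k) \<le> f ((F \<inter> X) \<union> A k)"
    proof (rule met)
      show "1 / real (Suc k) > 0" by simp
      fix a b assume "a \<in> F \<inter> X" "b \<in> A k"
      then show "1 / real (Suc k) \<le> dist a b"
        using infdist_le[of a F b] by (auto simp: A_def dist_commute)
    qed
    also have "\<dots> \<le> f X" using AX by (intro mono) auto
    finally show ?thesis .
  qed
  \<comment> \<open>Here s selects the parity. A ring of index at most M - 2 lies at distance at
    least 1/M from F, the ring of index M at distance less than 1/(M+1); the difference separates
    them.\<close>
  have rings: "(\<Sum>k<N. f (R (2 * k + s))) \<le> f (\<Union>k<N. R (2 * k + s))" for N s
  proof (induction N)
    case (Suc N)
    have "(\<Sum>k<Suc N. f (R (2 * k + s))) \<le> f (\<Union>k<N. R (2 * k + s)) + f (R (2 * N + s))"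
      using Suc by (simp add: add_mono)
    also have "\<dots> \<le> f ((\<Union>k<N. R (2 * k + s)) \<union> R (2 * N + s))"
    proof (cases "N = 0")
      case True
      then show ?thesis by (simp add: f0)
    next
      case False
      define M where "M = 2 * N + s"
      have M: "M > 0" using False by (simp add: M_def)
      show ?thesis
      proof (rule met)
        show "1 / real M - 1 / real (Suc M) > 0" using M by (simp add: divide_strict_left_mono)
        fix x y assume x: "x \<in> (\<Union>k<N. R (2 * k + s))" and y: "y \<in> R (2 * N + s)"
        then obtain k where k: "k < N" "x \<in> A (Suc (2 * k + s))" by (auto simp: R_def)
        have "1 / real M \<le> 1 / real (Suc (Suc (2 * k + s)))"
          using k by (intro divide_left_mono) (auto simp: M_def)
        also have "\<dots> \<le> infdist x F" using k by (auto simp: A_def)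
        also have "\<dots> \<le> infdist y F + dist x y" by (rule infdist_triangle)
        also have "infdist y F < 1 / real (Suc M)"
          using y by (auto simp: R_def A_def M_def)
        finally show "1 / real M - 1 / real (Suc M) \<le> dist x y" by simp
      qed
    qed
    finally show ?case by (simp add: lessThan_Suc Un_commute)
  qed simp
  have ringsX: "(\<Sum>k<N. f (R (2 * k + s))) \<le> f X" for N s
    using rings[of s N] mono[of "\<Union>k<N. R (2 * k + s)" X] RX by (meson UN_least order_trans)
  \<comment> \<open>The even and the odd rings contribute at most \<open>f X\<close> each.\<close>
  have partial: "(\<Sum>k<n. f (R k)) \<le> f X + f X" for n
  proof -
    have "(\<Sum>k<n. f (R k)) \<le> (\<Sum>k<2 * n. f (R k))" by (intro sum_mono2) auto
    also have "\<dots> = (\<Sum>k<n. f (R (2 * k + 0))) + (\<Sum>k<n. f (R (2 * k + 1)))"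
      by (induction n) (auto simp: algebra_simps)
    also have "\<dots> \<le> f X + f X" by (intro add_mono ringsX)
    finally show ?thesis .
  qed
  define S where "S = (\<Sum>k. f (R k))"
  have "S \<le> f X + f X" unfolding S_def suminf_eq_SUP using partial by (intro SUP_least) auto
  then have Sfin: "S < \<infinity>" using fin by (simp add: less_top[symmetric] top_unique) (auto simp: top_unique)
  define T where "T k = (\<Sum>j. f (R (j + k)))" for k
  have ST: "S = T k + (\<Sum>j<k. f (R j))" for k
    unfolding S_def T_def by (rule suminf_offset) simp
  have Tk: "T k = S - (\<Sum>j<k. f (R j))" for k
  proof -
    have "f X + f X < top" using fin by simp
    then have "(\<Sum>j<k. f (R j)) \<noteq> top" using partial[of k] by (metis leD top_greatest)
    then show ?thesis using ST[of k] by simp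
  qed
  have "(\<lambda>k. S - (\<Sum>j<k. f (R j))) \<longlonglongrightarrow> S - S"
    using Sfin by (intro tendsto_diff_ennreal tendsto_const) (auto simp: S_def summable_LIMSEQ)
  then have T0: "T \<longlonglongrightarrow> 0" using Sfin by (simp add: Tk[abs_def])
  have split: "f (X - F) \<le> f (A k) + T k" for k
  proof -
    define B where "B i = (case i of 0 \<Rightarrow> A k | Suc j \<Rightarrow> R (j + k))" for i
    have "X - F \<subseteq> (\<Union>i. B i)"
    proof
      fix x assume x: "x \<in> X - F"
      then have "infdist x F > 0" using F Fne infdist_pos_not_in_closed by blast
      then obtain n where "1 / real (Suc n) < infdist x F" using nat_approx_posE by blast
      then have ex: "x \<in> A n" using x by (auto simp: A_def)
      define m where "m = (LEAST n. x \<in> A n)"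
      have m: "x \<in> A m" unfolding m_def using ex by (rule LeastI)
      show "x \<in> (\<Union>i. B i)"
      proof (cases "m \<le> k")
        case True
        have "1 / real (Suc k) \<le> 1 / real (Suc m)" using True by (intro divide_left_mono) auto
        then have "x \<in> A k" using m by (auto simp: A_def)
        then have "x \<in> B 0" by (simp add: B_def)
        then show ?thesis by blast
      next
        case False
        then obtain j where j: "m = Suc (j + k)" by (metis less_iff_Suc_add add.commute not_le)
        have "x \<notin> A (j + k)" using j not_less_Least[of "j + k" "\<lambda>n. x \<in> A n"] by (auto simp: m_def)
        then have "x \<in> R (j + k)" using m j by (auto simp: R_def)
        then have "x \<in> B (Suc j)" by (simp add: B_def)
        then show ?thesis by blast
      qed
    qed
    then have "f (X - F) \<le> f (\<Union>i. B i)" by (rule mono)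
    also have "\<dots> \<le> (\<Sum>i. f (B i))" by (rule sub)
    also have "\<dots> = (\<Sum>j. f (B (j + 1))) + (\<Sum>j<1. f (B j))" by (rule suminf_offset) simp
    also have "\<dots> = f (A k) + T k" by (simp add: B_def T_def add.commute)
    finally show ?thesis .
  qed
  have "f (F \<inter> X) + f (X - F) \<le> f X + T k" for k
  proof -
    have "f (F \<inter> X) + f (X - F) \<le> f (F \<inter> X) + (f (A k) + T k)" by (intro add_mono split) auto
    also have "\<dots> = (f (F \<inter> X) + f (A k)) + T k" by (simp add: add.assoc)
    also have "\<dots> \<le> f X + T k" by (intro add_mono sep) auto
    finally show ?thesis .
  qed
  moreover have "(\<lambda>k. f X + T k) \<longlonglongrightarrow> f X + 0" by (intro tendsto_add tendsto_const T0)
  ultimately have "f (F \<inter> X) + f (X - F) \<le> f X + 0" by (intro LIMSEQ_le_const) auto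
  then show ?thesis by simp
qed

text \<open>The set function inside \<open>hausdorff_measure\<close>, kept on all subsets: the value
  of a \<open>measure_of\<close> is accessible only after countable additivity on the Borel sets has
  been proved.\<close>

definition hausdorff_outer :: "nat \<Rightarrow> 'a::metric_space set \<Rightarrow> ennreal" where
  "hausdorff_outer m A = (SUP \<delta>\<in>{0<..}. hausdorff_premeasure m \<delta> A)"

lemma hausdorff_premeasure_le:
  assumes "A \<subseteq> (\<Union>i. U i)" "\<And>i. bounded (U i)" "\<And>i. diameter (U i) \<le> \<delta>"
  shows "hausdorff_premeasure m \<delta> A \<le> (\<Sum>i. ennreal (unit_ball_vol (real m) * (diameter (U i) / 2) ^ m))"
  unfolding hausdorff_premeasure_def using assms by (intro Inf_lower) auto

lemma hausdorff_premeasure_mono: "A \<subseteq> B \<Longrightarrow> hausdorff_premeasure m \<delta> A \<le> hausdorff_premeasure m \<delta> B"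
  unfolding hausdorff_premeasure_def by (rule Inf_superset_mono) blast

lemma hausdorff_premeasure_anti: "\<delta> \<le> \<delta>' \<Longrightarrow> hausdorff_premeasure m \<delta>' A \<le> hausdorff_premeasure m \<delta> A"
  unfolding hausdorff_premeasure_def by (rule Inf_superset_mono) (auto, metis order_trans)

lemma hausdorff_premeasure_empty:
  assumes "m > 0" "\<delta> > 0" shows "hausdorff_premeasure m \<delta> ({} :: 'a::metric_space set) = 0"
proof -
  have "hausdorff_premeasure m \<delta> ({} :: 'a set) \<le> (\<Sum>i::nat. ennreal (unit_ball_vol (real m) * (diameter ({}::'a set) / 2) ^ m))"
    by (rule hausdorff_premeasure_le[where U="\<lambda>_. {}"]) (use assms in auto)
  then show ?thesis using assms by (simp add: power_0_left)
qed

lemma hausdorff_premeasure_close: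
  assumes "hausdorff_premeasure m \<delta> A < x"
  obtains U :: "nat \<Rightarrow> 'a::metric_space set" where "A \<subseteq> (\<Union>i. U i)" "\<And>i. bounded (U i)" "\<And>i. diameter (U i) \<le> \<delta>"
    "(\<Sum>i. ennreal (unit_ball_vol (real m) * (diameter (U i) / 2) ^ m)) < x"
  using assms unfolding hausdorff_premeasure_def Inf_less_iff by blast

lemma hausdorff_premeasure_subadditive:
  fixes A :: "nat \<Rightarrow> 'a::metric_space set"
  shows "hausdorff_premeasure m \<delta> (\<Union>i. A i) \<le> (\<Sum>i. hausdorff_premeasure m \<delta> (A i))"
proof (rule ennreal_le_epsilon)
  let ?O = "hausdorff_premeasure m \<delta> :: 'a set \<Rightarrow> ennreal"
  let ?g = "\<lambda>U::'a set. ennreal (unit_ball_vol (real m) * (diameter U / 2) ^ m)"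
  fix e :: real assume "0 < e" "(\<Sum>n. ?O (A n)) < top"
  then have *: "\<And>n. ?O (A n) < ?O (A n) + e * (1/2)^Suc n"
    by (auto simp add: less_top dest!: ennreal_suminf_lessD)
  have "\<forall>n. \<exists>U :: nat \<Rightarrow> 'a set. A n \<subseteq> (\<Union>i. U i) \<and> (\<forall>i. bounded (U i) \<and> diameter (U i) \<le> \<delta>) \<and> (\<Sum>i. ?g (U i)) \<le> ?O (A n) + e * (1/2)^Suc n"
  proof
    fix n
    obtain U :: "nat \<Rightarrow> 'a set" where "A n \<subseteq> (\<Union>i. U i)" "\<And>i. bounded (U i)" "\<And>i. diameter (U i) \<le> \<delta>"
      "(\<Sum>i. ?g (U i)) < ?O (A n) + e * (1/2)^Suc n"
      using hausdorff_premeasure_close[OF *] by metis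
    then show "\<exists>U :: nat \<Rightarrow> 'a set. A n \<subseteq> (\<Union>i. U i) \<and> (\<forall>i. bounded (U i) \<and> diameter (U i) \<le> \<delta>) \<and> (\<Sum>i. ?g (U i)) \<le> ?O (A n) + e * (1/2)^Suc n"
      by (intro exI[of _ U]) auto
  qed
  then obtain B :: "nat \<Rightarrow> nat \<Rightarrow> 'a set" where sbB: "\<And>n. A n \<subseteq> (\<Union>i. B n i)"
    and Bd: "\<And>n i. bounded (B n i)" "\<And>n i. diameter (B n i) \<le> \<delta>"
    and Ble: "\<And>n. (\<Sum>i. ?g (B n i)) \<le> ?O (A n) + e * (1/2)^Suc n" by metis
  define C where "C = case_prod B o prod_decode"
  have A_C: "(\<Union>i. A i) \<subseteq> (\<Union>i. C i)"
  proof
    fix x assume "x \<in> (\<Union>i. A i)"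
    then obtain n i where "x \<in> B n i" using sbB by blast
    then have "x \<in> C (prod_encode (n, i))" by (simp add: C_def)
    then show "x \<in> (\<Union>i. C i)" by blast
  qed
  have "?O (\<Union>i. A i) \<le> (\<Sum>i. ?g (C i))"
    using A_C Bd by (intro hausdorff_premeasure_le) (auto simp: C_def split_def)
  also have "\<dots> = (\<Sum>i. (\<lambda>(n, i). ?g (B n i)) (prod_decode i))" by (simp add: C_def split_def)
  also have "\<dots> = (\<Sum>n. \<Sum>i. ?g (B n i))" by (rule suminf_ennreal_2dimen) simp
  also have "\<dots> \<le> (\<Sum>n. ?O (A n) + e * (1/2) ^ Suc n)"
    by (intro suminf_le allI Ble) auto
  also have "... = (\<Sum>n. ?O (A n)) + (\<Sum>n. ennreal e * ennreal ((1/2) ^ Suc n))"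
    using \<open>0 < e\<close> by (subst suminf_add[symmetric])
                     (auto simp del: ennreal_suminf_cmult simp add: ennreal_mult[symmetric])
  also have "\<dots> = (\<Sum>n. ?O (A n)) + e"
    unfolding ennreal_suminf_cmult
    by (subst suminf_ennreal_eq[OF zero_le_power power_half_series]) auto
  finally show "?O (\<Union>i. A i) \<le> (\<Sum>n. ?O (A n)) + e" .
qed

text \<open>A covering set of diameter at most \<delta> < d cannot meet both A and B, so a cover of
  the union splits into a cover of each. Members that are discarded become empty sets, which cost
  nothing because m is positive.\<close>

lemma hausdorff_premeasure_separated:
  assumes m: "m > 0" and d: "\<delta> < d" and sep: "\<And>a b. a \<in> A \<Longrightarrow> b \<in> B \<Longrightarrow> d \<le> dist a b"
  shows "hausdorff_premeasure m \<delta> A + hausdorff_premeasure m \<delta> B \<le> hausdorff_premeasure m \<delta> (A \<union> B)"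
proof (subst (3) hausdorff_premeasure_def, rule Inf_greatest, clarify)
  let ?g = "\<lambda>U::'a set. ennreal (unit_ball_vol (real m) * (diameter U / 2) ^ m)"
  fix U :: "nat \<Rightarrow> 'a set" assume U: "A \<union> B \<subseteq> (\<Union>i. U i)" "\<forall>i. bounded (U i) \<and> diameter (U i) \<le> \<delta>"
  have d0: "0 \<le> \<delta>" using U(2) diameter_ge_0 by (meson order_trans)
  define V where "V i = (if U i \<inter> A = {} then {} else U i)" for i
  define W where "W i = (if U i \<inter> B = {} then {} else U i)" for i
  have excl: "U i \<inter> A = {} \<or> U i \<inter> B = {}" for i
  proof (rule ccontr)
    assume "\<not> ?thesis"
    then obtain a b where ab: "a \<in> U i" "a \<in> A" "b \<in> U i" "b \<in> B" by blast
    have "dist a b \<le> diameter (U i)" using U(2) ab by (intro diameter_bounded_bound) auto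
    then show False using sep[OF ab(2,4)] U(2) d by (meson le_less_trans not_le order_trans)
  qed
  have z: "?g {} = 0" using m by (simp add: power_0_left)
  have "hausdorff_premeasure m \<delta> A \<le> (\<Sum>i. ?g (V i))"
    using U d0 by (intro hausdorff_premeasure_le) (auto simp: V_def, blast)
  moreover have "hausdorff_premeasure m \<delta> B \<le> (\<Sum>i. ?g (W i))"
    using U d0 by (intro hausdorff_premeasure_le) (auto simp: W_def, blast)
  ultimately have "hausdorff_premeasure m \<delta> A + hausdorff_premeasure m \<delta> B \<le> (\<Sum>i. ?g (V i)) + (\<Sum>i. ?g (W i))"
    by (rule add_mono)
  also have "\<dots> = (\<Sum>i. ?g (V i) + ?g (W i))" by (rule suminf_add) auto
  also have "\<dots> \<le> (\<Sum>i. ?g (U i))"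
  proof (rule suminf_le)
    show "?g (V i) + ?g (W i) \<le> ?g (U i)" for i
      using excl[of i] z m unfolding V_def W_def by (auto simp: power_0_left)
  qed auto
  finally show "hausdorff_premeasure m \<delta> A + hausdorff_premeasure m \<delta> B \<le> (\<Sum>i. ?g (U i))" .
qed

lemma hausdorff_premeasure_le_outer: "\<delta> > 0 \<Longrightarrow> hausdorff_premeasure m \<delta> A \<le> hausdorff_outer m A"
  unfolding hausdorff_outer_def by (rule SUP_upper) simp

lemma hausdorff_outer_mono: "A \<subseteq> B \<Longrightarrow> hausdorff_outer m A \<le> hausdorff_outer m B"
  unfolding hausdorff_outer_def by (intro SUP_mono) (auto intro: hausdorff_premeasure_mono)

lemma hausdorff_outer_empty: "m > 0 \<Longrightarrow> hausdorff_outer m {} = 0"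
  unfolding hausdorff_outer_def by (auto simp: hausdorff_premeasure_empty)

lemma hausdorff_outer_subadditive: "hausdorff_outer m (\<Union>i. A i) \<le> (\<Sum>i. hausdorff_outer m (A i))"
proof (subst hausdorff_outer_def, rule SUP_least)
  fix \<delta> :: real assume d: "\<delta> \<in> {0<..}"
  have "hausdorff_premeasure m \<delta> (\<Union>i. A i) \<le> (\<Sum>i. hausdorff_premeasure m \<delta> (A i))"
    by (rule hausdorff_premeasure_subadditive)
  also have "\<dots> \<le> (\<Sum>i. hausdorff_outer m (A i))"
    using d by (intro suminf_le hausdorff_premeasure_le_outer) auto
  finally show "hausdorff_premeasure m \<delta> (\<Union>i. A i) \<le> (\<Sum>i. hausdorff_outer m (A i))" .
qed

lemma hausdorff_outer_separated:
  assumes m: "m > 0" and d: "d > 0" and sep: "\<And>a b. a \<in> A \<Longrightarrow> b \<in> B \<Longrightarrow> d \<le> dist a b"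
  shows "hausdorff_outer m A + hausdorff_outer m B \<le> hausdorff_outer m (A \<union> B)"
proof -
  have "hausdorff_outer m A + hausdorff_outer m B
      = (SUP \<delta>\<in>{0<..}. hausdorff_premeasure m \<delta> A + hausdorff_premeasure m \<delta> B)"
    unfolding hausdorff_outer_def
  proof (rule SUP_add_directed_ennreal[symmetric])
    fix i j :: real assume "i \<in> {0<..}" "j \<in> {0<..}"
    then show "\<exists>k\<in>{0<..}. hausdorff_premeasure m i A + hausdorff_premeasure m j B
        \<le> hausdorff_premeasure m k A + hausdorff_premeasure m k B"
      by (intro bexI[of _ "min i j"] add_mono hausdorff_premeasure_anti) auto
  qed
  also have "\<dots> \<le> hausdorff_outer m (A \<union> B)"
  proof (rule SUP_least)
    fix \<delta> :: real assume \<delta>: "\<delta> \<in> {0<..}"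
    define \<delta>' where "\<delta>' = min \<delta> (d / 2)"
    have \<delta>': "\<delta>' > 0" "\<delta>' < d" "\<delta>' \<le> \<delta>" using \<delta> d by (auto simp: \<delta>'_def)
    have "hausdorff_premeasure m \<delta> A + hausdorff_premeasure m \<delta> B \<le> hausdorff_premeasure m \<delta>' A + hausdorff_premeasure m \<delta>' B"
      by (intro add_mono hausdorff_premeasure_anti \<delta>')
    also have "\<dots> \<le> hausdorff_premeasure m \<delta>' (A \<union> B)" by (rule hausdorff_premeasure_separated[OF m \<delta>'(2) sep])
    also have "\<dots> \<le> hausdorff_outer m (A \<union> B)" by (rule hausdorff_premeasure_le_outer[OF \<delta>'(1)])
    finally show "hausdorff_premeasure m \<delta> A + hausdorff_premeasure m \<delta> B \<le> hausdorff_outer m (A \<union> B)" .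
  qed
  finally show ?thesis .
qed

lemma hausdorff_outer_binary:
  assumes "m > 0" shows "hausdorff_outer m (A \<union> B) \<le> hausdorff_outer m A + hausdorff_outer m B"
proof -
  have "hausdorff_outer m (\<Union>i. binaryset A B i) \<le> (\<Sum>i. hausdorff_outer m (binaryset A B i))"
    by (rule hausdorff_outer_subadditive)
  also have "\<dots> = hausdorff_outer m A + hausdorff_outer m B"
    by (rule suminf_binaryset_eq) (rule hausdorff_outer_empty[OF assms])
  finally show ?thesis by (simp add: UN_binaryset_eq)
qed

text \<open>The metric criterion puts every closed set into the lambda system of the outer measure,
  which is a sigma algebra and therefore contains all Borel sets.\<close>

lemma hausdorff_outer_borel:
  assumes m: "m > 0"
  shows "measure_space (UNIV :: 'a::metric_space set) (sets borel) (hausdorff_outer m)"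
proof -
  interpret sigma_algebra "UNIV :: 'a set" UNIV using sigma_algebra_Pow[of "UNIV :: 'a set"] by simp
  have oms: "outer_measure_space (UNIV :: 'a set set) (hausdorff_outer m)"
    unfolding outer_measure_space_def positive_def increasing_def countably_subadditive_def
    using hausdorff_outer_empty[OF m] hausdorff_outer_mono hausdorff_outer_subadditive by blast
  let ?L = "lambda_system (UNIV :: 'a set) UNIV (hausdorff_outer m)"
  have ms: "measure_space UNIV ?L (hausdorff_outer m)" by (rule caratheodory_lemma[OF oms])
  have cl: "F \<in> ?L" if "closed F" for F
  proof -
    have "hausdorff_outer m (F \<inter> X) + hausdorff_outer m ((UNIV - F) \<inter> X) = hausdorff_outer m X" for X
    proof (rule antisym)
      have e: "(UNIV - F) \<inter> X = X - F" "X = F \<inter> X \<union> (X - F)" by auto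
      show "hausdorff_outer m (F \<inter> X) + hausdorff_outer m ((UNIV - F) \<inter> X) \<le> hausdorff_outer m X"
        unfolding e(1)
        by (rule metric_outer_measure_closed[OF hausdorff_outer_empty[OF m] hausdorff_outer_mono
              hausdorff_outer_subadditive hausdorff_outer_separated[OF m] that])
      show "hausdorff_outer m X \<le> hausdorff_outer m (F \<inter> X) + hausdorff_outer m ((UNIV - F) \<inter> X)"
        unfolding e(1) using hausdorff_outer_binary[OF m, of "F \<inter> X" "X - F"] e(2) by simp
    qed
    then show ?thesis by (auto simp: lambda_system_def)
  qed
  have sa: "sigma_algebra UNIV ?L" using ms by (simp add: measure_space_def)
  have "sets (borel :: 'a measure) = sigma_sets UNIV (Collect closed)"
    by (subst borel_eq_closed) (simp add: sets_measure_of)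
  also have "\<dots> \<subseteq> ?L" using sigma_algebra.sigma_sets_subset[OF sa, of "Collect closed"] cl by auto
  finally have "sets (borel :: 'a measure) \<subseteq> ?L" .
  moreover have "sigma_algebra (UNIV :: 'a set) (sets borel)"
    using sets.sigma_algebra_axioms[of "borel :: 'a measure"] by simp
  ultimately show ?thesis using measure_down[OF ms] by blast
qed

lemma sets_hausdorff_measure [simp]: "sets (hausdorff_measure m :: 'a::metric_space measure) = sets borel"
  unfolding hausdorff_measure_def by (simp add: sets.sigma_sets_eq[of borel, simplified] flip: sets.sigma_sets_eq[of borel, simplified])

lemma space_hausdorff_measure [simp]: "space (hausdorff_measure m :: 'a::metric_space measure) = UNIV"
  unfolding hausdorff_measure_def by simp

lemma emeasure_hausdorff_measure:
  assumes m: "m > 0" and A: "A \<in> sets (borel :: 'a::metric_space measure)"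
  shows "emeasure (hausdorff_measure m) A = hausdorff_outer m A"
proof (rule emeasure_measure_of)
  show "hausdorff_measure m = measure_of UNIV (sets borel) (hausdorff_outer m)"
    by (simp add: hausdorff_measure_def hausdorff_outer_def[abs_def])
  show "positive (sets (hausdorff_measure m)) (hausdorff_outer m)"
    "countably_additive (sets (hausdorff_measure m)) (hausdorff_outer m)"
    using hausdorff_outer_borel[OF m] by (auto simp: measure_space_def)
qed (use A in auto)

section \<open>Upper and lower area bounds for boundary caps\<close>

lemma hausdorff_premeasure_finite_cover:
  fixes U :: "'i \<Rightarrow> 'a::metric_space set"
  assumes m: "m > 0" and I: "finite I" and A: "A \<subseteq> (\<Union>i\<in>I. U i)"
    and U: "\<And>i. i \<in> I \<Longrightarrow> bounded (U i)" "\<And>i. i \<in> I \<Longrightarrow> diameter (U i) \<le> D" and D: "0 \<le> D" "D \<le> \<delta>"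
  shows "hausdorff_premeasure m \<delta> A \<le> ennreal (real (card I) * (unit_ball_vol (real m) * (D / 2) ^ m))"
proof -
  obtain h where h: "bij_betw h {..<card I} I" using I by (metis bij_betw_from_nat_into_finite)
  define V where "V k = (if k < card I then U (h k) else {})" for k
  have hI: "k < card I \<Longrightarrow> h k \<in> I" for k using h by (auto simp: bij_betw_def)
  have "A \<subseteq> (\<Union>k. V k)"
  proof
    fix x assume "x \<in> A"
    then obtain i where i: "i \<in> I" "x \<in> U i" using A by blast
    then obtain k where "k < card I" "h k = i" using h unfolding bij_betw_def by (metis imageE lessThan_iff)
    then have "x \<in> V k" using i by (simp add: V_def)
    then show "x \<in> (\<Union>k. V k)" by blast
  qed
  moreover have "diameter (V k) \<le> \<delta>" for k
    using order_trans[OF U(2)[OF hI] D(2), of k] D by (simp add: V_def)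
  ultimately have "hausdorff_premeasure m \<delta> A \<le> (\<Sum>k. ennreal (unit_ball_vol (real m) * (diameter (V k) / 2) ^ m))"
    using U hI by (intro hausdorff_premeasure_le) (auto simp: V_def)
  also have "\<dots> = (\<Sum>k<card I. ennreal (unit_ball_vol (real m) * (diameter (V k) / 2) ^ m))"
    using m by (intro suminf_finite) (auto simp: V_def power_0_left)
  also have "\<dots> \<le> (\<Sum>k<card I. ennreal (unit_ball_vol (real m) * (D / 2) ^ m))"
    using U hI D diameter_ge_0
    by (intro sum_mono ennreal_leI mult_left_mono power_mono divide_right_mono) (auto simp: V_def)
  also have "\<dots> = ennreal (real (card I) * (unit_ball_vol (real m) * (D / 2) ^ m))"
    using D by (simp add: ennreal_mult ennreal_of_nat_eq_real_of_nat)
  finally show ?thesis .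
qed

text \<open>The cube of half side 2 r about p: b and s name a face, k a cell of side 4 r / N on it.
  The index range ends at N rather than N - 1 because rounding down the coordinate 2 r yields N; the
  surplus cells are harmless in an upper bound.\<close>

lemma cube_boundary_cell:
  fixes p y :: "'a::euclidean_space"
  assumes r: "r > 0" and N: "N > (0::nat)" and y: "infnorm (y - p) = 2 * r"
  shows "\<exists>b\<in>Basis. \<exists>s\<in>{-1,1}. \<exists>k\<in>PiE (Basis - {b}) (\<lambda>_. {..N}). (y - p) \<bullet> b = s * (2 * r) \<and>
    (\<forall>b'\<in>Basis - {b}. 4 * r / N * real (k b') - 2 * r \<le> (y - p) \<bullet> b' \<and> (y - p) \<bullet> b' \<le> 4 * r / N * (real (k b') + 1) - 2 * r)"
proof -
  have M: "2 * r = Max ((\<lambda>i. \<bar>(y - p) \<bullet> i\<bar>) ` Basis)" using y by (simp add: infnorm_Max)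
  have "Max ((\<lambda>i. \<bar>(y - p) \<bullet> i\<bar>) ` Basis) \<in> (\<lambda>i. \<bar>(y - p) \<bullet> i\<bar>) ` Basis" by (rule Max_in) auto
  then obtain b where "b \<in> Basis" "Max ((\<lambda>i. \<bar>(y - p) \<bullet> i\<bar>) ` Basis) = \<bar>(y - p) \<bullet> b\<bar>" by (rule imageE)
  then have b: "b \<in> Basis" "\<bar>(y - p) \<bullet> b\<bar> = 2 * r" using M by linarith+
  have le: "\<bar>(y - p) \<bullet> i\<bar> \<le> 2 * r" if "i \<in> Basis" for i unfolding M using that by (intro Max_ge) auto
  define s where "s = (if (y - p) \<bullet> b \<ge> 0 then 1 else (-1::real))"
  have s: "s \<in> {-1,1}" "(y - p) \<bullet> b = s * (2 * r)" using b by (auto simp: s_def abs_if split: if_splits)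
  define h where "h = 4 * r / N"
  have h: "h > 0" using r N by (simp add: h_def)
  define k where "k = restrict (\<lambda>b'. nat \<lfloor>((y - p) \<bullet> b' + 2 * r) / h\<rfloor>) (Basis - {b})"
  have kb: "k b' \<le> N \<and> h * real (k b') - 2 * r \<le> (y - p) \<bullet> b' \<and> (y - p) \<bullet> b' \<le> h * (real (k b') + 1) - 2 * r"
    if b': "b' \<in> Basis - {b}" for b'
  proof -
    define q where "q = ((y - p) \<bullet> b' + 2 * r) / h"
    have qh: "q * h = (y - p) \<bullet> b' + 2 * r" using h by (simp add: q_def)
    have rng: "- (2 * r) \<le> (y - p) \<bullet> b'" "(y - p) \<bullet> b' \<le> 2 * r" using le[of b'] b' by (auto simp: abs_le_iff)
    have q0: "0 \<le> q" using rng h by (simp add: q_def)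
    have kq: "k b' = nat \<lfloor>q\<rfloor>" using b' by (simp add: k_def q_def)
    have rk: "real (k b') \<le> q" "q \<le> real (k b') + 1" using q0 unfolding kq by linarith+
    have "q \<le> real N"
    proof -
      have "real N * h = 4 * r" using N by (simp add: h_def)
      then have "q * h \<le> real N * h" using rng by (simp add: qh)
      then show ?thesis using h by simp
    qed
    then have "k b' \<le> N" using rk by linarith
    moreover have "h * real (k b') \<le> q * h" using rk(1) h by (simp add: mult.commute)
    moreover have "q * h \<le> h * (real (k b') + 1)" using rk(2) h by (simp add: mult.commute)
    ultimately show ?thesis unfolding qh by simp
  qed
  have "k \<in> PiE (Basis - {b}) (\<lambda>_. {..N})" using kb by (auto simp: k_def)
  then show ?thesis using b(1) s kb unfolding h_def[symmetric] by blast
qed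

context smooth_convex_body begin

definition bdim :: nat where "bdim = DIM('a) - 1"

text \<open>A boundary point is the nearest point of the convex body to every point of its normal ray, so the nearest-point
  retraction, which is 1-Lipschitz, maps the boundary of a cube onto a neighbourhood of \<open>p\<close> in the boundary.\<close>

lemma frontier_upper:
  assumes m: "bdim > 0"
  shows "\<exists>K>0. \<forall>p r. r > 0 \<longrightarrow> hausdorff_outer bdim (frontier \<Omega> \<inter> cball p r) \<le> ennreal (K * r ^ bdim)"
proof -
  define n where "n = DIM('a)"
  have n: "n > 0" by (simp add: n_def)
  define K where "K = 2 * real n * unit_ball_vol (real bdim) * (4 * real n) ^ bdim"
  have K: "K > 0" using n unfolding K_def by (intro mult_pos_pos zero_less_power) auto
  have main: "hausdorff_premeasure bdim \<delta> (frontier \<Omega> \<inter> cball p r) \<le> ennreal (K * r ^ bdim)" if r: "r > 0" and \<delta>: "\<delta> > 0" for p r \<delta>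
  proof (cases "frontier \<Omega> \<inter> cball p r = {}")
    case True
    then show ?thesis by (simp add: hausdorff_premeasure_empty[OF m \<delta>])
  next
    case False
    define K0 where "K0 = closure \<Omega> \<inter> cball p r"
    have K0: "convex K0" "closed K0" "K0 \<noteq> {}"
      using False cvx frontier_closure by (auto simp: K0_def convex_closure convex_Int)
    \<comment> \<open>Fine enough that the cells, of diameter at most D, are admissible at scale
      \<delta>.\<close>
    obtain N where N: "N > (0::nat)" "4 * r * real n / \<delta> < real N"
      using reals_Archimedean2[of "4 * r * real n / \<delta>"] r \<delta> n by (metis divide_nonneg_pos gr0I less_eq_real_def mult_nonneg_nonneg not_le of_nat_0 of_nat_0_le_iff zero_le_numeral)
    define D where "D = real n * (4 * r / real N)"
    have D: "0 \<le> D" using r by (simp add: D_def)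
    have "4 * r * real n \<le> \<delta> * real N" using N(2) \<delta> by (simp add: pos_divide_less_eq mult.commute)
    then have "(4 * r * real n) / real N \<le> \<delta>" using N(1) by (simp add: pos_divide_le_eq)
    then have D\<delta>: "D \<le> \<delta>" by (simp add: D_def mult_ac)
    define cell where "cell = (\<lambda>(b, s, k). {y. (y - p) \<bullet> b = s * (2 * r) \<and> (\<forall>b'\<in>Basis - {b}. 4 * r / N * real (k b') - 2 * r \<le> (y - p) \<bullet> b' \<and> (y - p) \<bullet> b' \<le> 4 * r / N * (real (k b') + 1) - 2 * r)})"
    define I where "I = Sigma (Basis :: 'a set) (\<lambda>b. {-1,1::real} \<times> PiE (Basis - {b}) (\<lambda>_. {..N}))"
    define U where "U i = closest_point K0 ` cell i" for i
    have fin: "finite I" unfolding I_def by (intro finite_SigmaI finite_cartesian_product finite_PiE) auto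
    have cardI: "real (card I) = 2 * real n * (real N + 1) ^ bdim"
    proof -
      have c1: "card ({-1,1::real} \<times> PiE (Basis - {b}) (\<lambda>_. {..N})) = 2 * (N + 1) ^ bdim" if "b \<in> Basis" for b :: 'a
        using that by (simp add: card_cartesian_product card_PiE bdim_def)
      have "card I = (\<Sum>b\<in>(Basis::'a set). card ({-1,1::real} \<times> PiE (Basis - {b}) (\<lambda>_. {..N})))"
        unfolding I_def by (rule card_SigmaI) (auto intro!: finite_cartesian_product finite_PiE)
      also have "\<dots> = (\<Sum>b\<in>(Basis::'a set). 2 * (N + 1) ^ bdim)" by (intro sum.cong c1) auto
      finally show ?thesis by (simp add: n_def mult.assoc add.commute)
    qed
    have dcell: "dist y z \<le> D" if "y \<in> cell i" "z \<in> cell i" "i \<in> I" for y z i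
    proof -
      obtain b s k where i: "i = (b, s, k)" by (metis prod_cases3)
      have "\<bar>(y - z) \<bullet> b'\<bar> \<le> 4 * r / N" if b': "b' \<in> Basis" for b'
      proof (cases "b' = b")
        case True
        have "(y - p) \<bullet> b = s * (2 * r)" "(z - p) \<bullet> b = s * (2 * r)"
          using \<open>y \<in> cell i\<close> \<open>z \<in> cell i\<close> by (auto simp: cell_def i)
        then have "(y - z) \<bullet> b' = 0" by (simp add: True inner_diff_left)
        then show ?thesis using r by simp
      next
        case False
        have e: "(y - z) \<bullet> b' = (y - p) \<bullet> b' - (z - p) \<bullet> b'" by (simp add: inner_diff_left)
        have "4 * r / N * real (k b') - 2 * r \<le> (y - p) \<bullet> b'" "(y - p) \<bullet> b' \<le> 4 * r / N * (real (k b') + 1) - 2 * r"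
          "4 * r / N * real (k b') - 2 * r \<le> (z - p) \<bullet> b'" "(z - p) \<bullet> b' \<le> 4 * r / N * (real (k b') + 1) - 2 * r"
          using \<open>y \<in> cell i\<close> \<open>z \<in> cell i\<close> False b' by (auto simp: cell_def i)
        then show ?thesis unfolding e by (simp add: abs_le_iff distrib_left)
      qed
      then have "(\<Sum>b'\<in>Basis. \<bar>(y - z) \<bullet> b'\<bar>) \<le> (\<Sum>b'\<in>(Basis::'a set). 4 * r / N)" by (rule sum_mono)
      then show ?thesis using norm_le_l1[of "y - z"] by (simp add: dist_norm D_def n_def)
    qed
    have dU: "dist y z \<le> D" if yz: "y \<in> U i" "z \<in> U i" "i \<in> I" for y z i
    proof -
      obtain y' z' where y': "y' \<in> cell i" "y = closest_point K0 y'" and z': "z' \<in> cell i" "z = closest_point K0 z'"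
        using yz unfolding U_def by blast
      show ?thesis unfolding y' z'
        using closest_point_lipschitz[OF K0, of y' z'] dcell[OF y'(1) z'(1) yz(3)] by linarith
    qed
    have bU: "bounded (U i)" if "i \<in> I" for i
      using dU[OF _ _ that] unfolding bounded_two_points by blast
    have diam: "diameter (U i) \<le> D" if "i \<in> I" for i
      using dU[OF _ _ that] D by (intro diameter_le) (auto simp: dist_norm)
    have cover: "frontier \<Omega> \<inter> cball p r \<subseteq> (\<Union>i\<in>I. U i)"
    proof
      fix x assume x: "x \<in> frontier \<Omega> \<inter> cball p r"
      define v where "v = nv x"
      have v: "norm v = 1" using nv x by (simp add: v_def)
      have xK: "x \<in> K0" using x frontier_closure by (auto simp: K0_def)
      define g where "g t = infnorm (x + t *\<^sub>R v - p)" for t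
      \<comment> \<open>At this time the normal ray has reached distance
        \<open>2 * r * sqrt (real n)\<close> from p, where the maximum norm is at least 2 r; so it
        has met the boundary of the cube.\<close>
      define T where "T = r + 2 * r * sqrt (real n)"
      have T: "0 \<le> T" using r by (simp add: T_def)
      have "continuous_on {0..T} g" unfolding g_def by (intro continuous_intros)
      moreover have "g 0 \<le> 2 * r"
        using infnorm_le_norm[of "x - p"] x r by (auto simp: g_def dist_norm norm_minus_commute)
      moreover have "2 * r \<le> g T"
      proof -
        have "T - r \<le> norm (T *\<^sub>R v) - norm (p - x)" using v T x by (auto simp: dist_norm)
        also have "\<dots> \<le> norm (x + T *\<^sub>R v - p)" using norm_triangle_ineq2[of "T *\<^sub>R v" "p - x"] by (simp add: algebra_simps)
        also have "\<dots> \<le> sqrt (real n) * g T" unfolding g_def n_def by (rule norm_le_infnorm)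
        finally have "2 * r * sqrt (real n) \<le> g T * sqrt (real n)" by (simp add: T_def mult.commute)
        then show ?thesis using n by simp
      qed
      ultimately obtain t where t: "0 \<le> t" "g t = 2 * r" using IVT'[of g 0 "2 * r" T] T by auto
      define y where "y = x + t *\<^sub>R v"
      have "infnorm (y - p) = 2 * r" using t(2) by (simp add: g_def y_def)
      from cube_boundary_cell[OF r N(1) this] obtain b s k where bsk: "b \<in> Basis" "s \<in> {-1,1}"
        "k \<in> PiE (Basis - {b}) (\<lambda>_. {..N})" "(y - p) \<bullet> b = s * (2 * r)"
        "\<forall>b'\<in>Basis - {b}. 4 * r / N * real (k b') - 2 * r \<le> (y - p) \<bullet> b' \<and> (y - p) \<bullet> b' \<le> 4 * r / N * (real (k b') + 1) - 2 * r"
        by blast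
      have "(b, s, k) \<in> I" using bsk(1,2,3) unfolding I_def by blast
      moreover have "y \<in> cell (b, s, k)" using bsk(4,5) unfolding cell_def by simp
      ultimately have "\<exists>i\<in>I. y \<in> cell i" by blast
      moreover have "x = closest_point K0 y"
      proof (rule closest_point_unique[OF K0(1,2) xK], rule ballI)
        fix z assume z: "z \<in> K0"
        have "0 \<le> c * (dist x z)\<^sup>2" using c by simp
        also have "\<dots> \<le> v \<bullet> (x - z)" unfolding v_def using x z by (intro outer) (auto simp: K0_def)
        finally have vz: "0 \<le> v \<bullet> (x - z)" .
        have "(norm (y - z))\<^sup>2 = t\<^sup>2 + 2 * t * (v \<bullet> (x - z)) + (norm (x - z))\<^sup>2"
        proof -
          have e: "y - z = t *\<^sub>R v + (x - z)" by (simp add: y_def)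
          have "v \<bullet> v = 1" using v by (simp add: norm_eq_1)
          then show ?thesis unfolding e power2_norm_eq_inner
            by (simp add: inner_add_left inner_add_right inner_commute[of "x - z" v] power2_eq_square distrib_left del: inner_diff_right)
        qed
        moreover have "0 \<le> 2 * t * (v \<bullet> (x - z))" using t vz by simp
        ultimately have "t\<^sup>2 \<le> (norm (y - z))\<^sup>2" by (metis add.commute add_increasing2 le_add_same_cancel1 order_trans zero_le_power2)
        then have "t \<le> norm (y - z)" by (rule power2_le_imp_le) simp
        moreover have "dist y x = t" using v t by (simp add: y_def dist_norm)
        ultimately show "dist y x \<le> dist y z" by (simp add: dist_norm)
      qed
      ultimately show "x \<in> (\<Union>i\<in>I. U i)" unfolding U_def by blast
    qed
    have "hausdorff_premeasure bdim \<delta> (frontier \<Omega> \<inter> cball p r) \<le> ennreal (real (card I) * (unit_ball_vol (real bdim) * (D / 2) ^ bdim))"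
      by (rule hausdorff_premeasure_finite_cover[OF m fin cover bU diam D D\<delta>])
    also have "\<dots> \<le> ennreal (K * r ^ bdim)"
    proof (rule ennreal_leI)
      \<comment> \<open>Replacing N + 1 by 2 N makes N cancel against D, so the estimate is
        independent of \<delta>.\<close>
      have "(real N + 1) * (D / 2) \<le> (2 * real N) * (D / 2)" using N D by (intro mult_right_mono) auto
      also have "\<dots> = 4 * real n * r" using N by (simp add: D_def)
      finally have 1: "((real N + 1) * (D / 2)) ^ bdim \<le> (4 * real n * r) ^ bdim" using D by (intro power_mono) auto
      have "real (card I) * (unit_ball_vol (real bdim) * (D / 2) ^ bdim)
          = 2 * real n * unit_ball_vol (real bdim) * ((real N + 1) * (D / 2)) ^ bdim"
        unfolding cardI power_mult_distrib by simp
      also have "\<dots> \<le> 2 * real n * unit_ball_vol (real bdim) * (4 * real n * r) ^ bdim"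
        using 1 by (intro mult_left_mono) auto
      also have "\<dots> = K * r ^ bdim" by (simp add: K_def power_mult_distrib)
      finally show "real (card I) * (unit_ball_vol (real bdim) * (D / 2) ^ bdim) \<le> K * r ^ bdim" .
    qed
    finally show ?thesis .
  qed
  have "hausdorff_outer bdim (frontier \<Omega> \<inter> cball p r) \<le> ennreal (K * r ^ bdim)" if "r > 0" for p r
    unfolding hausdorff_outer_def using main[OF that] by (intro SUP_least) auto
  then show ?thesis using K by blast
qed

end

text \<open>A set of diameter d, moved along v over length 2 r, is covered by about 2 r / d balls of
  radius 2 d. Their total volume is of order r times d to the power \<open>DIM('a) - 1\<close>, the
  quantity summed in a Hausdorff premeasure.\<close>

lemma swept_set_measure:
  fixes U :: "'a::euclidean_space set"
  assumes r: "r > 0" and d: "d > 0" "d \<le> r" and v: "norm v = 1" and U: "\<And>x y. x \<in> U \<Longrightarrow> y \<in> U \<Longrightarrow> dist x y \<le> d"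
  shows "\<exists>V\<in>sets lborel. {x + t *\<^sub>R v | x t. x \<in> U \<and> \<bar>t\<bar> \<le> r} \<subseteq> V \<and>
    emeasure lborel V \<le> ennreal (4 * 2 ^ DIM('a) * unit_ball_vol (DIM('a)) * r * d ^ (DIM('a) - 1))"
proof (cases "U = {}")
  case True
  then show ?thesis by (intro bexI[of _ "{}"]) auto
next
  case False
  then obtain q where q: "q \<in> U" by blast
  define J where "J = nat \<lfloor>2 * r / d\<rfloor>"
  define V where "V = (\<Union>j\<in>{..J}. cball (q + (real j * d - r) *\<^sub>R v) (2 * d))"
  have "{x + t *\<^sub>R v | x t. x \<in> U \<and> \<bar>t\<bar> \<le> r} \<subseteq> V"
  proof clarify
    fix x t assume x: "x \<in> U" and t: "\<bar>t\<bar> \<le> r"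
    define j where "j = nat \<lfloor>(t + r) / d\<rfloor>"
    have tr: "0 \<le> t + r" "t + r \<le> 2 * r" using t by (auto simp: abs_le_iff)
    have q0: "0 \<le> (t + r) / d" using tr d by simp
    have rj: "real j \<le> (t + r) / d" "(t + r) / d \<le> real j + 1" using q0 unfolding j_def by linarith+
    have "(t + r) / d \<le> 2 * r / d" using tr d by (intro divide_right_mono) auto
    then have jJ: "j \<le> J" unfolding j_def J_def by (intro nat_mono floor_mono)
    have "real j * d \<le> t + r" "t + r \<le> (real j + 1) * d" using rj d by (simp_all add: field_simps)
    then have "\<bar>real j * d - r - t\<bar> \<le> d" by (simp add: abs_le_iff algebra_simps)
    then have "norm ((real j * d - r - t) *\<^sub>R v) \<le> d" using v by simp
    moreover have "norm (q - x) \<le> d" using U[OF q x] by (simp add: dist_norm)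
    moreover have eq: "(q + (real j * d - r) *\<^sub>R v) - (x + t *\<^sub>R v) = (q - x) + (real j * d - r - t) *\<^sub>R v"
      by (simp add: algebra_simps)
    ultimately have "dist (q + (real j * d - r) *\<^sub>R v) (x + t *\<^sub>R v) \<le> 2 * d"
      unfolding dist_norm eq using norm_triangle_ineq[of "q - x" "(real j * d - r - t) *\<^sub>R v"] by linarith
    then show "x + t *\<^sub>R v \<in> V" unfolding V_def using jJ by auto
  qed
  moreover have "emeasure lborel V \<le> ennreal (4 * 2 ^ DIM('a) * unit_ball_vol (DIM('a)) * r * d ^ (DIM('a) - 1))"
  proof -
    have "emeasure lborel V \<le> (\<Sum>j\<in>{..J}. emeasure lborel (cball (q + (real j * d - r) *\<^sub>R v) (2 * d)))"
      unfolding V_def by (intro emeasure_subadditive_finite) auto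
    also have "\<dots> = (\<Sum>j\<in>{..J}. ennreal (unit_ball_vol (real DIM('a)) * (2 * d) ^ DIM('a)))"
      using d by (simp add: emeasure_cball)
    also have "\<dots> = ennreal (real (Suc J) * (unit_ball_vol (real DIM('a)) * (2 * d) ^ DIM('a)))"
      using d by (simp add: ennreal_mult ennreal_of_nat_eq_real_of_nat)
    also have "\<dots> \<le> ennreal (4 * r / d * (unit_ball_vol (real DIM('a)) * (2 * d) ^ DIM('a)))"
    proof (intro ennreal_leI mult_right_mono)
      have "real J \<le> 2 * r / d" using r d by (simp add: J_def)
      moreover have "1 \<le> r / d" using d by simp
      ultimately show "real (Suc J) \<le> 4 * r / d" by simp
    qed (use d in auto)
    also have "4 * r / d * (unit_ball_vol (real DIM('a)) * (2 * d) ^ DIM('a)) = 4 * 2 ^ DIM('a) * unit_ball_vol (DIM('a)) * r * d ^ (DIM('a) - 1)"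
    proof -
      have "d ^ DIM('a) = d * d ^ (DIM('a) - 1)" by (metis DIM_positive Suc_pred' power_Suc)
      then show ?thesis using d by (simp add: power_mult_distrib)
    qed
    finally show ?thesis .
  qed
  moreover have "V \<in> sets lborel" unfolding V_def by auto
  ultimately show ?thesis by blast
qed

text \<open>Lower bounds for area from volume: if S swept along v fills a ball, then every cover of
  S, swept the same way, covers that ball, so its volume bounds the sum of the powers of the
  diameters from below. The premeasure at scale r already suffices.\<close>

lemma hausdorff_lower_by_sweep:
  fixes S :: "'a::euclidean_space set"
  assumes m: "m = DIM('a) - 1" "m > 0" and r: "r > 0" and v: "norm v = 1"
    and sub: "ball p \<rho> \<subseteq> {x + t *\<^sub>R v | x t. x \<in> S \<and> \<bar>t\<bar> \<le> r}" and \<rho>: "\<rho> > 0"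
  shows "ennreal (unit_ball_vol (real m) * \<rho> ^ DIM('a) / (2 ^ m * (4 * 2 ^ DIM('a)) * r)) \<le> hausdorff_outer m S"
proof -
  define L where "L = 4 * 2 ^ DIM('a) * unit_ball_vol (DIM('a)) * r"
  have L: "L > 0" using r by (simp add: L_def)
  define \<beta> where "\<beta> = unit_ball_vol (real m) / 2 ^ m"
  have \<beta>: "\<beta> > 0" by (simp add: \<beta>_def)
  have "ennreal (\<beta> * (unit_ball_vol DIM('a) * \<rho> ^ DIM('a)) / L) \<le> hausdorff_premeasure m r S"
    unfolding hausdorff_premeasure_def
  proof (rule Inf_greatest, clarify)
    fix U :: "nat \<Rightarrow> 'a set" assume U: "S \<subseteq> (\<Union>i. U i)" "\<forall>i. bounded (U i) \<and> diameter (U i) \<le> r"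
    let ?g = "\<lambda>i. ennreal (unit_ball_vol (real m) * (diameter (U i) / 2) ^ m)"
    have d0: "0 \<le> diameter (U i)" for i using U(2) diameter_ge_0 by blast
    have key: "ennreal (unit_ball_vol DIM('a) * \<rho> ^ DIM('a)) \<le> (\<Sum>i. ennreal (L * diameter (U i) ^ m)) + ennreal \<eta>" if \<eta>: "\<eta> > 0" for \<eta>
    proof -
      have "\<exists>V. V \<in> sets lborel \<and> {x + t *\<^sub>R v | x t. x \<in> U i \<and> \<bar>t\<bar> \<le> r} \<subseteq> V \<and>
         emeasure lborel V \<le> ennreal (L * diameter (U i) ^ m) + ennreal (\<eta> * (1/2) ^ Suc i)" for i
      proof -
        \<comment> \<open>\<open>swept_set_measure\<close> needs a positive width. Sets of diameter
          0 receive one so small that their total contribution is at most \<eta>.\<close>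
        define d where "d = (if diameter (U i) > 0 then diameter (U i) else min r (\<eta> * (1/2) ^ Suc i / (L * r ^ (m - 1))))"
        have Lr: "L * r ^ (m - 1) > 0" using L r by simp
        have d: "d > 0" "d \<le> r" "diameter (U i) \<le> d" using U(2) r \<eta> Lr d0[of i] by (auto simp: d_def)
        have "\<exists>V\<in>sets lborel. {x + t *\<^sub>R v | x t. x \<in> U i \<and> \<bar>t\<bar> \<le> r} \<subseteq> V \<and> emeasure lborel V \<le> ennreal (L * d ^ m)"
          unfolding L_def m(1)
          by (rule swept_set_measure[OF r d(1,2) v]) (use U(2) diameter_bounded_bound d(3) order_trans in blast)
        moreover have "ennreal (L * d ^ m) \<le> ennreal (L * diameter (U i) ^ m) + ennreal (\<eta> * (1/2) ^ Suc i)"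
        proof (cases "diameter (U i) > 0")
          case True
          then show ?thesis by (simp add: d_def)
        next
          case False
          have "L * d ^ m = L * (d * d ^ (m - 1))" using m(2) by (metis Suc_pred' power_Suc)
          also have "\<dots> \<le> L * (d * r ^ (m - 1))" using d L by (intro mult_left_mono power_mono) auto
          also have "\<dots> = (L * r ^ (m - 1)) * d" by simp
          also have "\<dots> \<le> (L * r ^ (m - 1)) * (\<eta> * (1/2) ^ Suc i / (L * r ^ (m - 1)))"
            using Lr False by (intro mult_left_mono) (auto simp: d_def)
          also have "\<dots> = \<eta> * (1/2) ^ Suc i" using Lr L r by simp
          finally show ?thesis using False d0[of i] m(2) by (simp add: power_0_left ennreal_leI)
        qed
        ultimately show ?thesis by (meson order_trans)
      qed
      then have "\<forall>i. \<exists>V. V \<in> sets lborel \<and> {x + t *\<^sub>R v | x t. x \<in> U i \<and> \<bar>t\<bar> \<le> r} \<subseteq> V \<and>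
         emeasure lborel V \<le> ennreal (L * diameter (U i) ^ m) + ennreal (\<eta> * (1/2) ^ Suc i)" by (rule allI)
      from choice[OF this] obtain V where V0: "\<forall>i. V i \<in> sets lborel \<and> {x + t *\<^sub>R v | x t. x \<in> U i \<and> \<bar>t\<bar> \<le> r} \<subseteq> V i \<and>
         emeasure lborel (V i) \<le> ennreal (L * diameter (U i) ^ m) + ennreal (\<eta> * (1/2) ^ Suc i)" ..
      then have V: "\<And>i. V i \<in> sets lborel" "\<And>i. {x + t *\<^sub>R v | x t. x \<in> U i \<and> \<bar>t\<bar> \<le> r} \<subseteq> V i"
        "\<And>i. emeasure lborel (V i) \<le> ennreal (L * diameter (U i) ^ m) + ennreal (\<eta> * (1/2) ^ Suc i)" by auto
      have "ball p \<rho> \<subseteq> (\<Union>i. V i)"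
      proof
        fix z assume "z \<in> ball p \<rho>"
        then obtain x t where xt: "z = x + t *\<^sub>R v" "x \<in> S" "\<bar>t\<bar> \<le> r" using sub by blast
        then obtain i where "x \<in> U i" using U(1) by blast
        then show "z \<in> (\<Union>i. V i)" using V(2)[of i] xt by blast
      qed
      then have "emeasure lborel (ball p \<rho>) \<le> emeasure lborel (\<Union>i. V i)" using V(1) by (intro emeasure_mono) auto
      also have "\<dots> \<le> (\<Sum>i. emeasure lborel (V i))" using V(1) by (intro emeasure_subadditive_countably) auto
      also have "\<dots> \<le> (\<Sum>i. ennreal (L * diameter (U i) ^ m) + ennreal (\<eta> * (1/2) ^ Suc i))" by (intro suminf_le V(3)) auto
      also have "\<dots> = (\<Sum>i. ennreal (L * diameter (U i) ^ m)) + (\<Sum>i. ennreal (\<eta> * (1/2) ^ Suc i))"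
        by (rule suminf_add[symmetric]) auto
      also have "(\<Sum>i. ennreal (\<eta> * (1/2) ^ Suc i)) = ennreal \<eta>"
      proof (rule suminf_ennreal_eq)
        show "(\<lambda>i. \<eta> * (1 / 2) ^ Suc i) sums \<eta>" using sums_mult[OF power_half_series, of \<eta>] by simp
      qed (use \<eta> in auto)
      finally show ?thesis using \<rho> by (simp add: emeasure_ball)
    qed
    have "ennreal (unit_ball_vol DIM('a) * \<rho> ^ DIM('a)) \<le> (\<Sum>i. ennreal (L * diameter (U i) ^ m))"
      by (rule ennreal_le_epsilon) (use key in auto)
    also have "\<dots> = (\<Sum>i. ennreal (L / \<beta>) * ?g i)"
    proof (intro suminf_cong)
      fix i
      have "ennreal (L / \<beta>) * ?g i = ennreal (L / \<beta> * (unit_ball_vol (real m) * (diameter (U i) / 2) ^ m))"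
        using L \<beta> d0[of i] by (intro ennreal_mult[symmetric]) auto
      also have "L / \<beta> * (unit_ball_vol (real m) * (diameter (U i) / 2) ^ m) = L * diameter (U i) ^ m"
        using unit_ball_vol_pos[of "real m"] by (simp add: \<beta>_def power_divide del: unit_ball_vol_pos)
      finally show "ennreal (L * diameter (U i) ^ m) = ennreal (L / \<beta>) * ?g i" by simp
    qed
    also have "\<dots> = ennreal (L / \<beta>) * (\<Sum>i. ?g i)" by (rule ennreal_suminf_cmult)
    finally have "ennreal (\<beta> / L) * ennreal (unit_ball_vol DIM('a) * \<rho> ^ DIM('a)) \<le> ennreal (\<beta> / L) * (ennreal (L / \<beta>) * (\<Sum>i. ?g i))"
      by (rule mult_left_mono) simp
    also have "\<dots> = (\<Sum>i. ?g i)" using L \<beta> by (simp add: mult.assoc[symmetric] ennreal_mult[symmetric])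
    also have "ennreal (\<beta> / L) * ennreal (unit_ball_vol DIM('a) * \<rho> ^ DIM('a)) = ennreal (\<beta> * (unit_ball_vol DIM('a) * \<rho> ^ DIM('a)) / L)"
      using L \<beta> \<rho> by (subst ennreal_mult[symmetric]) auto
    finally show "ennreal (\<beta> * (unit_ball_vol DIM('a) * \<rho> ^ DIM('a)) / L) \<le> (\<Sum>i. ?g i)" .
  qed
  also have "\<dots> \<le> hausdorff_outer m S" by (rule hausdorff_premeasure_le_outer[OF r])
  also have "\<beta> * (unit_ball_vol DIM('a) * \<rho> ^ DIM('a)) / L = unit_ball_vol (real m) * \<rho> ^ DIM('a) / (2 ^ m * (4 * 2 ^ DIM('a)) * r)"
    using r unit_ball_vol_pos[of "real DIM('a)"] by (simp add: L_def \<beta>_def del: unit_ball_vol_pos)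
  finally show ?thesis .
qed

context smooth_convex_body begin

text \<open>Every line parallel to the normal at p through a point of the ball of radius r/4 crosses
  the boundary inside \<open>cball p r\<close>: its point at height - r/4 lies in \<Omega> by the
  inner estimate, the one at height r/4 outside by the outer estimate. Hence the cap sweeps out that
  ball.\<close>

lemma frontier_lower:
  assumes m: "bdim > 0"
  shows "\<exists>K>0. \<exists>r0>0. \<forall>p r. p \<in> frontier \<Omega> \<longrightarrow> 0 < r \<longrightarrow> r \<le> r0 \<longrightarrow> ennreal (K * r ^ bdim) \<le> hausdorff_outer bdim (frontier \<Omega> \<inter> cball p r)"
proof -
  \<comment> \<open>r at most 1/C turns C times the squared distance of p and a, which is at most C
    r^2 / 8, into at most r/8, below the depth r/4; r at most e keeps a within reach of
    \<open>inner\<close>.\<close>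
  define r0 where "r0 = min (1 / C) e"
  have r0: "r0 > 0" using C e by (simp add: r0_def)
  define K where "K = unit_ball_vol (real bdim) * (1/4) ^ DIM('a) / (2 ^ bdim * (4 * 2 ^ DIM('a)))"
  have K: "K > 0" by (simp add: K_def)
  have "ennreal (K * r ^ bdim) \<le> hausdorff_outer bdim (frontier \<Omega> \<inter> cball p r)"
    if p: "p \<in> frontier \<Omega>" and r: "0 < r" "r \<le> r0" for p r
  proof -
    define v where "v = nv p"
    have v: "norm v = 1" using nv p by (simp add: v_def)
    have vv: "v \<bullet> v = 1" using v by (simp add: norm_eq_1)
    have "ball p (r / 4) \<subseteq> {x + t *\<^sub>R v | x t. x \<in> frontier \<Omega> \<inter> cball p r \<and> \<bar>t\<bar> \<le> r}"
    proof
      fix z assume z: "z \<in> ball p (r / 4)"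
      define s where "s = v \<bullet> (z - p)"
      define u where "u = z - p - s *\<^sub>R v"
      have zp: "norm (z - p) < r / 4" using z by (simp add: dist_norm norm_minus_commute)
      have s: "\<bar>s\<bar> < r / 4" using Cauchy_Schwarz_ineq2[of v "z - p"] v zp by (simp add: s_def)
      have vu: "v \<bullet> u = 0" by (simp add: u_def inner_diff_right vv s_def)
      have uu: "(norm u)\<^sup>2 \<le> (r / 4)\<^sup>2"
      proof -
        have "z - p = u + s *\<^sub>R v" by (simp add: u_def)
        then have "(norm (z - p))\<^sup>2 = (norm u)\<^sup>2 + s\<^sup>2"
          unfolding power2_norm_eq_inner using vu vv
          by (simp add: inner_add_left inner_add_right inner_commute[of u v] power2_eq_square)
        moreover have "(norm (z - p))\<^sup>2 \<le> (r / 4)\<^sup>2" using zp by (intro power_mono) auto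
        ultimately show ?thesis by (smt (verit) zero_le_power2)
      qed
      have dist_line: "(dist p (p + u + \<tau> *\<^sub>R v))\<^sup>2 = (norm u)\<^sup>2 + \<tau>\<^sup>2" for \<tau>
      proof -
        have "(dist p (p + u + \<tau> *\<^sub>R v))\<^sup>2 = (norm (u + \<tau> *\<^sub>R v))\<^sup>2"
          unfolding dist_norm by (metis add.assoc add_diff_cancel_left' norm_minus_commute)
        then show ?thesis unfolding power2_norm_eq_inner using vu vv
          by (simp add: inner_add_left inner_add_right inner_commute[of u v] power2_eq_square)
      qed
      have dl: "dist p (p + u + \<tau> *\<^sub>R v) \<le> r / 2" if "\<bar>\<tau>\<bar> \<le> r / 4" for \<tau>
      proof (rule power2_le_imp_le)
        have "\<tau>\<^sup>2 \<le> (r / 4)\<^sup>2" using that by (simp add: abs_le_square_iff[symmetric])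
        then show "(dist p (p + u + \<tau> *\<^sub>R v))\<^sup>2 \<le> (r / 2)\<^sup>2"
        proof -
          have "(r / 4)\<^sup>2 = r\<^sup>2 / 16" "(r / 2)\<^sup>2 = r\<^sup>2 / 4" by (simp_all add: power_divide)
          then show ?thesis unfolding dist_line using uu \<open>\<tau>\<^sup>2 \<le> (r / 4)\<^sup>2\<close> zero_le_power2[of r] by linarith
        qed
      qed (use r in simp)
      define a where "a = p + u + (- (r / 4)) *\<^sub>R v"
      define b where "b = p + u + (r / 4) *\<^sub>R v"
      have "a \<in> \<Omega>"
      proof (rule inner[OF p])
        have "dist p a \<le> r / 2" unfolding a_def by (rule dl) (use r in simp)
        then show "dist p a < e" using r by (auto simp: r0_def)
        have "C * (dist p a)\<^sup>2 \<le> C * ((r / 4)\<^sup>2 + (r / 4)\<^sup>2)" unfolding a_def dist_line using uu C by (intro mult_left_mono) auto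
        also have "\<dots> = (C * r) * (r / 8)" by (simp add: power2_eq_square)
        also have "\<dots> \<le> 1 * (r / 8)"
        proof (rule mult_right_mono)
          have "r \<le> 1 / C" using r by (simp add: r0_def)
          then show "C * r \<le> 1" using C by (simp add: field_simps)
        qed (use r in simp)
        also have "\<dots> < r / 4" using r by simp
        also have "r / 4 = nv p \<bullet> (p - a)" unfolding v_def[symmetric] by (simp add: a_def inner_diff_right inner_add_right vu vv)
        finally show "C * (dist p a)\<^sup>2 < nv p \<bullet> (p - a)" .
      qed
      moreover have "b \<notin> \<Omega>"
      proof
        assume "b \<in> \<Omega>"
        then have "c * (dist p b)\<^sup>2 \<le> v \<bullet> (p - b)" unfolding v_def using closure_subset p by (intro outer) auto
        moreover have "v \<bullet> (p - b) = - (r / 4)" by (simp add: b_def inner_diff_right inner_add_right vu vv)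
        ultimately show False using c r by (smt (verit) divide_pos_pos mult_nonneg_nonneg zero_le_power2)
      qed
      ultimately have "closed_segment a b \<inter> frontier \<Omega> \<noteq> {}"
        by (intro connected_Int_frontier) auto
      then obtain q where q: "q \<in> closed_segment a b" "q \<in> frontier \<Omega>" by blast
      obtain l where l: "0 \<le> l" "l \<le> 1" "q = (1 - l) *\<^sub>R a + l *\<^sub>R b" using q(1) by (auto simp: in_segment)
      define \<tau> where "\<tau> = (1 - l) * (- (r / 4)) + l * (r / 4)"
      have "q = ((1 - l) + l) *\<^sub>R (p + u) + \<tau> *\<^sub>R v"
        unfolding l(3) a_def b_def \<tau>_def by (simp only: scaleR_add_right scaleR_add_left scaleR_scaleR add_ac)
      then have q\<tau>: "q = p + u + \<tau> *\<^sub>R v" by simp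
      have eq\<tau>: "\<tau> = (2 * l - 1) * (r / 4)" by (simp add: \<tau>_def field_simps)
      have "\<bar>\<tau>\<bar> = \<bar>2 * l - 1\<bar> * (r / 4)" unfolding eq\<tau> abs_mult using r by simp
      moreover have "\<bar>2 * l - 1\<bar> \<le> 1" using l by (simp add: abs_le_iff)
      ultimately have \<tau>: "\<bar>\<tau>\<bar> \<le> r / 4" using r mult_right_mono[of "\<bar>2 * l - 1\<bar>" 1 "r / 4"] by simp
      have "q \<in> cball p r" using dl[OF \<tau>] r unfolding q\<tau> mem_cball by linarith
      moreover have "z = q + (s - \<tau>) *\<^sub>R v" unfolding q\<tau> u_def by (simp add: algebra_simps)
      moreover have "\<bar>s - \<tau>\<bar> \<le> r" using s \<tau> r by linarith
      ultimately show "z \<in> {x + t *\<^sub>R v | x t. x \<in> frontier \<Omega> \<inter> cball p r \<and> \<bar>t\<bar> \<le> r}" using q(2) by blast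
    qed
    from hausdorff_lower_by_sweep[OF bdim_def m r(1) v this]
    have "ennreal (unit_ball_vol (real bdim) * (r / 4) ^ DIM('a) / (2 ^ bdim * (4 * 2 ^ DIM('a)) * r)) \<le> hausdorff_outer bdim (frontier \<Omega> \<inter> cball p r)"
      using r by simp
    moreover have "unit_ball_vol (real bdim) * (r / 4) ^ DIM('a) / (2 ^ bdim * (4 * 2 ^ DIM('a)) * r) = K * r ^ bdim"
    proof -
      have "(r / 4) ^ DIM('a) = (1/4) ^ DIM('a) * (r * r ^ bdim)"
      proof -
        have "r ^ DIM('a) = r * r ^ bdim" unfolding bdim_def by (metis DIM_positive Suc_pred' power_Suc)
        then show ?thesis by (simp add: power_divide)
      qed
      then show ?thesis using r by (simp add: K_def)
    qed
    ultimately show ?thesis by simp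
  qed
  then show ?thesis using K r0 by blast
qed

end

section \<open>The Laplace transform of the surface measure\<close>

text \<open>Termwise differentiation raises the degree of the polynomial factor without shrinking
  the disc of convergence.\<close>

lemma summable_poly_geometric:
  fixes x :: real
  assumes "\<bar>x\<bar> < 1" shows "summable (\<lambda>n. (real n + 1) ^ m * x ^ n)"
  using assms
proof (induction m arbitrary: x)
  case 0
  then show ?case by (simp add: summable_geometric)
next
  case (Suc m)
  have "summable (\<lambda>n. diffs (\<lambda>n. (real n + 1) ^ m) n * \<bar>x\<bar> ^ n)"
  proof (rule termdiff_converges[where K=1])
    show "norm \<bar>x\<bar> < 1" using Suc.prems by simp
    show "summable (\<lambda>n. (real n + 1) ^ m * y ^ n)" if "norm y < 1" for y :: real using Suc.IH[of y] that by simp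
  qed
  then show ?case
  proof (rule summable_comparison_test'[where N=0])
    fix n
    have "(real n + 1) ^ m \<le> (real (Suc n) + 1) ^ m" by (intro power_mono) auto
    then have "(real n + 1) ^ Suc m \<le> diffs (\<lambda>n. (real n + 1) ^ m) n"
      using mult_left_mono[of "(real n + 1) ^ m" "(real (Suc n) + 1) ^ m" "real n + 1"] by (simp add: diffs_def add.commute)
    then show "norm ((real n + 1) ^ Suc m * x ^ n) \<le> diffs (\<lambda>n. (real n + 1) ^ m) n * \<bar>x\<bar> ^ n"
      unfolding real_norm_def abs_mult power_abs by (intro mult_right_mono) auto
  qed
qed

lemma summable_gaussian_poly:
  fixes c :: real
  assumes "c > 0" shows "summable (\<lambda>n. exp (- c * (real n)\<^sup>2) * (real n + 1) ^ m)"
proof (rule summable_comparison_test'[where N=0])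
  show "summable (\<lambda>n. (real n + 1) ^ m * exp (- c) ^ n)"
    using assms by (intro summable_poly_geometric) simp
  fix n :: nat
  have "real n \<le> (real n)\<^sup>2" by (cases n) (auto simp: power2_eq_square)
  then have "c * real n \<le> c * (real n)\<^sup>2" using assms by (intro mult_left_mono) auto
  then have "exp (- c * (real n)\<^sup>2) \<le> exp (real n * (- c))" by (simp add: mult.commute)
  also have "\<dots> = exp (- c) ^ n" by (rule exp_of_nat_mult)
  finally have "exp (- c * (real n)\<^sup>2) * (real n + 1) ^ m \<le> exp (- c) ^ n * (real n + 1) ^ m" by (intro mult_right_mono) auto
  then show "norm (exp (- c * (real n)\<^sup>2) * (real n + 1) ^ m) \<le> (real n + 1) ^ m * exp (- c) ^ n"
    by (simp add: mult.commute)
qed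

context smooth_convex_body begin

abbreviation \<sigma> :: "'a measure" where "\<sigma> \<equiv> surface_measure \<Omega>"

lemma surface_measure_eq: "\<sigma> = restrict_space (hausdorff_measure bdim) (frontier \<Omega>)"
  by (simp add: surface_measure_def bdim_def)

lemma space_surface: "space \<sigma> = frontier \<Omega>" by (simp add: surface_measure_eq space_restrict_space)

lemma borel_surface: "f \<in> borel_measurable borel \<Longrightarrow> f \<in> borel_measurable \<sigma>"
  unfolding surface_measure_eq by (rule measurable_restrict_space1) (simp cong: measurable_cong_sets)

lemma emeasure_surface:
  assumes "bdim > 0" "A \<in> sets borel"
  shows "frontier \<Omega> \<inter> A \<in> sets \<sigma>" "emeasure \<sigma> (frontier \<Omega> \<inter> A) = hausdorff_outer bdim (frontier \<Omega> \<inter> A)"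
proof -
  have f: "frontier \<Omega> \<in> sets (borel :: 'a measure)" by simp
  show "frontier \<Omega> \<inter> A \<in> sets \<sigma>" using assms f unfolding surface_measure_eq sets_restrict_space by auto
  have "emeasure \<sigma> (frontier \<Omega> \<inter> A) = emeasure (hausdorff_measure bdim) (frontier \<Omega> \<inter> A)"
    unfolding surface_measure_eq by (rule emeasure_restrict_space) (use f in auto)
  also have "\<dots> = hausdorff_outer bdim (frontier \<Omega> \<inter> A)"
    by (rule emeasure_hausdorff_measure[OF assms(1)]) (use f assms in auto)
  finally show "emeasure \<sigma> (frontier \<Omega> \<inter> A) = hausdorff_outer bdim (frontier \<Omega> \<inter> A)" .
qed

text \<open>The squared norm of the exponential as a nonnegative integral, so that it can be
  estimated before it is known to be finite. For the weight at z it is taken at the conjugate vector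
  of z.\<close>

definition lap :: "'a \<Rightarrow> ennreal" where "lap w = (\<integral>\<^sup>+\<zeta>. ennreal (exp (2 * (\<zeta> \<bullet> w))) \<partial>\<sigma>)"

text \<open>Only the cap of radius \<rho> / sqrt |w| about \<open>pt w\<close> is kept; there the
  exponent is within 2 C \<rho>^2 of its maximum. The restriction to |w| at least 1 keeps this
  radius in the range of \<open>frontier_lower\<close>.\<close>

lemma lap_lower:
  assumes m: "bdim > 0"
  shows "\<exists>k>0. \<forall>w. 1 \<le> norm w \<longrightarrow> ennreal (k * (exp (2 * hsup w) * (1 / sqrt (norm w)) ^ bdim)) \<le> lap w"
proof -
  obtain K r0 where K: "K > 0" "r0 > 0" "\<And>p r. p \<in> frontier \<Omega> \<Longrightarrow> 0 < r \<Longrightarrow> r \<le> r0 \<Longrightarrow> ennreal (K * r ^ bdim) \<le> hausdorff_outer bdim (frontier \<Omega> \<inter> cball p r)"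
    using frontier_lower[OF m] by blast
  define \<rho> where "\<rho> = min r0 (e / 2)"
  have \<rho>: "\<rho> > 0" "\<rho> \<le> r0" "\<rho> < e" using K e by (auto simp: \<rho>_def)
  define k where "k = exp (- (2 * C * \<rho>\<^sup>2)) * (K * \<rho> ^ bdim)"
  have "ennreal (k * (exp (2 * hsup w) * (1 / sqrt (norm w)) ^ bdim)) \<le> lap w" if w: "1 \<le> norm w" for w
  proof -
    have w0: "w \<noteq> 0" using w by auto
    have sq: "sqrt (norm w) \<ge> 1" using w by simp
    define r where "r = \<rho> * (1 / sqrt (norm w))"
    have "\<rho> * (1 / sqrt (norm w)) \<le> \<rho> * 1" using \<rho> sq by (intro mult_left_mono) (auto simp: divide_le_eq)
    moreover have "0 < 1 / sqrt (norm w)" using w0 by simp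
    ultimately have r: "0 < r" "r \<le> \<rho>" using \<rho> by (auto simp: r_def)
    have wr: "norm w * r\<^sup>2 = \<rho>\<^sup>2" using w0 by (simp add: r_def power_divide power_mult_distrib)
    define A where "A = frontier \<Omega> \<inter> cball (pt w) r"
    define E where "E = exp (2 * hsup w - 2 * C * \<rho>\<^sup>2)"
    have AE: "E \<le> exp (2 * (\<zeta> \<bullet> w))" if z: "\<zeta> \<in> A" for \<zeta>
    proof -
      have d: "dist (pt w) \<zeta> \<le> r" using z by (simp add: A_def)
      have "hsup w - \<zeta> \<bullet> w \<le> C * norm w * (dist (pt w) \<zeta>)\<^sup>2"
        by (rule gap_upper[OF w0]) (use z d r \<rho> frontier_closure in \<open>auto simp: A_def\<close>)
      also have "\<dots> \<le> C * norm w * r\<^sup>2" using d C by (intro mult_left_mono power_mono) auto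
      also have "\<dots> = C * \<rho>\<^sup>2" using wr by simp
      finally show ?thesis by (simp add: E_def)
    qed
    have "ennreal (k * (exp (2 * hsup w) * (1 / sqrt (norm w)) ^ bdim)) = ennreal (E * (K * r ^ bdim))"
      by (simp add: k_def E_def r_def exp_diff exp_minus power_mult_distrib field_simps)
    also have "\<dots> = ennreal E * ennreal (K * r ^ bdim)" using K r by (intro ennreal_mult) (auto simp: E_def)
    also have "\<dots> \<le> ennreal E * emeasure \<sigma> A"
      unfolding A_def emeasure_surface(2)[OF m borel_closed[OF closed_cball]]
      using K(3)[OF pt_frontier[OF w0], of r] r \<rho> by (intro mult_left_mono) auto
    also have "\<dots> = (\<integral>\<^sup>+\<zeta>. ennreal E * indicator A \<zeta> \<partial>\<sigma>)"
      by (rule nn_integral_cmult_indicator[symmetric]) (simp add: A_def emeasure_surface(1)[OF m borel_closed[OF closed_cball]])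
    also have "\<dots> \<le> lap w" unfolding lap_def
      using AE by (intro nn_integral_mono) (auto simp: indicator_def intro!: ennreal_leI)
    finally show ?thesis .
  qed
  moreover have "k > 0" using K \<rho> by (simp add: k_def)
  ultimately show ?thesis by blast
qed

text \<open>Boundary points at distance about j / sqrt |w| from \<open>pt w\<close> lose at least 2
  c j^2 in the exponent, while their area is at most of order ((j+1) / sqrt
  |w|)^\<open>bdim\<close>; the sum over j is Gaussian. \<open>frontier_upper\<close> has no
  restriction on the radius, hence the validity for every nonzero w.\<close>

lemma lap_upper:
  assumes m: "bdim > 0"
  shows "\<exists>k>0. \<forall>w. w \<noteq> 0 \<longrightarrow> lap w \<le> ennreal (k * (exp (2 * hsup w) * (1 / sqrt (norm w)) ^ bdim))"
proof -
  obtain K where K: "K > 0" "\<And>p r. r > 0 \<Longrightarrow> hausdorff_outer bdim (frontier \<Omega> \<inter> cball p r) \<le> ennreal (K * r ^ bdim)"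
    using frontier_upper[OF m] by blast
  define b where "b j = exp (- (2 * c) * (real j)\<^sup>2) * (real j + 1) ^ bdim" for j
  have b: "summable b" unfolding b_def using c by (intro summable_gaussian_poly) auto
  have b0: "b j > 0" for j by (simp add: b_def add_nonneg_pos)
  have B: "suminf b > 0" by (rule suminf_pos[OF b b0])
  have "lap w \<le> ennreal (suminf b * K * (exp (2 * hsup w) * (1 / sqrt (norm w)) ^ bdim))" if w0: "w \<noteq> 0" for w
  proof -
    define s where "s = 1 / sqrt (norm w)"
    have s: "s > 0" using w0 by (simp add: s_def)
    have ws: "norm w * s\<^sup>2 = 1" using w0 by (simp add: s_def power_divide)
    \<comment> \<open>Full caps in place of shells: the overlap only enlarges the upper bound, and
      \<open>frontier_upper\<close> is stated for caps.\<close>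
    define A where "A j = frontier \<Omega> \<inter> cball (pt w) ((real j + 1) * s)" for j
    define a where "a j = exp (2 * hsup w) * exp (- (2 * c) * (real j)\<^sup>2)" for j
    have As: "A j \<in> sets \<sigma>" for j unfolding A_def by (rule emeasure_surface(1)[OF m]) simp
    have pw: "ennreal (exp (2 * (\<zeta> \<bullet> w))) \<le> (\<Sum>j. ennreal (a j) * indicator (A j) \<zeta>)" if z: "\<zeta> \<in> space \<sigma>" for \<zeta>
    proof -
      have zf: "\<zeta> \<in> frontier \<Omega>" using z by (simp add: space_surface)
      define d where "d = dist (pt w) \<zeta>"
      define j where "j = nat \<lfloor>d / s\<rfloor>"
      have "0 \<le> d / s" using s by (simp add: d_def)
      then have rj: "real j \<le> d / s" "d / s \<le> real j + 1" unfolding j_def by linarith+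
      have zA: "\<zeta> \<in> A j" using rj(2) s zf by (simp add: A_def d_def field_simps)
      have "real j * s \<le> d" using rj(1) s by (simp add: field_simps)
      then have "(real j * s)\<^sup>2 \<le> d\<^sup>2" using s by (intro power_mono) auto
      then have "norm w * (real j * s)\<^sup>2 \<le> norm w * d\<^sup>2" by (rule mult_left_mono) simp
      moreover have "norm w * (real j * s)\<^sup>2 = (real j)\<^sup>2" using ws by (simp add: power_mult_distrib)
      ultimately have "c * (real j)\<^sup>2 \<le> c * (norm w * d\<^sup>2)" using c by (intro mult_left_mono) auto
      also have "\<dots> \<le> hsup w - \<zeta> \<bullet> w" using gap_lower[OF w0, of \<zeta>] zf frontier_closure by (simp add: d_def mult_ac)
      finally have "exp (2 * (\<zeta> \<bullet> w)) \<le> a j" by (simp add: a_def flip: exp_add)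
      then have "ennreal (exp (2 * (\<zeta> \<bullet> w))) \<le> ennreal (a j) * indicator (A j) \<zeta>" using zA by (simp add: ennreal_leI)
      also have "\<dots> = (\<Sum>i\<in>{j}. ennreal (a i) * indicator (A i) \<zeta>)"
        by (simp only: sum.insert finite.emptyI empty_iff not_False_eq_True sum.empty add_0_right)
      also have "\<dots> \<le> (\<Sum>j. ennreal (a j) * indicator (A j) \<zeta>)" by (rule sum_le_suminf) auto
      finally show ?thesis .
    qed
    have "lap w \<le> (\<integral>\<^sup>+\<zeta>. (\<Sum>j. ennreal (a j) * indicator (A j) \<zeta>) \<partial>\<sigma>)"
      unfolding lap_def by (intro nn_integral_mono pw)
    also have "\<dots> = (\<Sum>j. (\<integral>\<^sup>+\<zeta>. ennreal (a j) * indicator (A j) \<zeta> \<partial>\<sigma>))"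
      using As by (intro nn_integral_suminf) auto
    also have "\<dots> = (\<Sum>j. ennreal (a j) * emeasure \<sigma> (A j))" using As by (simp add: nn_integral_cmult_indicator)
    also have "\<dots> \<le> (\<Sum>j. ennreal (exp (2 * hsup w) * K * s ^ bdim * b j))"
    proof (rule suminf_le)
      fix j
      have "emeasure \<sigma> (A j) \<le> ennreal (K * ((real j + 1) * s) ^ bdim)"
        unfolding A_def emeasure_surface(2)[OF m borel_closed[OF closed_cball]] using s by (intro K(2)) (simp add: add_nonneg_pos)
      then have "ennreal (a j) * emeasure \<sigma> (A j) \<le> ennreal (a j) * ennreal (K * ((real j + 1) * s) ^ bdim)"
        by (rule mult_left_mono) simp
      also have "\<dots> = ennreal (a j * (K * ((real j + 1) * s) ^ bdim))" using K s by (intro ennreal_mult[symmetric]) (auto simp: a_def)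
      also have "a j * (K * ((real j + 1) * s) ^ bdim) = exp (2 * hsup w) * K * s ^ bdim * b j"
        by (simp add: a_def b_def power_mult_distrib)
      finally show "ennreal (a j) * emeasure \<sigma> (A j) \<le> ennreal (exp (2 * hsup w) * K * s ^ bdim * b j)" .
    qed auto
    also have "\<dots> = ennreal (exp (2 * hsup w) * K * s ^ bdim * suminf b)"
    proof (rule suminf_ennreal_eq)
      show "(\<lambda>j. exp (2 * hsup w) * K * s ^ bdim * b j) sums (exp (2 * hsup w) * K * s ^ bdim * suminf b)"
        by (intro sums_mult summable_sums b)
      show "0 \<le> exp (2 * hsup w) * K * s ^ bdim * b j" for j using K s b0[of j] by simp
    qed
    finally show ?thesis by (simp add: s_def mult_ac)
  qed
  moreover have "suminf b * K > 0" using B K by simp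
  ultimately show ?thesis by blast
qed

text \<open>For |w| at most 1 the integrand lies between positive constants, so the transform is
  comparable to the total area of the boundary, which is finite and positive.\<close>

lemma lap_near_zero:
  assumes m: "bdim > 0"
  shows "\<exists>k1>0. \<exists>k2>0. \<forall>w. norm w \<le> 1 \<longrightarrow> ennreal k1 \<le> lap w \<and> lap w \<le> ennreal k2"
proof -
  obtain K r0 where K: "K > 0" "r0 > 0" "\<And>p r. p \<in> frontier \<Omega> \<Longrightarrow> 0 < r \<Longrightarrow> r \<le> r0 \<Longrightarrow> ennreal (K * r ^ bdim) \<le> hausdorff_outer bdim (frontier \<Omega> \<inter> cball p r)"
    using frontier_lower[OF m] by blast
  obtain K' where K': "K' > 0" "\<And>p r. r > 0 \<Longrightarrow> hausdorff_outer bdim (frontier \<Omega> \<inter> cball p r) \<le> ennreal (K' * r ^ bdim)"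
    using frontier_upper[OF m] by blast
  obtain R where R: "R > 0" "\<And>x. x \<in> closure \<Omega> \<Longrightarrow> norm x \<le> R"
    using bounded_closure[OF bd] bounded_pos by blast
  obtain b :: 'a where "b \<in> Basis" using nonempty_Basis by blast
  then have p: "pt b \<in> frontier \<Omega>" by (intro pt_frontier) auto
  have frs: "frontier \<Omega> \<in> sets \<sigma>" using emeasure_surface(1)[OF m, of UNIV] by simp
  have fr: "emeasure \<sigma> (frontier \<Omega>) = hausdorff_outer bdim (frontier \<Omega>)" using emeasure_surface(2)[OF m, of UNIV] by simp
  have low: "ennreal (K * r0 ^ bdim) \<le> emeasure \<sigma> (frontier \<Omega>)"
    unfolding fr using K(3)[OF p K(2) order_refl] by (rule order_trans) (auto intro: hausdorff_outer_mono)
  have up: "emeasure \<sigma> (frontier \<Omega>) \<le> ennreal (K' * R ^ bdim)"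
  proof -
    have "frontier \<Omega> \<inter> cball 0 R = frontier \<Omega>" using R frontier_closure by (auto simp: dist_norm)
    then show ?thesis unfolding fr using K'(2)[OF R(1), of 0] by simp
  qed
  have "ennreal (exp (- (2 * R)) * (K * r0 ^ bdim)) \<le> lap w \<and> lap w \<le> ennreal (exp (2 * R) * (K' * R ^ bdim))" if w: "norm w \<le> 1" for w
  proof -
    have zw: "\<bar>\<zeta> \<bullet> w\<bar> \<le> R" if "\<zeta> \<in> frontier \<Omega>" for \<zeta>
    proof -
      have "\<bar>\<zeta> \<bullet> w\<bar> \<le> norm \<zeta> * norm w" by (rule Cauchy_Schwarz_ineq2)
      also have "\<dots> \<le> R * 1" using R w that frontier_closure by (intro mult_mono) auto
      finally show ?thesis by simp
    qed
    have "ennreal (exp (- (2 * R)) * (K * r0 ^ bdim)) = ennreal (exp (- (2 * R))) * ennreal (K * r0 ^ bdim)"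
      using K by (intro ennreal_mult) auto
    also have "\<dots> \<le> ennreal (exp (- (2 * R))) * emeasure \<sigma> (frontier \<Omega>)" by (intro mult_left_mono low) auto
    also have "\<dots> = (\<integral>\<^sup>+\<zeta>. ennreal (exp (- (2 * R))) * indicator (frontier \<Omega>) \<zeta> \<partial>\<sigma>)"
      by (rule nn_integral_cmult_indicator[symmetric, OF frs])
    also have "\<dots> \<le> lap w" unfolding lap_def
      using zw by (intro nn_integral_mono) (force simp: indicator_def abs_le_iff intro!: ennreal_leI)
    finally have 1: "ennreal (exp (- (2 * R)) * (K * r0 ^ bdim)) \<le> lap w" .
    have "lap w \<le> (\<integral>\<^sup>+\<zeta>. ennreal (exp (2 * R)) * indicator (frontier \<Omega>) \<zeta> \<partial>\<sigma>)" unfolding lap_def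
      using zw by (intro nn_integral_mono) (auto simp: space_surface abs_le_iff intro!: ennreal_leI)
    also have "\<dots> = ennreal (exp (2 * R)) * emeasure \<sigma> (frontier \<Omega>)"
      by (rule nn_integral_cmult_indicator[OF frs])
    also have "\<dots> \<le> ennreal (exp (2 * R)) * ennreal (K' * R ^ bdim)" by (intro mult_left_mono up) auto
    also have "\<dots> = ennreal (exp (2 * R) * (K' * R ^ bdim))" using K' R by (intro ennreal_mult[symmetric]) auto
    finally show ?thesis using 1 by blast
  qed
  moreover have "exp (- (2 * R)) * (K * r0 ^ bdim) > 0" "exp (2 * R) * (K' * R ^ bdim) > 0" using K K' R by auto
  ultimately show ?thesis by blast
qed

lemma finite_measure_surface: assumes "bdim > 0" shows "finite_measure \<sigma>"
proof (rule finite_measureI)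
  obtain k where "lap 0 \<le> ennreal k" using lap_near_zero[OF assms] by (metis norm_zero zero_le_one)
  moreover have "lap 0 = emeasure \<sigma> (space \<sigma>)" by (simp add: lap_def)
  ultimately show "emeasure \<sigma> (space \<sigma>) \<noteq> \<infinity>" by (simp add: top_unique) (metis ennreal_neq_top top_unique)
qed

end

section \<open>Test functions\<close>

text \<open>The compact set of \<open>test_functions\<close> replaced by a ball, so that radii can
  be tracked through products and convolutions.\<close>

definition supported :: "real \<Rightarrow> ('a::real_normed_vector \<Rightarrow> complex) \<Rightarrow> bool" where
  "supported R f \<longleftrightarrow> continuous_on UNIV f \<and> (\<forall>x. norm x > R \<longrightarrow> f x = 0)"

lemma test_functions_supported:
  fixes f :: "'a::euclidean_space \<Rightarrow> complex"
  shows "f \<in> test_functions \<longleftrightarrow> (\<exists>R>0. supported R f)"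
proof
  assume "f \<in> test_functions"
  then obtain K where K: "continuous_on UNIV f" "compact K" "\<And>z. z \<notin> K \<Longrightarrow> f z = 0" by (auto simp: test_functions_def)
  obtain R where R: "R > 0" "\<And>x. x \<in> K \<Longrightarrow> norm x \<le> R" using compact_imp_bounded[OF K(2)] bounded_pos by blast
  have "f x = 0" if "norm x > R" for x using K(3)[of x] R(2)[of x] that by (meson not_le)
  then show "\<exists>R>0. supported R f" using K R by (auto simp: supported_def)
next
  assume "\<exists>R>0. supported R f"
  then obtain R where R: "R > 0" "supported R f" by blast
  then have "continuous_on UNIV f \<and> compact (cball (0::'a) R) \<and> (\<forall>z. z \<notin> cball 0 R \<longrightarrow> f z = 0)"
    by (auto simp: supported_def dist_norm)
  then show "f \<in> test_functions" unfolding test_functions_def by blast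
qed

lemma supported_mono: "supported R f \<Longrightarrow> R \<le> R' \<Longrightarrow> supported R' f"
  by (auto simp: supported_def)

lemma supported_integrable:
  fixes f :: "'a::euclidean_space \<Rightarrow> complex"
  assumes "supported R f" shows "integrable lborel f"
proof -
  have "integrable lborel (\<lambda>x. indicator (cball 0 R) x *\<^sub>R f x)"
    using assms by (intro borel_integrable_compact) (auto simp: supported_def intro: continuous_on_subset)
  also have "(\<lambda>x. indicator (cball 0 R) x *\<^sub>R f x) = f"
    using assms by (auto simp: supported_def fun_eq_iff indicator_def dist_norm)
  finally show ?thesis .
qed

lemma supported_measurable:
  fixes f :: "'a::euclidean_space \<Rightarrow> complex"
  shows "supported R f \<Longrightarrow> f \<in> borel_measurable borel"
  unfolding supported_def by (auto intro: borel_measurable_continuous_onI)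

lemma supported_bounded:
  fixes f :: "'a::euclidean_space \<Rightarrow> complex"
  assumes "supported R f" shows "\<exists>B>0. \<forall>x. norm (f x) \<le> B"
proof -
  have "compact (f ` cball 0 R)" using assms by (intro compact_continuous_image) (auto simp: supported_def intro: continuous_on_subset)
  then obtain B where B: "B > 0" "\<And>y. y \<in> f ` cball 0 R \<Longrightarrow> norm y \<le> B" using compact_imp_bounded bounded_pos by metis
  have "norm (f x) \<le> B" for x
  proof (cases "norm x \<le> R")
    case True then show ?thesis using B(2)[of "f x"] by (auto simp: dist_norm)
  next
    case False then show ?thesis using assms B(1) by (simp add: supported_def)
  qed
  then show ?thesis using B(1) by blast
qed

lemma supported_uniform:
  fixes f :: "'a::euclidean_space \<Rightarrow> complex"
  assumes f: "supported R f" and e: "e > 0"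
  shows "\<exists>d>0. \<forall>x y. norm (x - y) < d \<longrightarrow> norm (f x - f y) < e"
proof -
  have "uniformly_continuous_on (cball 0 (R + 1)) f"
    using f by (intro compact_uniformly_continuous) (auto simp: supported_def intro: continuous_on_subset)
  then obtain d where d: "d > 0" "\<And>x y. x \<in> cball 0 (R + 1) \<Longrightarrow> y \<in> cball 0 (R + 1) \<Longrightarrow> dist y x < d \<Longrightarrow> dist (f y) (f x) < e"
    using e unfolding uniformly_continuous_on_def by metis
  have "norm (f x - f y) < e" if xy: "norm (x - y) < min d 1" for x y
  proof (cases "norm x \<le> R + 1 \<and> norm y \<le> R + 1")
    case True
    then show ?thesis using d(2)[of y x] xy by (auto simp: dist_norm)
  next
    case False
    have "norm x > R" "norm y > R"
      using False xy norm_triangle_sub[of x y] norm_triangle_sub[of y x] by (auto simp: norm_minus_commute)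
    then show ?thesis using f e by (simp add: supported_def)
  qed
  then show ?thesis using d(1) by (intro exI[of _ "min d 1"]) auto
qed

text \<open>The direction comes before the point, so that \<open>ddir f v\<close> is again a
  function to which the same notions apply.\<close>

definition ddir :: "('a::real_normed_vector \<Rightarrow> complex) \<Rightarrow> 'a \<Rightarrow> 'a \<Rightarrow> complex" where
  "ddir f v x = frechet_derivative f (at x) v"

text \<open>One derivative only: the products with the first derivatives of the potential and with
  the cutoffs below are no smoother.\<close>

definition supportedC1 :: "real \<Rightarrow> ('a::real_normed_vector \<Rightarrow> complex) \<Rightarrow> bool" where
  "supportedC1 R f \<longleftrightarrow> supported R f \<and> (\<forall>x. f differentiable (at x)) \<and> (\<forall>v. supported R (ddir f v))"

lemma ddir_works: "f differentiable (at x) \<Longrightarrow> (f has_derivative (\<lambda>v. ddir f v x)) (at x)"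
  unfolding ddir_def using frechet_derivative_works by blast

lemma ddir_eqI: "(f has_derivative f') (at x) \<Longrightarrow> ddir f v x = f' v"
  unfolding ddir_def by (simp add: frechet_derivative_eqI)

lemma ddir_linear: "f differentiable (at x) \<Longrightarrow> linear (\<lambda>v. ddir f v x)"
  unfolding ddir_def by (rule linear_frechet_derivative)

lemma ddir_outside:
  assumes "supported R f" "norm x > R"
  shows "(f has_derivative (\<lambda>v. 0)) (at x)"
proof (rule has_derivative_transform_within_open[where f="\<lambda>_. 0" and s="{x. norm x > R}"])
  show "open {x :: 'a. norm x > R}" by (intro open_Collect_less continuous_intros)
qed (use assms in \<open>auto simp: supported_def\<close>)

lemma supportedC1I:
  assumes "supported R f" "\<And>x. (f has_derivative f' x) (at x)" "\<And>v. continuous_on UNIV (\<lambda>x. f' x v)"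
  shows "supportedC1 R f" "\<And>v. ddir f v = (\<lambda>x. f' x v)"
proof -
  show e: "ddir f v = (\<lambda>x. f' x v)" for v using ddir_eqI[OF assms(2)] by auto
  have "supported R (ddir f v)" for v
    unfolding supported_def using assms(3) ddir_outside[OF assms(1)] ddir_eqI[of f "\<lambda>_. 0"] e by auto
  then show "supportedC1 R f" using assms by (auto simp: supportedC1_def differentiable_def)
qed

lemma supportedC1_der: "supportedC1 R f \<Longrightarrow> (f has_derivative (\<lambda>v. ddir f v x)) (at x)"
  by (simp add: supportedC1_def ddir_works)

lemma ddir_basis_expand:
  fixes f :: "'a::euclidean_space \<Rightarrow> complex"
  assumes "f differentiable (at x)"
  shows "ddir f v x = (\<Sum>b\<in>Basis. (v \<bullet> b) *\<^sub>R ddir f b x)"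
proof -
  have "ddir f v x = ddir f (\<Sum>b\<in>Basis. (v \<bullet> b) *\<^sub>R b) x" by (simp add: euclidean_representation)
  also have "\<dots> = (\<Sum>b\<in>Basis. (v \<bullet> b) *\<^sub>R ddir f b x)"
    by (simp add: linear_sum[OF ddir_linear[OF assms]] linear_scale[OF ddir_linear[OF assms]])
  finally show ?thesis .
qed

text \<open>Compact support makes the derivative uniformly continuous, and the mean value inequality
  for f minus its linearisation at x then gives an expansion uniform in x. This permits integrating
  the remainder.\<close>

lemma supportedC1_uniform_diff:
  fixes f :: "'a::euclidean_space \<Rightarrow> complex"
  assumes f: "supportedC1 R f" and e: "e > 0"
  shows "\<exists>d>0. \<forall>x h. norm h < d \<longrightarrow> norm (f (x + h) - f x - ddir f h x) \<le> e * norm h"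
proof -
  define n where "n = real DIM('a)"
  have n: "n > 0" by (simp add: n_def)
  have "\<forall>b\<in>Basis. \<exists>d>0. \<forall>x y. norm (x - y) < d \<longrightarrow> norm (ddir f b x - ddir f b y) < e / n"
    using f e n by (auto simp: supportedC1_def intro!: supported_uniform)
  then obtain d where d: "\<And>b. b \<in> Basis \<Longrightarrow> d b > 0"
    "\<And>b x y. b \<in> Basis \<Longrightarrow> norm (x - y) < d b \<Longrightarrow> norm (ddir f b x - ddir f b y) < e / n"
    by metis
  define D where "D = Min (d ` Basis)"
  have D: "D > 0" "\<And>b. b \<in> Basis \<Longrightarrow> D \<le> d b" using d by (auto simp: D_def)
  have fd: "f differentiable (at x)" for x using f by (simp add: supportedC1_def)
  have main: "norm (f (x + h) - f x - ddir f h x) \<le> e * norm h" if h: "norm h < D" for x h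
  proof -
    define g where "g z = f z - ddir f z x" for z
    have gd: "(g has_derivative (\<lambda>v. ddir f v z - ddir f v x)) (at z within ball x D)" for z
      unfolding g_def
      by (intro has_derivative_diff has_derivative_at_withinI[OF ddir_works[OF fd]]
           linear_imp_has_derivative ddir_linear fd)
    have "norm (g (x + h) - g x) \<le> e * norm (x + h - x)"
    proof (rule differentiable_bound[OF convex_ball gd])
      fix z assume z: "z \<in> ball x D"
      show "onorm (\<lambda>v. ddir f v z - ddir f v x) \<le> e"
      proof (rule onorm_bound)
        fix v
        have "ddir f v z - ddir f v x = (\<Sum>b\<in>Basis. (v \<bullet> b) *\<^sub>R (ddir f b z - ddir f b x))"
          by (simp add: ddir_basis_expand[OF fd, of v] sum_subtractf scaleR_diff_right)
        also have "norm \<dots> \<le> (\<Sum>b\<in>(Basis::'a set). norm v * (e / n))"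
        proof (rule sum_norm_le)
          fix b :: 'a assume b: "b \<in> Basis"
          have "norm (ddir f b z - ddir f b x) \<le> e / n"
            using d(2)[OF b, of z x] D(2)[OF b] z by (simp add: dist_norm norm_minus_commute)
          then show "norm ((v \<bullet> b) *\<^sub>R (ddir f b z - ddir f b x)) \<le> norm v * (e / n)"
            unfolding norm_scaleR using Basis_le_norm[OF b, of v] by (intro mult_mono) auto
        qed
        also have "\<dots> = e * norm v" using n by (simp add: n_def)
        finally show "norm (ddir f v z - ddir f v x) \<le> e * norm v" .
      qed (use e in simp)
    qed (use D h in \<open>auto simp: dist_norm\<close>)
    moreover have "ddir f (x + h) x = ddir f x x + ddir f h x" using linear_add[OF ddir_linear[OF fd]] .
    ultimately show ?thesis by (simp add: g_def algebra_simps)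
  qed
  then show ?thesis using D(1) by blast
qed

section \<open>Convolution and integrals of derivatives\<close>

definition conv :: "('a::euclidean_space \<Rightarrow> complex) \<Rightarrow> ('a \<Rightarrow> complex) \<Rightarrow> 'a \<Rightarrow> complex" where
  "conv f g x = (LINT y|lborel. f y * g (x - y))"

lemma lborel_reflect: "distr lborel borel (\<lambda>y. x - y) = (lborel :: 'a::euclidean_space measure)"
  using lborel_affine[of "-1" x] by (simp add: density_1)

lemma lborel_integral_reflect:
  fixes F :: "'a::euclidean_space \<Rightarrow> complex"
  assumes "F \<in> borel_measurable borel"
  shows "(LINT y|lborel. F (x - y)) = (LINT y|lborel. F y)"
proof -
  have "(LINT y|lborel. F y) = (LINT y|distr lborel borel (\<lambda>y. x - y). F y)" by (simp add: lborel_reflect)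
  also have "\<dots> = (LINT y|lborel. F (x - y))" by (rule integral_distr) (use assms in auto)
  finally show ?thesis by simp
qed

lemma supported_mult_shift:
  assumes "supported R f" "supported R' g"
  shows "supported R (\<lambda>y. f y * g (x - y))"
proof -
  have "continuous_on UNIV (\<lambda>y. g (x - y))"
    by (rule continuous_on_compose2[where t=UNIV and g=g]) (use assms in \<open>auto simp: supported_def intro!: continuous_intros\<close>)
  then show ?thesis using assms by (auto simp: supported_def intro!: continuous_intros)
qed

lemma conv_commute:
  assumes "supported R f" "supported R' g"
  shows "conv f g = conv g f"
proof
  fix x
  have m: "(\<lambda>y. f y * g (x - y)) \<in> borel_measurable borel"
    using supported_measurable[OF supported_mult_shift[OF assms]] .
  show "conv f g x = conv g f x"
    unfolding conv_def using lborel_integral_reflect[OF m, of x] by (simp add: mult.commute)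
qed

lemma conv_outside:
  assumes "supported R f" "supported R' g" "norm x > R + R'"
  shows "conv f g x = 0"
proof -
  have z: "f y * g (x - y) = 0" for y
  proof (cases "norm y > R")
    case False
    then have "norm (x - y) > R'" using assms(3) norm_triangle_sub[of x y] by simp
    then show ?thesis using assms(2) by (simp add: supported_def)
  qed (use assms(1) in \<open>simp add: supported_def\<close>)
  show ?thesis unfolding conv_def z by simp
qed

lemma conv_supported:
  assumes f: "supported R f" and g: "supported R' g"
  shows "supported (R + R') (conv f g)"
proof -
  have int: "integrable lborel (\<lambda>y. f y * g (x - y))" for x
    using supported_integrable[OF supported_mult_shift[OF f g]] .
  define I where "I = (LINT y|lborel. norm (f y))"
  have I: "0 \<le> I" by (simp add: I_def)
  have "isCont (conv f g) x" for x
    unfolding continuous_at_eps_delta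
  proof (intro allI impI)
    fix e :: real assume e: "e > 0"
    obtain d where d: "d > 0" "\<And>x y. norm (x - y) < d \<Longrightarrow> norm (g x - g y) < e / (I + 1)"
      using supported_uniform[OF g, of "e / (I + 1)"] e I by auto
    have "dist (conv f g x') (conv f g x) < e" if x': "dist x' x < d" for x'
    proof -
      have "norm (conv f g x' - conv f g x) = norm (LINT y|lborel. f y * (g (x' - y) - g (x - y)))"
        unfolding conv_def by (subst Bochner_Integration.integral_diff[symmetric, OF int int]) (simp add: right_diff_distrib)
      also have "\<dots> \<le> (LINT y|lborel. norm (f y * (g (x' - y) - g (x - y))))" by (rule integral_norm_bound)
      also have "\<dots> \<le> (LINT y|lborel. norm (f y) * (e / (I + 1)))"
      proof (rule integral_mono)
        show "integrable lborel (\<lambda>y. norm (f y * (g (x' - y) - g (x - y))))"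
          using Bochner_Integration.integrable_diff[OF int int, of x' x] by (intro integrable_norm) (simp add: right_diff_distrib)
        show "integrable lborel (\<lambda>y. norm (f y) * (e / (I + 1)))" using supported_integrable[OF f] by simp
        show "norm (f y * (g (x' - y) - g (x - y))) \<le> norm (f y) * (e / (I + 1))" for y
          unfolding norm_mult using d(2)[of "x' - y" "x - y"] x' by (intro mult_left_mono) (auto simp: dist_norm)
      qed
      also have "\<dots> = I * (e / (I + 1))" by (simp add: I_def)
      also have "\<dots> < e" using e I by (simp add: field_simps)
      finally show ?thesis by (simp add: dist_norm)
    qed
    then show "\<exists>d>0. \<forall>x'. dist x' x < d \<longrightarrow> dist (conv f g x') (conv f g x) < e" using d(1) by blast
  qed
  then show ?thesis unfolding supported_def using conv_outside[OF f g] by (simp add: continuous_at_imp_continuous_on)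
qed

text \<open>The remainder of g is small uniformly in the integration variable, hence also after
  integration against f; only the second factor has to be differentiable.\<close>

lemma conv_has_derivative:
  assumes f: "supported R f" and g: "supportedC1 R' g"
  shows "(conv f g has_derivative (\<lambda>v. conv f (ddir g v) x)) (at x)"
proof -
  have gs: "supported R' g" and gd: "\<And>v. supported R' (ddir g v)" and dif: "\<And>x. g differentiable (at x)" using g by (auto simp: supportedC1_def)
  have int: "integrable lborel (\<lambda>y. f y * g (x - y))" for x using supported_integrable[OF supported_mult_shift[OF f gs]] .
  have intd: "integrable lborel (\<lambda>y. f y * ddir g v (x - y))" for x v using supported_integrable[OF supported_mult_shift[OF f gd]] .
  define I where "I = (LINT y|lborel. norm (f y))"
  have I: "0 \<le> I" by (simp add: I_def)
  have lin: "linear (\<lambda>v. conv f (ddir g v) x)"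
  proof (rule linearI)
    show "conv f (ddir g (v + w)) x = conv f (ddir g v) x + conv f (ddir g w) x" for v w
      unfolding conv_def
      by (subst Bochner_Integration.integral_add[symmetric, OF intd intd]) (simp add: linear_add[OF ddir_linear[OF dif]] distrib_left)
    show "conv f (ddir g (c *\<^sub>R v)) x = c *\<^sub>R conv f (ddir g v) x" for c v
      unfolding conv_def
      by (subst integral_scaleR_right[symmetric]) (simp add: linear_scale[OF ddir_linear[OF dif]])
  qed
  show ?thesis unfolding has_derivative_at_alt
  proof (intro conjI allI impI)
    show "bounded_linear (\<lambda>v. conv f (ddir g v) x)" using lin by (simp add: linear_linear)
    fix e :: real assume e: "e > 0"
    obtain d where d: "d > 0" "\<And>x h. norm h < d \<Longrightarrow> norm (g (x + h) - g x - ddir g h x) \<le> e / (I + 1) * norm h"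
      using supportedC1_uniform_diff[OF g, of "e / (I + 1)"] e I by auto
    have "norm (conv f g x' - conv f g x - conv f (ddir g (x' - x)) x) \<le> e * norm (x' - x)" if x': "norm (x' - x) < d" for x'
    proof -
      define h where "h = x' - x"
      define E where "E y = g (x' - y) - g (x - y) - ddir g h (x - y)" for y
      have E: "norm (E y) \<le> e / (I + 1) * norm h" for y
        using d(2)[of h "x - y"] x' by (simp add: E_def h_def algebra_simps)
      have fE: "f y * E y = f y * g (x' - y) - f y * g (x - y) - f y * ddir g h (x - y)" for y by (simp add: E_def right_diff_distrib)
      have iE: "integrable lborel (\<lambda>y. f y * E y)" unfolding fE by (intro Bochner_Integration.integrable_diff int intd)
      have "conv f g x' - conv f g x - conv f (ddir g h) x = (LINT y|lborel. f y * E y)"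
        unfolding conv_def fE by (simp add: Bochner_Integration.integral_diff int intd)
      also have "norm \<dots> \<le> (LINT y|lborel. norm (f y * E y))" by (rule integral_norm_bound)
      also have "\<dots> \<le> (LINT y|lborel. norm (f y) * (e / (I + 1) * norm h))"
      proof (rule integral_mono)
        show "integrable lborel (\<lambda>y. norm (f y * E y))" using iE by (rule integrable_norm)
        show "integrable lborel (\<lambda>y. norm (f y) * (e / (I + 1) * norm h))" using supported_integrable[OF f] by simp
        show "norm (f y * E y) \<le> norm (f y) * (e / (I + 1) * norm h)" for y
          unfolding norm_mult[of "f y"] using E by (intro mult_left_mono) auto
      qed
      also have "\<dots> = I * (e / (I + 1) * norm h)" by (simp add: I_def)
      also have "\<dots> \<le> e * norm h"
      proof -
        have "I * (e / (I + 1)) \<le> e" using e I by (simp add: field_simps)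
        then show ?thesis using mult_right_mono[of "I * (e / (I + 1))" e "norm h"] by simp
      qed
      finally show ?thesis by (simp add: h_def)
    qed
    then show "\<exists>d>0. \<forall>y. norm (y - x) < d \<longrightarrow> norm (conv f g y - conv f g x - conv f (ddir g (y - x)) x) \<le> e * norm (y - x)"
      using d(1) by blast
  qed
qed

lemma conv_C1:
  assumes f: "supported R f" and g: "supportedC1 R' g"
  shows "supportedC1 (R + R') (conv f g)" "\<And>v. ddir (conv f g) v = conv f (ddir g v)"
proof -
  have gs: "supported R' g" and gd: "\<And>v. supported R' (ddir g v)" using g by (auto simp: supportedC1_def)
  have c: "continuous_on UNIV (\<lambda>x. conv f (ddir g v) x)" for v
    using conv_supported[OF f gd] by (simp add: supported_def)
  note * = supportedC1I[OF conv_supported[OF f gs] conv_has_derivative[OF f g] c]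
  show "supportedC1 (R + R') (conv f g)" by (rule *(1))
  show "ddir (conv f g) v = conv f (ddir g v)" for v using *(2) by auto
qed

lemma emeasure_cball_less_top: "emeasure lborel (cball (c::'a::euclidean_space) r) < top"
  using emeasure_bounded_finite[of "cball c r"] by (simp add: infinity_ennreal_def)

text \<open>Translation invariance: a difference quotient of f has integral 0, and it approximates
  the derivative uniformly on a fixed ball. The tolerance e is chosen so that a nonzero integral J
  would be at most half its own size. This is the source of all integrations by parts below.\<close>

lemma integral_ddir_zero:
  fixes f :: "'a::euclidean_space \<Rightarrow> complex"
  assumes f: "supportedC1 R f" shows "(LINT x|lborel. ddir f v x) = 0"
proof (rule ccontr)
  define J where "J = (LINT x|lborel. ddir f v x)"
  assume "(LINT x|lborel. ddir f v x) \<noteq> 0"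
  then have J: "norm J > 0" by (simp add: J_def)
  have fs: "supported R f" and fd: "supported R (ddir f v)" using f by (auto simp: supportedC1_def)
  have lin: "linear (\<lambda>v. ddir f v x)" for x using f by (intro ddir_linear) (simp add: supportedC1_def)
  \<comment> \<open>As t is at most 1, beyond this radius x and x + t v both lie outside the
    support, so the volume in the error bound does not depend on t.\<close>
  define R' where "R' = \<bar>R\<bar> + norm v + 1"
  define M where "M = measure lborel (cball (0::'a) R')"
  have M: "0 \<le> M" by (simp add: M_def)
  define e where "e = norm J / (2 * (norm v + 1) * (M + 1))"
  have e: "e > 0" using J M by (auto simp: e_def intro!: divide_pos_pos mult_pos_pos add_nonneg_pos)
  obtain d where d: "d > 0" "\<And>x h. norm h < d \<Longrightarrow> norm (f (x + h) - f x - ddir f h x) \<le> e * norm h"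
    using supportedC1_uniform_diff[OF f e] by blast
  define t where "t = min 1 (d / (2 * (norm v + 1)))"
  have nv: "norm v + 1 > 0" by (simp add: add_nonneg_pos)
  have t: "0 < t" "t \<le> 1" using d nv by (auto simp: t_def)
  have tv: "norm (t *\<^sub>R v) < d"
  proof -
    have "t * norm v \<le> t * (norm v + 1)" using t by simp
    also have "\<dots> \<le> d / (2 * (norm v + 1)) * (norm v + 1)" using nv by (intro mult_right_mono) (auto simp: t_def)
    also have "\<dots> = d / 2" using nv by (simp add: field_simps)
    finally show ?thesis using t d by simp
  qed
  define E where "E x = f (x + t *\<^sub>R v) - f x - t *\<^sub>R ddir f v x" for x
  have E: "norm (E x) \<le> e * (t * norm v)" for x
    using d(2)[OF tv, of x] t by (simp add: E_def linear_scale[OF lin])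
  have E0: "E x = 0" if "norm x > R'" for x
  proof -
    have "norm (x + t *\<^sub>R v) > R"
    proof -
      have "norm (t *\<^sub>R v) \<le> norm v" using t by (simp add: mult_left_le_one_le)
      then show ?thesis using that norm_triangle_ineq4[of "x + t *\<^sub>R v" "t *\<^sub>R v"] by (simp add: R'_def)
    qed
    moreover have "norm x > R" using that norm_ge_zero[of v] unfolding R'_def by linarith
    ultimately show ?thesis using fs fd by (simp add: E_def supported_def)
  qed
  have mf: "f \<in> borel_measurable borel" by (rule supported_measurable[OF fs])
  have d1: "distr lborel borel (\<lambda>x. x + t *\<^sub>R v) = (lborel :: 'a measure)"
    using lborel_distr_plus[of "t *\<^sub>R v"] by (simp add: add.commute[of _ "t *\<^sub>R v"])
  have i0: "integrable lborel f" "integrable lborel (ddir f v)" using supported_integrable fs fd by blast+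
  have i1: "integrable lborel (\<lambda>x. f (x + t *\<^sub>R v))"
    using integrable_distr[of "\<lambda>x. x + t *\<^sub>R v" lborel borel f] i0(1) by (simp add: d1)
  have "(LINT x|lborel. f (x + t *\<^sub>R v)) = (LINT x|distr lborel borel (\<lambda>x. x + t *\<^sub>R v). f x)"
    by (rule integral_distr[symmetric]) (use mf in auto)
  then have eq: "(LINT x|lborel. f (x + t *\<^sub>R v)) = (LINT x|lborel. f x)" by (simp add: d1)
  have iE: "integrable lborel E" unfolding E_def by (intro Bochner_Integration.integrable_diff i0 i1 integrable_scaleR_right)
  have "(LINT x|lborel. E x) = - (t *\<^sub>R J)"
    unfolding E_def J_def using i0 i1 by (simp add: Bochner_Integration.integral_diff eq)
  then have "t * norm J = norm (LINT x|lborel. E x)" using t by simp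
  also have "\<dots> \<le> (LINT x|lborel. norm (E x))" by (rule integral_norm_bound)
  also have "\<dots> \<le> (LINT x|lborel. e * (t * norm v) * indicator (cball (0::'a) R') x)"
  proof (rule integral_mono)
    show "integrable lborel (\<lambda>x. norm (E x))" using iE by (rule integrable_norm)
    show "integrable lborel (\<lambda>x. e * (t * norm v) * indicator (cball 0 R') x :: real)"
      by (intro integrable_mult_right integrable_real_indicator) (auto simp: emeasure_cball_less_top)
    show "norm (E x) \<le> e * (t * norm v) * indicator (cball 0 R') x" for x
      using E[of x] E0[of x] by (auto simp: indicator_def dist_norm)
  qed
  also have "\<dots> = e * (t * norm v) * M" by (simp add: M_def)
  finally have "t * norm J \<le> t * (e * norm v * M)" by (simp add: mult_ac)
  then have "norm J \<le> e * norm v * M" using t by simp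
  also have "\<dots> \<le> e * (norm v + 1) * (M + 1)" using e M by (intro mult_mono) auto
  also have "\<dots> = norm J / 2"
  proof -
    define q where "q = (norm v + 1) * (M + 1)"
    have "q > 0" using nv M by (simp add: q_def)
    moreover have "e = norm J / (2 * q)" "e * (norm v + 1) * (M + 1) = e * q"
      by (simp_all add: e_def q_def mult.assoc)
    ultimately show ?thesis by simp
  qed
  finally show False using J by simp
qed

section \<open>Smooth bumps and mollification\<close>

definition flat :: "nat \<Rightarrow> real \<Rightarrow> real" where
  "flat j t = (if t > 0 then exp (- 1 / t) / t ^ j else 0)"

lemma flat_small: "((\<lambda>t. flat j t / t) \<longlongrightarrow> 0) (at 0)"
proof -
  have "((\<lambda>t. flat j t / t) \<longlongrightarrow> 0) (at_right 0)"
  proof -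
    have "((\<lambda>t. inverse t ^ Suc j / exp (inverse t)) \<longlongrightarrow> 0) (at_right (0::real))"
      by (rule filterlim_compose[OF tendsto_power_div_exp_0 filterlim_inverse_at_top_right])
    then show ?thesis
    proof (rule Lim_transform_eventually)
      have "eventually (\<lambda>t. t > (0::real)) (at_right 0)" by (rule eventually_at_right_less)
      then show "\<forall>\<^sub>F t in at_right (0::real). inverse t ^ Suc j / exp (inverse t) = flat j t / t"
        by eventually_elim (simp add: flat_def exp_minus field_simps)
    qed
  qed
  moreover have "((\<lambda>t. flat j t / t) \<longlongrightarrow> 0) (at_left 0)"
  proof (rule Lim_transform_eventually[OF tendsto_const])
    show "\<forall>\<^sub>F t in at_left (0::real). 0 = flat j t / t"
      unfolding eventually_at by (intro exI[of _ 1]) (auto simp: flat_def)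
  qed
  ultimately show ?thesis by (simp add: filterlim_split_at)
qed

text \<open>The negative powers of t are there to close the family under differentiation. At 0 both
  one-sided limits of the difference quotient vanish, on the right because the exponential beats
  every power.\<close>

lemma flat_deriv: "(flat j has_real_derivative (flat (j + 2) t - real j * flat (j + 1) t)) (at t)"
proof -
  consider "t < 0" | "t > 0" | "t = 0" by linarith
  then show ?thesis
  proof cases
    case 1
    have "((\<lambda>_. 0) has_real_derivative 0) (at t)" by simp
    then have "(flat j has_real_derivative 0) (at t)"
      by (rule has_field_derivative_transform_within_open[where S="{..<0}"]) (use 1 in \<open>auto simp: flat_def\<close>)
    then show ?thesis using 1 by (simp add: flat_def)
  next
    case 2
    have ex: "((\<lambda>t. exp (- 1 / t)) has_real_derivative exp (- 1 / t) * (1 / t\<^sup>2)) (at t)"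
      using 2 by (auto intro!: derivative_eq_intros simp: power2_eq_square)
    have "((\<lambda>t. exp (- 1 / t) / t ^ j) has_real_derivative (flat (j + 2) t - real j * flat (j + 1) t)) (at t)"
      by (rule DERIV_cong[OF DERIV_divide[OF ex DERIV_pow]])
         (use 2 in \<open>cases j; auto simp: flat_def field_simps power2_eq_square\<close>)+
    then show ?thesis
      by (rule has_field_derivative_transform_within_open[where S="{0<..}"]) (use 2 in \<open>auto simp: flat_def\<close>)
  next
    case 3
    have "((\<lambda>h. (flat j (0 + h) - flat j 0) / h) \<longlongrightarrow> 0) (at 0)" using flat_small[of j] by (simp add: flat_def)
    then have "(flat j has_real_derivative 0) (at 0)" unfolding DERIV_def .
    then show ?thesis using 3 by (simp add: flat_def)
  qed
qed

text \<open>The smallest class containing the usual bump that is visibly closed under directional derivatives.\<close>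

inductive_set bumps :: "real \<Rightarrow> ('a::euclidean_space \<Rightarrow> complex) set" for r where
  gen: "(\<lambda>x. of_real (flat j (r\<^sup>2 - x \<bullet> x))) \<in> bumps r"
| add: "f \<in> bumps r \<Longrightarrow> g \<in> bumps r \<Longrightarrow> (\<lambda>x. f x + g x) \<in> bumps r"
| scale: "f \<in> bumps r \<Longrightarrow> (\<lambda>x. c * f x) \<in> bumps r"
| lin: "f \<in> bumps r \<Longrightarrow> (\<lambda>x. of_real (x \<bullet> v) * f x) \<in> bumps r"

lemma bumps_outside: "f \<in> bumps r \<Longrightarrow> r > 0 \<Longrightarrow> norm x > r \<Longrightarrow> f x = 0"
proof (induction rule: bumps.induct)
  case (gen j)
  then have "r\<^sup>2 < (norm x)\<^sup>2" by (intro power_strict_mono) auto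
  then show ?case by (simp add: flat_def power2_norm_eq_inner)
qed auto

lemma bumps_derivative:
  "f \<in> bumps r \<Longrightarrow> \<exists>f'. (\<forall>x. (f has_derivative f' x) (at x)) \<and> (\<forall>v. (\<lambda>x. f' x v) \<in> bumps r)"
proof (induction rule: bumps.induct)
  case (gen j)
  define f' where "f' x v = complex_of_real ((flat (j + 2) (r\<^sup>2 - x \<bullet> x) - real j * flat (j + 1) (r\<^sup>2 - x \<bullet> x)) * (- 2 * (x \<bullet> v)))" for x v :: 'a
  have "((\<lambda>x. complex_of_real (flat j (r\<^sup>2 - x \<bullet> x))) has_derivative f' x) (at x)" for x
  proof -
    have "((\<lambda>x::'a. r\<^sup>2 - x \<bullet> x) has_derivative (\<lambda>v. - 2 * (x \<bullet> v))) (at x)"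
      by (auto intro!: derivative_eq_intros simp: inner_commute)
    moreover have "(flat j has_derivative (*) (flat (j + 2) (r\<^sup>2 - x \<bullet> x) - real j * flat (j + 1) (r\<^sup>2 - x \<bullet> x))) (at (r\<^sup>2 - x \<bullet> x))"
      using flat_deriv unfolding has_field_derivative_def .
    ultimately have "((\<lambda>x. flat j (r\<^sup>2 - x \<bullet> x)) has_derivative (\<lambda>v. (flat (j + 2) (r\<^sup>2 - x \<bullet> x) - real j * flat (j + 1) (r\<^sup>2 - x \<bullet> x)) * (- 2 * (x \<bullet> v)))) (at x)"
      by (rule has_derivative_compose)
    then show ?thesis unfolding f'_def by (rule has_derivative_of_real)
  qed
  moreover have "(\<lambda>x. f' x v) \<in> bumps r" for v
  proof -
    have "(\<lambda>x. (- 2) * (of_real (x \<bullet> v) * (complex_of_real (flat (j + 2) (r\<^sup>2 - x \<bullet> x)) + (- of_nat j) * complex_of_real (flat (j + 1) (r\<^sup>2 - x \<bullet> x))))) \<in> bumps r"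
      by (intro bumps.scale bumps.lin bumps.add bumps.gen)
    also have "(\<lambda>x. (- 2) * (of_real (x \<bullet> v) * (complex_of_real (flat (j + 2) (r\<^sup>2 - x \<bullet> x)) + (- of_nat j) * complex_of_real (flat (j + 1) (r\<^sup>2 - x \<bullet> x))))) = (\<lambda>x. f' x v)"
      by (simp add: f'_def fun_eq_iff algebra_simps)
    finally show ?thesis .
  qed
  ultimately show ?case by blast
next
  case (add f g)
  then obtain f' g' where "\<forall>x. (f has_derivative f' x) (at x)" "\<forall>v. (\<lambda>x. f' x v) \<in> bumps r"
    "\<forall>x. (g has_derivative g' x) (at x)" "\<forall>v. (\<lambda>x. g' x v) \<in> bumps r" by blast
  then show ?case by (intro exI[of _ "\<lambda>x v. f' x v + g' x v"]) (auto intro!: bumps.add has_derivative_add)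
next
  case (scale f c)
  then obtain f' where "\<forall>x. (f has_derivative f' x) (at x)" "\<forall>v. (\<lambda>x. f' x v) \<in> bumps r" by blast
  then show ?case by (intro exI[of _ "\<lambda>x v. c * f' x v"]) (auto intro!: bumps.scale has_derivative_mult_right)
next
  case (lin f u)
  then obtain f' where f': "\<forall>x. (f has_derivative f' x) (at x)" "\<forall>v. (\<lambda>x. f' x v) \<in> bumps r" by blast
  have "((\<lambda>x. of_real (x \<bullet> u) * f x) has_derivative (\<lambda>v. of_real (x \<bullet> u) * f' x v + of_real (v \<bullet> u) * f x)) (at x)" for x
    using f'(1) by (intro has_derivative_mult has_derivative_of_real has_derivative_inner_left has_derivative_ident) auto
  moreover have "(\<lambda>x. of_real (x \<bullet> u) * f' x v + of_real (v \<bullet> u) * f x) \<in> bumps r" for v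
    using f'(2) lin(1) by (intro bumps.add bumps.scale bumps.lin) auto
  ultimately show ?case by (intro exI[of _ "\<lambda>x v. of_real (x \<bullet> u) * f' x v + of_real (v \<bullet> u) * f x"]) auto
qed

lemma bumps_supported:
  assumes "f \<in> bumps r" "r > 0" shows "supportedC1 r f" "\<And>v. ddir f v \<in> bumps r"
proof -
  obtain f' where f': "\<And>x. (f has_derivative f' x) (at x)" "\<And>v. (\<lambda>x. f' x v) \<in> bumps r"
    using bumps_derivative[OF assms(1)] by blast
  have c: "continuous_on UNIV g" if "g \<in> bumps r" for g :: "'a \<Rightarrow> complex"
    using bumps_derivative[OF that] by (meson continuous_at_imp_continuous_on has_derivative_continuous)
  have "supported r f" using c[OF assms(1)] bumps_outside[OF assms] by (auto simp: supported_def)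
  note * = supportedC1I[OF this f'(1) c[OF f'(2)]]
  show "supportedC1 r f" by (rule *(1))
  show "ddir f v \<in> bumps r" for v using *(2) f'(2) by simp
qed

text \<open>Smoothness by coinduction: a class of continuous differentiable functions that is closed
  under directional derivatives consists of smooth functions.\<close>

lemma cont_diff_coinduct:
  assumes "f \<in> F" and F: "\<And>f. f \<in> F \<Longrightarrow> continuous_on UNIV f" "\<And>f x. f \<in> F \<Longrightarrow> f differentiable (at x)"
    "\<And>f v. f \<in> F \<Longrightarrow> (\<lambda>x. frechet_derivative f (at x) v) \<in> F"
  shows "cont_diff_on k f UNIV"
  using assms(1)
proof (induction k arbitrary: f)
  case 0 then show ?case using F by simp
next
  case (Suc k) then show ?case using F by simp
qed

lemma ddir_eta: "(\<lambda>x. frechet_derivative f (at x) v) = ddir f v"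
  by (simp add: fun_eq_iff ddir_def)

lemma smooth_supportedC1:
  fixes f :: "'a::euclidean_space \<Rightarrow> complex"
  assumes f: "f \<in> smooth_test_functions"
  shows "\<exists>R>0. supportedC1 R f" "\<And>v. ddir f v \<in> smooth_test_functions"
proof -
  obtain R where R: "R > 0" "supported R f" using f test_functions_supported by (auto simp: smooth_test_functions_def)
  have cd: "\<And>k. cont_diff_on k f UNIV" using f by (simp add: smooth_test_functions_def)
  have dif: "f differentiable (at x)" for x using cd[of "Suc 0"] by simp
  have cdd: "cont_diff_on k (ddir f v) UNIV" for k v using cd[of "Suc k"] by (simp add: ddir_eta)
  have sd: "supported R (ddir f v)" for v
    unfolding supported_def using cdd[of 0 v] ddir_eqI[OF ddir_outside[OF R(2)]] by auto
  show "\<exists>R>0. supportedC1 R f" using R sd dif by (auto simp: supportedC1_def)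
  show "ddir f v \<in> smooth_test_functions" for v
    using R(1) sd cdd by (auto simp: smooth_test_functions_def test_functions_supported)
qed

text \<open>All derivatives fall on the bump, so the convolutions of the fixed g with bumps form a
  class as in \<open>cont_diff_coinduct\<close>.\<close>

lemma conv_smooth:
  assumes g: "supported R g" and b: "b \<in> bumps r" "r > 0"
  shows "conv g b \<in> smooth_test_functions"
proof -
  define F where "F = {conv g b | b. b \<in> bumps r}"
  have der: "supportedC1 (R + r) (conv g b)" "\<And>v. ddir (conv g b) v = conv g (ddir b v)" if "b \<in> bumps r" for b
    using conv_C1[OF g bumps_supported(1)[OF that b(2)]] .
  have "cont_diff_on k (conv g b) UNIV" for k
  proof (rule cont_diff_coinduct[where F=F])
    show "conv g b \<in> F" using b by (auto simp: F_def)
    fix f assume "f \<in> F"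
    then obtain b' where b': "b' \<in> bumps r" "f = conv g b'" by (auto simp: F_def)
    show "continuous_on UNIV f" using der(1)[OF b'(1)] b' by (auto simp: supportedC1_def supported_def)
    show "f differentiable (at x)" for x using der(1)[OF b'(1)] b' by (auto simp: supportedC1_def)
    show "(\<lambda>x. frechet_derivative f (at x) v) \<in> F" for v
      unfolding ddir_eta using der(2)[OF b'(1)] b' bumps_supported(2)[OF b'(1) b(2)] by (auto simp: F_def)
  qed
  moreover have "conv g b \<in> test_functions"
  proof -
    have "supported (max 1 (R + r)) (conv g b)" using der(1)[OF b(1)] supported_mono[of "R + r" "conv g b" "max 1 (R + r)"] by (auto simp: supportedC1_def)
    then show ?thesis unfolding test_functions_supported by (intro exI[of _ "max 1 (R + r)"]) auto
  qed
  ultimately show ?thesis by (simp add: smooth_test_functions_def)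
qed

lemma normalized_bump:
  assumes r: "r > 0"
  shows "\<exists>b \<in> (bumps r :: ('a \<Rightarrow> complex) set). \<exists>\<beta> :: 'a::euclidean_space \<Rightarrow> real. (\<forall>x. b x = of_real (\<beta> x) \<and> \<beta> x \<ge> 0) \<and> integrable lborel \<beta> \<and> (LINT x|lborel. \<beta> x) = 1"
proof -
  define \<phi> where "\<phi> x = flat 0 (r\<^sup>2 - x \<bullet> x)" for x :: 'a
  have gen: "(\<lambda>x. complex_of_real (\<phi> x)) \<in> bumps r" unfolding \<phi>_def by (rule bumps.gen)
  have nn: "\<phi> x \<ge> 0" for x by (simp add: \<phi>_def flat_def)
  have intc: "integrable lborel (\<lambda>x. complex_of_real (\<phi> x))"
    using bumps_supported(1)[OF gen r] by (auto simp: supportedC1_def intro: supported_integrable)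
  then have int: "integrable lborel \<phi>" by (simp add: complex_of_real_integrable_eq)
  define I where "I = (LINT x|lborel. \<phi> x)"
  have "I > 0"
  proof -
    define s where "s = r / 2"
    have s: "s > 0" using r by (simp add: s_def)
    define m where "m = exp (- 1 / (3 * r\<^sup>2 / 4))"
    have low: "m * indicator (cball 0 s) x \<le> \<phi> x" for x
    proof (cases "norm x \<le> s")
      case True
      then have "x \<bullet> x \<le> s\<^sup>2" by (simp add: power2_norm_eq_inner[symmetric] power_mono)
      then have a: "3 * r\<^sup>2 / 4 \<le> r\<^sup>2 - x \<bullet> x" by (simp add: s_def power_divide)
      moreover have p: "0 < 3 * r\<^sup>2 / 4" using r by simp
      ultimately have "1 / (r\<^sup>2 - x \<bullet> x) \<le> 1 / (3 * r\<^sup>2 / 4)" by (intro divide_left_mono mult_pos_pos) linarith+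
      then have "m \<le> exp (- 1 / (r\<^sup>2 - x \<bullet> x))" unfolding m_def by simp
      moreover have "0 < r\<^sup>2 - x \<bullet> x" using a p by linarith
      ultimately show ?thesis using True by (simp add: \<phi>_def flat_def dist_norm)
    qed (use nn in \<open>auto simp: dist_norm\<close>)
    have "0 < m * measure lborel (cball (0::'a) s)"
      using s by (simp add: m_def content_cball_pos)
    also have "\<dots> = (LINT x|lborel. m * indicator (cball (0::'a) s) x)" by simp
    also have "\<dots> \<le> I" unfolding I_def
    proof (rule integral_mono)
      show "integrable lborel (\<lambda>x. m * indicator (cball (0::'a) s) x :: real)"
        by (intro integrable_mult_right integrable_real_indicator) (auto simp: emeasure_cball_less_top)
    qed (use int low in auto)
    finally show ?thesis .
  qed
  define \<beta> where "\<beta> x = \<phi> x / I" for x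
  have "(\<lambda>x. of_real (1 / I) * complex_of_real (\<phi> x)) \<in> bumps r" by (rule bumps.scale[OF gen])
  moreover have "\<beta> x \<ge> 0" for x using nn \<open>I > 0\<close> by (simp add: \<beta>_def)
  moreover have "integrable lborel \<beta>" "(LINT x|lborel. \<beta> x) = 1"
    using int \<open>I > 0\<close> by (auto simp: \<beta>_def[abs_def] I_def)
  ultimately show ?thesis
    by (intro bexI[of _ "\<lambda>x. of_real (1 / I) * complex_of_real (\<phi> x)"] exI[of _ \<beta>]) (auto simp: \<beta>_def)
qed

text \<open>\<open>conv g b x\<close> is an average of g over the ball of radius r about x, so a
  bound for the deviation of g from a on that ball is inherited. Taking a as the value at x gives
  convergence, a = 0 boundedness, and a = B = 0 the persistence of zeros.\<close>

lemma conv_bump_bound: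
  assumes g: "supported R g" and b: "b \<in> bumps r" "r > 0" "\<And>x. b x = of_real (\<beta> x)" "\<And>x. \<beta> x \<ge> 0"
    "integrable lborel \<beta>" "(LINT x|lborel. \<beta> x) = 1"
    and B: "\<And>y. norm y \<le> r \<Longrightarrow> norm (g (x - y) - a) \<le> B"
  shows "norm (conv g b x - a) \<le> B"
proof -
  have bs: "supported r b" using bumps_supported(1)[OF b(1,2)] by (simp add: supportedC1_def)
  have int: "integrable lborel (\<lambda>y. b y * g (x - y))" using supported_integrable[OF supported_mult_shift[OF bs g]] .
  have bi: "integrable lborel b" by (rule supported_integrable[OF bs])
  have b1: "(LINT y|lborel. b y) = 1" using b(6) by (simp add: b(3) integral_complex_of_real)
  have "conv g b x - a = (LINT y|lborel. b y * g (x - y)) - (LINT y|lborel. b y * a)"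
    unfolding conv_commute[OF g bs] using b1 by (simp add: conv_def)
  also have "\<dots> = (LINT y|lborel. b y * (g (x - y) - a))"
    using int bi by (simp add: Bochner_Integration.integral_diff[symmetric] right_diff_distrib)
  also have "norm \<dots> \<le> (LINT y|lborel. norm (b y * (g (x - y) - a)))" by (rule integral_norm_bound)
  also have "\<dots> \<le> (LINT y|lborel. \<beta> y * B)"
  proof (rule integral_mono)
    show "integrable lborel (\<lambda>y. norm (b y * (g (x - y) - a)))"
      unfolding right_diff_distrib using int bi by (intro integrable_norm Bochner_Integration.integrable_diff) auto
    show "integrable lborel (\<lambda>y. \<beta> y * B)" using b(5) by simp
    show "norm (b y * (g (x - y) - a)) \<le> \<beta> y * B" for y
    proof (cases "norm y \<le> r")
      case True
      then show ?thesis using B[OF True] b(3,4) by (simp add: norm_mult mult_left_mono)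
    next
      case False
      then have "b y = 0" using bs by (simp add: supported_def)
      then show ?thesis using b(3)[of y] by simp
    qed
  qed
  also have "\<dots> = B" using b(6) by simp
  finally show ?thesis .
qed

lemma smooth_uniform_approx:
  fixes g :: "'a::euclidean_space \<Rightarrow> complex"
  assumes g: "supported R g" and e: "e > 0"
  shows "\<exists>f\<in>smooth_test_functions. supported (R + 1) f \<and> (\<forall>x. norm (f x - g x) \<le> e)"
proof -
  obtain d where d: "d > 0" "\<And>x y. norm (x - y) < d \<Longrightarrow> norm (g x - g y) < e" using supported_uniform[OF g e] by blast
  define r where "r = min (d / 2) 1"
  have r: "r > 0" "r < d" "r \<le> 1" using d by (auto simp: r_def)
  obtain b :: "'a \<Rightarrow> complex" and \<beta> where b: "b \<in> bumps r" "\<And>x. b x = of_real (\<beta> x)" "\<And>x. \<beta> x \<ge> 0"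
    "integrable lborel \<beta>" "(LINT x|lborel. \<beta> x) = 1" using normalized_bump[OF r(1)] by blast
  have "norm (conv g b x - g x) \<le> e" for x
  proof (rule conv_bump_bound[OF g b(1) r(1) b(2-5)])
    show "norm (g (x - y) - g x) \<le> e" if "norm y \<le> r" for y :: 'a using d(2)[of "x - y" x] that r by simp
  qed
  moreover have "supported (R + 1) (conv g b)"
    using conv_supported[OF g] bumps_supported(1)[OF b(1) r(1)] r(3) by (auto simp: supportedC1_def intro: supported_mono)
  ultimately show ?thesis using conv_smooth[OF g b(1) r(1)] by blast
qed

text \<open>Mollification at scales tending to 0. Derivatives that converge pointwise and stay
  uniformly bounded are what dominated convergence needs to pass from smooth to C^1 test functions;
  scales of at most \<delta>/2 preserve the vanishing near the origin.\<close>

lemma smooth_C1_approx: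
  fixes g :: "'a::euclidean_space \<Rightarrow> complex"
  assumes g: "supportedC1 R g" and \<delta>: "\<delta> > 0" "\<And>x. norm x < \<delta> \<Longrightarrow> g x = 0"
  shows "\<exists>f. (\<forall>j. f j \<in> smooth_test_functions \<and> supportedC1 (R + 1) (f j) \<and> (\<forall>x. norm x < \<delta> / 2 \<longrightarrow> f j x = 0)) \<and>
    (\<forall>v x. (\<lambda>j. ddir (f j) v x) \<longlonglongrightarrow> ddir g v x) \<and> (\<forall>v. \<exists>B. \<forall>j x. norm (ddir (f j) v x) \<le> B)"
proof -
  have gs: "supported R g" and gd: "\<And>v. supported R (ddir g v)" using g by (auto simp: supportedC1_def)
  define r where "r j = min 1 (\<delta> / 2) / real (Suc j)" for j
  have r: "r j > 0" "r j \<le> min 1 (\<delta> / 2)" for j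
  proof -
    show "r j > 0" using \<delta> by (simp add: r_def)
    have "min 1 (\<delta> / 2) / real (Suc j) \<le> min 1 (\<delta> / 2) / 1" using \<delta> by (intro divide_left_mono) auto
    then show "r j \<le> min 1 (\<delta> / 2)" by (simp add: r_def)
  qed
  have r0: "r \<longlonglongrightarrow> 0" unfolding r_def by (rule LIMSEQ_Suc[OF lim_const_over_n])
  have "\<forall>j. \<exists>(b :: 'a \<Rightarrow> complex) \<beta>. b \<in> bumps (r j) \<and> (\<forall>x::'a. b x = of_real (\<beta> x) \<and> \<beta> x \<ge> 0) \<and> integrable lborel \<beta> \<and> (LINT x|lborel. \<beta> x) = 1"
    using normalized_bump[OF r(1)] by blast
  then obtain b :: "nat \<Rightarrow> 'a \<Rightarrow> complex" and \<beta> where b: "\<And>j. b j \<in> bumps (r j)" "\<And>j x. b j x = of_real (\<beta> j x)" "\<And>j (x::'a). \<beta> j x \<ge> 0"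
    "\<And>j. integrable lborel (\<beta> j)" "\<And>j. (LINT x|lborel. \<beta> j x) = 1" by metis
  have bC: "supportedC1 (r j) (b j)" and bs: "supported (r j) (b j)" for j
    using bumps_supported(1)[OF b(1) r(1)] by (auto simp: supportedC1_def)
  define f where "f j = conv g (b j)" for j
  have fc: "f j = conv (b j) g" for j unfolding f_def by (rule conv_commute[OF gs bs])
  have fd: "ddir (f j) v = conv (ddir g v) (b j)" for j v
    unfolding fc conv_C1(2)[OF bs g] by (rule conv_commute[OF bs gd])
  have f1: "f j \<in> smooth_test_functions" for j unfolding f_def by (rule conv_smooth[OF gs b(1) r(1)])
  have f2: "supportedC1 (R + 1) (f j)" for j
  proof -
    have "supportedC1 (r j + R) (f j)" unfolding fc by (rule conv_C1(1)[OF bs g])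
    then show ?thesis using r(2)[of j] unfolding supportedC1_def by (auto intro: supported_mono[of "r j + R"])
  qed
  have f3: "f j x = 0" if x: "norm x < \<delta> / 2" for j x
  proof -
    have "norm (f j x - 0) \<le> 0" unfolding f_def
    proof (rule conv_bump_bound[OF gs b(1) r(1) b(2-5)])
      fix y :: 'a assume "norm y \<le> r j"
      then have "norm (x - y) < \<delta>" using x r(2)[of j] norm_triangle_ineq4[of x y] by linarith
      then show "norm (g (x - y) - 0) \<le> 0" using \<delta> by simp
    qed
    then show ?thesis by simp
  qed
  have f4: "(\<lambda>j. ddir (f j) v x) \<longlonglongrightarrow> ddir g v x" for v x
  proof (rule LIMSEQ_I)
    fix e :: real assume e: "e > 0"
    obtain d where d: "d > 0" "\<And>x y. norm (x - y) < d \<Longrightarrow> norm (ddir g v x - ddir g v y) < e / 2"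
      using supported_uniform[OF gd, of "e / 2" v] e by auto
    have "\<forall>\<^sub>F j in sequentially. r j < d" using r0 d(1) by (rule order_tendstoD)
    then obtain J where J: "\<And>j. j \<ge> J \<Longrightarrow> r j < d" by (auto simp: eventually_sequentially)
    have "norm (ddir (f j) v x - ddir g v x) < e" if "j \<ge> J" for j
    proof -
      have "norm (ddir (f j) v x - ddir g v x) \<le> e / 2" unfolding fd
      proof (rule conv_bump_bound[OF gd b(1) r(1) b(2-5)])
        show "norm (ddir g v (x - y) - ddir g v x) \<le> e / 2" if "norm y \<le> r j" for y :: 'a
          using d(2)[of "x - y" x] that J[OF \<open>j \<ge> J\<close>] by simp
      qed
      then show ?thesis using e by simp
    qed
    then show "\<exists>no. \<forall>n\<ge>no. norm (ddir (f n) v x - ddir g v x) < e" by blast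
  qed
  have f5: "\<exists>B. \<forall>j x. norm (ddir (f j) v x) \<le> B" for v
  proof -
    obtain B where B: "\<And>x. norm (ddir g v x) \<le> B" using supported_bounded[OF gd] by blast
    have "norm (ddir (f j) v x - 0) \<le> B" for j x
      unfolding fd by (rule conv_bump_bound[OF gd b(1) r(1) b(2-5)]) (use B in simp)
    then show ?thesis by auto
  qed
  show ?thesis using f1 f2 f3 f4 f5 by blast
qed

lemma smooth_ddir_commute:
  fixes f :: "'a::euclidean_space \<Rightarrow> complex"
  assumes f: "f \<in> smooth_test_functions"
  shows "ddir (ddir f v) w x = ddir (ddir f w) v x"
proof -
  obtain R where R: "supportedC1 R f" using smooth_supportedC1(1)[OF f] by blast
  have R2: "\<exists>R. supportedC1 R (ddir f v)" for v using smooth_supportedC1(1)[OF smooth_supportedC1(2)[OF f]] by blast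
  have d1: "(f has_derivative (\<lambda>v. ddir f v y)) (at y)" for y by (rule supportedC1_der[OF R])
  have d2: "(ddir f v has_derivative (\<lambda>w. ddir (ddir f v) w y)) (at y)" for y v using R2 supportedC1_der by blast
  have c2: "continuous_on UNIV (\<lambda>y. ddir (ddir f v) w y)" for v w
  proof -
    have "ddir (ddir f v) w \<in> smooth_test_functions" by (intro smooth_supportedC1(2) f)
    then show ?thesis by (simp add: smooth_test_functions_def test_functions_def)
  qed
  have "Re (ddir (ddir f v) w x) = Re (ddir (ddir f w) v x)"
    by (rule symmetric_second_derivative[where f="\<lambda>x. Re (f x)" and U=UNIV and f'="\<lambda>y v. Re (ddir f v y)"
          and A="\<lambda>y u. Re (ddir (ddir f v) u y)" and B="\<lambda>y u. Re (ddir (ddir f w) u y)"])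
       (use d1 d2 c2 in \<open>auto intro!: has_derivative_Re continuous_intros\<close>)
  moreover have "Im (ddir (ddir f v) w x) = Im (ddir (ddir f w) v x)"
    by (rule symmetric_second_derivative[where f="\<lambda>x. Im (f x)" and U=UNIV and f'="\<lambda>y v. Im (ddir f v y)"
          and A="\<lambda>y u. Im (ddir (ddir f v) u y)" and B="\<lambda>y u. Im (ddir (ddir f w) u y)"])
       (use d1 d2 c2 in \<open>auto intro!: has_derivative_Im continuous_intros\<close>)
  ultimately show ?thesis by (simp add: complex_eq_iff)
qed

section \<open>Point singularities and cutoffs at the origin\<close>

lemma integrable_norm_power:
  assumes k: "k < DIM('a::euclidean_space)" and R: "R > 0"
  shows "integrable lborel (\<lambda>x::'a. indicator (cball 0 R) x * (inverse (norm x)) ^ k)"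
proof (rule integrableI_bounded)
  show "(\<lambda>x::'a. indicator (cball 0 R) x * (inverse (norm x)) ^ k) \<in> borel_measurable lborel"
    by (intro borel_measurable_times borel_measurable_indicator borel_measurable_power borel_measurable_inverse borel_measurable_norm) auto
  define n where "n = DIM('a)"
  \<comment> \<open>Dyadic decomposition: \<open>a j\<close> bounds the integrand for |x| between R
    / 2^(j+1) and R / 2^j. Multiplied by the volume of the ball of radius R / 2^j it gives a
    geometric series with ratio 1 / 2^(n - k).\<close>
  define a where "a j = (2 ^ Suc j / R) ^ k" for j :: nat
  have pw: "ennreal (norm (indicator (cball 0 R) x * (inverse (norm x)) ^ k))
      \<le> (\<Sum>j. ennreal (a j) * indicator (cball 0 (R / 2 ^ j)) x)" if x: "x \<noteq> 0" for x :: 'a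
  proof (cases "norm x \<le> R")
    case True
    have ex: "\<exists>j. R / 2 ^ Suc j < norm x"
    proof -
      obtain j where "R / norm x < 2 ^ j" using real_arch_pow[of 2 "R / norm x"] by auto
      then have "R < 2 ^ j * norm x" using x by (simp add: pos_divide_less_eq)
      also have "\<dots> \<le> 2 ^ Suc j * norm x" by simp
      finally show ?thesis by (intro exI[of _ j]) (simp add: pos_divide_less_eq mult.commute)
    qed
    define j where "j = (LEAST j. R / 2 ^ Suc j < norm x)"
    have j1: "R / 2 ^ Suc j < norm x" unfolding j_def using ex by (rule LeastI_ex)
    have j2: "norm x \<le> R / 2 ^ j"
    proof (cases j)
      case (Suc i)
      then show ?thesis using not_less_Least[of i "\<lambda>j. R / 2 ^ Suc j < norm x"] by (auto simp: j_def)
    qed (use True in simp)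
    have "inverse (norm x) \<le> inverse (R / 2 ^ Suc j)" using j1 R by (intro le_imp_inverse_le) auto
    then have "(inverse (norm x)) ^ k \<le> a j" unfolding a_def using x by (intro power_mono) (auto simp: inverse_eq_divide)
    then have "ennreal (norm (indicator (cball 0 R) x * (inverse (norm x)) ^ k)) \<le> ennreal (a j) * indicator (cball 0 (R / 2 ^ j)) x"
      using True j2 by (simp add: ennreal_leI)
    also have "\<dots> = (\<Sum>i\<in>{j}. ennreal (a i) * indicator (cball 0 (R / 2 ^ i)) x)"
      by (simp only: sum.insert finite.emptyI empty_iff not_False_eq_True sum.empty add_0_right)
    also have "\<dots> \<le> (\<Sum>j. ennreal (a j) * indicator (cball 0 (R / 2 ^ j)) x)" by (rule sum_le_suminf) auto
    finally show ?thesis .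
  qed simp
  have AE: "AE x in lborel. x \<noteq> (0::'a)" by (rule AE_lborel_singleton)
  have "(nn_integral lborel (\<lambda>x::'a. ennreal (norm (indicator (cball 0 R) x * (inverse (norm x)) ^ k))))
      \<le> (nn_integral lborel (\<lambda>x::'a. (\<Sum>j. ennreal (a j) * indicator (cball 0 (R / 2 ^ j)) x)))"
    by (intro nn_integral_mono_AE eventually_mono[OF AE] pw)
  also have "\<dots> = (\<Sum>j. (nn_integral lborel (\<lambda>x::'a. ennreal (a j) * indicator (cball 0 (R / 2 ^ j)) x)))"
    by (intro nn_integral_suminf) (auto intro!: borel_measurable_times_ennreal borel_measurable_indicator)
  also have "\<dots> = (\<Sum>j. ennreal (a j) * emeasure lborel (cball (0::'a) (R / 2 ^ j)))" by (simp add: nn_integral_cmult_indicator)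
  also have "\<dots> = (\<Sum>j. ennreal ((2 / R) ^ k * unit_ball_vol n * R ^ n * (1 / 2 ^ (n - k)) ^ j))"
  proof (intro suminf_cong)
    fix j
    have "ennreal (a j) * emeasure lborel (cball (0::'a) (R / 2 ^ j)) = ennreal (a j * (unit_ball_vol n * (R / 2 ^ j) ^ n))"
      using R by (simp add: emeasure_cball n_def a_def ennreal_mult)
    also have "a j * (unit_ball_vol n * (R / 2 ^ j) ^ n) = (2 / R) ^ k * unit_ball_vol n * R ^ n * (1 / 2 ^ (n - k)) ^ j"
    proof -
      have "(2::real) ^ n = 2 ^ k * 2 ^ (n - k)" using k by (simp add: n_def flip: power_add)
      then have "((2::real) ^ j) ^ n = (2 ^ j) ^ k * (2 ^ (n - k)) ^ j"
        by (metis power_commutes power_mult power_mult_distrib mult.commute)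
      then show ?thesis using R by (simp add: a_def power_divide power_mult_distrib)
    qed
    finally show "ennreal (a j) * emeasure lborel (cball (0::'a) (R / 2 ^ j)) = ennreal ((2 / R) ^ k * unit_ball_vol n * R ^ n * (1 / 2 ^ (n - k)) ^ j)" .
  qed
  also have "\<dots> < \<infinity>"
  proof -
    have "1 / 2 ^ (n - k) < (1::real)" using k by (simp add: n_def)
    then have "summable (\<lambda>j. (1 / 2 ^ (n - k)) ^ j :: real)" by (intro summable_geometric) auto
    then have "summable (\<lambda>j. (2 / R) ^ k * unit_ball_vol n * R ^ n * (1 / 2 ^ (n - k)) ^ j)" by (rule summable_mult)
    then have "(\<Sum>j. ennreal ((2 / R) ^ k * unit_ball_vol n * R ^ n * (1 / 2 ^ (n - k)) ^ j))
        = ennreal (\<Sum>j. (2 / R) ^ k * unit_ball_vol n * R ^ n * (1 / 2 ^ (n - k)) ^ j)"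
      using R by (intro suminf_ennreal2) auto
    then show ?thesis by simp
  qed
  finally show "(nn_integral lborel (\<lambda>x::'a. ennreal (norm (indicator (cball 0 R) x * (inverse (norm x)) ^ k)))) < \<infinity>" .
qed

lemma borel_measurable_off_zero:
  fixes F :: "'a::euclidean_space \<Rightarrow> complex"
  assumes "continuous_on (- {0}) F" shows "F \<in> borel_measurable borel"
proof -
  have "(\<lambda>x. indicator (- {0}) x *\<^sub>R F x) \<in> borel_measurable borel"
    by (rule borel_measurable_continuous_on_indicator[OF _ assms]) auto
  then have "(\<lambda>x. indicator (- {0}) x *\<^sub>R F x + indicator {0} x *\<^sub>R F 0) \<in> borel_measurable borel" by measurable
  also have "(\<lambda>x. indicator (- {0}) x *\<^sub>R F x + indicator {0} x *\<^sub>R F 0) = F" by (auto simp: fun_eq_iff indicator_def)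
  finally show ?thesis .
qed

lemma integrable_singular:
  fixes F :: "'a::euclidean_space \<Rightarrow> complex"
  assumes c: "continuous_on (- {0}) F" and k: "k < DIM('a)"
    and F: "\<And>x. x \<noteq> 0 \<Longrightarrow> norm (F x) \<le> A * (inverse (norm x)) ^ k" and R: "\<And>x. norm x > R \<Longrightarrow> F x = 0"
  shows "integrable lborel F"
proof -
  define R' where "R' = max R 1"
  have "integrable lborel (\<lambda>x::'a. A * (indicator (cball 0 R') x * (inverse (norm x)) ^ k))"
    by (intro integrable_mult_right integrable_norm_power k) (simp add: R'_def)
  then show ?thesis
  proof (rule Bochner_Integration.integrable_bound)
    show "F \<in> borel_measurable lborel" using borel_measurable_off_zero[OF c] by simp
    have "norm (F x) \<le> norm (A * (indicator (cball 0 R') x * (inverse (norm x)) ^ k))" if "x \<noteq> 0" for x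
    proof (cases "norm x \<le> R'")
      case True
      have "norm (F x) \<le> \<bar>A * (inverse (norm x)) ^ k\<bar>" using F[OF that] abs_ge_self order_trans by blast
      then show ?thesis using True by simp
    qed (use R[of x] in \<open>simp add: R'_def\<close>)
    then show "AE x in lborel. norm (F x) \<le> norm (A * (indicator (cball 0 R') x * (inverse (norm x)) ^ k))"
      using AE_lborel_singleton[of "0::'a"] by (auto elim!: eventually_mono)
  qed
qed

text \<open>The derivatives of a homogeneous potential are continuous off the origin only; a factor
  that vanishes near the origin makes the product globally continuous.
  \<open>supportedC1_mult_off_zero\<close> is the C^1 counterpart.\<close>

lemma supported_off_zero:
  assumes c: "continuous_on (- {0::'a::euclidean_space}) F" and d: "\<delta> > 0" "\<And>x. norm x < \<delta> \<Longrightarrow> F x = 0"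
    and R: "\<And>x. norm x > R \<Longrightarrow> F x = 0"
  shows "supported R F"
proof -
  have "continuous_on (ball 0 \<delta>) F"
    by (rule continuous_on_eq[OF continuous_on_const[of _ 0]]) (use d(2) in auto)
  then have "continuous_on (- {0} \<union> ball 0 \<delta>) F" using c by (intro continuous_on_open_Un) auto
  moreover have "- {0} \<union> ball 0 \<delta> = (UNIV :: 'a set)" using d(1) by auto
  ultimately show ?thesis using R by (simp add: supported_def)
qed

lemma ddir_near_zero:
  assumes "\<And>x. norm x < \<delta> \<Longrightarrow> f x = 0" "norm z < \<delta>"
  shows "(f has_derivative (\<lambda>v. 0)) (at z)" "ddir f v z = 0"
proof -
  show *: "(f has_derivative (\<lambda>v. 0)) (at z)"
  proof (rule has_derivative_transform_within_open[where f="\<lambda>_. 0" and s="{x. norm x < \<delta>}"])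
    show "open {x :: 'a. norm x < \<delta>}" by (intro open_Collect_less continuous_intros)
  qed (use assms in auto)
  show "ddir f v z = 0" using ddir_eqI[OF *] by simp
qed

lemma supportedC1_mult_off_zero:
  fixes f g :: "'a::euclidean_space \<Rightarrow> complex"
  assumes g: "\<And>z. z \<noteq> 0 \<Longrightarrow> (g has_derivative g' z) (at z)" and cg: "\<And>v. continuous_on (- {0}) (\<lambda>z. g' z v)"
    and f: "supportedC1 R f" and d: "\<delta> > 0" "\<And>x. norm x < \<delta> \<Longrightarrow> f x = 0"
  shows "supportedC1 R (\<lambda>z. g z * f z)" "\<And>z v. ddir (\<lambda>z. g z * f z) v z = g z * ddir f v z + g' z v * f z"
proof -
  have der: "((\<lambda>z. g z * f z) has_derivative (\<lambda>v. g z * ddir f v z + g' z v * f z)) (at z)" for z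
  proof (cases "z = 0")
    case True
    then have z: "norm z < \<delta>" using d by simp
    have "((\<lambda>z. g z * f z) has_derivative (\<lambda>v. 0)) (at z)" by (rule ddir_near_zero(1)[OF _ z]) (use d in simp)
    moreover have "ddir f v z = 0" "f z = 0" for v using ddir_near_zero(2)[OF d(2) z] d(2)[OF z] by auto
    ultimately show ?thesis by simp
  next
    case False
    then show ?thesis using has_derivative_mult[OF g supportedC1_der[OF f]] by blast
  qed
  have cgc: "continuous_on (- {0}) g"
    by (auto intro!: continuous_at_imp_continuous_on has_derivative_continuous[OF g])
  have cf: "continuous_on (- {0}) f" "\<And>v. continuous_on (- {0}) (ddir f v)"
    using f unfolding supportedC1_def supported_def by (meson continuous_on_subset subset_UNIV)+
  have fR: "f z = 0" "ddir f v z = 0" if "norm z > R" for z v using f that by (auto simp: supportedC1_def supported_def)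
  have s: "supported R (\<lambda>z. g z * f z)"
    by (rule supported_off_zero[OF _ d(1)]) (use cgc cf d fR in \<open>auto intro!: continuous_intros\<close>)
  have s': "supported R (\<lambda>z. g z * ddir f v z + g' z v * f z)" for v
  proof (rule supported_off_zero[OF _ d(1)])
    show "continuous_on (- {0}) (\<lambda>z. g z * ddir f v z + g' z v * f z)" by (intro continuous_intros cgc cf cg)
    show "g z * ddir f v z + g' z v * f z = 0" if "norm z < \<delta>" for z using ddir_near_zero(2)[OF d(2) that] d(2)[OF that] by simp
  qed (use fR in auto)
  then have c: "continuous_on UNIV (\<lambda>z. g z * ddir f v z + g' z v * f z)" for v by (simp add: supported_def)
  note * = supportedC1I[OF s der c]
  show "supportedC1 R (\<lambda>z. g z * f z)" by (rule *(1))
  show "ddir (\<lambda>z. g z * f z) v z = g z * ddir f v z + g' z v * f z" for z v using *(2)[of v] by simp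
qed

text \<open>\<open>C\<^sup>1\<close>, vanishing near the origin, and with derivative \<open>O(1 / \<bar>z\<bar>)\<close> uniformly in \<open>\<epsilon>\<close>.\<close>

definition cutoff :: "real \<Rightarrow> 'a::euclidean_space \<Rightarrow> complex" where
  "cutoff \<epsilon> z = (if z = 0 then 0 else of_real ((max 0 (1 - \<epsilon>\<^sup>2 / (z \<bullet> z)))\<^sup>2))"

definition dcutoff :: "real \<Rightarrow> 'a::euclidean_space \<Rightarrow> 'a \<Rightarrow> complex" where
  "dcutoff \<epsilon> z v = of_real (2 * max 0 (1 - \<epsilon>\<^sup>2 / (z \<bullet> z)) * (2 * \<epsilon>\<^sup>2 * (z \<bullet> v) / (z \<bullet> z)\<^sup>2))"

lemma max_sq_deriv: "((\<lambda>t. (max 0 t)\<^sup>2) has_real_derivative 2 * max 0 t) (at t)"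
proof -
  consider "t < 0" | "t > 0" | "t = 0" by linarith
  then show ?thesis
  proof cases
    case 1
    have "((\<lambda>_. 0) has_real_derivative 0) (at t)" by simp
    then have "((\<lambda>t. (max 0 t)\<^sup>2) has_real_derivative 0) (at t)"
      by (rule has_field_derivative_transform_within_open[where S="{..<0}"]) (use 1 in auto)
    then show ?thesis using 1 by simp
  next
    case 2
    have "((\<lambda>t. t\<^sup>2) has_real_derivative 2 * t) (at t)" by (auto intro!: derivative_eq_intros)
    then have "((\<lambda>t. (max 0 t)\<^sup>2) has_real_derivative 2 * t) (at t)"
      by (rule has_field_derivative_transform_within_open[where S="{0<..}"]) (use 2 in auto)
    then show ?thesis using 2 by simp
  next
    case 3
    have "((\<lambda>h::real. (max 0 h)\<^sup>2 / h) \<longlongrightarrow> 0) (at 0)"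
    proof (rule Lim_null_comparison)
      show "\<forall>\<^sub>F h in at (0::real). norm ((max 0 h)\<^sup>2 / h) \<le> \<bar>h\<bar>"
        by (rule always_eventually) (auto simp: max_def power2_eq_square)
      show "((\<lambda>h::real. \<bar>h\<bar>) \<longlongrightarrow> 0) (at 0)" by (rule tendsto_rabs_zero) simp
    qed
    then show ?thesis unfolding DERIV_def using 3 by simp
  qed
qed

lemma cutoff_small:
  assumes "0 < \<epsilon>" "norm z < \<epsilon>" shows "cutoff \<epsilon> z = 0" "dcutoff \<epsilon> z v = 0"
proof -
  have "z = 0 \<or> 1 - \<epsilon>\<^sup>2 / (z \<bullet> z) \<le> 0"
  proof (cases "z = 0")
    case False
    then have "z \<bullet> z > 0" by simp
    moreover have "z \<bullet> z \<le> \<epsilon>\<^sup>2" using assms by (simp add: power2_norm_eq_inner[symmetric] power_mono)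
    ultimately show ?thesis by simp
  qed simp
  then show "cutoff \<epsilon> z = 0" "dcutoff \<epsilon> z v = 0" by (auto simp: cutoff_def dcutoff_def max_def)
qed

lemma cutoff_derivative:
  assumes z: "z \<noteq> 0" shows "(cutoff \<epsilon> has_derivative dcutoff \<epsilon> z) (at z)"
proof -
  have zz: "z \<bullet> z > 0" using z by simp
  have "((\<lambda>z::'a. 1 - \<epsilon>\<^sup>2 / (z \<bullet> z)) has_derivative (\<lambda>v. 2 * \<epsilon>\<^sup>2 * (z \<bullet> v) / (z \<bullet> z)\<^sup>2)) (at z)"
    using z by (auto intro!: derivative_eq_intros simp: fun_eq_iff inner_commute power2_eq_square field_simps)
  moreover have "((\<lambda>t. (max 0 t)\<^sup>2) has_derivative (*) (2 * max 0 (1 - \<epsilon>\<^sup>2 / (z \<bullet> z)))) (at (1 - \<epsilon>\<^sup>2 / (z \<bullet> z)))"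
    using max_sq_deriv unfolding has_field_derivative_def .
  ultimately have "((\<lambda>z. (max 0 (1 - \<epsilon>\<^sup>2 / (z \<bullet> z)))\<^sup>2) has_derivative (\<lambda>v. 2 * max 0 (1 - \<epsilon>\<^sup>2 / (z \<bullet> z)) * (2 * \<epsilon>\<^sup>2 * (z \<bullet> v) / (z \<bullet> z)\<^sup>2))) (at z)"
    by (rule has_derivative_compose)
  then have "((\<lambda>z. complex_of_real ((max 0 (1 - \<epsilon>\<^sup>2 / (z \<bullet> z)))\<^sup>2)) has_derivative dcutoff \<epsilon> z) (at z)"
    unfolding dcutoff_def[abs_def] by (rule has_derivative_of_real)
  then show ?thesis
    by (rule has_derivative_transform_within_open[where s="- {0}"]) (use z in \<open>auto simp: cutoff_def\<close>)
qed

text \<open>Where the derivative does not vanish, \<epsilon> is at most |z| and can be traded for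
  it. The resulting bound is free of \<epsilon> and can enter a dominating function.\<close>

lemma cutoff_bounds:
  assumes e: "\<epsilon> > 0" and z: "z \<noteq> 0"
  shows "norm (cutoff \<epsilon> z) \<le> 1" "norm (dcutoff \<epsilon> z v) \<le> 4 * norm v * inverse (norm z)"
proof -
  define m where "m = max 0 (1 - \<epsilon>\<^sup>2 / (z \<bullet> z))"
  have m: "0 \<le> m" "m \<le> 1" by (auto simp: m_def)
  have "m\<^sup>2 \<le> 1\<^sup>2" using m by (intro power_mono)
  then show "norm (cutoff \<epsilon> z) \<le> 1" using z by (simp add: cutoff_def m_def norm_power)
  show "norm (dcutoff \<epsilon> z v) \<le> 4 * norm v * inverse (norm z)"
  proof (cases "norm z < \<epsilon>")
    case True
    then show ?thesis using cutoff_small(2)[OF e True] by simp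
  next
    case False
    define N where "N = norm z"
    have N: "N > 0" "\<epsilon> \<le> N" using z False by (auto simp: N_def)
    have zz: "z \<bullet> z = N\<^sup>2" by (simp add: N_def power2_norm_eq_inner)
    have "norm (dcutoff \<epsilon> z v) = 2 * m * (2 * \<epsilon>\<^sup>2 * \<bar>z \<bullet> v\<bar> / (N\<^sup>2)\<^sup>2)"
      unfolding dcutoff_def norm_of_real using m by (simp add: abs_mult m_def zz)
    also have "\<dots> \<le> 2 * 1 * (2 * N\<^sup>2 * (N * norm v) / (N\<^sup>2)\<^sup>2)"
      using m N e Cauchy_Schwarz_ineq2[of z v] unfolding N_def[symmetric]
      by (intro mult_mono divide_right_mono power_mono) auto
    also have "\<dots> = 4 * norm v * inverse N" using N by (simp add: power2_eq_square field_simps)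
    finally show ?thesis by (simp add: N_def)
  qed
qed

lemma cutoff_limits:
  assumes z: "z \<noteq> 0"
  shows "(\<lambda>j. cutoff (1 / real (Suc j)) z) \<longlonglongrightarrow> 1" "(\<lambda>j. dcutoff (1 / real (Suc j)) z v) \<longlonglongrightarrow> 0"
proof -
  have e: "(\<lambda>j. 1 / real (Suc j)) \<longlonglongrightarrow> 0" by (rule LIMSEQ_Suc[OF lim_const_over_n])
  have zz: "z \<bullet> z \<noteq> 0" using z by simp
  have m: "(\<lambda>j. max 0 (1 - (1 / real (Suc j))\<^sup>2 / (z \<bullet> z))) \<longlonglongrightarrow> max 0 (1 - 0\<^sup>2 / (z \<bullet> z))"
    by (intro tendsto_intros e zz)
  have "(\<lambda>j. complex_of_real ((max 0 (1 - (1 / real (Suc j))\<^sup>2 / (z \<bullet> z)))\<^sup>2)) \<longlonglongrightarrow> of_real ((max 0 (1 - 0\<^sup>2 / (z \<bullet> z)))\<^sup>2)"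
    by (intro tendsto_of_real tendsto_power m)
  then show "(\<lambda>j. cutoff (1 / real (Suc j)) z) \<longlonglongrightarrow> 1" using z by (simp add: cutoff_def)
  have "(\<lambda>j. dcutoff (1 / real (Suc j)) z v) \<longlonglongrightarrow> of_real (2 * max 0 (1 - 0\<^sup>2 / (z \<bullet> z)) * (2 * 0\<^sup>2 * (z \<bullet> v) / (z \<bullet> z)\<^sup>2))"
    unfolding dcutoff_def using zz by (intro tendsto_of_real tendsto_mult tendsto_divide tendsto_const tendsto_power e m) auto
  then show "(\<lambda>j. dcutoff (1 / real (Suc j)) z v) \<longlonglongrightarrow> 0" by simp
qed

lemma dcutoff_cont: "continuous_on (- {0}) (\<lambda>z. dcutoff \<epsilon> z v)"
  unfolding dcutoff_def by (intro continuous_intros) auto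

section \<open>The Monge--Ampere currents of a homogeneous potential\<close>

lemma dz_ddir: "dz p f z = (ddir f (axis p 1) z - \<i> * ddir f (axis p \<i>) z) / 2"
  by (simp add: dz_def ddir_def)

lemma dzbar_ddir: "dzbar p f z = (ddir f (axis p 1) z + \<i> * ddir f (axis p \<i>) z) / 2"
  by (simp add: dzbar_def ddir_def)

lemma dzbar_supported: "supportedC1 R f \<Longrightarrow> supported R (dzbar p f)"
  and dz_supported: "supportedC1 R f \<Longrightarrow> supported R (dz p f)"
  unfolding supportedC1_def supported_def dzbar_ddir[abs_def] dz_ddir[abs_def]
  by (auto intro!: continuous_intros)

lemma dzbar_near_zero:
  assumes "\<And>x. norm x < \<delta> \<Longrightarrow> f x = 0" "norm z < \<delta>"
  shows "dzbar p f z = 0" "dz p f z = 0"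
  unfolding dzbar_ddir dz_ddir using ddir_near_zero(2)[OF assms] by auto

lemma integral_dzbar_zero:
  assumes "supportedC1 R f" shows "(LINT z|lborel. dzbar p f z) = 0"
proof -
  have i: "integrable lborel (ddir f v)" for v using assms by (auto simp: supportedC1_def intro: supported_integrable)
  have "(LINT z|lborel. dzbar p f z) = ((LINT z|lborel. ddir f (axis p 1) z) + \<i> * (LINT z|lborel. ddir f (axis p \<i>) z)) / 2"
    unfolding dzbar_ddir using i by simp
  then show ?thesis by (simp add: integral_ddir_zero[OF assms])
qed

lemma has_derivative_cnj: "(f has_derivative f') F \<Longrightarrow> ((\<lambda>z. cnj (f z)) has_derivative (\<lambda>v. cnj (f' v))) F"
  by (rule bounded_linear.has_derivative[OF bounded_linear_cnj])

lemma supportedC1_cnj: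
  fixes f :: "'a::euclidean_space \<Rightarrow> complex"
  assumes "supportedC1 R f" shows "supportedC1 R (\<lambda>z. cnj (f z))" "\<And>v. ddir (\<lambda>z. cnj (f z)) v = (\<lambda>z. cnj (ddir f v z))"
proof -
  have s: "supported R (\<lambda>z. cnj (f z))" and c: "\<And>v. continuous_on UNIV (\<lambda>z. cnj (ddir f v z))"
    using assms by (auto simp: supportedC1_def supported_def intro!: continuous_intros)
  note * = supportedC1I[OF s has_derivative_cnj[OF supportedC1_der[OF assms]] c]
  show "supportedC1 R (\<lambda>z. cnj (f z))" by (rule *(1))
  show "\<And>v. ddir (\<lambda>z. cnj (f z)) v = (\<lambda>z. cnj (ddir f v z))" by (rule *(2))
qed

lemma dzbar_cnj: "supportedC1 R f \<Longrightarrow> dzbar p (\<lambda>z. cnj (f z)) z = cnj (dz p f z)"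
  by (simp add: dzbar_ddir dz_ddir supportedC1_cnj(2))

lemma cont_diff_on_lincomb:
  fixes f g :: "'a::euclidean_space \<Rightarrow> complex"
  assumes "cont_diff_on k f UNIV" "cont_diff_on k g UNIV"
  shows "cont_diff_on k (\<lambda>x. a * f x + b * g x) UNIV"
  using assms
proof (induction k arbitrary: f g)
  case 0
  then show ?case by (auto intro!: continuous_intros)
next
  case (Suc k)
  have der: "((\<lambda>x. a * f x + b * g x) has_derivative (\<lambda>v. a * ddir f v x + b * ddir g v x)) (at x)" for x
    using Suc.prems by (auto intro!: has_derivative_add has_derivative_mult_right ddir_works)
  have e: "(\<lambda>x. frechet_derivative (\<lambda>x. a * f x + b * g x) (at x) v) = (\<lambda>x. a * ddir f v x + b * ddir g v x)" for v
    using frechet_derivative_eqI[OF der] by (simp add: fun_eq_iff)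
  have "cont_diff_on k (ddir f v) UNIV" "cont_diff_on k (ddir g v) UNIV" for v
    using Suc.prems by (simp_all add: ddir_eta)
  moreover have "(\<lambda>x. a * f x + b * g x) differentiable (at x)" for x using der by (rule differentiableI)
  ultimately show ?case unfolding cont_diff_on.simps e by (auto intro: Suc.IH)
qed

lemma smooth_lincomb:
  fixes f g :: "'a::euclidean_space \<Rightarrow> complex"
  assumes f: "f \<in> smooth_test_functions" and g: "g \<in> smooth_test_functions"
  shows "(\<lambda>x. a * f x + b * g x) \<in> smooth_test_functions"
proof -
  obtain R R' where R: "R > 0" "supported R f" and R': "R' > 0" "supported R' g"
    using f g by (auto simp: smooth_test_functions_def test_functions_supported)
  have "supported (max R R') (\<lambda>x. a * f x + b * g x)"
    using R(2) R'(2) by (auto simp: supported_def intro!: continuous_intros)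
  moreover have "max R R' > 0" using R by simp
  ultimately have "(\<lambda>x. a * f x + b * g x) \<in> test_functions" unfolding test_functions_supported by blast
  moreover have "cont_diff_on k (\<lambda>x. a * f x + b * g x) UNIV" for k
    using f g by (intro cont_diff_on_lincomb) (auto simp: smooth_test_functions_def)
  ultimately show ?thesis by (simp add: smooth_test_functions_def)
qed

lemma smooth_dzbar: "f \<in> smooth_test_functions \<Longrightarrow> dzbar p f \<in> smooth_test_functions"
  and smooth_dz: "f \<in> smooth_test_functions \<Longrightarrow> dz p f \<in> smooth_test_functions"
proof -
  assume f: "f \<in> smooth_test_functions"
  have "dzbar p f = (\<lambda>z. (1/2) * ddir f (axis p 1) z + (\<i>/2) * ddir f (axis p \<i>) z)"
    by (simp add: fun_eq_iff dzbar_ddir add_divide_distrib)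
  then show "dzbar p f \<in> smooth_test_functions" by (simp only: smooth_lincomb smooth_supportedC1(2)[OF f])
  have "dz p f = (\<lambda>z. (1/2) * ddir f (axis p 1) z + (-\<i>/2) * ddir f (axis p \<i>) z)"
    by (simp add: fun_eq_iff dz_ddir diff_divide_distrib)
  then show "dz p f \<in> smooth_test_functions" by (simp only: smooth_lincomb smooth_supportedC1(2)[OF f])
qed

lemma smooth_ddir_dzbar:
  assumes f: "f \<in> smooth_test_functions"
  shows "ddir (dzbar p f) v z = (ddir (ddir f (axis p 1)) v z + \<i> * ddir (ddir f (axis p \<i>)) v z) / 2"
    "ddir (dz p f) v z = (ddir (ddir f (axis p 1)) v z - \<i> * ddir (ddir f (axis p \<i>)) v z) / 2"
proof -
  have d: "(ddir f u has_derivative (\<lambda>v. ddir (ddir f u) v z)) (at z)" for u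
    using smooth_supportedC1(1)[OF smooth_supportedC1(2)[OF f]] supportedC1_der by blast
  have "(dzbar p f has_derivative (\<lambda>v. (ddir (ddir f (axis p 1)) v z + \<i> * ddir (ddir f (axis p \<i>)) v z) / 2)) (at z)"
    unfolding dzbar_ddir[abs_def] divide_inverse
    by (intro has_derivative_mult_left has_derivative_add has_derivative_mult_right d)
  then show "ddir (dzbar p f) v z = (ddir (ddir f (axis p 1)) v z + \<i> * ddir (ddir f (axis p \<i>)) v z) / 2" by (rule ddir_eqI)
  have "(dz p f has_derivative (\<lambda>v. (ddir (ddir f (axis p 1)) v z - \<i> * ddir (ddir f (axis p \<i>)) v z) / 2)) (at z)"
    unfolding dz_ddir[abs_def] divide_inverse
    by (intro has_derivative_mult_left has_derivative_diff has_derivative_mult_right d)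
  then show "ddir (dz p f) v z = (ddir (ddir f (axis p 1)) v z - \<i> * ddir (ddir f (axis p \<i>)) v z) / 2" by (rule ddir_eqI)
qed

lemma smooth_dzbar_commute:
  assumes f: "f \<in> smooth_test_functions"
  shows "dzbar p (dzbar q f) z = dzbar q (dzbar p f) z"
  unfolding dzbar_ddir[of _ "dzbar _ _"] smooth_ddir_dzbar[OF f]
  by (simp add: smooth_ddir_commute[OF f, of _ "axis p _"] field_simps)

text \<open>The constant that \<open>integration_current\<close> puts in front of the integral. On
  lists of length \<open>CARD('n)\<close> with distinct first list it is the generalised Kronecker
  symbol divided by the power of pi.\<close>

definition current_coeff :: "'n::finite list \<Rightarrow> 'n list \<Rightarrow> complex" where
  "current_coeff js ls = (\<Sum>\<pi> | \<pi> permutes (UNIV :: 'n set).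
         if distinct js \<and> ls = map \<pi> js then of_int (sign \<pi>) else 0) / of_real (pi ^ CARD('n))"

lemma current_coeff_not_distinct: "\<not> distinct ls \<Longrightarrow> current_coeff js ls = 0"
proof -
  assume nd: "\<not> distinct ls"
  have "\<not> (distinct js \<and> ls = map \<pi> js)" if "\<pi> permutes UNIV" for \<pi>
    using nd permutes_inj_on[OF that, of "set js"] by (auto simp: distinct_map)
  then have "(\<Sum>\<pi> | \<pi> permutes (UNIV :: 'a set). if distinct js \<and> ls = map \<pi> js then complex_of_int (sign \<pi>) else 0) = 0"
    by (intro sum.neutral) auto
  then show "current_coeff js ls = 0" unfolding current_coeff_def by simp
qed

text \<open>Composition with the transposition of a and b permutes the summands and reverses their
  signs. This antisymmetry of the wedge product is what makes second derivatives cancel in the proof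
  of closedness.\<close>

lemma current_coeff_swap: "current_coeff js (xs @ a # b # ys) = - current_coeff js (xs @ b # a # ys)"
proof (cases "distinct (xs @ a # b # ys)")
  case False
  then have "\<not> distinct (xs @ b # a # ys)" by auto
  then show ?thesis using False by (simp add: current_coeff_not_distinct)
next
  case True
  define t where "t = Transposition.transpose a b"
  have ab: "a \<noteq> b" using True by auto
  have tp: "t permutes UNIV" unfolding t_def by (rule permutes_swap_id) auto
  have tt: "map t (map t zs) = zs" for zs by (simp add: t_def)
  have mt: "map t (xs @ b # a # ys) = xs @ a # b # ys"
    using True by (auto simp: t_def intro!: map_idI transpose_apply_other)
  have "(\<Sum>\<pi> | \<pi> permutes (UNIV :: 'a set). if distinct js \<and> xs @ b # a # ys = map \<pi> js then complex_of_int (sign \<pi>) else 0)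
      = (\<Sum>\<pi> | \<pi> permutes (UNIV :: 'a set). if distinct js \<and> xs @ b # a # ys = map (t \<circ> \<pi>) js then complex_of_int (sign (t \<circ> \<pi>)) else 0)"
    by (rule setum_permutations_compose_left[OF tp])
  also have "\<dots> = (\<Sum>\<pi> | \<pi> permutes (UNIV :: 'a set). - (if distinct js \<and> xs @ a # b # ys = map \<pi> js then complex_of_int (sign \<pi>) else 0))"
  proof (rule sum.cong[OF refl])
    fix \<pi> :: "'a \<Rightarrow> 'a" assume "\<pi> \<in> {\<pi>. \<pi> permutes UNIV}"
    then have p: "permutation \<pi>" "permutation t" using tp by (auto intro: permutes_imp_permutation)
    have s: "sign (t \<circ> \<pi>) = - sign \<pi>" using sign_compose[OF p(2,1)] ab by (simp add: t_def sign_swap_id)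
    have "xs @ b # a # ys = map (t \<circ> \<pi>) js \<longleftrightarrow> xs @ a # b # ys = map \<pi> js"
      using mt tt by (metis list.map_comp)
    then show "(if distinct js \<and> xs @ b # a # ys = map (t \<circ> \<pi>) js then complex_of_int (sign (t \<circ> \<pi>)) else 0)
      = - (if distinct js \<and> xs @ a # b # ys = map \<pi> js then complex_of_int (sign \<pi>) else 0)" by (simp add: s)
  qed
  finally show ?thesis unfolding current_coeff_def by (simp add: sum_negf)
qed

lemma current_coeff_sym: "current_coeff js ls = current_coeff ls js"
proof -
  have "(\<Sum>\<pi> | \<pi> permutes (UNIV :: 'a set). if distinct js \<and> ls = map \<pi> js then complex_of_int (sign \<pi>) else 0)
     = (\<Sum>\<pi> | \<pi> permutes (UNIV :: 'a set). if distinct js \<and> ls = map (inv \<pi>) js then complex_of_int (sign (inv \<pi>)) else 0)"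
    by (rule sum_permutations_inverse)
  also have "\<dots> = (\<Sum>\<pi> | \<pi> permutes (UNIV :: 'a set). if distinct ls \<and> js = map \<pi> ls then complex_of_int (sign \<pi>) else 0)"
  proof (rule sum.cong[OF refl])
    fix \<pi> :: "'a \<Rightarrow> 'a" assume "\<pi> \<in> {\<pi>. \<pi> permutes UNIV}"
    then have p: "\<pi> permutes UNIV" by simp
    have s: "sign (inv \<pi>) = sign \<pi>" by (rule sign_inverse[OF permutes_imp_permutation[OF _ p]]) simp
    have "ls = map (inv \<pi>) js \<longleftrightarrow> js = map \<pi> ls"
      using permutes_inv_o[OF p] by (metis list.map_comp list.map_id)
    moreover have "distinct (map \<pi> ls) = distinct ls"
      using permutes_inj_on[OF p, of "set ls"] by (simp add: distinct_map)
    ultimately show "(if distinct js \<and> ls = map (inv \<pi>) js then complex_of_int (sign (inv \<pi>)) else 0)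
      = (if distinct ls \<and> js = map \<pi> ls then complex_of_int (sign \<pi>) else 0)" using s by auto
  qed
  finally show ?thesis by (simp add: current_coeff_def)
qed

lemma current_coeff_bound: "\<exists>K\<ge>0. \<forall>js ls :: 'n::finite list. norm (current_coeff js ls) \<le> K"
proof -
  define K where "K = real (card {\<pi>. \<pi> permutes (UNIV :: 'n set)}) / pi ^ CARD('n)"
  have "norm (current_coeff js ls) \<le> K" for js ls :: "'n list"
  proof -
    have "norm (\<Sum>\<pi> | \<pi> permutes (UNIV :: 'n set). if distinct js \<and> ls = map \<pi> js then complex_of_int (sign \<pi>) else 0)
        \<le> (\<Sum>\<pi> | \<pi> permutes (UNIV :: 'n set). 1)"
      by (rule sum_norm_le) (auto simp: sign_def)
    then show ?thesis unfolding current_coeff_def K_def norm_divide by (intro divide_mono) (auto simp: norm_power)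
  qed
  then show ?thesis by (intro exI[of _ K]) (auto simp: K_def)
qed

lemma current_coeff_real: "cnj (current_coeff js ls) = current_coeff js ls"
  unfolding current_coeff_def by (auto simp: cnj_sum if_distrib cong: if_cong)

lemma integration_current_coeff: "integration_current js ls f = (LINT z|lborel. current_coeff js ls * f z)"
  by (simp add: integration_current_def current_coeff_def)

lemma sum_antisym_zero:
  fixes X :: "'n::finite \<Rightarrow> 'n \<Rightarrow> complex"
  assumes "\<And>a b. X a b = - X b a" shows "(\<Sum>a\<in>UNIV. \<Sum>b\<in>UNIV. X a b) = 0"
proof -
  have "(\<Sum>a\<in>UNIV. \<Sum>b\<in>UNIV. X a b) = (\<Sum>b\<in>UNIV. \<Sum>a\<in>UNIV. X a b)" by (rule sum.swap)
  also have "\<dots> = (\<Sum>b\<in>UNIV. \<Sum>a\<in>UNIV. - X b a)" by (intro sum.cong refl assms)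
  also have "\<dots> = - (\<Sum>a\<in>UNIV. \<Sum>b\<in>UNIV. X a b)" by (simp add: sum_negf)
  finally show ?thesis by simp
qed

text \<open>Here \<open>w = \<partial>u\<close> and \<open>h\<close> is the complex Hessian; the growth bounds are those of a function that is homogeneous of
  degree one and \<open>C\<^sup>2\<close> off the origin.\<close>

locale homogeneous_potential =
  fixes u :: "complex^'n::finite \<Rightarrow> real" and du :: "complex^'n \<Rightarrow> complex^'n \<Rightarrow> complex"
    and w :: "'n \<Rightarrow> complex^'n \<Rightarrow> complex" and dw :: "'n \<Rightarrow> complex^'n \<Rightarrow> complex^'n \<Rightarrow> complex"
    and h :: "'n \<Rightarrow> 'n \<Rightarrow> complex^'n \<Rightarrow> complex" and B :: real
  assumes u_cont: "continuous_on UNIV u" and B0: "B \<ge> 0"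
    and u_bound: "\<bar>u z\<bar> \<le> B * norm z"
    and w_bound: "z \<noteq> 0 \<Longrightarrow> norm (w p z) \<le> B"
    and h_bound: "z \<noteq> 0 \<Longrightarrow> norm (h p q z) \<le> B * inverse (norm z)"
    and u_deriv: "z \<noteq> 0 \<Longrightarrow> ((\<lambda>z. of_real (u z)) has_derivative du z) (at z)"
    and du_cont: "continuous_on (- {0}) (\<lambda>z. du z v)"
    and du_w: "z \<noteq> 0 \<Longrightarrow> (du z (axis p 1) - \<i> * du z (axis p \<i>)) / 2 = w p z"
    and w_deriv: "z \<noteq> 0 \<Longrightarrow> (w p has_derivative dw p z) (at z)"
    and dw_cont: "continuous_on (- {0}) (\<lambda>z. dw p z v)"
    and dw_h: "(dw p z (axis q 1) + \<i> * dw p z (axis q \<i>)) / 2 = h p q z"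
    and h_herm: "cnj (h p q z) = h q p z"
begin

text \<open>The coefficients of the \<open>k\<close>-th power of \<open>dd\<^sup>c u\<close> off the origin. They are \<open>O(\<bar>z\<bar>\<^sup>-\<^sup>k)\<close> with \<open>k \<le> n < 2 n\<close>, hence locally
  integrable, and the origin carries no mass.\<close>

primrec M :: "nat \<Rightarrow> 'n list \<Rightarrow> 'n list \<Rightarrow> complex^'n \<Rightarrow> complex" where
  "M 0 js ls z = current_coeff js ls"
| "M (Suc k) js ls z = (\<Sum>p\<in>UNIV. \<Sum>q\<in>UNIV. h p q z * M k (p # js) (q # ls) z)"

lemma h_cont: "continuous_on (- {0}) (h p q)"
proof -
  have "continuous_on (- {0}) (\<lambda>z. (dw p z (axis q 1) + \<i> * dw p z (axis q \<i>)) / 2)"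
    by (intro continuous_intros dw_cont) auto
  then show ?thesis by (simp add: dw_h)
qed

lemma w_cont: "continuous_on (- {0}) (w p)"
  using w_deriv by (auto intro!: continuous_at_imp_continuous_on has_derivative_continuous)

lemma M_cont: "continuous_on (- {0}) (M k js ls)"
proof (induction k arbitrary: js ls)
  case 0
  then show ?case by simp
next
  case (Suc k)
  have "continuous_on (- {0}) (\<lambda>z. \<Sum>p\<in>UNIV. \<Sum>q\<in>UNIV. h p q z * M k (p # js) (q # ls) z)"
    by (intro continuous_intros h_cont Suc)
  then show ?case by simp
qed

lemma M_meas: "M k js ls \<in> borel_measurable borel" by (rule borel_measurable_off_zero[OF M_cont])

text \<open>The prefix \<open>xs\<close> is there for the induction, because each unfolding of
  \<open>M\<close> adds an index in front of the list.\<close>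

lemma M_swap: "M k js (xs @ a # b # ys) z = - M k js (xs @ b # a # ys) z"
proof (induction k arbitrary: js xs)
  case 0
  show ?case unfolding M.simps by (rule current_coeff_swap)
next
  case (Suc k)
  have e: "M k (p # js) (q # xs @ a # b # ys) z = - M k (p # js) (q # xs @ b # a # ys) z" for p q
    using Suc[of "p # js" "q # xs"] by (simp only: append_Cons)
  show ?case unfolding M.simps e by (simp only: mult_minus_right sum_negf)
qed

text \<open>Conjugation exchanges the two index lists, so closedness in the holomorphic direction
  follows from closedness in the antiholomorphic one.\<close>

lemma M_cnj: "cnj (M k js ls z) = M k ls js z"
proof (induction k arbitrary: js ls)
  case 0
  then show ?case by (simp add: current_coeff_real current_coeff_sym)
next
  case (Suc k)
  have "cnj (M (Suc k) js ls z) = (\<Sum>p\<in>UNIV. \<Sum>q\<in>UNIV. h q p z * M k (q # ls) (p # js) z)"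
    by (simp add: h_herm Suc)
  also have "\<dots> = M (Suc k) ls js z" unfolding M.simps by (rule sum.swap)
  finally show ?case .
qed

lemma M_bound: "\<exists>A\<ge>0. \<forall>js ls z. z \<noteq> 0 \<longrightarrow> norm (M k js ls z) \<le> A * inverse (norm z) ^ k"
proof (induction k)
  case 0
  obtain K where "K \<ge> 0" "\<And>js ls :: 'n list. norm (current_coeff js ls) \<le> K" using current_coeff_bound by blast
  then show ?case by (intro exI[of _ K]) simp
next
  case (Suc k)
  then obtain A where A: "A \<ge> 0" "\<And>js ls z. z \<noteq> 0 \<Longrightarrow> norm (M k js ls z) \<le> A * inverse (norm z) ^ k" by blast
  define N where "N = real CARD('n)"
  have "norm (M (Suc k) js ls z) \<le> (N * (N * (B * A))) * inverse (norm z) ^ Suc k" if z: "z \<noteq> 0" for js ls z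
  proof -
    have t: "norm (h p q z * M k (p # js) (q # ls) z) \<le> (B * A) * inverse (norm z) ^ Suc k" for p q
    proof -
      have "norm (h p q z * M k (p # js) (q # ls) z) \<le> (B * inverse (norm z)) * (A * inverse (norm z) ^ k)"
        unfolding norm_mult using h_bound[OF z] A(2)[OF z] B0 by (intro mult_mono) auto
      then show ?thesis by (simp add: mult_ac)
    qed
    have "norm (M (Suc k) js ls z) \<le> (\<Sum>p\<in>(UNIV::'n set). \<Sum>q\<in>(UNIV::'n set). (B * A) * inverse (norm z) ^ Suc k)"
      unfolding M.simps by (intro sum_norm_le t)
    then show ?thesis by (simp add: N_def mult.assoc)
  qed
  then show ?case using A(1) B0 by (intro exI[of _ "N * (N * (B * A))"]) (auto simp: N_def)
qed

lemma M_mult_integrable: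
  assumes F: "supported R F" and d: "\<delta> > 0" "\<And>z. norm z < \<delta> \<Longrightarrow> F z = 0"
  shows "integrable lborel (\<lambda>z. M k js ls z * F z)"
proof (rule supported_integrable, rule supported_off_zero[OF _ d(1)])
  show "continuous_on (- {0}) (\<lambda>z. M k js ls z * F z)"
    using F M_cont by (auto simp: supported_def intro!: continuous_intros intro: continuous_on_subset)
  show "\<And>x. norm x < \<delta> \<Longrightarrow> M k js ls x * F x = 0" using d by simp
  show "\<And>x. norm x > R \<Longrightarrow> M k js ls x * F x = 0" using F by (simp add: supported_def)
qed

text \<open>Weak closedness of the current with coefficients \<open>M k\<close> away from the origin. In the induction step the closedness
  of \<open>M k\<close> is applied to \<open>w p * dzbar b f\<close>, which is only \<open>C\<^sup>1\<close>; this is why the test functions are \<open>C\<^sup>1\<close>.\<close>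

lemma M_closed_dzbar:
  assumes "supportedC1 R g" "\<delta> > 0" "\<And>z. norm z < \<delta> \<Longrightarrow> g z = 0"
  shows "(\<Sum>b\<in>UNIV. LINT z|lborel. M k js (b # ls) z * dzbar b g z) = 0"
  using assms
proof (induction k arbitrary: js ls g R \<delta>)
  case 0
  then show ?case by (simp add: integral_dzbar_zero)
next
  case (Suc k)
  have smooth: "(\<Sum>b\<in>UNIV. LINT z|lborel. M (Suc k) js (b # ls) z * dzbar b f z) = 0"
    if f: "f \<in> smooth_test_functions" and f1: "supportedC1 R' f" and d: "\<delta>' > 0" "\<And>z. norm z < \<delta>' \<Longrightarrow> f z = 0" for f R' \<delta>'
  proof -
    define X where "X p b q = (LINT z|lborel. M k (p # js) (q # b # ls) z * (h p q z * dzbar b f z))" for p b q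
    define Y where "Y p b q = (LINT z|lborel. M k (p # js) (q # b # ls) z * (w p z * dzbar q (dzbar b f) z))" for p b q
    obtain Rb where Rb: "\<And>b. supportedC1 (Rb b) (dzbar b f)" using smooth_supportedC1(1)[OF smooth_dzbar[OF f]] by metis
    have nz: "dzbar b f z = 0" if "norm z < \<delta>'" for b z using dzbar_near_zero(1)[OF d(2) that] .
    have nz2: "dzbar q (dzbar b f) z = 0" if "norm z < \<delta>'" for b q z using dzbar_near_zero(1)[OF nz that] .
    have sup1: "supported (Rb b) (\<lambda>z. h p q z * dzbar b f z)" for p b q
      by (rule supported_off_zero[OF _ d(1)])
         (use Rb[of b] nz h_cont in \<open>auto simp: supportedC1_def supported_def intro!: continuous_intros intro: continuous_on_subset\<close>)
    have sup2: "supported (Rb b) (\<lambda>z. w p z * dzbar q (dzbar b f) z)" for p b q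
      by (rule supported_off_zero[OF _ d(1)])
         (use dzbar_supported[OF Rb[of b]] nz2 w_cont in \<open>auto simp: supported_def intro!: continuous_intros intro: continuous_on_subset\<close>)
    have int1: "integrable lborel (\<lambda>z. M k (p # js) (q # b # ls) z * (h p q z * dzbar b f z))" for p b q
      by (rule M_mult_integrable[OF sup1 d(1)]) (simp add: nz)
    have int2: "integrable lborel (\<lambda>z. M k (p # js) (q # b # ls) z * (w p z * dzbar q (dzbar b f) z))" for p b q
      by (rule M_mult_integrable[OF sup2 d(1)]) (simp add: nz2)
    \<comment> \<open>Closedness of \<open>M k\<close> for the C^1 function
      \<open>w p * dbar_b f\<close>: the product rule yields the Hessian entry times a first
      derivative and \<open>w p\<close> times a second derivative, so the singular factor h is
      exchanged for w at the price of one more derivative on f.\<close>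
    have XY: "(\<Sum>q\<in>UNIV. X p b q) = - (\<Sum>q\<in>UNIV. Y p b q)" for p b
    proof -
      have C1: "supportedC1 (Rb b) (\<lambda>z. w p z * dzbar b f z)"
        by (rule supportedC1_mult_off_zero(1)[where g="w p" and g'="dw p", OF w_deriv dw_cont Rb d(1) nz])
      have C2: "ddir (\<lambda>z. w p z * dzbar b f z) v z = w p z * ddir (dzbar b f) v z + dw p z v * dzbar b f z" for v z
        by (rule supportedC1_mult_off_zero(2)[where g="w p" and g'="dw p", OF w_deriv dw_cont Rb d(1) nz])
      have e: "dzbar q (\<lambda>z. w p z * dzbar b f z) z = w p z * dzbar q (dzbar b f) z + h p q z * dzbar b f z" for q z
        unfolding dzbar_ddir[of _ "\<lambda>z. w p z * dzbar b f z"] dzbar_ddir[of _ "dzbar b f"] C2 dw_h[symmetric] by (simp add: field_simps)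
      have "(\<Sum>q\<in>UNIV. LINT z|lborel. M k (p # js) (q # b # ls) z * dzbar q (\<lambda>z. w p z * dzbar b f z) z) = 0"
        by (rule Suc.IH[OF C1 d(1)]) (simp add: nz)
      then have "(\<Sum>q\<in>UNIV. Y p b q + X p b q) = 0"
        unfolding e distrib_left X_def Y_def using int1 int2 by simp
      then show ?thesis by (simp add: sum.distrib add_eq_0_iff)
    qed
    have "(\<Sum>b\<in>UNIV. LINT z|lborel. M (Suc k) js (b # ls) z * dzbar b f z) = (\<Sum>b\<in>UNIV. \<Sum>p\<in>UNIV. \<Sum>q\<in>UNIV. X p b q)"
    proof (rule sum.cong[OF refl])
      fix b
      have "(LINT z|lborel. M (Suc k) js (b # ls) z * dzbar b f z)
          = (LINT z|lborel. (\<Sum>p\<in>UNIV. \<Sum>q\<in>UNIV. M k (p # js) (q # b # ls) z * (h p q z * dzbar b f z)))"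
        by (simp only: M.simps sum_distrib_right) (simp only: mult_ac)
      also have "\<dots> = (\<Sum>p\<in>UNIV. \<Sum>q\<in>UNIV. X p b q)" unfolding X_def using int1 by simp
      finally show "(LINT z|lborel. M (Suc k) js (b # ls) z * dzbar b f z) = (\<Sum>p\<in>UNIV. \<Sum>q\<in>UNIV. X p b q)" .
    qed
    also have "\<dots> = - (\<Sum>b\<in>UNIV. \<Sum>p\<in>UNIV. \<Sum>q\<in>UNIV. Y p b q)" by (simp add: XY sum_negf)
    also have "(\<Sum>b\<in>UNIV. \<Sum>p\<in>UNIV. \<Sum>q\<in>UNIV. Y p b q) = (\<Sum>p\<in>UNIV. \<Sum>b\<in>UNIV. \<Sum>q\<in>UNIV. Y p b q)" by (rule sum.swap)
    also have "\<dots> = 0"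
    proof (rule sum.neutral, rule ballI)
      fix p
      show "(\<Sum>b\<in>UNIV. \<Sum>q\<in>UNIV. Y p b q) = 0"
      proof (rule sum_antisym_zero)
        fix a b
        \<comment> \<open>\<open>M\<close> changes sign when the two indices are exchanged, whereas
          the second antiholomorphic derivatives of a smooth f commute.\<close>
        show "Y p a b = - Y p b a"
          unfolding Y_def using M_swap[of k "p # js" "[]" b a ls] by (simp add: smooth_dzbar_commute[OF f, of b a])
      qed
    qed
    finally show ?thesis by simp
  qed
  \<comment> \<open>From smooth f to the C^1 function g by dominated convergence. All approximants
    vanish for |z| < \<delta>/2, where the singularity of \<open>M\<close> sits, so a multiple of
    the indicator of a ball dominates.\<close>
  obtain f where f: "\<And>j. f j \<in> smooth_test_functions" "\<And>j. supportedC1 (R + 1) (f j)" "\<And>j z. norm z < \<delta> / 2 \<Longrightarrow> f j z = 0"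
    and lim: "\<And>v z. (\<lambda>j. ddir (f j) v z) \<longlonglongrightarrow> ddir g v z" and bnd: "\<And>v. \<exists>K. \<forall>j z. norm (ddir (f j) v z) \<le> K"
    using smooth_C1_approx[OF Suc.prems] by blast
  have d2: "\<delta> / 2 > 0" using Suc.prems by simp
  have lim': "(\<lambda>j. LINT z|lborel. M (Suc k) js (b # ls) z * dzbar b (f j) z) \<longlonglongrightarrow> (LINT z|lborel. M (Suc k) js (b # ls) z * dzbar b g z)" for b
  proof -
    obtain A where A: "A \<ge> 0" "\<And>z. z \<noteq> 0 \<Longrightarrow> norm (M (Suc k) js (b # ls) z) \<le> A * inverse (norm z) ^ Suc k" using M_bound by blast
    obtain K1 K2 where K: "\<And>j z. norm (ddir (f j) (axis b 1) z) \<le> K1" "\<And>j z. norm (ddir (f j) (axis b \<i>) z) \<le> K2" using bnd by metis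
    have K0: "0 \<le> K1 + K2" using K[of 0 0] norm_ge_zero order_trans add_nonneg_nonneg by metis
    have dzb: "norm (dzbar b (f j) z) \<le> K1 + K2" for j z
    proof -
      have "norm (dzbar b (f j) z) \<le> (norm (ddir (f j) (axis b 1) z) + norm (ddir (f j) (axis b \<i>) z)) / 2"
        unfolding dzbar_ddir norm_divide using norm_triangle_ineq[of "ddir (f j) (axis b 1) z" "\<i> * ddir (f j) (axis b \<i>) z"] by (simp add: norm_mult)
      also have "\<dots> \<le> norm (ddir (f j) (axis b 1) z) + norm (ddir (f j) (axis b \<i>) z)" by simp
      also have "\<dots> \<le> K1 + K2" by (intro add_mono K)
      finally show ?thesis .
    qed
    define D where "D = A * inverse (\<delta> / 2) ^ Suc k * (K1 + K2)"
    show ?thesis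
    proof (rule integral_dominated_convergence[where w="\<lambda>z. D * indicator (cball 0 (R + 1)) z"])
      show "(\<lambda>z. M (Suc k) js (b # ls) z * dzbar b g z) \<in> borel_measurable lborel"
        using M_meas supported_measurable[OF dzbar_supported[OF Suc.prems(1)]] by (simp del: M.simps)
      show "(\<lambda>z. M (Suc k) js (b # ls) z * dzbar b (f j) z) \<in> borel_measurable lborel" for j
        using M_meas supported_measurable[OF dzbar_supported[OF f(2)]] by (simp del: M.simps)
      show "integrable lborel (\<lambda>z :: complex^'n. D * indicator (cball 0 (R + 1)) z :: real)"
        by (intro integrable_mult_right integrable_real_indicator) (auto simp: emeasure_cball_less_top)
      show "AE z in lborel. (\<lambda>j. M (Suc k) js (b # ls) z * dzbar b (f j) z) \<longlonglongrightarrow> M (Suc k) js (b # ls) z * dzbar b g z"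
        unfolding dzbar_ddir by (intro always_eventually allI tendsto_intros lim) auto
      show "AE z in lborel. norm (M (Suc k) js (b # ls) z * dzbar b (f j) z) \<le> D * indicator (cball 0 (R + 1)) z" for j
      proof (intro always_eventually allI)
        fix z :: "complex^'n"
        consider "norm z < \<delta> / 2" | "norm z > R + 1" | "\<delta> / 2 \<le> norm z" "norm z \<le> R + 1" by linarith
        then show "norm (M (Suc k) js (b # ls) z * dzbar b (f j) z) \<le> D * indicator (cball 0 (R + 1)) z"
        proof cases
          case 1
          have "dzbar b (f j) z = 0" by (rule dzbar_near_zero(1)[of "\<delta> / 2"]) (use f(3) 1 in auto)
          then show ?thesis using A K0 d2 by (simp add: D_def del: M.simps)
        next
          case 2
          then have "dzbar b (f j) z = 0" using dzbar_supported[OF f(2)] by (simp add: supported_def)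
          then show ?thesis using 2 by (simp del: M.simps)
        next
          case 3
          then have z: "z \<noteq> 0" using d2 by auto
          have "inverse (norm z) ^ Suc k \<le> inverse (\<delta> / 2) ^ Suc k" using 3 d2 z by (intro power_mono le_imp_inverse_le) auto
          then have "norm (M (Suc k) js (b # ls) z) \<le> A * inverse (\<delta> / 2) ^ Suc k"
            using A(2)[OF z] mult_left_mono[OF _ A(1)] order_trans by blast
          then have "norm (M (Suc k) js (b # ls) z * dzbar b (f j) z) \<le> D"
            unfolding D_def norm_mult using dzb[of j z] A d2 by (intro mult_mono) (auto simp del: M.simps)
          then show ?thesis using 3 by (simp del: M.simps)
        qed
      qed
    qed
  qed
  have "(\<lambda>j. \<Sum>b\<in>UNIV. LINT z|lborel. M (Suc k) js (b # ls) z * dzbar b (f j) z) \<longlonglongrightarrow> (\<Sum>b\<in>UNIV. LINT z|lborel. M (Suc k) js (b # ls) z * dzbar b g z)"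
    by (intro tendsto_sum lim')
  moreover have z: "(\<Sum>b\<in>UNIV. LINT z|lborel. M (Suc k) js (b # ls) z * dzbar b (f j) z) = 0" for j
    by (rule smooth[OF f(1,2) d2 f(3)])
  ultimately have "(\<lambda>j::nat. 0) \<longlonglongrightarrow> (\<Sum>b\<in>UNIV. LINT z|lborel. M (Suc k) js (b # ls) z * dzbar b g z)"
    by (simp only: z)
  then show ?case by (simp only: LIMSEQ_const_iff)
qed

lemma M_closed_dz:
  assumes g: "supportedC1 R g" and d: "\<delta> > 0" "\<And>z. norm z < \<delta> \<Longrightarrow> g z = 0"
  shows "(\<Sum>a\<in>UNIV. LINT z|lborel. M k (a # js) ls z * dz a g z) = 0"
proof -
  have "cnj (\<Sum>a\<in>UNIV. LINT z|lborel. M k (a # js) ls z * dz a g z)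
      = (\<Sum>a\<in>UNIV. LINT z|lborel. cnj (M k (a # js) ls z * dz a g z))"
    by (simp add: integral_cnj[symmetric] del: complex_cnj_mult)
  also have "\<dots> = (\<Sum>a\<in>UNIV. LINT z|lborel. M k ls (a # js) z * dzbar a (\<lambda>z. cnj (g z)) z)"
    by (simp add: M_cnj dzbar_cnj[OF g])
  also have "\<dots> = 0" by (rule M_closed_dzbar[OF supportedC1_cnj(1)[OF g] d(1)]) (use d in simp)
  finally show ?thesis by (simp only: complex_cnj_zero_iff)
qed

end

lemma smooth_supportedC1':
  fixes f :: "'a::euclidean_space \<Rightarrow> complex"
  assumes f: "f \<in> smooth_test_functions" and R: "supported R f" shows "supportedC1 R f"
proof -
  obtain R' where R': "supportedC1 R' f" using smooth_supportedC1(1)[OF f] by blast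
  have c: "continuous_on UNIV (\<lambda>x. ddir f v x)" for v using R' by (simp add: supportedC1_def supported_def)
  show ?thesis by (rule supportedC1I(1)[OF R supportedC1_der[OF R'] c])
qed

lemma cutoff_has_derivative:
  assumes e: "\<epsilon> > 0" shows "(cutoff \<epsilon> has_derivative dcutoff \<epsilon> z) (at z)"
proof (cases "z = 0")
  case True
  have "(cutoff \<epsilon> has_derivative (\<lambda>v. 0)) (at z)"
    by (rule ddir_near_zero(1)[of \<epsilon>]) (use cutoff_small(1)[OF e] True e in auto)
  moreover have "dcutoff \<epsilon> z = (\<lambda>v. 0)" using True by (simp add: dcutoff_def fun_eq_iff)
  ultimately show ?thesis by simp
qed (rule cutoff_derivative)

lemma cutoff_mult:
  fixes f :: "'a::euclidean_space \<Rightarrow> complex"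
  assumes e: "\<epsilon> > 0" and f: "supportedC1 R f"
  shows "supportedC1 R (\<lambda>z. cutoff \<epsilon> z * f z)"
    "\<And>z v. ddir (\<lambda>z. cutoff \<epsilon> z * f z) v z = cutoff \<epsilon> z * ddir f v z + dcutoff \<epsilon> z v * f z"
proof -
  have der: "((\<lambda>z. cutoff \<epsilon> z * f z) has_derivative (\<lambda>v. cutoff \<epsilon> z * ddir f v z + dcutoff \<epsilon> z v * f z)) (at z)" for z
    by (rule has_derivative_mult[OF cutoff_has_derivative[OF e] supportedC1_der[OF f]])
  have cc: "continuous_on UNIV (cutoff \<epsilon> :: 'a \<Rightarrow> complex)"
    using cutoff_has_derivative[OF e] by (auto intro!: continuous_at_imp_continuous_on has_derivative_continuous)
  have dc: "continuous_on UNIV (\<lambda>z::'a. dcutoff \<epsilon> z v)" for v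
  proof -
    have "continuous_on (ball 0 \<epsilon>) (\<lambda>z::'a. dcutoff \<epsilon> z v)"
      by (rule continuous_on_eq[OF continuous_on_const[of _ 0]]) (use cutoff_small(2)[OF e] in auto)
    then have "continuous_on (- {0} \<union> ball 0 \<epsilon>) (\<lambda>z::'a. dcutoff \<epsilon> z v)" using dcutoff_cont by (intro continuous_on_open_Un) auto
    moreover have "- {0} \<union> ball 0 \<epsilon> = (UNIV :: 'a set)" using e by auto
    ultimately show ?thesis by simp
  qed
  have cf: "continuous_on UNIV f" "\<And>v. continuous_on UNIV (ddir f v)" and f0: "\<And>z. norm z > R \<Longrightarrow> f z = 0"
    using f by (auto simp: supportedC1_def supported_def)
  have s: "supported R (\<lambda>z. cutoff \<epsilon> z * f z)" using cc cf f0 by (auto simp: supported_def intro!: continuous_intros)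
  have c: "continuous_on UNIV (\<lambda>z. cutoff \<epsilon> z * ddir f v z + dcutoff \<epsilon> z v * f z)" for v by (intro continuous_intros cc dc cf)
  note * = supportedC1I[OF s der c]
  show "supportedC1 R (\<lambda>z. cutoff \<epsilon> z * f z)" by (rule *(1))
  show "ddir (\<lambda>z. cutoff \<epsilon> z * f z) v z = cutoff \<epsilon> z * ddir f v z + dcutoff \<epsilon> z v * f z" for z v using *(2)[of v] by simp
qed

lemma norm_axis: "norm (axis p x :: complex^'n::finite) = norm x"
  by (simp add: norm_eq_sqrt_inner inner_axis_axis)

definition dz_cutoff :: "'n \<Rightarrow> real \<Rightarrow> complex^'n::finite \<Rightarrow> complex" where
  "dz_cutoff p \<epsilon> z = (dcutoff \<epsilon> z (axis p 1) - \<i> * dcutoff \<epsilon> z (axis p \<i>)) / 2"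

definition dzbar_cutoff :: "'n \<Rightarrow> real \<Rightarrow> complex^'n::finite \<Rightarrow> complex" where
  "dzbar_cutoff p \<epsilon> z = (dcutoff \<epsilon> z (axis p 1) + \<i> * dcutoff \<epsilon> z (axis p \<i>)) / 2"

lemma dz_cutoff_bounds:
  assumes "\<epsilon> > 0" "z \<noteq> 0"
  shows "norm (dz_cutoff p \<epsilon> z) \<le> 4 * inverse (norm z)" "norm (dzbar_cutoff p \<epsilon> z) \<le> 4 * inverse (norm z)"
proof -
  have a: "norm (dcutoff \<epsilon> z (axis p 1)) \<le> 4 * inverse (norm z)" "norm (\<i> * dcutoff \<epsilon> z (axis p \<i>)) \<le> 4 * inverse (norm z)"
    using cutoff_bounds(2)[OF assms, of "axis p 1"] cutoff_bounds(2)[OF assms, of "axis p \<i>"] by (simp_all add: norm_mult norm_axis)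
  show "norm (dz_cutoff p \<epsilon> z) \<le> 4 * inverse (norm z)"
    using norm_triangle_ineq4[of "dcutoff \<epsilon> z (axis p 1)" "\<i> * dcutoff \<epsilon> z (axis p \<i>)"] a by (simp add: dz_cutoff_def norm_divide)
  show "norm (dzbar_cutoff p \<epsilon> z) \<le> 4 * inverse (norm z)"
    using norm_triangle_ineq[of "dcutoff \<epsilon> z (axis p 1)" "\<i> * dcutoff \<epsilon> z (axis p \<i>)"] a by (simp add: dzbar_cutoff_def norm_divide)
qed

lemma dz_cutoff_limits:
  assumes z: "z \<noteq> 0"
  shows "(\<lambda>j. dz_cutoff p (1 / real (Suc j)) z) \<longlonglongrightarrow> 0" "(\<lambda>j. dzbar_cutoff p (1 / real (Suc j)) z) \<longlonglongrightarrow> 0"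
proof -
  have "(\<lambda>j. dz_cutoff p (1 / real (Suc j)) z) \<longlonglongrightarrow> (0 - \<i> * 0) / 2" "(\<lambda>j. dzbar_cutoff p (1 / real (Suc j)) z) \<longlonglongrightarrow> (0 + \<i> * 0) / 2"
    unfolding dz_cutoff_def dzbar_cutoff_def by (intro tendsto_intros cutoff_limits z; simp)+
  then show "(\<lambda>j. dz_cutoff p (1 / real (Suc j)) z) \<longlonglongrightarrow> 0" "(\<lambda>j. dzbar_cutoff p (1 / real (Suc j)) z) \<longlonglongrightarrow> 0" by simp_all
qed

context homogeneous_potential begin

lemma M_integrable:
  assumes k: "k < DIM(complex^'n)" and f: "supported R f"
  shows "integrable lborel (\<lambda>z. M k js ls z * f z)"
proof -
  obtain A where A: "A \<ge> 0" "\<And>z. z \<noteq> 0 \<Longrightarrow> norm (M k js ls z) \<le> A * inverse (norm z) ^ k" using M_bound by blast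
  obtain K where K: "K > 0" "\<And>z. norm (f z) \<le> K" using supported_bounded[OF f] by blast
  show ?thesis
  proof (rule integrable_singular[OF _ k])
    show "continuous_on (- {0}) (\<lambda>z. M k js ls z * f z)"
      using f M_cont by (auto simp: supported_def intro!: continuous_intros intro: continuous_on_subset)
    show "norm (M k js ls z * f z) \<le> (A * K) * inverse (norm z) ^ k" if "z \<noteq> 0" for z
    proof -
      have "norm (M k js ls z * f z) \<le> (A * inverse (norm z) ^ k) * K"
        unfolding norm_mult using A(2)[OF that] K A(1) by (intro mult_mono) auto
      then show ?thesis by (simp add: mult_ac)
    qed
    show "\<And>x. norm x > R \<Longrightarrow> M k js ls x * f x = 0" using f by (simp add: supported_def)
  qed
qed

text \<open>The recursion dd^c (u T) = S for the densities, across the origin. Two integrations by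
  parts move one derivative from f to u and the next to w, each an application of closedness of
  \<open>M k\<close> to a product with a cutoff. The derivatives of the cutoff cost a factor 1/|z|,
  so every term is at most of order |z|^(-(k+1)), integrable since k + 1 < 2n, and the cutoff terms
  tend to 0 pointwise: no mass appears at the origin.\<close>

lemma M_identity:
  assumes k: "k < CARD('n)" and f: "f \<in> smooth_test_functions"
  shows "(\<Sum>p\<in>UNIV. \<Sum>q\<in>UNIV. LINT z|lborel. M k (p # js) (q # ls) z * (of_real (u z) * dz p (dzbar q f) z))
    = (LINT z|lborel. M (Suc k) js ls z * f z)"
proof -
  obtain R where R: "R > 0" "supported R f" using f by (auto simp: smooth_test_functions_def test_functions_supported)
  have f1: "supportedC1 R f" by (rule smooth_supportedC1'[OF f R(2)])
  have fq1: "supportedC1 R (dzbar q f)" for q by (rule smooth_supportedC1'[OF smooth_dzbar[OF f] dzbar_supported[OF f1]])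
  have fq: "supported R (dzbar q f)" for q using fq1 by (simp add: supportedC1_def)
  have fpq: "supported R (dz p (dzbar q f))" for p q by (rule dz_supported[OF fq1])
  have dim: "Suc k < DIM(complex^'n)" using k by simp
  have cont0: "continuous_on (- {0}) g" if "supported R g" for g :: "complex^'n \<Rightarrow> complex"
    using that by (auto simp: supported_def intro: continuous_on_subset)
  define L where "L p q z = M k (p # js) (q # ls) z * (of_real (u z) * dz p (dzbar q f) z - h p q z * f z)" for p q z
  define \<epsilon> where "\<epsilon> j = 1 / real (Suc j)" for j
  have \<epsilon>: "\<epsilon> j > 0" for j by (simp add: \<epsilon>_def)
  \<comment> \<open>The two C^1 functions to which closedness is applied: \<open>gA\<close> in the
    holomorphic direction p, and \<open>gB\<close> in the antiholomorphic direction q.\<close>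
  define gA where "gA j q z = of_real (u z) * (cutoff (\<epsilon> j) z * dzbar q f z)" for j q z
  define gB where "gB j p z = w p z * (cutoff (\<epsilon> j) z * f z)" for j p z
  define \<Phi> where "\<Phi> j p q z = M k (p # js) (q # ls) z * (dz p (gA j q) z - dzbar q (gB j p) z)" for j p q z
  have cz: "cutoff (\<epsilon> j) z * g z = 0" if "norm z < \<epsilon> j" for j z and g :: "complex^'n \<Rightarrow> complex"
    using cutoff_small(1)[OF \<epsilon> that] by simp
  have gA1: "supportedC1 R (gA j q)" and gA2: "ddir (gA j q) v z = of_real (u z) * (cutoff (\<epsilon> j) z * ddir (dzbar q f) v z + dcutoff (\<epsilon> j) z v * dzbar q f z) + du z v * (cutoff (\<epsilon> j) z * dzbar q f z)" for j q v z
  proof -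
    note C = supportedC1_mult_off_zero[where g="\<lambda>z. of_real (u z)" and g'="du" and \<delta>="\<epsilon> j" and R=R and f="\<lambda>z. cutoff (\<epsilon> j) z * dzbar q f z",
        OF _ _ cutoff_mult(1)[OF \<epsilon> fq1] \<epsilon>]
    show "supportedC1 R (gA j q)" unfolding gA_def by (rule C(1)) (use u_deriv du_cont cz in auto)
    show "ddir (gA j q) v z = of_real (u z) * (cutoff (\<epsilon> j) z * ddir (dzbar q f) v z + dcutoff (\<epsilon> j) z v * dzbar q f z) + du z v * (cutoff (\<epsilon> j) z * dzbar q f z)"
      unfolding gA_def cutoff_mult(2)[OF \<epsilon> fq1, symmetric] by (rule C(2)) (use u_deriv du_cont cz in auto)
  qed
  have gB1: "supportedC1 R (gB j p)" and gB2: "ddir (gB j p) v z = w p z * (cutoff (\<epsilon> j) z * ddir f v z + dcutoff (\<epsilon> j) z v * f z) + dw p z v * (cutoff (\<epsilon> j) z * f z)" for j p v z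
  proof -
    note C = supportedC1_mult_off_zero[where g="w p" and g'="dw p" and \<delta>="\<epsilon> j" and R=R and f="\<lambda>z. cutoff (\<epsilon> j) z * f z",
        OF _ _ cutoff_mult(1)[OF \<epsilon> f1] \<epsilon>]
    show "supportedC1 R (gB j p)" unfolding gB_def by (rule C(1)) (use w_deriv dw_cont cz in auto)
    show "ddir (gB j p) v z = w p z * (cutoff (\<epsilon> j) z * ddir f v z + dcutoff (\<epsilon> j) z v * f z) + dw p z v * (cutoff (\<epsilon> j) z * f z)"
      unfolding gB_def cutoff_mult(2)[OF \<epsilon> f1, symmetric] by (rule C(2)) (use w_deriv dw_cont cz in auto)
  qed
  have gA0: "gA j q z = 0" and gB0: "gB j p z = 0" if "norm z < \<epsilon> j" for j p q z
    using cz[OF that] by (auto simp: gA_def gB_def)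
  \<comment> \<open>The products of \<open>w p\<close>, the cutoff and the first derivative of f
    occur in both divergences and cancel in the difference.\<close>
  have \<Phi>_eq: "\<Phi> j p q z = M k (p # js) (q # ls) z * (cutoff (\<epsilon> j) z * (of_real (u z) * dz p (dzbar q f) z - h p q z * f z)
      + dz_cutoff p (\<epsilon> j) z * of_real (u z) * dzbar q f z - dzbar_cutoff q (\<epsilon> j) z * w p z * f z)" if z: "z \<noteq> 0" for j p q z
  proof -
    have "dz p (gA j q) z = of_real (u z) * (cutoff (\<epsilon> j) z * dz p (dzbar q f) z + dz_cutoff p (\<epsilon> j) z * dzbar q f z) + w p z * (cutoff (\<epsilon> j) z * dzbar q f z)"
      unfolding dz_ddir[of p "gA j q"] dz_ddir[of p "dzbar q f"] gA2 dz_cutoff_def du_w[OF z, symmetric] by (simp add: field_simps)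
    moreover have "dzbar q (gB j p) z = w p z * (cutoff (\<epsilon> j) z * dzbar q f z + dzbar_cutoff q (\<epsilon> j) z * f z) + h p q z * (cutoff (\<epsilon> j) z * f z)"
      unfolding dzbar_ddir[of q "gB j p"] dzbar_ddir[of q f] gB2 dzbar_cutoff_def dw_h[symmetric] by (simp add: field_simps)
    ultimately show ?thesis unfolding \<Phi>_def by (simp add: algebra_simps)
  qed
  have \<Phi>0: "\<Phi> j p q z = 0" if "norm z < \<epsilon> j" for j p q z
    unfolding \<Phi>_def using dzbar_near_zero(2)[OF gA0 that] dzbar_near_zero(1)[OF gB0 that] by simp
  have intA: "integrable lborel (\<lambda>z. M k (p # js) (q # ls) z * dz p (gA j q) z)" for j p q
    by (rule M_mult_integrable[OF dz_supported[OF gA1] \<epsilon>]) (rule dzbar_near_zero(2)[OF gA0])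
  have intB: "integrable lborel (\<lambda>z. M k (p # js) (q # ls) z * dzbar q (gB j p) z)" for j p q
    by (rule M_mult_integrable[OF dzbar_supported[OF gB1] \<epsilon>]) (rule dzbar_near_zero(1)[OF gB0])
  \<comment> \<open>For fixed q the first part sums to 0 over p, for fixed p the second part sums to
    0 over q.\<close>
  have sum0: "(\<Sum>p\<in>UNIV. \<Sum>q\<in>UNIV. LINT z|lborel. \<Phi> j p q z) = 0" for j
  proof -
    have A: "(\<Sum>p\<in>UNIV. LINT z|lborel. M k (p # js) (q # ls) z * dz p (gA j q) z) = 0" for q
      by (rule M_closed_dz[OF gA1 \<epsilon> gA0])
    have B: "(\<Sum>q\<in>UNIV. LINT z|lborel. M k (p # js) (q # ls) z * dzbar q (gB j p) z) = 0" for p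
      by (rule M_closed_dzbar[OF gB1 \<epsilon> gB0])
    have "(\<Sum>p\<in>UNIV. \<Sum>q\<in>UNIV. LINT z|lborel. \<Phi> j p q z)
       = (\<Sum>p\<in>UNIV. \<Sum>q\<in>UNIV. LINT z|lborel. M k (p # js) (q # ls) z * dz p (gA j q) z)
       - (\<Sum>p\<in>UNIV. \<Sum>q\<in>UNIV. LINT z|lborel. M k (p # js) (q # ls) z * dzbar q (gB j p) z)"
      unfolding \<Phi>_def right_diff_distrib using intA intB by (simp add: sum_subtractf)
    also have "\<dots> = (\<Sum>q\<in>UNIV. \<Sum>p\<in>UNIV. LINT z|lborel. M k (p # js) (q # ls) z * dz p (gA j q) z)"
      unfolding B by (subst sum.swap) simp
    also have "\<dots> = 0" unfolding A by simp
    finally show ?thesis .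
  qed
  have lim: "(\<lambda>j. LINT z|lborel. \<Phi> j p q z) \<longlonglongrightarrow> (LINT z|lborel. L p q z)" for p q
  proof -
    obtain A where A: "A \<ge> 0" "\<And>z. z \<noteq> 0 \<Longrightarrow> norm (M k (p # js) (q # ls) z) \<le> A * inverse (norm z) ^ k" using M_bound by blast
    obtain K1 K2 K3 where K': "K1 > 0" "\<And>z. norm (f z) \<le> K1" "K2 > 0" "\<And>z. norm (dzbar q f z) \<le> K2" "K3 > 0" "\<And>z. norm (dz p (dzbar q f) z) \<le> K3"
      using supported_bounded[OF R(2)] supported_bounded[OF fq] supported_bounded[OF fpq] by metis
    define K where "K = K1 + K2 + K3"
    have K: "K > 0" "norm (f z) \<le> K" "norm (dzbar q f z) \<le> K" "norm (dz p (dzbar q f) z) \<le> K" for z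
      using K'(1,3,5) K'(2)[of z] K'(4)[of z] K'(6)[of z] unfolding K_def by linarith+
    \<comment> \<open>The four summands in the last factor belong, in order, to u times the second
      derivative of f, to the Hessian term, to the cutoff derivative times u, and to the cutoff
      derivative times w. Inside the ball 1 is at most R / |z|, which brings all of them to the same
      power of |z|.\<close>
    define D where "D = A * (B * K * (R * R + 1 + 4 * R + 4))"
    have D: "D \<ge> 0" using A B0 K R unfolding D_def by (intro mult_nonneg_nonneg add_nonneg_nonneg) auto
    have bound: "norm (\<Phi> j p q z) \<le> D * (indicator (cball 0 R) z * inverse (norm z) ^ Suc k)" if z: "z \<noteq> 0" for j z
    proof (cases "norm z \<le> R")
      case False
      then have "f z = 0" "dzbar q f z = 0" "dz p (dzbar q f) z = 0" using R(2) fq fpq by (auto simp: supported_def)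
      then show ?thesis unfolding \<Phi>_eq[OF z] using False by simp
    next
      case True
      define s where "s = inverse (norm z)"
      have s: "s > 0" "norm z * s = 1" using z by (auto simp: s_def)
      have Rs: "1 \<le> R * s" using mult_right_mono[OF True, of s] s by simp
      have zR: "norm z \<le> R * R * s" using mult_mono[OF True Rs] R(1) s by (simp add: mult_ac)
      have cu: "norm (cutoff (\<epsilon> j) z) \<le> 1" by (rule cutoff_bounds(1)[OF \<epsilon> z])
      have t1: "norm (cutoff (\<epsilon> j) z * (of_real (u z) * dz p (dzbar q f) z - h p q z * f z)) \<le> B * K * (R * R * s + s)"
      proof -
        have "norm (of_real (u z) * dz p (dzbar q f) z) \<le> (B * norm z) * K"
          unfolding norm_mult using u_bound[of z] K(4)[of z] B0 by (intro mult_mono) auto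
        moreover have "norm (h p q z * f z) \<le> (B * s) * K"
          unfolding norm_mult s_def using h_bound[OF z] K(2)[of z] B0 by (intro mult_mono) auto
        ultimately have "norm (of_real (u z) * dz p (dzbar q f) z - h p q z * f z) \<le> (B * norm z) * K + (B * s) * K"
          using norm_triangle_ineq4 order_trans add_mono by metis
        also have "\<dots> = B * K * (norm z + s)" by (simp add: algebra_simps)
        also have "\<dots> \<le> B * K * (R * R * s + s)" using zR B0 K(1) by (intro mult_left_mono) auto
        finally have "norm (cutoff (\<epsilon> j) z) * norm (of_real (u z) * dz p (dzbar q f) z - h p q z * f z) \<le> 1 * (B * K * (R * R * s + s))"
          using cu by (intro mult_mono) auto
        then show ?thesis by (simp add: norm_mult)
      qed
      have t2: "norm (dz_cutoff p (\<epsilon> j) z * of_real (u z) * dzbar q f z) \<le> B * K * (4 * R * s)"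
      proof -
        have "norm (dz_cutoff p (\<epsilon> j) z * of_real (u z) * dzbar q f z) \<le> ((4 * s) * (B * norm z)) * K"
          unfolding norm_mult s_def using dz_cutoff_bounds(1)[OF \<epsilon> z, of p j] u_bound[of z] K(3)[of z] B0 by (intro mult_mono) auto
        also have "\<dots> = B * K * 4 * (norm z * s)" by simp
        also have "\<dots> \<le> B * K * 4 * (R * s)" unfolding s(2) using Rs B0 K(1) by (intro mult_left_mono) auto
        finally show ?thesis by (simp add: mult_ac)
      qed
      have t3: "norm (dzbar_cutoff q (\<epsilon> j) z * w p z * f z) \<le> B * K * (4 * s)"
      proof -
        have "norm (dzbar_cutoff q (\<epsilon> j) z * w p z * f z) \<le> ((4 * s) * B) * K"
          unfolding norm_mult s_def using dz_cutoff_bounds(2)[OF \<epsilon> z, of q j] w_bound[OF z, of p] K(2)[of z] B0 by (intro mult_mono) auto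
        then show ?thesis by (simp add: mult_ac)
      qed
      have "norm (cutoff (\<epsilon> j) z * (of_real (u z) * dz p (dzbar q f) z - h p q z * f z) + dz_cutoff p (\<epsilon> j) z * of_real (u z) * dzbar q f z - dzbar_cutoff q (\<epsilon> j) z * w p z * f z)
          \<le> B * K * (R * R * s + s) + B * K * (4 * R * s) + B * K * (4 * s)"
        by (rule order_trans[OF norm_triangle_ineq4 add_mono[OF order_trans[OF norm_triangle_ineq add_mono[OF t1 t2]] t3]])
      also have "\<dots> = B * K * (R * R + 1 + 4 * R + 4) * s" by (simp add: algebra_simps)
      finally have "norm (\<Phi> j p q z) \<le> (A * s ^ k) * (B * K * (R * R + 1 + 4 * R + 4) * s)"
        unfolding \<Phi>_eq[OF z] norm_mult[of "M k (p # js) (q # ls) z"] using A(2)[OF z] A(1) s(1) unfolding s_def[symmetric] by (intro mult_mono) auto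
      also have "\<dots> = D * s ^ Suc k" by (simp add: D_def)
      finally show ?thesis using True by (simp add: s_def)
    qed
    show ?thesis
    proof (rule integral_dominated_convergence[where w="\<lambda>z. D * (indicator (cball 0 R) z * inverse (norm z) ^ Suc k)"])
      have "continuous_on (- {0}) (L p q)"
        unfolding L_def using u_cont by (intro continuous_intros M_cont h_cont cont0[OF fpq] cont0[OF R(2)]) (auto intro: continuous_on_subset)
      then show "L p q \<in> borel_measurable lborel" using borel_measurable_off_zero by simp
      show "\<Phi> j p q \<in> borel_measurable lborel" for j
        unfolding \<Phi>_def using M_meas supported_measurable[OF dz_supported[OF gA1]] supported_measurable[OF dzbar_supported[OF gB1]]
        by (simp del: M.simps)
      show "integrable lborel (\<lambda>z::complex^'n. D * (indicator (cball 0 R) z * inverse (norm z) ^ Suc k))"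
        by (intro integrable_mult_right integrable_norm_power dim R(1))
      show "AE z in lborel. (\<lambda>j. \<Phi> j p q z) \<longlonglongrightarrow> L p q z"
      proof (rule eventually_mono[OF AE_lborel_singleton[of "0 :: complex^'n"]])
        fix z :: "complex^'n" assume z: "z \<noteq> 0"
        have "(\<lambda>j. M k (p # js) (q # ls) z * (cutoff (\<epsilon> j) z * (of_real (u z) * dz p (dzbar q f) z - h p q z * f z)
            + dz_cutoff p (\<epsilon> j) z * of_real (u z) * dzbar q f z - dzbar_cutoff q (\<epsilon> j) z * w p z * f z))
          \<longlonglongrightarrow> M k (p # js) (q # ls) z * (1 * (of_real (u z) * dz p (dzbar q f) z - h p q z * f z)
            + 0 * of_real (u z) * dzbar q f z - 0 * w p z * f z)"
          unfolding \<epsilon>_def by (intro tendsto_intros cutoff_limits[OF z] dz_cutoff_limits[OF z])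
        then show "(\<lambda>j. \<Phi> j p q z) \<longlonglongrightarrow> L p q z" by (simp add: \<Phi>_eq[OF z] L_def)
      qed
      show "AE z in lborel. norm (\<Phi> j p q z) \<le> D * (indicator (cball 0 R) z * inverse (norm z) ^ Suc k)" for j
        by (rule eventually_mono[OF AE_lborel_singleton[of "0 :: complex^'n"]]) (rule bound)
    qed
  qed
  have "(\<lambda>j. \<Sum>p\<in>UNIV. \<Sum>q\<in>UNIV. LINT z|lborel. \<Phi> j p q z) \<longlonglongrightarrow> (\<Sum>p\<in>UNIV. \<Sum>q\<in>UNIV. LINT z|lborel. L p q z)"
    by (intro tendsto_sum lim)
  then have L0: "(\<Sum>p\<in>UNIV. \<Sum>q\<in>UNIV. LINT z|lborel. L p q z) = 0" by (simp only: sum0 LIMSEQ_const_iff)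
  have usup: "supported R (\<lambda>z. of_real (u z) * dz p (dzbar q f) z)" for p q
    using fpq u_cont by (auto simp: supported_def intro!: continuous_intros)
  have int1: "integrable lborel (\<lambda>z. M k (p # js) (q # ls) z * (of_real (u z) * dz p (dzbar q f) z))" for p q
    by (rule M_integrable[OF _ usup]) (use dim in simp)
  have int2: "integrable lborel (\<lambda>z. M k (p # js) (q # ls) z * (h p q z * f z))" for p q
  proof -
    obtain A where A: "A \<ge> 0" "\<And>z. z \<noteq> 0 \<Longrightarrow> norm (M k (p # js) (q # ls) z) \<le> A * inverse (norm z) ^ k" using M_bound by blast
    obtain K where K: "K > 0" "\<And>z. norm (f z) \<le> K" using supported_bounded[OF R(2)] by blast
    show ?thesis
    proof (rule integrable_singular[OF _ dim])
      show "continuous_on (- {0}) (\<lambda>z. M k (p # js) (q # ls) z * (h p q z * f z))"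
        by (intro continuous_intros M_cont h_cont cont0[OF R(2)])
      show "norm (M k (p # js) (q # ls) z * (h p q z * f z)) \<le> (A * B * K) * inverse (norm z) ^ Suc k" if z: "z \<noteq> 0" for z
      proof -
        have "norm (M k (p # js) (q # ls) z * (h p q z * f z)) \<le> (A * inverse (norm z) ^ k) * ((B * inverse (norm z)) * K)"
          unfolding norm_mult using A(2)[OF z] h_bound[OF z] K(2) K(1) A(1) B0 by (intro mult_mono) auto
        then show ?thesis by (simp add: mult_ac)
      qed
      show "\<And>x. norm x > R \<Longrightarrow> M k (p # js) (q # ls) x * (h p q x * f x) = 0" using R(2) by (simp add: supported_def)
    qed
  qed
  have "(\<Sum>p\<in>UNIV. \<Sum>q\<in>UNIV. LINT z|lborel. M k (p # js) (q # ls) z * (of_real (u z) * dz p (dzbar q f) z))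
      - (\<Sum>p\<in>UNIV. \<Sum>q\<in>UNIV. LINT z|lborel. M k (p # js) (q # ls) z * (h p q z * f z)) = 0"
    using L0 int1 int2 unfolding L_def right_diff_distrib by (simp add: sum_subtractf)
  moreover have "(\<Sum>p\<in>UNIV. \<Sum>q\<in>UNIV. LINT z|lborel. M k (p # js) (q # ls) z * (h p q z * f z)) = (LINT z|lborel. M (Suc k) js ls z * f z)"
  proof -
    have "(LINT z|lborel. M (Suc k) js ls z * f z) = (LINT z|lborel. (\<Sum>p\<in>UNIV. \<Sum>q\<in>UNIV. M k (p # js) (q # ls) z * (h p q z * f z)))"
      by (simp only: M.simps sum_distrib_right) (simp only: mult_ac)
    also have "\<dots> = (\<Sum>p\<in>UNIV. \<Sum>q\<in>UNIV. LINT z|lborel. M k (p # js) (q # ls) z * (h p q z * f z))" using int2 by simp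
    finally show ?thesis by simp
  qed
  ultimately show ?thesis by simp
qed

lemma M_order_zero:
  assumes k: "k < DIM(complex^'n)"
  shows "order_zero (\<lambda>f. LINT z|lborel. M k js ls z * f z)"
  unfolding order_zero_def
proof (intro conjI allI ballI impI)
  have int: "integrable lborel (\<lambda>z. M k js ls z * f z)" if "f \<in> test_functions" for f
    using that M_integrable[OF k] unfolding test_functions_supported by blast
  fix f g :: "complex^'n \<Rightarrow> complex" assume "f \<in> test_functions" "g \<in> test_functions"
  then show "(LINT z|lborel. M k js ls z * (f z + g z)) = (LINT z|lborel. M k js ls z * f z) + (LINT z|lborel. M k js ls z * g z)"
    unfolding distrib_left using int by (simp del: M.simps)
next
  fix c and f :: "complex^'n \<Rightarrow> complex"
  have "(LINT z|lborel. M k js ls z * (c * f z)) = (LINT z|lborel. c * (M k js ls z * f z))" by (simp only: mult_ac)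
  then show "(LINT z|lborel. M k js ls z * (c * f z)) = c * (LINT z|lborel. M k js ls z * f z)" by (simp del: M.simps)
next
  fix S :: "(complex^'n) set" assume S: "compact S"
  obtain R where R: "R > 0" "\<And>x. x \<in> S \<Longrightarrow> norm x \<le> R" using compact_imp_bounded[OF S] bounded_pos by blast
  obtain A where A0: "A \<ge> 0 \<and> (\<forall>js ls z. z \<noteq> 0 \<longrightarrow> norm (M k js ls z) \<le> A * inverse (norm z) ^ k)"
    using M_bound[of k] by (rule exE)
  then have A: "A \<ge> 0" "\<And>z. z \<noteq> 0 \<Longrightarrow> norm (M k js ls z) \<le> A * inverse (norm z) ^ k" by simp_all
  define C where "C = (LINT z|lborel. A * (indicator (cball (0::complex^'n) R) z * inverse (norm z) ^ k))"
  have "cmod (LINT z|lborel. M k js ls z * f z) \<le> C * b" if f: "f \<in> test_functions" "\<forall>z. z \<notin> S \<longrightarrow> f z = 0" "\<forall>z. cmod (f z) \<le> b" for f b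
  proof -
    have b0: "b \<ge> 0" using f(3) norm_ge_zero order_trans by blast
    have int: "integrable lborel (\<lambda>z. M k js ls z * f z)" using f(1) M_integrable[OF k] unfolding test_functions_supported by blast
    have "cmod (LINT z|lborel. M k js ls z * f z) \<le> (LINT z|lborel. cmod (M k js ls z * f z))" by (rule integral_norm_bound)
    also have "\<dots> \<le> (LINT z|lborel. A * (indicator (cball (0::complex^'n) R) z * inverse (norm z) ^ k) * b)"
    proof (rule integral_mono_AE)
      show "integrable lborel (\<lambda>z. cmod (M k js ls z * f z))" using int by (rule integrable_norm)
      show "integrable lborel (\<lambda>z. A * (indicator (cball (0::complex^'n) R) z * inverse (norm z) ^ k) * b)"
        by (intro integrable_mult_right integrable_mult_left integrable_norm_power k R(1))
      show "AE z in lborel. cmod (M k js ls z * f z) \<le> A * (indicator (cball 0 R) z * inverse (norm z) ^ k) * b"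
      proof (rule eventually_mono[OF AE_lborel_singleton[of "0 :: complex^'n"]])
        fix z :: "complex^'n" assume z: "z \<noteq> 0"
        show "cmod (M k js ls z * f z) \<le> A * (indicator (cball 0 R) z * inverse (norm z) ^ k) * b"
        proof (cases "z \<in> S")
          case True
          then have "indicator (cball 0 R) z = (1::real)" using R(2) by simp
          moreover have "cmod (M k js ls z * f z) \<le> (A * inverse (norm z) ^ k) * b"
            unfolding norm_mult using A(2)[OF z] f(3) A(1) by (intro mult_mono) auto
          ultimately show ?thesis by simp
        next
          case False
          then show ?thesis using f(2) A(1) b0 by simp
        qed
      qed
    qed
    also have "\<dots> = C * b" unfolding C_def by (rule integral_mult_left_zero)
    finally show ?thesis .
  qed
  then show "\<exists>C. \<forall>f\<in>test_functions. \<forall>B. (\<forall>z. z \<notin> S \<longrightarrow> f z = 0) \<longrightarrow> (\<forall>z. cmod (f z) \<le> B) \<longrightarrow> cmod (LINT z|lborel. M k js ls z * f z) \<le> C * B"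
    by blast
qed

text \<open>The chain of currents is integration against \<open>M k\<close>; its links are
  \<open>M_identity\<close> and \<open>M_order_zero\<close>. Nothing is known about \<open>M\<close>
  at the origin, so reality and positivity are used almost everywhere.\<close>

lemma is_monge_ampere_density:
  assumes pos: "\<And>z. z \<noteq> 0 \<Longrightarrow> M CARD('n) [] [] z = of_real (m z) \<and> m z \<ge> 0"
  shows "is_monge_ampere u (density lborel (\<lambda>z. ennreal (Re (M CARD('n) [] [] z))))"
proof -
  have dim: "CARD('n) < DIM(complex^'n)" by simp
  define T :: "nat \<Rightarrow> 'n current" where "T k js ls f = (LINT z|lborel. M k js ls z * f z)" for k js ls f
  have T0: "T 0 = integration_current"
    by (intro ext) (simp add: T_def integration_current_coeff)
  have Tk: "ddc_product (CARD('n) - Suc k) u (T k) (T (Suc k))" if k: "k < CARD('n)" for k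
    unfolding ddc_product_def
  proof (intro allI impI conjI ballI)
    fix js ls :: "'n list"
    have "Suc k < DIM(complex^'n)" using k by simp
    then show "order_zero (T (Suc k) js ls)" unfolding T_def by (rule M_order_zero)
    fix f :: "complex^'n \<Rightarrow> complex" assume f: "f \<in> smooth_test_functions"
    show "T (Suc k) js ls f = (\<Sum>p\<in>UNIV. \<Sum>q\<in>UNIV. T k (p # js) (q # ls) (\<lambda>z. of_real (u z) * dz p (dzbar q f) z))"
      unfolding T_def by (rule M_identity[OF k f, symmetric])
  qed
  define D where "D z = Re (M CARD('n) [] [] z)" for z
  have Dm: "D \<in> borel_measurable lborel" unfolding D_def using M_meas by (simp del: M.simps)
  have Dpos: "AE z in lborel. 0 \<le> D z"
    by (rule eventually_mono[OF AE_lborel_singleton[of "0 :: complex^'n"]]) (use pos in \<open>auto simp: D_def\<close>)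
  have DM: "AE z in lborel. D z *\<^sub>R f z = M CARD('n) [] [] z * f z" for f :: "complex^'n \<Rightarrow> complex"
    by (rule eventually_mono[OF AE_lborel_singleton[of "0 :: complex^'n"]]) (use pos in \<open>auto simp: D_def scaleR_conv_of_real\<close>)
  have "integrable (density lborel (\<lambda>z. ennreal (D z))) f \<and> (LINT z|density lborel (\<lambda>z. ennreal (D z)). f z) = T CARD('n) [] [] f"
    if f: "f \<in> test_functions" for f
  proof -
    obtain R where R: "supported R f" using f by (auto simp: test_functions_supported)
    have fm: "f \<in> borel_measurable lborel" using supported_measurable[OF R] by simp
    have Mm: "(\<lambda>z. M CARD('n) [] [] z * f z) \<in> borel_measurable lborel" "(\<lambda>z. D z *\<^sub>R f z) \<in> borel_measurable lborel"
      using fm Dm M_meas by (simp_all del: M.simps)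
    have "integrable lborel (\<lambda>z. D z *\<^sub>R f z)"
      by (rule iffD2[OF integrable_cong_AE[OF Mm(2,1) DM] M_integrable[OF dim R]])
    moreover have "(LINT z|lborel. D z *\<^sub>R f z) = T CARD('n) [] [] f" unfolding T_def
      by (rule integral_cong_AE[OF Mm(2,1) DM])
    ultimately show ?thesis using integrable_density[OF fm Dm Dpos] integral_density[OF fm Dm Dpos] by simp
  qed
  then show ?thesis unfolding is_monge_ampere_def D_def using T0 Tk by (intro conjI exI[of _ T]) auto
qed

end

section \<open>Uniqueness of the Monge-Ampere measure\<close>

lemma test_integrals_determine_measure:
  fixes \<mu> \<nu> :: "'a::euclidean_space measure"
  assumes sets: "sets \<mu> = sets borel" "sets \<nu> = sets borel"
    and int: "\<And>f :: 'a \<Rightarrow> complex. f \<in> test_functions \<Longrightarrow> integrable \<mu> f \<and> integrable \<nu> f \<and> (LINT z|\<mu>. f z) = (LINT z|\<nu>. f z)"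
  shows "\<mu> = \<nu>"
proof -
  have nn: "(\<integral>\<^sup>+z. ennreal (g z) \<partial>\<mu>) = (\<integral>\<^sup>+z. ennreal (g z) \<partial>\<nu>) \<and> (\<integral>\<^sup>+z. ennreal (g z) \<partial>\<mu>) < \<infinity>"
    if g: "supported R (\<lambda>z. complex_of_real (g z))" "\<And>z. g z \<ge> 0" "R > 0" for g :: "'a \<Rightarrow> real" and R
  proof -
    have "(\<lambda>z. complex_of_real (g z)) \<in> test_functions" using g test_functions_supported by blast
    from int[OF this] have i: "integrable \<mu> g" "integrable \<nu> g" "(LINT z|\<mu>. g z) = (LINT z|\<nu>. g z)"
      by (auto simp: complex_of_real_integrable_eq integral_complex_of_real)
    then show ?thesis using g(2) by (simp add: nn_integral_eq_integral)
  qed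
  have box: "emeasure \<mu> S = emeasure \<nu> S \<and> emeasure \<mu> S < \<infinity>" if S: "open S" "bounded S" for S :: "'a set"
  proof (cases "S = {}")
    case False
    obtain R where R: "R > 0" "\<And>x. x \<in> S \<Longrightarrow> norm x \<le> R" using S(2) bounded_pos by blast
    \<comment> \<open>Continuous functions with support in a fixed ball that increase to the
      indicator of the bounded open set S, so that monotone convergence transfers the equality of
      integrals to S.\<close>
    define g where "g j z = min 1 (real j * infdist z (- S))" for j z
    have Sne: "- S \<noteq> {}" using S(2) by (metis Compl_empty_eq double_complement not_bounded_UNIV)
    have cl: "closed (- S)" using S(1) by (simp add: closed_Compl)
    have gs: "supported R (\<lambda>z. complex_of_real (g j z))" for j
    proof -
      have "continuous_on UNIV (\<lambda>z. complex_of_real (g j z))" unfolding g_def by (intro continuous_intros)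
      moreover have "g j z = 0" if "norm z > R" for z
      proof -
        have "z \<in> - S" using R(2)[of z] that by auto
        then show ?thesis by (simp add: g_def)
      qed
      ultimately show ?thesis by (simp add: supported_def)
    qed
    have g0: "g j z \<ge> 0" for j z by (simp add: g_def infdist_nonneg)
    have gsup: "(SUP j. ennreal (g j z)) = indicator S z" for z
    proof (cases "z \<in> S")
      case True
      then have d: "infdist z (- S) > 0" using infdist_pos_not_in_closed[OF cl Sne] by simp
      obtain j where "1 / infdist z (- S) < real j" using reals_Archimedean2 by blast
      then have "g j z = 1" using d by (simp add: g_def pos_divide_less_eq min_def)
      then have "1 \<le> (SUP j. ennreal (g j z))" by (metis SUP_upper UNIV_I ennreal_1)
      moreover have "(SUP j. ennreal (g j z)) \<le> 1"
        by (rule SUP_least) (use g_def in \<open>auto simp: ennreal_le_1\<close>)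
      ultimately show ?thesis using True by simp
    next
      case False
      then show ?thesis by (simp add: g_def)
    qed
    have inc: "incseq (\<lambda>j z. ennreal (g j z))"
      unfolding g_def by (intro incseq_SucI le_funI ennreal_leI min.mono order_refl mult_right_mono) (auto simp: infdist_nonneg)
    have em: "emeasure \<rho> S = (SUP j. \<integral>\<^sup>+z. ennreal (g j z) \<partial>\<rho>)" if sl: "sets \<rho> = sets borel" for \<rho> :: "'a measure"
    proof -
      have Sm: "S \<in> sets \<rho>" using S(1) sl by simp
      have gm: "(\<lambda>z. ennreal (g j z)) \<in> borel_measurable \<rho>" for j
      proof -
        have "g j \<in> borel_measurable borel" unfolding g_def by (intro borel_measurable_continuous_onI continuous_intros)
        then show ?thesis using sl by (simp cong: measurable_cong_sets)
      qed
      have "emeasure \<rho> S = (\<integral>\<^sup>+z. indicator S z \<partial>\<rho>)" using Sm by simp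
      also have "\<dots> = (\<integral>\<^sup>+z. (SUP j. ennreal (g j z)) \<partial>\<rho>)" by (simp add: gsup)
      also have "\<dots> = (SUP j. \<integral>\<^sup>+z. ennreal (g j z) \<partial>\<rho>)" by (rule nn_integral_monotone_convergence_SUP[OF inc gm])
      finally show ?thesis .
    qed
    have "emeasure \<mu> S = emeasure \<nu> S" unfolding em[OF sets(1)] em[OF sets(2)] using nn[OF gs g0 R(1)] by simp
    moreover have "emeasure \<mu> S < \<infinity>"
    proof -
      define t where "t z = max 0 (min 1 (R + 1 - norm z))" for z :: 'a
      have "supported (R + 1) (\<lambda>z. complex_of_real (t z))"
        unfolding supported_def t_def by (auto intro!: continuous_intros)
      then have fin: "(\<integral>\<^sup>+z. ennreal (t z) \<partial>\<mu>) < \<infinity>"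
        by (rule nn[THEN conjunct2]) (use R(1) in \<open>auto simp: t_def\<close>)
      have "emeasure \<mu> S = (\<integral>\<^sup>+z. indicator S z \<partial>\<mu>)" using S(1) sets by simp
      also have "\<dots> \<le> (\<integral>\<^sup>+z. ennreal (t z) \<partial>\<mu>)"
        by (intro nn_integral_mono) (use R(2) in \<open>force simp: indicator_def t_def\<close>)
      finally show ?thesis using fin by simp
    qed
    ultimately show ?thesis by simp
  qed simp
  show ?thesis
  proof (rule measure_eqI_generator_eq[where E="{S :: 'a set. open S \<and> bounded S}" and \<Omega>=UNIV and A="\<lambda>i. ball 0 (real i)"])
    show "Int_stable {S :: 'a set. open S \<and> bounded S}" by (auto simp: Int_stable_def)
    show "{S :: 'a set. open S \<and> bounded S} \<subseteq> Pow UNIV" by simp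
    have "sets (borel :: 'a measure) = sigma_sets UNIV {S. open S \<and> bounded S}"
    proof
      have "range (\<lambda>(a, b). box a b :: 'a set) \<subseteq> {S. open S \<and> bounded S}" by auto
      then have "sigma_sets UNIV (range (\<lambda>(a, b). box a b :: 'a set)) \<subseteq> sigma_sets UNIV {S. open S \<and> bounded S}" by (rule sigma_sets_mono')
      moreover have "sets (borel :: 'a measure) = sigma_sets UNIV (range (\<lambda>(a, b). box a b))"
        by (simp add: borel_eq_box)
      ultimately show "sets (borel :: 'a measure) \<subseteq> sigma_sets UNIV {S. open S \<and> bounded S}" by simp
      show "sigma_sets UNIV {S. open S \<and> bounded S} \<subseteq> sets (borel :: 'a measure)"
      proof -
        have "{S :: 'a set. open S \<and> bounded S} \<subseteq> sets borel" by auto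
        then show ?thesis using sets.sigma_sets_subset[of "{S. open S \<and> bounded S}" "borel :: 'a measure"] by simp
      qed
    qed
    then show "sets \<mu> = sigma_sets UNIV {S. open S \<and> bounded S}" "sets \<nu> = sigma_sets UNIV {S. open S \<and> bounded S}"
      using sets by auto
    show "range (\<lambda>i. ball (0::'a) (real i)) \<subseteq> {S. open S \<and> bounded S}" by auto
    show "(\<Union>i. ball (0::'a) (real i)) = UNIV" using reals_Archimedean2 by (auto simp: dist_norm)
    show "emeasure \<mu> (ball 0 (real i)) \<noteq> \<infinity>" for i using box[of "ball 0 (real i)"] by (auto simp: less_top[symmetric])
  qed (use box in auto)
qed

text \<open>A functional of order zero is continuous under uniform convergence with supports in a
  fixed compact set, and mollification approximates f in this sense. The ball of radius R + 1
  contains the supports of all approximants.\<close>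

lemma order_zero_eqI:
  assumes L: "order_zero L" and L': "order_zero L'"
    and eq: "\<And>f. f \<in> smooth_test_functions \<Longrightarrow> L f = L' f" and f: "f \<in> test_functions"
  shows "L (f :: 'a::euclidean_space \<Rightarrow> complex) = L' f"
proof -
  obtain R where R: "R > 0" "supported R f" using f by (auto simp: test_functions_supported)
  define K where "K = cball (0::'a) (R + 1)"
  obtain C where C: "\<And>g B. g \<in> test_functions \<Longrightarrow> (\<forall>z. z \<notin> K \<longrightarrow> g z = 0) \<Longrightarrow> (\<forall>z. cmod (g z) \<le> B) \<Longrightarrow> cmod (L g) \<le> C * B"
    using L unfolding order_zero_def K_def by (meson compact_cball)
  obtain C' where C': "\<And>g B. g \<in> test_functions \<Longrightarrow> (\<forall>z. z \<notin> K \<longrightarrow> g z = 0) \<Longrightarrow> (\<forall>z. cmod (g z) \<le> B) \<Longrightarrow> cmod (L' g) \<le> C' * B"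
    using L' unfolding order_zero_def K_def by (meson compact_cball)
  have sub: "\<Lambda> (\<lambda>z. f z + (-1) * g z) = \<Lambda> f - \<Lambda> g" if "order_zero \<Lambda>" "g \<in> test_functions" for \<Lambda> g
  proof -
    have t: "(\<lambda>z. (-1) * g z) \<in> test_functions" using that(2) by (auto simp: test_functions_def intro!: continuous_intros)
    have "\<Lambda> (\<lambda>z. f z + (-1) * g z) = \<Lambda> f + \<Lambda> (\<lambda>z. (-1) * g z)"
      by (rule that(1)[unfolded order_zero_def, THEN conjunct1, THEN bspec, OF f, THEN bspec, OF t])
    also have "\<Lambda> (\<lambda>z. (-1) * g z) = (-1) * \<Lambda> g"
      by (rule that(1)[unfolded order_zero_def, THEN conjunct2, THEN conjunct1, THEN spec, THEN bspec, OF that(2)])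
    finally show ?thesis by simp
  qed
  have "cmod (L f - L' f) \<le> (\<bar>C\<bar> + \<bar>C'\<bar>) * \<eta>" if \<eta>: "\<eta> > 0" for \<eta>
  proof -
    obtain g where g: "g \<in> smooth_test_functions" "supported (R + 1) g" "\<And>x. norm (g x - f x) \<le> \<eta>"
      using smooth_uniform_approx[OF R(2) \<eta>] by blast
    define d where "d z = f z + (-1) * g z" for z
    have gt: "g \<in> test_functions" using g(1) by (simp add: smooth_test_functions_def)
    have ds: "supported (R + 1) d" unfolding d_def using g(2) R(2) by (auto simp: supported_def intro!: continuous_intros)
    have dt: "d \<in> test_functions" unfolding test_functions_supported using ds R(1) by (intro exI[of _ "R + 1"]) auto
    have dK: "\<forall>z. z \<notin> K \<longrightarrow> d z = 0" using ds by (auto simp: supported_def K_def dist_norm)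
    have dB: "\<forall>z. cmod (d z) \<le> \<eta>" using g(3) by (simp add: d_def norm_minus_commute)
    have "cmod (L d) \<le> C * \<eta>" "cmod (L' d) \<le> C' * \<eta>" using C[OF dt dK dB] C'[OF dt dK dB] .
    moreover have "L d = L f - L g" "L' d = L' f - L' g" unfolding d_def by (rule sub[OF L gt], rule sub[OF L' gt])
    moreover have "L g = L' g" by (rule eq[OF g(1)])
    ultimately have "cmod (L f - L' f) \<le> C * \<eta> + C' * \<eta>"
      using norm_triangle_ineq4[of "L d" "L' d"] by simp
    also have "\<dots> \<le> (\<bar>C\<bar> + \<bar>C'\<bar>) * \<eta>" using \<eta> by (simp add: distrib_right add_mono mult_right_mono)
    finally show ?thesis .
  qed
  then have "cmod (L f - L' f) \<le> 0 + \<epsilon>" if "\<epsilon> > 0" for \<epsilon>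
  proof -
    have p: "\<bar>C\<bar> + \<bar>C'\<bar> + 1 > 0" by simp
    have "cmod (L f - L' f) \<le> (\<bar>C\<bar> + \<bar>C'\<bar>) * (\<epsilon> / (\<bar>C\<bar> + \<bar>C'\<bar> + 1))"
      using \<open>\<And>\<eta>. \<eta> > 0 \<Longrightarrow> cmod (L f - L' f) \<le> (\<bar>C\<bar> + \<bar>C'\<bar>) * \<eta>\<close>[of "\<epsilon> / (\<bar>C\<bar> + \<bar>C'\<bar> + 1)"] that p by simp
    also have "\<dots> \<le> (\<bar>C\<bar> + \<bar>C'\<bar> + 1) * (\<epsilon> / (\<bar>C\<bar> + \<bar>C'\<bar> + 1))" using that p by (intro mult_right_mono) auto
    also have "\<dots> = \<epsilon>" using p by simp
    finally show ?thesis by simp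
  qed
  then have "cmod (L f - L' f) \<le> 0" by (rule field_le_epsilon)
  then show ?thesis by simp
qed

text \<open>Induction along the chain. On smooth f the next current is given by the previous one on
  u times second derivatives of f, which is merely continuous; so the induction hypothesis must
  cover all test functions, and \<open>order_zero_eqI\<close> restores this generality. Only index
  lists of the right length are constrained by \<open>ddc_product\<close>.\<close>

lemma is_monge_ampere_unique:
  fixes u :: "complex^'n::finite \<Rightarrow> real"
  assumes u: "continuous_on UNIV u" and \<mu>: "is_monge_ampere u \<mu>" and \<nu>: "is_monge_ampere u \<nu>"
  shows "\<mu> = \<nu>"
proof -
  obtain T where T: "T 0 = integration_current" "\<And>k. k < CARD('n) \<Longrightarrow> ddc_product (CARD('n) - Suc k) u (T k) (T (Suc k))"
    "\<And>f. f \<in> test_functions \<Longrightarrow> integrable \<mu> f \<and> (LINT z|\<mu>. f z) = T CARD('n) [] [] f"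
    using \<mu> unfolding is_monge_ampere_def by blast
  obtain T' where T': "T' 0 = integration_current" "\<And>k. k < CARD('n) \<Longrightarrow> ddc_product (CARD('n) - Suc k) u (T' k) (T' (Suc k))"
    "\<And>f. f \<in> test_functions \<Longrightarrow> integrable \<nu> f \<and> (LINT z|\<nu>. f z) = T' CARD('n) [] [] f"
    using \<nu> unfolding is_monge_ampere_def by blast
  have "\<forall>js ls f. length js = CARD('n) - k \<longrightarrow> length ls = CARD('n) - k \<longrightarrow> f \<in> test_functions \<longrightarrow> T k js ls f = T' k js ls f"
    if "k \<le> CARD('n)" for k
    using that
  proof (induction k)
    case 0
    then show ?case using T(1) T'(1) by simp
  next
    case (Suc k)
    then have k: "k < CARD('n)" by simp
    show ?case
    proof (intro allI impI)
      fix js ls :: "'n list" and f :: "complex^'n \<Rightarrow> complex"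
      assume len: "length js = CARD('n) - Suc k" "length ls = CARD('n) - Suc k" and f: "f \<in> test_functions"
      have P: "order_zero (T (Suc k) js ls)" "\<And>f. f \<in> smooth_test_functions \<Longrightarrow> T (Suc k) js ls f = (\<Sum>p\<in>UNIV. \<Sum>q\<in>UNIV. T k (p # js) (q # ls) (\<lambda>z. of_real (u z) * dz p (dzbar q f) z))"
        using T(2)[OF k] len unfolding ddc_product_def by blast+
      have P': "order_zero (T' (Suc k) js ls)" "\<And>f. f \<in> smooth_test_functions \<Longrightarrow> T' (Suc k) js ls f = (\<Sum>p\<in>UNIV. \<Sum>q\<in>UNIV. T' k (p # js) (q # ls) (\<lambda>z. of_real (u z) * dz p (dzbar q f) z))"
        using T'(2)[OF k] len unfolding ddc_product_def by blast+
      have len': "length (p # js) = CARD('n) - k" "length (q # ls) = CARD('n) - k" for p q using len k by simp_all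
      show "T (Suc k) js ls f = T' (Suc k) js ls f"
      proof (rule order_zero_eqI[OF P(1) P'(1) _ f])
        fix g :: "complex^'n \<Rightarrow> complex" assume g: "g \<in> smooth_test_functions"
        have "(\<lambda>z. of_real (u z) * dz p (dzbar q g) z) \<in> test_functions" for p q
        proof -
          have "dz p (dzbar q g) \<in> test_functions" using smooth_dz[OF smooth_dzbar[OF g]] by (simp add: smooth_test_functions_def)
          then obtain K where K: "continuous_on UNIV (dz p (dzbar q g))" "compact K" "\<And>z. z \<notin> K \<Longrightarrow> dz p (dzbar q g) z = 0"
            by (auto simp: test_functions_def)
          have "continuous_on UNIV (\<lambda>z. complex_of_real (u z) * dz p (dzbar q g) z)" by (intro continuous_intros u K(1))
          then show ?thesis using K(2,3) unfolding test_functions_def by auto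
        qed
        then show "T (Suc k) js ls g = T' (Suc k) js ls g"
          unfolding P(2)[OF g] P'(2)[OF g] using Suc.IH k len' by (intro sum.cong refl) auto
      qed
    qed
  qed
  from this[of "CARD('n)"] have "T CARD('n) [] [] f = T' CARD('n) [] [] f" if "f \<in> test_functions" for f using that by simp
  moreover have "sets \<mu> = sets borel" "sets \<nu> = sets borel" using \<mu> \<nu> by (auto simp: is_monge_ampere_def)
  ultimately show ?thesis using T(3) T'(3) by (intro test_integrals_determine_measure) auto
qed

lemma monge_ampere_eqI:
  fixes u :: "complex^'n::finite \<Rightarrow> real"
  assumes "continuous_on UNIV u" "is_monge_ampere u \<mu>" shows "monge_ampere u = \<mu>"
  unfolding monge_ampere_def using assms is_monge_ampere_unique by blast

section \<open>Positivity of the Monge--Ampere density\<close>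

text \<open>A vector x in the kernel makes the form vanish at its conjugate, because the form
  conjugates its second argument.\<close>

lemma posdef_det_nonzero:
  fixes A :: "complex^'n::finite^'n"
  assumes pd: "\<And>c. c \<noteq> 0 \<Longrightarrow> Re (\<Sum>i\<in>UNIV. \<Sum>j\<in>UNIV. c $ i * cnj (c $ j) * A $ i $ j) > 0"
  shows "det A \<noteq> 0"
proof -
  have "x = 0" if x: "A *v x = 0" for x
  proof (rule ccontr)
    assume "x \<noteq> 0"
    define c where "c = (\<chi> i. cnj (x $ i))"
    have "c \<noteq> 0" using \<open>x \<noteq> 0\<close> by (auto simp: c_def vec_eq_iff)
    have "(\<Sum>i\<in>UNIV. \<Sum>j\<in>UNIV. c $ i * cnj (c $ j) * A $ i $ j) = (\<Sum>i\<in>UNIV. c $ i * (A *v x) $ i)"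
      by (simp add: matrix_vector_mult_def sum_distrib_left c_def mult_ac)
    also have "\<dots> = 0" by (simp add: x)
    finally show False using pd[OF \<open>c \<noteq> 0\<close>] by simp
  qed
  then have "\<exists>B. B ** A = mat 1" unfolding matrix_left_invertible_ker by blast
  then have "invertible A" using invertible_left_inverse by blast
  then show ?thesis by (simp add: invertible_det_nz)
qed

text \<open>The determinant is real and does not vanish along the segment from the identity to \<open>A\<close>.\<close>

lemma hermitian_posdef_det:
  fixes A :: "complex^'n::finite^'n"
  assumes herm: "\<And>i j. cnj (A $ i $ j) = A $ j $ i"
    and pd: "\<And>c. c \<noteq> 0 \<Longrightarrow> Re (\<Sum>i\<in>UNIV. \<Sum>j\<in>UNIV. c $ i * cnj (c $ j) * A $ i $ j) > 0"
  shows "\<exists>d>0. det A = of_real d"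
proof -
  define P where "P t = (\<chi> i j. of_real (1 - t) * (if i = j then 1 else 0) + of_real t * A $ i $ j)" for t :: real
  have Pherm: "cnj (P t $ i $ j) = P t $ j $ i" for t i j by (simp add: P_def herm)
  have cnjdet: "cnj (det (P t)) = det (P t)" for t
  proof -
    have "cnj (det (P t)) = det (transpose (P t))"
      unfolding det_def by (simp add: cnj_sum cnj_prod Pherm transpose_def)
    then show ?thesis by (simp add: det_transpose)
  qed
  have Ppd: "Re (\<Sum>i\<in>UNIV. \<Sum>j\<in>UNIV. c $ i * cnj (c $ j) * P t $ i $ j) > 0" if c: "c \<noteq> 0" and t: "0 \<le> t" "t \<le> 1" for c t
  proof -
    have id: "(\<Sum>i\<in>UNIV. \<Sum>j\<in>UNIV. c $ i * cnj (c $ j) * (if i = j then 1 else 0)) = of_real ((norm c)\<^sup>2)"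
    proof -
      have "(\<Sum>i\<in>UNIV. \<Sum>j\<in>UNIV. c $ i * cnj (c $ j) * (if i = j then 1 else 0)) = (\<Sum>i\<in>UNIV. c $ i * cnj (c $ i))"
        by (simp add: if_distrib cong: if_cong)
      also have "\<dots> = of_real (\<Sum>i\<in>UNIV. (cmod (c $ i))\<^sup>2)"
        unfolding of_real_sum complex_norm_square ..
      also have "(\<Sum>i\<in>UNIV. (cmod (c $ i))\<^sup>2) = (norm c)\<^sup>2"
        by (simp add: norm_vec_def L2_set_def sum_nonneg)
      finally show ?thesis .
    qed
    have "(\<Sum>i\<in>UNIV. \<Sum>j\<in>UNIV. c $ i * cnj (c $ j) * P t $ i $ j)
        = of_real (1 - t) * (\<Sum>i\<in>UNIV. \<Sum>j\<in>UNIV. c $ i * cnj (c $ j) * (if i = j then 1 else 0))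
        + of_real t * (\<Sum>i\<in>UNIV. \<Sum>j\<in>UNIV. c $ i * cnj (c $ j) * A $ i $ j)"
      by (simp only: P_def vec_lambda_beta distrib_left sum.distrib sum_distrib_left) (simp only: mult_ac)
    then have e: "Re (\<Sum>i\<in>UNIV. \<Sum>j\<in>UNIV. c $ i * cnj (c $ j) * P t $ i $ j)
        = (1 - t) * (norm c)\<^sup>2 + t * Re (\<Sum>i\<in>UNIV. \<Sum>j\<in>UNIV. c $ i * cnj (c $ j) * A $ i $ j)"
      unfolding id by (simp only: plus_complex.sel times_complex.sel Re_complex_of_real Im_complex_of_real)
    have n: "(norm c)\<^sup>2 > 0" using c by simp
    show ?thesis
    proof (cases "t = 0")
      case True then show ?thesis unfolding e using n by simp
    next
      case False
      then have "t * Re (\<Sum>i\<in>UNIV. \<Sum>j\<in>UNIV. c $ i * cnj (c $ j) * A $ i $ j) > 0" using pd[OF c] t by simp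
      moreover have "(1 - t) * (norm c)\<^sup>2 \<ge> 0" using t by simp
      ultimately show ?thesis unfolding e by linarith
    qed
  qed
  define g where "g t = Re (det (P t))" for t
  have gd: "det (P t) = of_real (g t)" for t using cnjdet[of t] by (simp add: g_def complex_eq_iff)
  have gnz: "g t \<noteq> 0" if "0 \<le> t" "t \<le> 1" for t
    using posdef_det_nonzero[of "P t"] Ppd that gd[of t] by auto
  have cont: "continuous_on {0..1} g"
    unfolding g_def det_def P_def by (intro continuous_intros)
  have "P 0 = mat 1" by (simp add: P_def mat_def vec_eq_iff)
  then have "det (P 0) = 1" by simp
  then have g0: "g 0 = 1" by (simp add: g_def)
  have "P 1 = A" by (simp add: P_def vec_eq_iff)
  then have g1: "det A = of_real (g 1)" using gd[of 1] by simp
  have "g 1 > 0"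
  proof (rule ccontr)
    assume "\<not> g 1 > 0"
    then obtain t where "0 \<le> t" "t \<le> 1" "g t = 0" using IVT2'[of g 1 0 0] g0 cont by auto
    then show False using gnz by blast
  qed
  then show ?thesis using g1 by blast
qed

text \<open>Split at the last entry: unfolding \<open>M\<close> once places the new index behind
  those that the expansion of the remaining steps will produce.\<close>

lemma sum_lists_snoc:
  fixes F :: "'n::finite list \<Rightarrow> 'b::comm_monoid_add"
  shows "sum F {xs. length xs = Suc k} = (\<Sum>xs | length xs = k. \<Sum>x\<in>UNIV. F (xs @ [x]))"
proof -
  have "{xs :: 'n list. length xs = Suc k} = (\<lambda>(xs, x). xs @ [x]) ` ({xs. length xs = k} \<times> UNIV)"
  proof (intro set_eqI iffI)
    fix ys :: "'n list" assume "ys \<in> {xs. length xs = Suc k}"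
    then obtain xs x where "ys = xs @ [x]" "length xs = k" by (auto simp: length_Suc_conv_rev)
    then show "ys \<in> (\<lambda>(xs, x). xs @ [x]) ` ({xs. length xs = k} \<times> UNIV)" by auto
  qed auto
  moreover have "inj_on (\<lambda>(xs, x). xs @ [x]) ({xs :: 'n list. length xs = k} \<times> UNIV)" by (auto simp: inj_on_def)
  ultimately have "sum F {xs. length xs = Suc k} = (\<Sum>(xs, x)\<in>{xs. length xs = k} \<times> UNIV. F (xs @ [x]))"
    by (simp add: sum.reindex o_def split_def)
  then show ?thesis by (simp add: sum.cartesian_product)
qed

context homogeneous_potential begin

lemma M_expand:
  "M k js ls z = (\<Sum>ps | length ps = k. \<Sum>qs | length qs = k.
     prod_list (map2 (\<lambda>p q. h p q z) ps qs) * current_coeff (ps @ js) (qs @ ls))"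
proof (induction k arbitrary: js ls)
  case 0
  then show ?case by simp
next
  case (Suc k)
  have "M (Suc k) js ls z = (\<Sum>p\<in>UNIV. \<Sum>q\<in>UNIV. \<Sum>ps | length ps = k. \<Sum>qs | length qs = k.
      h p q z * (prod_list (map2 (\<lambda>p q. h p q z) ps qs) * current_coeff (ps @ p # js) (qs @ q # ls)))"
    by (simp add: Suc sum_distrib_left)
  also have "\<dots> = (\<Sum>p\<in>UNIV. \<Sum>q\<in>UNIV. \<Sum>ps | length ps = k. \<Sum>qs | length qs = k.
      prod_list (map2 (\<lambda>p q. h p q z) (ps @ [p]) (qs @ [q])) * current_coeff ((ps @ [p]) @ js) ((qs @ [q]) @ ls))"
    by (intro sum.cong refl) (simp add: mult_ac)
  also have "\<dots> = (\<Sum>p\<in>UNIV. \<Sum>ps | length ps = k. \<Sum>q\<in>UNIV. \<Sum>qs | length qs = k.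
      prod_list (map2 (\<lambda>p q. h p q z) (ps @ [p]) (qs @ [q])) * current_coeff ((ps @ [p]) @ js) ((qs @ [q]) @ ls))"
    by (intro sum.cong refl sum.swap)
  also have "\<dots> = (\<Sum>ps | length ps = k. \<Sum>p\<in>UNIV. \<Sum>q\<in>UNIV. \<Sum>qs | length qs = k.
      prod_list (map2 (\<lambda>p q. h p q z) (ps @ [p]) (qs @ [q])) * current_coeff ((ps @ [p]) @ js) ((qs @ [q]) @ ls))"
    by (rule sum.swap)
  also have "\<dots> = (\<Sum>ps | length ps = k. \<Sum>p\<in>UNIV. \<Sum>qs | length qs = k. \<Sum>q\<in>UNIV.
      prod_list (map2 (\<lambda>p q. h p q z) (ps @ [p]) (qs @ [q])) * current_coeff ((ps @ [p]) @ js) ((qs @ [q]) @ ls))"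
    by (intro sum.cong refl sum.swap)
  also have "\<dots> = (\<Sum>ps | length ps = Suc k. \<Sum>qs | length qs = Suc k.
     prod_list (map2 (\<lambda>p q. h p q z) ps qs) * current_coeff (ps @ js) (qs @ ls))"
    unfolding sum_lists_snoc ..
  finally show ?case .
qed

text \<open>For a list \<open>ps\<close> that enumerates all indices, the coefficient leaves only
  the lists \<open>map \<pi> ps\<close>, and the sum over these is the Leibniz formula. Each
  enumeration contributes the same determinant; their number is n factorial.\<close>

lemma M_top:
  "M CARD('n) [] [] z = of_nat (card {ps :: 'n list. length ps = CARD('n) \<and> distinct ps}) / of_real (pi ^ CARD('n))
     * det (\<chi> i j. h i j z)"
proof -
  define c where "c = complex_of_real (pi ^ CARD('n))"
  have fin: "finite {ps :: 'n list. length ps = CARD('n)}" using finite_lists_length_eq[of "UNIV :: 'n set" "CARD('n)"] by simp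
  have row: "(\<Sum>qs | length qs = CARD('n). prod_list (map2 (\<lambda>p q. h p q z) ps qs) * current_coeff ps qs)
     = (if distinct ps then det (\<chi> i j. h i j z) / c else 0)" if len: "length ps = CARD('n)" for ps :: "'n list"
  proof (cases "distinct ps")
    case False
    then have "current_coeff ps qs = 0" for qs by (simp add: current_coeff_def)
    then show ?thesis using False by simp
  next
    case True
    have set: "set ps = UNIV"
      using True len by (metis card_subset_eq distinct_card finite_class.finite_UNIV subset_UNIV)
    have "(\<Sum>qs | length qs = CARD('n). prod_list (map2 (\<lambda>p q. h p q z) ps qs) * current_coeff ps qs)
        = (\<Sum>qs | length qs = CARD('n). \<Sum>\<pi> | \<pi> permutes (UNIV :: 'n set).
            (if qs = map \<pi> ps then prod_list (map2 (\<lambda>p q. h p q z) ps qs) * (of_int (sign \<pi>) / c) else 0))"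
      unfolding current_coeff_def c_def[symmetric] using True
      by (intro sum.cong refl) (auto simp: sum_distrib_left sum_divide_distrib intro!: sum.cong)
    also have "\<dots> = (\<Sum>\<pi> | \<pi> permutes (UNIV :: 'n set). \<Sum>qs | length qs = CARD('n).
            (if qs = map \<pi> ps then prod_list (map2 (\<lambda>p q. h p q z) ps qs) * (of_int (sign \<pi>) / c) else 0))"
      by (rule sum.swap)
    also have "\<dots> = (\<Sum>\<pi> | \<pi> permutes (UNIV :: 'n set). prod_list (map2 (\<lambda>p q. h p q z) ps (map \<pi> ps)) * (of_int (sign \<pi>) / c))"
      using len fin by (intro sum.cong refl) (simp add: sum.delta)
    also have "\<dots> = (\<Sum>\<pi> | \<pi> permutes (UNIV :: 'n set). of_int (sign \<pi>) * (\<Prod>i\<in>UNIV. h i (\<pi> i) z)) / c"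
    proof -
      have "prod_list (map2 (\<lambda>p q. h p q z) ps (map \<pi> ps)) = (\<Prod>i\<in>UNIV. h i (\<pi> i) z)" for \<pi>
      proof -
        have "map2 (\<lambda>p q. h p q z) ps (map \<pi> ps) = map (\<lambda>p. h p (\<pi> p) z) ps"
          by (induction ps) auto
        then show ?thesis using prod.distinct_set_conv_list[OF True, of "\<lambda>p. h p (\<pi> p) z"] by (simp add: set)
      qed
      then show ?thesis by (simp add: sum_divide_distrib mult.commute)
    qed
    also have "\<dots> = det (\<chi> i j. h i j z) / c" by (simp add: det_def)
    finally show ?thesis using True by simp
  qed
  have "M CARD('n) [] [] z = (\<Sum>ps\<in>{ps :: 'n list. length ps = CARD('n)}. if distinct ps then det (\<chi> i j. h i j z) / c else 0)"
    unfolding M_expand append_Nil2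
  proof (rule sum.cong[OF refl])
    fix ps :: "'n list" assume "ps \<in> {ps. length ps = CARD('n)}"
    then show "(\<Sum>qs | length qs = CARD('n). prod_list (map2 (\<lambda>p q. h p q z) ps qs) * current_coeff ps qs)
        = (if distinct ps then det (\<chi> i j. h i j z) / c else 0)" by (intro row) simp
  qed
  also have "\<dots> = (\<Sum>ps\<in>{ps \<in> {ps :: 'n list. length ps = CARD('n)}. distinct ps}. det (\<chi> i j. h i j z) / c)"
    by (rule sum.inter_filter[OF fin, symmetric])
  also have "{ps \<in> {ps :: 'n list. length ps = CARD('n)}. distinct ps} = {ps. length ps = CARD('n) \<and> distinct ps}" by auto
  finally show ?thesis by (simp add: c_def)
qed

lemma M_top_pos:
  assumes pd: "\<And>c. c \<noteq> 0 \<Longrightarrow> Re (\<Sum>p\<in>UNIV. \<Sum>q\<in>UNIV. c $ p * cnj (c $ q) * h p q z) > 0"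
  shows "\<exists>m>0. M CARD('n) [] [] z = of_real m"
proof -
  obtain d where d: "d > 0" "det (\<chi> i j. h i j z) = of_real d"
    using hermitian_posdef_det[of "\<chi> i j. h i j z"] h_herm pd by auto
  define N where "N = card {ps :: 'n list. length ps = CARD('n) \<and> distinct ps}"
  have "N > 0"
  proof -
    obtain ps :: "'n list" where "set ps = UNIV" "distinct ps" using finite_distinct_list[of "UNIV :: 'n set"] by auto
    then have "ps \<in> {ps. length ps = CARD('n) \<and> distinct ps}" using distinct_card[of ps] by simp
    moreover have "finite {ps :: 'n list. length ps = CARD('n) \<and> distinct ps}"
      using finite_lists_length_eq[of "UNIV :: 'n set" "CARD('n)"] by (auto intro: rev_finite_subset)
    ultimately show ?thesis unfolding N_def by (auto simp: card_gt_0_iff)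
  qed
  then show ?thesis
    by (intro exI[of _ "real N / pi ^ CARD('n) * d"]) (simp add: M_top N_def d)
qed

end

text \<open>The pairing \<open>cpair\<close> is bilinear, so its real part is the real inner product with the conjugate vector.\<close>

definition conj_vec :: "complex^'n::finite \<Rightarrow> complex^'n" where "conj_vec z = (\<chi> i. cnj (z $ i))"

lemma conj_vec_simps [simp]:
  "conj_vec (conj_vec z) = z" "norm (conj_vec z) = norm z" "conj_vec z = 0 \<longleftrightarrow> z = 0" "conj_vec z $ i = cnj (z $ i)"
  by (auto simp: conj_vec_def vec_eq_iff norm_vec_def L2_set_def)

lemma conj_vec_linear: "linear conj_vec"
  by (rule linearI) (auto simp: conj_vec_def vec_eq_iff)

lemma conj_vec_axis: "conj_vec (axis p x) = axis p (cnj x)"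
  by (auto simp: conj_vec_def axis_def vec_eq_iff)

lemma inner_conj_vec: "\<zeta> \<bullet> conj_vec z = Re (cpair \<zeta> z)"
  by (simp add: inner_vec_def cpair_def inner_complex_def)

lemma inner_axis_complex: "x \<bullet> axis p 1 = Re (x $ p)" "x \<bullet> axis p \<i> = Im (x $ p)"
  by (simp_all add: inner_axis inner_complex_def)

text \<open>For a real-linear A the bracket is twice its antilinear coefficient in the q-th
  coordinate. Contracting with the conjugate of c evaluates twice the antilinear part of A at c,
  which is A c + i A (i c).\<close>

lemma complex_real_linear_expand:
  fixes A :: "complex^'n::finite \<Rightarrow> complex"
  assumes A: "linear A"
  shows "(\<Sum>q\<in>UNIV. cnj (c $ q) * (A (axis q 1) + \<i> * A (axis q \<i>))) = A c + \<i> * A (\<chi> q. \<i> * c $ q)"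
proof -
  have ex: "A v = (\<Sum>q\<in>UNIV. of_real (Re (v $ q)) * A (axis q 1) + of_real (Im (v $ q)) * A (axis q \<i>))" for v
  proof -
    have "v = (\<Sum>q\<in>UNIV. Re (v $ q) *\<^sub>R axis q 1 + Im (v $ q) *\<^sub>R axis q \<i>)"
      by (auto simp: vec_eq_iff axis_def complex_eq_iff if_distrib sum.distrib cong: if_cong)
    then have "A v = A (\<Sum>q\<in>UNIV. Re (v $ q) *\<^sub>R axis q 1 + Im (v $ q) *\<^sub>R axis q \<i>)" by simp
    also have "\<dots> = (\<Sum>q\<in>UNIV. of_real (Re (v $ q)) * A (axis q 1) + of_real (Im (v $ q)) * A (axis q \<i>))"
      by (simp add: linear_sum[OF A] linear_add[OF A] linear_scale[OF A]) (simp add: scaleR_conv_of_real)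
    finally show ?thesis .
  qed
  have "A c + \<i> * A (\<chi> q. \<i> * c $ q) = (\<Sum>q\<in>UNIV. (of_real (Re (c $ q)) * A (axis q 1) + of_real (Im (c $ q)) * A (axis q \<i>))
      + \<i> * (of_real (- Im (c $ q)) * A (axis q 1) + of_real (Re (c $ q)) * A (axis q \<i>)))"
    unfolding ex[of c] ex[of "\<chi> q. \<i> * c $ q"] by (simp add: sum_distrib_left sum.distrib)
  also have "\<dots> = (\<Sum>q\<in>UNIV. cnj (c $ q) * (A (axis q 1) + \<i> * A (axis q \<i>)))"
  proof (intro sum.cong refl)
    fix q
    have cc: "cnj (c $ q) = of_real (Re (c $ q)) - \<i> * of_real (Im (c $ q))" by (simp add: complex_eq_iff)
    show "(of_real (Re (c $ q)) * A (axis q 1) + of_real (Im (c $ q)) * A (axis q \<i>))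
      + \<i> * (of_real (- Im (c $ q)) * A (axis q 1) + of_real (Re (c $ q)) * A (axis q \<i>)) = cnj (c $ q) * (A (axis q 1) + \<i> * A (axis q \<i>))"
      unfolding cc by (simp add: algebra_simps)
  qed
  finally show ?thesis by simp
qed

section \<open>The support function as a homogeneous potential\<close>

locale smooth_convex_body_complex = smooth_convex_body \<Omega> nv c C e
  for \<Omega> :: "(complex^'n::finite) set" and nv c C e
begin

text \<open>The data of \<open>homogeneous_potential\<close> for the support function.
  \<open>wpot\<close> is the holomorphic gradient; the factor 1/2 is that of the Wirtinger
  derivative. \<open>dwpot\<close> is set to 0 at the origin because the locale asks for the formula
  and the Hermitian symmetry of the Hessian at every point.\<close>

definition pot :: "complex^'n \<Rightarrow> real" where "pot z = hsup (conj_vec z)"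
definition dpot :: "complex^'n \<Rightarrow> complex^'n \<Rightarrow> complex" where "dpot z v = of_real (pt (conj_vec z) \<bullet> conj_vec v)"
definition wpot :: "'n \<Rightarrow> complex^'n \<Rightarrow> complex" where "wpot p z = pt (conj_vec z) $ p / 2"
definition dwpot :: "'n \<Rightarrow> complex^'n \<Rightarrow> complex^'n \<Rightarrow> complex" where
  "dwpot p z v = (if z = 0 then 0 else dpt (conj_vec z) (conj_vec v) $ p / 2)"
definition hpot :: "'n \<Rightarrow> 'n \<Rightarrow> complex^'n \<Rightarrow> complex" where
  "hpot p q z = (dwpot p z (axis q 1) + \<i> * dwpot p z (axis q \<i>)) / 2"

lemma support_function_pot: "support_function \<Omega> = pot"
  by (simp add: fun_eq_iff support_function_def pot_def hsup_def inner_conj_vec)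

lemma conj_vec_has_derivative: "(conj_vec has_derivative conj_vec) (at z)"
  using conj_vec_linear linear_imp_has_derivative by blast

lemma conj_vec_cont: "continuous_on S conj_vec"
  using conj_vec_linear linear_continuous_on linear_linear by blast

lemma comp_off_zero: "continuous_on (- {0}) f \<Longrightarrow> continuous_on (- {0}) (\<lambda>z. f (conj_vec z))"
  by (rule continuous_on_compose2[OF _ conj_vec_cont]) auto

lemma dwpot_linear: "linear (dwpot p z)"
proof (cases "z = 0")
  case True
  then show ?thesis by (simp add: dwpot_def[abs_def] linear_zero)
next
  case False
  have l: "linear (dpt (conj_vec z))" using False by (intro dpt_linear) simp
  show ?thesis unfolding dwpot_def[abs_def] using False
    by (intro linearI) (auto simp: linear_add[OF conj_vec_linear] linear_scale[OF conj_vec_linear] linear_add[OF l] linear_scale[OF l] add_divide_distrib)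
qed

lemma potential: "\<exists>B. homogeneous_potential pot dpot wpot dwpot hpot B"
proof -
  obtain R where R: "R > 0" "\<And>w. norm (pt w) \<le> R" "\<And>w w'. \<bar>hsup w - hsup w'\<bar> \<le> R * norm (w - w')" using hsup_bound by blast
  \<comment> \<open>R bounds \<open>pt\<close> and the Lipschitz constant of \<open>hsup\<close>;
    1/c bounds |z| times the operator norm of \<open>dpt\<close>.\<close>
  define B where "B = R + 1 / c"
  have B: "B \<ge> 0" "R \<le> B" "1 / c \<le> B" using R c by (auto simp: B_def)
  have "homogeneous_potential pot dpot wpot dwpot hpot B"
  proof
    have "continuous_on UNIV hsup"
    proof (rule continuous_at_imp_continuous_on, rule ballI)
      fix w
      have "((\<lambda>w'. hsup w' - hsup w) \<longlongrightarrow> 0) (at w)"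
      proof (rule Lim_null_comparison)
        show "\<forall>\<^sub>F w' in at w. norm (hsup w' - hsup w) \<le> R * norm (w' - w)" using R(3) by simp
        have "((\<lambda>w'. R * norm (w' - w)) \<longlongrightarrow> R * norm (w - w)) (at w)" by (intro tendsto_intros)
        then show "((\<lambda>w'. R * norm (w' - w)) \<longlongrightarrow> 0) (at w)" by simp
      qed
      then show "isCont hsup w" unfolding isCont_def by (rule LIM_zero_cancel)
    qed
    then show "continuous_on UNIV pot" unfolding pot_def by (rule continuous_on_compose2[OF _ conj_vec_cont]) auto
    show "B \<ge> 0" by (rule B(1))
    show "\<bar>pot z\<bar> \<le> B * norm z" for z
    proof -
      have "hsup 0 = 0" by (simp add: hsup_eq)
      then have "\<bar>pot z\<bar> \<le> R * norm z" using R(3)[of "conj_vec z" 0] by (simp add: pot_def)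
      also have "\<dots> \<le> B * norm z" using B by (intro mult_right_mono) auto
      finally show ?thesis .
    qed
    show "norm (wpot p z) \<le> B" for p z
    proof -
      have "norm (wpot p z) \<le> norm (pt (conj_vec z)) / 2" unfolding wpot_def norm_divide
        using Finite_Cartesian_Product.norm_nth_le[of "pt (conj_vec z)" p] by simp
      also have "\<dots> \<le> B" using R(2)[of "conj_vec z"] B R(1) by simp
      finally show ?thesis .
    qed
    show "norm (hpot p q z) \<le> B * inverse (norm z)" if z: "z \<noteq> 0" for p q z
    proof -
      have d: "norm (dwpot p z v) \<le> (1 / (c * norm z) * norm v) / 2" for v
      proof -
        have "norm (dwpot p z v) \<le> norm (dpt (conj_vec z) (conj_vec v)) / 2" unfolding dwpot_def
          using z Finite_Cartesian_Product.norm_nth_le[of "dpt (conj_vec z) (conj_vec v)" p] by (simp add: norm_divide)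
        also have "\<dots> \<le> (1 / (c * norm z) * norm v) / 2"
          using dpt_bound[of "conj_vec z" "conj_vec v"] z by (intro divide_right_mono) auto
        finally show ?thesis .
      qed
      have cz: "1 / (c * norm z) \<ge> 0" using c by simp
      have a: "norm (dwpot p z (axis q 1)) \<le> 1 / (c * norm z)" "norm (\<i> * dwpot p z (axis q \<i>)) \<le> 1 / (c * norm z)"
      proof -
        have u: "norm (dwpot p z v) \<le> 1 / (c * norm z)" if "norm v = 1" for v
        proof -
          define t where "t = 1 / (c * norm z)"
          have "norm (dwpot p z v) \<le> (t * 1) / 2" "t \<ge> 0" using d[of v] cz unfolding that t_def by auto
          then show ?thesis unfolding t_def[symmetric] by linarith
        qed
        show "norm (dwpot p z (axis q 1)) \<le> 1 / (c * norm z)" by (rule u) (simp add: norm_axis)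
        show "norm (\<i> * dwpot p z (axis q \<i>)) \<le> 1 / (c * norm z)" unfolding norm_mult using u[of "axis q \<i>"] by (simp add: norm_axis)
      qed
      have "norm (hpot p q z) \<le> 1 / (c * norm z)"
      proof -
        define t where "t = 1 / (c * norm z)"
        have "norm (dwpot p z (axis q 1) + \<i> * dwpot p z (axis q \<i>)) \<le> t + t"
          using norm_triangle_mono[OF a] by (simp only: t_def)
        then have "norm (hpot p q z) \<le> t" unfolding hpot_def norm_divide by simp
        then show ?thesis by (simp only: t_def)
      qed
      also have "\<dots> = 1 / c * inverse (norm z)" by (simp add: inverse_eq_divide)
      also have "\<dots> \<le> B * inverse (norm z)" using B by (intro mult_right_mono) auto
      finally show ?thesis .
    qed
    show "((\<lambda>z. complex_of_real (pot z)) has_derivative dpot z) (at z)" if "z \<noteq> 0" for z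
    proof -
      have "(pot has_derivative (\<lambda>v. pt (conj_vec z) \<bullet> conj_vec v)) (at z)"
        unfolding pot_def by (rule has_derivative_compose[OF conj_vec_has_derivative hsup_has_derivative]) (use that in simp)
      then show ?thesis unfolding dpot_def[abs_def] by (rule has_derivative_of_real)
    qed
    have cpt: "continuous_on (- {0}) (\<lambda>z. pt (conj_vec z))"
      by (rule comp_off_zero) (auto intro!: continuous_at_imp_continuous_on pt_cont)
    show "continuous_on (- {0}) (\<lambda>z. dpot z v)" for v unfolding dpot_def by (intro continuous_intros cpt)
    show "(dpot z (axis p 1) - \<i> * dpot z (axis p \<i>)) / 2 = wpot p z" for z p
    proof -
      have "pt (conj_vec z) \<bullet> axis p (- \<i>) = - Im (pt (conj_vec z) $ p)" by (simp add: inner_axis inner_complex_def)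
      then show ?thesis by (simp add: dpot_def wpot_def conj_vec_axis inner_axis_complex complex_eq_iff)
    qed
    show "(wpot p has_derivative dwpot p z) (at z)" if z: "z \<noteq> 0" for p z
    proof -
      have "((\<lambda>z. pt (conj_vec z)) has_derivative (\<lambda>v. dpt (conj_vec z) (conj_vec v))) (at z)"
        by (rule has_derivative_compose[OF conj_vec_has_derivative pt_has_derivative]) (use z in simp)
      then have "((\<lambda>z. pt (conj_vec z) $ p) has_derivative (\<lambda>v. dpt (conj_vec z) (conj_vec v) $ p)) (at z)"
        by (rule bounded_linear.has_derivative[OF bounded_linear_vec_nth])
      then have "((\<lambda>z. pt (conj_vec z) $ p * inverse 2) has_derivative (\<lambda>v. dpt (conj_vec z) (conj_vec v) $ p * inverse 2)) (at z)"
        by (rule has_derivative_mult_left)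
      moreover have "wpot p = (\<lambda>z. pt (conj_vec z) $ p * inverse 2)" by (rule ext) (simp only: wpot_def divide_inverse)
      moreover have "dwpot p z = (\<lambda>v. dpt (conj_vec z) (conj_vec v) $ p * inverse 2)"
        by (rule ext) (simp only: dwpot_def divide_inverse z if_False)
      ultimately show ?thesis by (simp only:)
    qed
    show "continuous_on (- {0}) (\<lambda>z. dwpot p z v)" for p v
    proof -
      have "continuous_on (- {0}) (\<lambda>z. dpt (conj_vec z) (conj_vec v) $ p / 2)"
        by (intro continuous_intros comp_off_zero[OF dpt_cont]) auto
      then show ?thesis by (rule continuous_on_eq) (simp add: dwpot_def)
    qed
    show "(dwpot p z (axis q 1) + \<i> * dwpot p z (axis q \<i>)) / 2 = hpot p q z" for p q z by (simp add: hpot_def)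
    show "cnj (hpot p q z) = hpot q p z" for p q z
    proof (cases "z = 0")
      case False
      \<comment> \<open>The real Hessian as a bilinear form. In terms of its entries the symmetry of
        D is the Hermitian symmetry of \<open>hpot\<close>.\<close>
      define D where "D a b = dpt (conj_vec z) a \<bullet> b" for a b
      have Dsym: "D a b = D b a" for a b unfolding D_def using False by (intro dpt_symmetric) simp
      have lin: "linear (dpt (conj_vec z))" using False by (intro dpt_linear) simp
      have neg: "dpt (conj_vec z) (axis q (- \<i>)) = - dpt (conj_vec z) (axis q \<i>)" for q
      proof -
        have "axis q (- \<i>) = (- 1) *\<^sub>R (axis q \<i> :: complex^'n)" by (simp add: axis_def vec_eq_iff)
        then show ?thesis using linear_scale[OF lin, of "- 1" "axis q \<i>"] by simp
      qed
      have comp: "dpt (conj_vec z) a $ p = Complex (D a (axis p 1)) (D a (axis p \<i>))" for a p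
        by (simp add: D_def inner_axis_complex complex_eq_iff)
      have f: "hpot p q z = Complex (D (axis q 1) (axis p 1) + D (axis q \<i>) (axis p \<i>)) (D (axis q 1) (axis p \<i>) - D (axis q \<i>) (axis p 1)) / 4" for p q
        using False by (simp add: hpot_def dwpot_def conj_vec_axis neg comp complex_eq_iff)
      show ?thesis unfolding f by (simp add: complex_eq_iff Dsym[of "axis p _"])
    qed (simp add: hpot_def dwpot_def)
  qed
  then show ?thesis by blast
qed

text \<open>The complex Hessian at a is a quarter of the sum of the real Hessian at the conjugates
  of a and of i a. Each summand is nonnegative and vanishes only on real multiples of one unit
  vector s; if both vanished, s would be scaled by a real and an imaginary factor at once.\<close>

lemma hpot_positive:
  assumes z: "z \<noteq> 0" and c0: "a \<noteq> 0"
  shows "Re (\<Sum>p\<in>UNIV. \<Sum>q\<in>UNIV. a $ p * cnj (a $ q) * hpot p q z) > 0"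
proof -
  define ia where "ia = (\<chi> q. \<i> * a $ q)"
  define D where "D v = dpt (conj_vec z) (conj_vec v)" for v
  have w: "conj_vec z \<noteq> 0" using z by simp
  have "(\<Sum>p\<in>UNIV. \<Sum>q\<in>UNIV. a $ p * cnj (a $ q) * hpot p q z)
      = (\<Sum>p\<in>UNIV. a $ p * ((\<Sum>q\<in>UNIV. cnj (a $ q) * (dwpot p z (axis q 1) + \<i> * dwpot p z (axis q \<i>))) / 2))"
    by (simp add: hpot_def sum_distrib_left sum_divide_distrib mult_ac)
  also have "\<dots> = (\<Sum>p\<in>UNIV. a $ p * ((dwpot p z a + \<i> * dwpot p z ia) / 2))"
    unfolding complex_real_linear_expand[OF dwpot_linear] ia_def ..
  also have "\<dots> = (\<Sum>p\<in>UNIV. (D a $ p * a $ p + D ia $ p * ia $ p) / 4)"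
    using z by (intro sum.cong refl) (simp add: dwpot_def D_def ia_def field_simps)
  also have "\<dots> = (cpair (D a) a + cpair (D ia) ia) / 4"
    by (simp add: cpair_def sum.distrib sum_divide_distrib add_divide_distrib)
  finally have "Re (\<Sum>p\<in>UNIV. \<Sum>q\<in>UNIV. a $ p * cnj (a $ q) * hpot p q z) = Re ((cpair (D a) a + cpair (D ia) ia) / 4)"
    by (rule arg_cong)
  also have "\<dots> = (D a \<bullet> conj_vec a + D ia \<bullet> conj_vec ia) / 4" by (simp add: inner_conj_vec)
  finally have eq: "Re (\<Sum>p\<in>UNIV. \<Sum>q\<in>UNIV. a $ p * cnj (a $ q) * hpot p q z)
      = (D a \<bullet> conj_vec a + D ia \<bullet> conj_vec ia) / 4" .
  have nn: "D a \<bullet> conj_vec a \<ge> 0" "D ia \<bullet> conj_vec ia \<ge> 0" unfolding D_def by (rule dpt_positive(1)[OF w])+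
  moreover have "\<not> (D a \<bullet> conj_vec a = 0 \<and> D ia \<bullet> conj_vec ia = 0)"
  proof
    assume h: "D a \<bullet> conj_vec a = 0 \<and> D ia \<bullet> conj_vec ia = 0"
    define s where "s = sgn (conj_vec z)"
    obtain x y where xy: "conj_vec a = x *\<^sub>R s" "conj_vec ia = y *\<^sub>R s"
      using dpt_positive(2)[OF w] h unfolding D_def s_def by blast
    have "x = 0"
    proof (rule ccontr)
      assume "x \<noteq> 0"
      have "s \<noteq> 0" using w by (simp add: s_def sgn_zero_iff)
      then obtain i where i: "s $ i \<noteq> 0" by (auto simp: vec_eq_iff)
      have "conj_vec ia $ i = - \<i> * conj_vec a $ i" by (simp add: ia_def)
      then have "of_real y * s $ i = - \<i> * (of_real x * s $ i)" unfolding xy by (simp only: vector_scaleR_component) (simp only: scaleR_conv_of_real mult.assoc)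
      then have "of_real y * s $ i = (- \<i> * of_real x) * s $ i" by (simp only: mult.assoc)
      then have "complex_of_real y = - \<i> * of_real x" using i by (simp only: mult_cancel_right) simp
      then show False using \<open>x \<noteq> 0\<close> by (simp add: complex_eq_iff)
    qed
    then have "conj_vec a = 0" using xy by simp
    then show False using c0 by simp
  qed
  ultimately have "D a \<bullet> conj_vec a + D ia \<bullet> conj_vec ia > 0"
    using add_nonneg_eq_0_iff[OF nn] by linarith
  then show ?thesis unfolding eq by simp
qed

text \<open>What the comparison of norms needs to know about the Monge-Ampere measure. The
  integrability of test functions will give finite mass near the origin, where the density is not
  bounded.\<close>

lemma monge_ampere_density:
  obtains m where "monge_ampere (support_function \<Omega>) = density lborel (\<lambda>z. ennreal (m z))"
    "m \<in> borel_measurable borel" "continuous_on (- {0}) m" "\<And>z. z \<noteq> 0 \<Longrightarrow> m z > 0"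
    "\<And>f :: complex^'n \<Rightarrow> complex. f \<in> test_functions \<Longrightarrow> integrable (monge_ampere (support_function \<Omega>)) f"
    "continuous_on UNIV (support_function \<Omega>)"
proof -
  obtain B where "homogeneous_potential pot dpot wpot dwpot hpot B" using potential by blast
  then interpret P: homogeneous_potential pot dpot wpot dwpot hpot B .
  define m where "m z = Re (P.M CARD('n) [] [] z)" for z
  have pos: "m z > 0 \<and> P.M CARD('n) [] [] z = of_real (m z)" if z: "z \<noteq> 0" for z
  proof -
    obtain d where "d > 0" "P.M CARD('n) [] [] z = of_real d" using P.M_top_pos[OF hpot_positive[OF z]] by blast
    then show ?thesis by (simp add: m_def)
  qed
  have ma: "is_monge_ampere pot (density lborel (\<lambda>z. ennreal (m z)))"
    unfolding m_def by (rule P.is_monge_ampere_density[where m=m]) (use pos in \<open>auto intro: less_imp_le\<close>)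
  have eq: "monge_ampere (support_function \<Omega>) = density lborel (\<lambda>z. ennreal (m z))"
    unfolding support_function_pot by (rule monge_ampere_eqI[OF P.u_cont ma])
  show thesis
  proof (rule that[OF eq])
    show "m \<in> borel_measurable borel" unfolding m_def using P.M_meas by (simp del: P.M.simps)
    show "continuous_on (- {0}) m" unfolding m_def by (intro continuous_intros P.M_cont)
    show "m z > 0" if "z \<noteq> 0" for z using pos[OF that] by simp
    show "integrable (monge_ampere (support_function \<Omega>)) f" if "f \<in> test_functions" for f :: "complex^'n \<Rightarrow> complex"
      using ma that unfolding eq is_monge_ampere_def by blast
    show "continuous_on UNIV (support_function \<Omega>)" unfolding support_function_pot by (rule P.u_cont)
  qed
qed

end

lemma strongly_convex_imp_body:
  fixes \<Omega> :: "'a::euclidean_space set"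
  assumes bd: "bounded \<Omega>" and sc: "strongly_convex_domain \<Omega>"
  shows "\<exists>nv c C e. smooth_convex_body \<Omega> nv c C e"
proof -
  obtain e c C where ecC: "e > 0" "c > 0" "C > 0" "\<And>x. x \<in> frontier \<Omega> \<Longrightarrow> \<exists>N. rolling_at \<Omega> e c C x N"
    using uniform_local_rolling[OF bd sc] by blast
  have cv: "convex \<Omega>" using sc by (intro convex_if_rolling[OF _ _ ecC(1,2,4)]) (auto simp: strongly_convex_domain_def)
  obtain c' where c': "c' > 0" "\<And>x N y. x \<in> frontier \<Omega> \<Longrightarrow> rolling_at \<Omega> e c C x N \<Longrightarrow> y \<in> closure \<Omega> \<Longrightarrow> c' * (dist x y)\<^sup>2 \<le> N \<bullet> (x - y)"
    using global_rolling[OF cv bd ecC(1,2,4)] by blast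
  obtain nv where nv: "\<And>x. x \<in> frontier \<Omega> \<Longrightarrow> rolling_at \<Omega> e c C x (nv x)" using ecC(4) by metis
  have "smooth_convex_body \<Omega> nv c' C e"
  proof
    show "norm (nv x) = 1" if "x \<in> frontier \<Omega>" for x using nv[OF that] by (simp add: rolling_at_def)
    show "c' * (dist x y)\<^sup>2 \<le> nv x \<bullet> (x - y)" if "x \<in> frontier \<Omega>" "y \<in> closure \<Omega>" for x y using c'(2)[OF that(1) nv[OF that(1)] that(2)] .
    show "y \<in> \<Omega>" if "x \<in> frontier \<Omega>" "dist x y < e" "C * (dist x y)\<^sup>2 < nv x \<bullet> (x - y)" for x y
      using nv[OF that(1)] that(2,3) unfolding rolling_at_def by (metis mem_ball)
  qed (use bd sc cv c'(1) ecC in auto)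
  then show ?thesis by blast
qed

section \<open>Mean values over an annulus\<close>

lemma nn_integral_lborel_shift:
  fixes f :: "'a::euclidean_space \<Rightarrow> ennreal"
  assumes "f \<in> borel_measurable borel"
  shows "(\<integral>\<^sup>+x. f (x + a) \<partial>lborel) = (\<integral>\<^sup>+x. f x \<partial>lborel)"
proof -
  have "(\<integral>\<^sup>+x. f x \<partial>lborel) = (\<integral>\<^sup>+x. f x \<partial>distr lborel borel ((+) a))" by (simp add: lborel_distr_plus)
  also have "\<dots> = (\<integral>\<^sup>+x. f (a + x) \<partial>lborel)" using assms by (subst nn_integral_distr) auto
  finally show ?thesis by (simp add: add.commute)
qed

text \<open>The integral of the indicator of A at T x times that of B at y + T x is computed in two
  orders. Integrating y first gives the measure of the preimage of A times that of B; shifting x by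
  a preimage of y before swapping gives the measure of A times that of the preimage of B.\<close>

lemma lborel_isometry:
  fixes T :: "'a::euclidean_space \<Rightarrow> 'a"
  assumes T: "linear T" "\<And>x. norm (T x) = norm x" and A: "A \<in> sets borel"
  shows "emeasure lborel (T -` A) = emeasure lborel A"
proof -
  have cT: "continuous_on UNIV T" using T(1) linear_continuous_on linear_linear by blast
  have mT [measurable]: "T \<in> borel_measurable borel" by (rule borel_measurable_continuous_onI[OF cT])
  have "x = 0" if "T x = 0" for x using T(2)[of x] that by simp
  then have "inj T" using T(1) by (simp add: linear_injective_0)
  then have surj: "surj T" using linear_injective_imp_surjective T(1) by blast
  \<comment> \<open>A set invariant under T, of finite positive measure, so that it can be cancelled
    at the end.\<close>
  define B where "B = (ball 0 1 :: 'a set)"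
  have mB [measurable]: "B \<in> sets borel" "A \<in> sets borel" using A by (auto simp: B_def)
  let ?I = "\<lambda>S x. indicator S x :: ennreal"
  have "T -` B = B" using T(2) by (auto simp: B_def)
  have pull: "emeasure lborel (T -` S) = (\<integral>\<^sup>+x. ?I S (T x) \<partial>lborel)" if "S \<in> sets borel" for S
  proof -
    have "T -` S \<in> sets borel" using measurable_sets[OF mT that] by simp
    then have "emeasure lborel (T -` S) = (\<integral>\<^sup>+x. ?I (T -` S) x \<partial>lborel)" by simp
    then show ?thesis by (simp add: indicator_vimage)
  qed
  have "emeasure lborel (T -` A) * emeasure lborel B = (\<integral>\<^sup>+x. ?I A (T x) * (\<integral>\<^sup>+y. ?I B y \<partial>lborel) \<partial>lborel)"
    by (subst nn_integral_multc) (auto simp: pull)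
  also have "\<dots> = (\<integral>\<^sup>+x. ?I A (T x) * (\<integral>\<^sup>+y. ?I B (y + T x) \<partial>lborel) \<partial>lborel)"
    by (subst nn_integral_lborel_shift) auto
  also have "\<dots> = (\<integral>\<^sup>+x. (\<integral>\<^sup>+y. ?I A (T x) * ?I B (y + T x) \<partial>lborel) \<partial>lborel)"
    by (subst nn_integral_cmult) auto
  also have "\<dots> = (\<integral>\<^sup>+y. (\<integral>\<^sup>+x. ?I A (T x) * ?I B (y + T x) \<partial>lborel) \<partial>lborel)"
    by (rule lborel_pair.Fubini') measurable
  also have "\<dots> = (\<integral>\<^sup>+y. (\<integral>\<^sup>+x. ?I A (T x - y) * ?I B (T x) \<partial>lborel) \<partial>lborel)"
  proof (rule nn_integral_cong)
    fix y
    obtain y' where y': "T y' = y" using surj by (metis surjD)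
    have "(\<integral>\<^sup>+x. ?I A (T x - y) * ?I B (T x) \<partial>lborel) = (\<integral>\<^sup>+x. ?I A (T (x + y') - y) * ?I B (T (x + y')) \<partial>lborel)"
      by (rule nn_integral_lborel_shift[symmetric, of "\<lambda>x. ?I A (T x - y) * ?I B (T x)"]) measurable
    then show "(\<integral>\<^sup>+x. ?I A (T x) * ?I B (y + T x) \<partial>lborel) = (\<integral>\<^sup>+x. ?I A (T x - y) * ?I B (T x) \<partial>lborel)"
      by (simp add: linear_add[OF T(1)] y' add.commute)
  qed
  also have "\<dots> = (\<integral>\<^sup>+x. (\<integral>\<^sup>+y. ?I A (T x - y) * ?I B (T x) \<partial>lborel) \<partial>lborel)"
    by (rule lborel_pair.Fubini') measurable
  also have "\<dots> = (\<integral>\<^sup>+x. (\<integral>\<^sup>+y. ?I A (T x - y) \<partial>lborel) * ?I B (T x) \<partial>lborel)"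
    by (subst nn_integral_multc) auto
  also have "\<dots> = (\<integral>\<^sup>+x. emeasure lborel A * ?I B (T x) \<partial>lborel)"
  proof (intro nn_integral_cong arg_cong2[where f="(*)"] refl)
    fix x
    have "(\<integral>\<^sup>+y. ?I A (T x - y) \<partial>lborel) = (\<integral>\<^sup>+y. ?I A y \<partial>lborel)"
      using nn_integral_distr[of "\<lambda>y. T x - y" lborel borel "?I A"] by (simp add: lborel_reflect)
    then show "(\<integral>\<^sup>+y. ?I A (T x - y) \<partial>lborel) = emeasure lborel A" by simp
  qed
  also have "\<dots> = emeasure lborel A * emeasure lborel B"
    using \<open>T -` B = B\<close> by (subst nn_integral_cmult) (auto simp: pull[symmetric])
  finally have "emeasure lborel (T -` A) * emeasure lborel B = emeasure lborel A * emeasure lborel B" .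
  moreover have "unit_ball_vol (real DIM('a)) \<noteq> 0"
    using unit_ball_vol_pos[of "real DIM('a)"] by (metis less_irrefl of_nat_0_le_iff)
  then have "emeasure lborel B \<noteq> 0" "emeasure lborel B \<noteq> \<infinity>"
    using emeasure_lborel_ball_finite[of "0::'a" 1] by (auto simp: B_def emeasure_ball)
  ultimately show ?thesis by (simp add: ennreal_mult_cancel_left mult.commute[of _ "emeasure lborel B"])
qed

lemma nn_integral_isometry:
  fixes T :: "'a::euclidean_space \<Rightarrow> 'a" and f :: "'a \<Rightarrow> ennreal"
  assumes T: "linear T" "\<And>x. norm (T x) = norm x" and f: "f \<in> borel_measurable borel"
  shows "(\<integral>\<^sup>+x. f (T x) \<partial>lborel) = (\<integral>\<^sup>+x. f x \<partial>lborel)"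
proof -
  have cT: "continuous_on UNIV T" using T(1) linear_continuous_on linear_linear by blast
  have mT: "T \<in> borel_measurable borel" by (rule borel_measurable_continuous_onI[OF cT])
  have "distr lborel borel T = lborel"
    by (rule measure_eqI) (use mT lborel_isometry[OF T] in \<open>auto simp: emeasure_distr\<close>)
  then have "(\<integral>\<^sup>+x. f x \<partial>lborel) = (\<integral>\<^sup>+x. f x \<partial>distr lborel borel T)" by simp
  also have "\<dots> = (\<integral>\<^sup>+x. f (T x) \<partial>lborel)" using mT f by (subst nn_integral_distr) auto
  finally show ?thesis ..
qed

text \<open>Cauchy's formula on the unit circle, with absolute values taken. The right-hand side is
  a nonnegative integral, ready for Tonelli.\<close>

lemma circle_mean_bound:
  assumes "g holomorphic_on UNIV"
  shows "ennreal (cmod (g 0)) \<le> (\<integral>\<^sup>+t. ennreal (cmod (g (exp (2 * of_real pi * \<i> * of_real t)))) * indicator {0..1} t \<partial>lborel)"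
proof -
  have "((\<lambda>u. g u / (u - 0)) has_contour_integral (2 * of_real pi * \<i> * g 0)) (circlepath 0 1)"
    by (rule Cauchy_integral_circlepath_simple) (use assms in \<open>auto intro: holomorphic_on_subset\<close>)
  then have "((\<lambda>t. g (circlepath 0 1 t) / circlepath 0 1 t * vector_derivative (circlepath 0 1) (at t)) has_integral (2 * of_real pi * \<i> * g 0)) {0..1}"
    unfolding has_contour_integral by simp
  moreover have "g (circlepath 0 1 t) / circlepath 0 1 t * vector_derivative (circlepath 0 1) (at t)
      = 2 * of_real pi * \<i> * g (exp (2 * of_real pi * \<i> * of_real t))" for t
    unfolding vector_derivative_circlepath by (simp add: circlepath)
  ultimately have "((\<lambda>t. 2 * of_real pi * \<i> * g (exp (2 * of_real pi * \<i> * of_real t))) has_integral (2 * of_real pi * \<i> * g 0)) {0..1}"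
    by simp
  from has_integral_mult_right[OF this, of "1 / (2 * of_real pi * \<i>)"]
  have i: "((\<lambda>t. g (exp (2 * of_real pi * \<i> * of_real t))) has_integral g 0) {0..1}" by simp
  have c: "continuous_on {0..1} (\<lambda>t. g (exp (2 * of_real pi * \<i> * of_real t)))"
    by (intro continuous_on_compose2[OF holomorphic_on_imp_continuous_on[OF assms]] continuous_intros) auto
  have b: "cmod (g 0) \<le> integral {0..1} (\<lambda>t. cmod (g (exp (2 * of_real pi * \<i> * of_real t))))"
    unfolding integral_unique[OF i, symmetric]
    by (intro integral_norm_bound_integral integrable_continuous_interval continuous_on_norm c) simp
  let ?h = "\<lambda>t. cmod (g (exp (2 * of_real pi * \<i> * of_real t)))"
  show ?thesis
  proof (cases "(\<integral>\<^sup>+t\<in>{0..1}. ?h t \<partial>lborel) < \<infinity>")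
    case True
    have "set_borel_measurable borel {0..1} ?h"
      unfolding set_borel_measurable_def by (intro borel_measurable_continuous_on_indicator continuous_on_norm c) simp
    then have "(\<integral>\<^sup>+t\<in>{0..1}. ?h t \<partial>lborel) = ennreal (integral {0..1} ?h)"
      by (rule set_nn_integral_lborel_eq_integral) (use True in auto)
    then show ?thesis using b by (simp add: ennreal_leI)
  qed (simp add: less_top[symmetric])
qed

lemma entire_line_holomorphic:
  assumes "entire F"
  shows "(\<lambda>s. F (z + s *s a)) holomorphic_on UNIV"
proof -
  have "\<exists>D. ((\<lambda>s. F (z + s *s a)) has_field_derivative D) (at s)" for s
  proof -
    obtain F' where F': "(F has_derivative F') (at (z + s *s a))" "\<And>c v. F' (c *s v) = c * F' v"
      using assms unfolding entire_def by blast
    have "linear (\<lambda>s::complex. s *s a)" by (rule linearI) (simp_all add: vec_eq_iff distrib_right)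
    then have "((\<lambda>s. z + s *s a) has_derivative (\<lambda>s. s *s a)) (at s)"
      using has_derivative_add[OF has_derivative_const[of z] linear_imp_has_derivative] by fastforce
    from has_derivative_compose[OF this F'(1)]
    have "((\<lambda>s. F (z + s *s a)) has_derivative (\<lambda>s. s * F' a)) (at s)" by (simp add: F'(2))
    then show ?thesis unfolding has_field_derivative_def by (metis (no_types, lifting) ext mult.commute)
  qed
  then show ?thesis by (auto simp: holomorphic_on_def field_differentiable_def)
qed

lemma entire_continuous: "entire F \<Longrightarrow> continuous_on UNIV F"
  unfolding entire_def by (metis continuous_at_imp_continuous_on has_derivative_continuous)

text \<open>The circle mean value on the complex lines through z in direction a, averaged over a in
  an annulus. Multiplication of a by a unit complex number preserves the annulus and Lebesgue
  measure, so the integration over the circle disappears; translation by z enlarges the annulus by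
  at most 1 on either side. An annulus is used to stay away from the origin, where weight and
  density are not controlled.\<close>

lemma entire_annulus_bound:
  fixes F :: "complex^'n::finite \<Rightarrow> complex"
  assumes F: "entire F" and z: "norm z \<le> 1"
  shows "ennreal ((cmod (F z))\<^sup>2) * emeasure lborel {a::complex^'n. 4 \<le> norm a \<and> norm a \<le> 6}
    \<le> (\<integral>\<^sup>+w. ennreal ((cmod (F w))\<^sup>2) * indicator {w. 3 \<le> norm w \<and> norm w \<le> 7} w \<partial>lborel)"
proof -
  define A where "A = {a::complex^'n. 4 \<le> norm a \<and> norm a \<le> 6}"
  define G where "G w = ennreal ((cmod (F w))\<^sup>2)" for w
  define E where "E t = exp (2 * complex_of_real pi * \<i> * of_real t)" for t :: real
  have Fm: "F \<in> borel_measurable borel" using entire_continuous[OF F] by (rule borel_measurable_continuous_onI)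
  have Gm [measurable]: "G \<in> borel_measurable borel" unfolding G_def using Fm by measurable
  have Am [measurable]: "A \<in> sets borel" unfolding A_def by measurable
  have mean: "G z \<le> (\<integral>\<^sup>+t. G (z + E t *s a) * indicator {0..1} t \<partial>lborel)" for a
  proof -
    have "(\<lambda>s. (F (z + s *s a))\<^sup>2) holomorphic_on UNIV"
      by (intro holomorphic_intros entire_line_holomorphic[OF F])
    from circle_mean_bound[OF this] show ?thesis by (simp add: G_def E_def norm_power)
  qed
  have cs: "continuous_on UNIV (\<lambda>p :: (complex^'n) \<times> real. z + E (snd p) *s fst p)"
    unfolding E_def vector_scalar_mult_def by (intro continuous_intros)
  have sm [measurable]: "(\<lambda>p. z + E (snd p) *s fst p) \<in> borel_measurable (lborel \<Otimes>\<^sub>M lborel)"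
    using borel_measurable_continuous_onI[OF cs] by (simp add: lborel_prod borel_prod)
  have pm [measurable]: "(\<lambda>p. G (z + E (snd p) *s fst p) * indicator {0..1} (snd p) * indicator A (fst p)) \<in> borel_measurable (lborel \<Otimes>\<^sub>M lborel)"
    using measurable_compose[OF sm Gm] by measurable
  have "G z * emeasure lborel A = (\<integral>\<^sup>+a. G z * indicator A a \<partial>lborel)" by (simp add: nn_integral_cmult_indicator)
  also have "\<dots> \<le> (\<integral>\<^sup>+a. (\<integral>\<^sup>+t. G (z + E t *s a) * indicator {0..1} t \<partial>lborel) * indicator A a \<partial>lborel)"
    by (intro nn_integral_mono mult_right_mono mean) auto
  also have "\<dots> = (\<integral>\<^sup>+a. (\<integral>\<^sup>+t. G (z + E t *s a) * indicator {0..1} t * indicator A a \<partial>lborel) \<partial>lborel)"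
  proof (rule nn_integral_cong)
    fix a
    show "(\<integral>\<^sup>+t. G (z + E t *s a) * indicator {0..1} t \<partial>lborel) * indicator A a
        = (\<integral>\<^sup>+t. G (z + E t *s a) * indicator {0..1} t * indicator A a \<partial>lborel)"
      by (cases "a \<in> A") auto
  qed
  also have "\<dots> = (\<integral>\<^sup>+t. (\<integral>\<^sup>+a. G (z + E t *s a) * indicator {0..1} t * indicator A a \<partial>lborel) \<partial>lborel)"
    by (rule lborel_pair.Fubini'[symmetric]) (use pm in \<open>simp add: split_def\<close>)
  also have "\<dots> = (\<integral>\<^sup>+t. (\<integral>\<^sup>+a. G (z + a) * indicator {0..1} (t::real) * indicator A a \<partial>lborel) \<partial>lborel)"
  proof (rule nn_integral_cong)
    fix t :: real
    have E1: "cmod (E t) = 1" by (simp add: E_def norm_exp_eq_Re)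
    have nT: "norm (E t *s a) = norm a" for a :: "complex^'n" by (simp add: norm_vec_def L2_set_def norm_mult E1)
    have lT: "linear (\<lambda>a :: complex^'n. E t *s a)" by (rule linearI) (auto simp: vec_eq_iff distrib_left)
    have "(\<integral>\<^sup>+a. G (z + E t *s a) * indicator {0..1} t * indicator A (E t *s a) \<partial>lborel)
        = (\<integral>\<^sup>+a. G (z + a) * indicator {0..1} t * indicator A a \<partial>lborel)"
      by (rule nn_integral_isometry[OF lT nT, of "\<lambda>a. G (z + a) * indicator {0..1} t * indicator A a"]) measurable
    moreover have "indicator A (E t *s a) = (indicator A a :: ennreal)" for a by (simp add: A_def indicator_def nT)
    ultimately show "(\<integral>\<^sup>+a. G (z + E t *s a) * indicator {0..1} t * indicator A a \<partial>lborel)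
        = (\<integral>\<^sup>+a. G (z + a) * indicator {0..1} t * indicator A a \<partial>lborel)" by simp
  qed
  also have "\<dots> = (\<integral>\<^sup>+t. (\<integral>\<^sup>+a. G (z + a) * indicator A a \<partial>lborel) * indicator {0..1} (t::real) \<partial>lborel)"
  proof (rule nn_integral_cong)
    fix t :: real
    show "(\<integral>\<^sup>+a. G (z + a) * indicator {0..1} t * indicator A a \<partial>lborel) = (\<integral>\<^sup>+a. G (z + a) * indicator A a \<partial>lborel) * indicator {0..1} t"
      by (cases "t \<in> {0..1}") auto
  qed
  also have "\<dots> = (\<integral>\<^sup>+a. G (z + a) * indicator A a \<partial>lborel)" by (simp add: nn_integral_cmult_indicator)
  also have "\<dots> \<le> (\<integral>\<^sup>+a. G (a + z) * indicator {w. 3 \<le> norm w \<and> norm w \<le> 7} (a + z) \<partial>lborel)"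
  proof (rule nn_integral_mono)
    fix a
    have "a + z \<in> {w. 3 \<le> norm w \<and> norm w \<le> 7}" if "a \<in> A"
      using that z norm_triangle_ineq[of a z] norm_diff_ineq[of a z] by (auto simp: A_def)
    then show "G (z + a) * indicator A a \<le> G (a + z) * indicator {w. 3 \<le> norm w \<and> norm w \<le> 7} (a + z)"
      by (cases "a \<in> A") (auto simp: add.commute)
  qed
  also have "\<dots> = (\<integral>\<^sup>+a. G a * indicator {w. 3 \<le> norm w \<and> norm w \<le> 7} a \<partial>lborel)"
    by (rule nn_integral_lborel_shift) measurable
  finally show ?thesis unfolding G_def A_def .
qed

section \<open>The weighted spaces\<close>

lemma A2_iff:
  assumes "sets \<omega> = sets borel"
  shows "F \<in> A2 \<omega> \<longleftrightarrow> entire F \<and> (\<integral>\<^sup>+z. ennreal ((cmod (F z))\<^sup>2) \<partial>\<omega>) < \<infinity>"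
proof -
  have "(\<lambda>z. (cmod (F z))\<^sup>2) \<in> borel_measurable \<omega>" if "entire F"
  proof -
    have [measurable]: "F \<in> borel_measurable borel" using entire_continuous[OF that] by (rule borel_measurable_continuous_onI)
    have "(\<lambda>z. (cmod (F z))\<^sup>2) \<in> borel_measurable borel" by measurable
    then show ?thesis using assms by (simp cong: measurable_cong_sets)
  qed
  then show ?thesis by (auto simp: A2_def integrable_iff_bounded)
qed

lemma L2_norm_nn_integral:
  assumes "sets \<omega> = sets borel" "entire F"
  shows "L2_norm \<omega> F = sqrt (enn2real (\<integral>\<^sup>+z. ennreal ((cmod (F z))\<^sup>2) \<partial>\<omega>))"
proof -
  have [measurable]: "F \<in> borel_measurable borel" using entire_continuous[OF assms(2)] by (rule borel_measurable_continuous_onI)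
  have "(\<lambda>z. (cmod (F z))\<^sup>2) \<in> borel_measurable borel" by measurable
  then have "(\<lambda>z. (cmod (F z))\<^sup>2) \<in> borel_measurable \<omega>" using assms by (simp cong: measurable_cong_sets)
  then show ?thesis unfolding L2_norm_def by (subst integral_eq_nn_integral) auto
qed

lemma L2_norm_le:
  assumes s: "sets \<omega> = sets borel" "sets \<omega>' = sets borel" and F: "entire F" and K: "K > 0"
    and fin: "(\<integral>\<^sup>+z. ennreal ((cmod (F z))\<^sup>2) \<partial>\<omega>') < \<infinity>"
    and le: "(\<integral>\<^sup>+z. ennreal ((cmod (F z))\<^sup>2) \<partial>\<omega>) \<le> ennreal K * (\<integral>\<^sup>+z. ennreal ((cmod (F z))\<^sup>2) \<partial>\<omega>')"
  shows "L2_norm \<omega> F \<le> sqrt K * L2_norm \<omega>' F"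
proof -
  have "enn2real (\<integral>\<^sup>+z. ennreal ((cmod (F z))\<^sup>2) \<partial>\<omega>) \<le> enn2real (ennreal K * (\<integral>\<^sup>+z. ennreal ((cmod (F z))\<^sup>2) \<partial>\<omega>'))"
    using fin by (intro enn2real_mono le) (simp add: ennreal_mult_less_top)
  also have "\<dots> = K * enn2real (\<integral>\<^sup>+z. ennreal ((cmod (F z))\<^sup>2) \<partial>\<omega>')" using K by (simp add: enn2real_mult)
  finally show ?thesis unfolding L2_norm_nn_integral[OF s(1) F] L2_norm_nn_integral[OF s(2) F] real_sqrt_mult[symmetric]
    by (rule real_sqrt_le_mono)
qed

text \<open>Inequalities between nonnegative integrals for all entire functions settle both parts at
  once: finiteness transfers in each direction, and square roots give the norm constants.\<close>

lemma identity_isomorphismI: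
  fixes \<omega> \<omega>' :: "(complex^'n::finite) measure"
  assumes s: "sets \<omega> = sets borel" "sets \<omega>' = sets borel" and K: "K > 0" "K' > 0"
    and le: "\<And>F. entire F \<Longrightarrow> (\<integral>\<^sup>+z. ennreal ((cmod (F z))\<^sup>2) \<partial>\<omega>) \<le> ennreal K * (\<integral>\<^sup>+z. ennreal ((cmod (F z))\<^sup>2) \<partial>\<omega>')"
    and le': "\<And>F. entire F \<Longrightarrow> (\<integral>\<^sup>+z. ennreal ((cmod (F z))\<^sup>2) \<partial>\<omega>') \<le> ennreal K' * (\<integral>\<^sup>+z. ennreal ((cmod (F z))\<^sup>2) \<partial>\<omega>)"
  shows "identity_isomorphism \<omega> \<omega>'"
proof -
  have fin: "(\<integral>\<^sup>+z. ennreal ((cmod (F z))\<^sup>2) \<partial>\<omega>) < \<infinity> \<longleftrightarrow> (\<integral>\<^sup>+z. ennreal ((cmod (F z))\<^sup>2) \<partial>\<omega>') < \<infinity>" if "entire F" for F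
    using le[OF that] le'[OF that] by (auto simp: ennreal_mult_less_top intro: le_less_trans)
  have eq: "A2 \<omega> = A2 \<omega>'" using fin by (auto simp: A2_iff[OF s(1)] A2_iff[OF s(2)])
  have "1 / sqrt K * L2_norm \<omega> F \<le> L2_norm \<omega>' F \<and> L2_norm \<omega>' F \<le> sqrt K' * L2_norm \<omega> F" if "F \<in> A2 \<omega>" for F
  proof
    have F: "entire F" and f: "(\<integral>\<^sup>+z. ennreal ((cmod (F z))\<^sup>2) \<partial>\<omega>) < \<infinity>" using that by (auto simp: A2_iff[OF s(1)])
    have "L2_norm \<omega> F \<le> sqrt K * L2_norm \<omega>' F" using L2_norm_le[OF s F K(1) _ le[OF F]] f fin[OF F] by blast
    then show "1 / sqrt K * L2_norm \<omega> F \<le> L2_norm \<omega>' F" using K(1) by (simp add: field_simps)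
    show "L2_norm \<omega>' F \<le> sqrt K' * L2_norm \<omega> F" by (rule L2_norm_le[OF s(2,1) F K(2) f le'[OF F]])
  qed
  moreover have "1 / sqrt K > 0" "sqrt K' > 0" using K by auto
  ultimately show ?thesis unfolding identity_isomorphism_def using eq by blast
qed

text \<open>The weights need not be comparable near the origin: values there are controlled by the annulus.\<close>

lemma comparable_weights_isomorphism:
  fixes m a b :: "complex^'n::finite \<Rightarrow> real"
  assumes [measurable]: "m \<in> borel_measurable borel" "a \<in> borel_measurable borel" "b \<in> borel_measurable borel"
    and b0: "\<And>z. b z \<ge> 0"
    and K: "K > 0" and ba: "\<And>z. b z \<le> K * a z" and ab: "\<And>z. norm z \<ge> 1 \<Longrightarrow> a z \<le> K * b z"
    and near: "\<And>z. norm z \<le> 1 \<Longrightarrow> a z \<le> K"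
    and k: "k > 0" and ann: "\<And>z. 3 \<le> norm z \<Longrightarrow> norm z \<le> 7 \<Longrightarrow> k \<le> b z * m z \<and> m z > 0"
    and fin: "emeasure (density lborel (\<lambda>z. ennreal (m z))) (cball 0 1) < \<infinity>"
  defines "\<mu> \<equiv> density lborel (\<lambda>z. ennreal (m z))"
  shows "identity_isomorphism (density \<mu> (\<lambda>z. ennreal (a z))) (density \<mu> (\<lambda>z. ennreal (b z)))"
proof -
  define A where "A = {x::complex^'n. 4 \<le> norm x \<and> norm x \<le> 6}"
  define A' where "A' = {x::complex^'n. 3 \<le> norm x \<and> norm x \<le> 7}"
  have [measurable]: "A' \<in> sets borel" unfolding A'_def by measurable
  have [measurable]: "cball 0 1 \<in> sets (borel :: (complex^'n) measure)" by simp
  obtain V where V: "V > 0" "emeasure lborel A = ennreal V"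
  proof -
    have "emeasure lborel A \<le> emeasure lborel (cball (0 :: complex^'n) 6)" by (rule emeasure_mono) (auto simp: A_def)
    then have "emeasure lborel A < top" using emeasure_cball_less_top by (rule le_less_trans)
    moreover have "emeasure lborel A > 0"
    proof -
      obtain x :: "complex^'n" where "norm x = 5" using vector_choose_size[of 5] by auto
      have "cball x 1 \<subseteq> A"
      proof
        fix y assume "y \<in> cball x 1"
        then have "norm (y - x) \<le> 1" by (simp add: dist_norm norm_minus_commute)
        then show "y \<in> A" using norm_triangle_ineq2[of y x] norm_triangle_ineq2[of x y] \<open>norm x = 5\<close>
          by (simp add: A_def norm_minus_commute)
      qed
      moreover have "A \<in> sets lborel" unfolding A_def by measurable
      ultimately have "emeasure lborel (cball x 1) \<le> emeasure lborel A" by (intro emeasure_mono)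
      moreover have "emeasure lborel (cball x 1) > 0"
        using unit_ball_vol_pos[of "real DIM(complex^'n)"] by (simp add: emeasure_cball)
      ultimately show ?thesis by (rule less_le_trans[rotated])
    qed
    ultimately show thesis using that[of "enn2real (emeasure lborel A)"] by (auto simp: enn2real_positive_iff)
  qed
  obtain M where M: "M \<ge> 0" "emeasure \<mu> (cball 0 1) = ennreal M"
    using fin unfolding \<mu>_def[symmetric] by (cases "emeasure \<mu> (cball 0 1)" rule: ennreal_cases) auto
  have [measurable_cong]: "sets \<mu> = sets borel" by (simp add: \<mu>_def)
  define N where "N w F = (\<integral>\<^sup>+z. ennreal (w z) * ennreal ((cmod (F z))\<^sup>2) \<partial>\<mu>)" for w :: "complex^'n \<Rightarrow> real" and F :: "complex^'n \<Rightarrow> complex"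
  have Fm: "F \<in> borel_measurable borel" if "entire F" for F :: "complex^'n \<Rightarrow> complex"
    using entire_continuous[OF that] by (rule borel_measurable_continuous_onI)
  have dens: "(\<integral>\<^sup>+z. ennreal ((cmod (F z))\<^sup>2) \<partial>density \<mu> (\<lambda>z. ennreal (w z))) = N w F"
    if "w \<in> borel_measurable borel" "entire F" for w F
    unfolding N_def using that(1) Fm[OF that(2)] by (intro nn_integral_density) auto
  have one: "N b F \<le> ennreal K * N a F" if "entire F" for F
  proof -
    have "N b F \<le> (\<integral>\<^sup>+z. ennreal K * (ennreal (a z) * ennreal ((cmod (F z))\<^sup>2)) \<partial>\<mu>)"
      unfolding N_def
    proof (rule nn_integral_mono)
      fix z
      have "ennreal (b z) \<le> ennreal (K * a z)" using ba by (rule ennreal_leI)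
      also have "\<dots> = ennreal K * ennreal (a z)" using K by (intro ennreal_mult') simp
      finally show "ennreal (b z) * ennreal ((cmod (F z))\<^sup>2) \<le> ennreal K * (ennreal (a z) * ennreal ((cmod (F z))\<^sup>2))"
        unfolding mult.assoc[symmetric] by (rule mult_right_mono) simp
    qed
    also have "\<dots> = ennreal K * N a F" unfolding N_def using Fm[OF that] by (intro nn_integral_cmult) auto
    finally show ?thesis .
  qed
  \<comment> \<open>k bounds b m from below on the larger annulus, V is the volume of the smaller
    one; their product is what the mean value estimate loses.\<close>
  define c where "c = 1 / (k * V)"
  have c: "c > 0" using k V by (simp add: c_def)
  have center: "ennreal ((cmod (F z))\<^sup>2) \<le> ennreal c * N b F" if F: "entire F" and z: "norm z \<le> 1" for F z
  proof -
    have [measurable]: "F \<in> borel_measurable borel" by (rule Fm[OF F])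
    have kV: "ennreal (k * V) = ennreal k * ennreal V" using k V(1) by (intro ennreal_mult) auto
    have "ennreal (k * V) * ennreal ((cmod (F z))\<^sup>2) = ennreal k * (ennreal ((cmod (F z))\<^sup>2) * emeasure lborel A)"
      unfolding V(2) kV by (simp only: mult_ac)
    also have "\<dots> \<le> ennreal k * (\<integral>\<^sup>+w. ennreal ((cmod (F w))\<^sup>2) * indicator A' w \<partial>lborel)"
      using entire_annulus_bound[OF F z] unfolding A_def A'_def by (intro mult_left_mono) auto
    also have "\<dots> = (\<integral>\<^sup>+w. ennreal k * (ennreal ((cmod (F w))\<^sup>2) * indicator A' w) \<partial>lborel)"
      by (rule nn_integral_cmult[symmetric]) measurable
    also have "\<dots> \<le> (\<integral>\<^sup>+w. ennreal (m w) * (ennreal (b w) * ennreal ((cmod (F w))\<^sup>2)) \<partial>lborel)"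
    proof (rule nn_integral_mono)
      fix w
      show "ennreal k * (ennreal ((cmod (F w))\<^sup>2) * indicator A' w) \<le> ennreal (m w) * (ennreal (b w) * ennreal ((cmod (F w))\<^sup>2))"
      proof (cases "w \<in> A'")
        case True
        then have "k \<le> b w * m w" "m w > 0" using ann by (auto simp: A'_def)
        then have "ennreal k \<le> ennreal (m w) * ennreal (b w)"
          using b0[of w] by (simp add: ennreal_mult'[symmetric] ennreal_leI mult.commute)
        then show ?thesis using True unfolding mult.assoc[symmetric] by (simp add: mult_right_mono)
      qed simp
    qed
    also have "\<dots> = N b F" unfolding N_def \<mu>_def by (subst nn_integral_density) (auto simp: mult_ac)
    finally have "ennreal c * (ennreal (k * V) * ennreal ((cmod (F z))\<^sup>2)) \<le> ennreal c * N b F" by (rule mult_left_mono) simp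
    moreover have "ennreal c * ennreal (k * V) = 1" using k V c by (simp add: ennreal_mult'[symmetric] c_def)
    ultimately show ?thesis by (simp add: mult.assoc[symmetric])
  qed
  have two: "N a F \<le> ennreal (K + K * M * c) * N b F" if F: "entire F" for F
  proof -
    have [measurable]: "F \<in> borel_measurable borel" by (rule Fm[OF F])
    \<comment> \<open>Off the unit ball the weights are comparable; on it a is bounded by K and F by
      its values on the annulus, which leaves a constant times the mass M of the ball.\<close>
    have "N a F \<le> (\<integral>\<^sup>+z. ennreal K * (ennreal (b z) * ennreal ((cmod (F z))\<^sup>2)) + ennreal K * (ennreal c * N b F) * indicator (cball 0 1) z \<partial>\<mu>)"
      unfolding N_def[of a]
    proof (rule nn_integral_mono)
      fix z
      show "ennreal (a z) * ennreal ((cmod (F z))\<^sup>2) \<le> ennreal K * (ennreal (b z) * ennreal ((cmod (F z))\<^sup>2)) + ennreal K * (ennreal c * N b F) * indicator (cball 0 1) z"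
      proof (cases "norm z \<le> 1")
        case True
        have "ennreal (a z) * ennreal ((cmod (F z))\<^sup>2) \<le> ennreal K * (ennreal c * N b F)"
          by (intro mult_mono ennreal_leI near True center F) auto
        then show ?thesis using True by (simp add: add_increasing)
      next
        case False
        then have "ennreal (a z) \<le> ennreal (K * b z)" by (intro ennreal_leI ab) simp
        also have "\<dots> = ennreal K * ennreal (b z)" using K by (intro ennreal_mult') simp
        finally have "ennreal (a z) * ennreal ((cmod (F z))\<^sup>2) \<le> ennreal K * (ennreal (b z) * ennreal ((cmod (F z))\<^sup>2))"
          unfolding mult.assoc[symmetric] by (rule mult_right_mono) simp
        then show ?thesis using False by simp
      qed
    qed
    also have "\<dots> = (\<integral>\<^sup>+z. ennreal K * (ennreal (b z) * ennreal ((cmod (F z))\<^sup>2)) \<partial>\<mu>) + (\<integral>\<^sup>+z. ennreal K * (ennreal c * N b F) * indicator (cball 0 1) z \<partial>\<mu>)"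
      by (intro nn_integral_add) measurable
    also have "(\<integral>\<^sup>+z. ennreal K * (ennreal (b z) * ennreal ((cmod (F z))\<^sup>2)) \<partial>\<mu>) = ennreal K * N b F"
      unfolding N_def by (intro nn_integral_cmult) measurable
    also have "(\<integral>\<^sup>+z. ennreal K * (ennreal c * N b F) * indicator (cball 0 1) z \<partial>\<mu>) = ennreal K * (ennreal c * N b F) * emeasure \<mu> (cball 0 1)"
      by (rule nn_integral_cmult_indicator) simp
    also have "ennreal K * N b F + ennreal K * (ennreal c * N b F) * emeasure \<mu> (cball 0 1) = ennreal (K + K * M * c) * N b F"
    proof -
      have "ennreal (K + K * M * c) = ennreal K + ennreal K * ennreal M * ennreal c"
        using K M c by (simp add: ennreal_mult)
      then show ?thesis unfolding M by (simp only: distrib_right) (simp only: mult_ac)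
    qed
    finally show ?thesis .
  qed
  show ?thesis
  proof (rule identity_isomorphismI)
    show "K + K * M * c > 0" "K > 0" using K M c by (auto intro: add_pos_nonneg)
  qed (auto simp: dens one two, auto simp: \<mu>_def)
qed

section \<open>Comparison of the two weights\<close>

context smooth_convex_body_complex begin

lemma bdim_complex: "bdim = 2 * CARD('n) - 1" "bdim > 0"
proof -
  show eq: "bdim = 2 * CARD('n) - 1" by (simp add: bdim_def)
  show "bdim > 0" unfolding eq using zero_less_card_finite[where 'a='n] by linarith
qed

text \<open>The origin of the exponent n - 1/2: half of \<open>bdim\<close> = 2n - 1, as the
  relevant caps have radius of order |z|^(-1/2).\<close>

lemma root_power: "r > 0 \<Longrightarrow> (1 / sqrt r) ^ bdim = 1 / r powr (real CARD('n) - 1 / 2)"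
proof -
  assume r: "r > 0"
  have e: "real bdim / 2 = real CARD('n) - 1 / 2" using bdim_complex by (simp add: of_nat_diff field_simps)
  have "sqrt r ^ bdim = r powr (real CARD('n) - 1 / 2)"
    unfolding e[symmetric] using r by (simp add: powr_realpow[symmetric] powr_half_sqrt[symmetric] powr_powr)
  then show ?thesis by (simp add: power_divide)
qed

lemma L2_norm_exp: "(L2_norm \<sigma> (\<lambda>\<zeta>. exp (cpair z \<zeta>)))\<^sup>2 = enn2real (lap (conj_vec z))"
proof -
  have e: "(cmod (exp (cpair z \<zeta>)))\<^sup>2 = exp (2 * (\<zeta> \<bullet> conj_vec z))" for \<zeta>
    by (simp add: inner_conj_vec norm_exp_eq_Re exp_double[symmetric] cpair_def mult.commute)
  have m: "(\<lambda>\<zeta>. exp (2 * (\<zeta> \<bullet> conj_vec z))) \<in> borel_measurable \<sigma>" by (rule borel_surface) measurable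
  have "(L2_norm \<sigma> (\<lambda>\<zeta>. exp (cpair z \<zeta>)))\<^sup>2 = (LINT \<zeta>|\<sigma>. exp (2 * (\<zeta> \<bullet> conj_vec z)))"
    unfolding L2_norm_def e by (simp add: integral_nonneg_AE)
  also have "\<dots> = enn2real (lap (conj_vec z))"
    unfolding lap_def by (rule integral_eq_nn_integral[OF m]) simp
  finally show ?thesis .
qed

lemma lap_measurable: "lap \<in> borel_measurable borel"
proof -
  interpret finite_measure \<sigma> by (rule finite_measure_surface[OF bdim_complex(2)])
  have [measurable]: "(\<lambda>x. x) \<in> borel_measurable \<sigma>" by (rule borel_surface) simp
  have "(\<lambda>w. \<integral>\<^sup>+\<zeta>. ennreal (exp (2 * (\<zeta> \<bullet> w))) \<partial>\<sigma>) \<in> borel_measurable borel"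
    by (rule borel_measurable_nn_integral) measurable
  then show ?thesis by (simp add: lap_def[abs_def])
qed

definition weight_tilde :: "complex^'n \<Rightarrow> real" where
  "weight_tilde z = 1 / (L2_norm \<sigma> (\<lambda>\<zeta>. exp (cpair z \<zeta>)))\<^sup>2"

definition weight_nu :: "complex^'n \<Rightarrow> real" where
  "weight_nu z = exp (- 2 * support_function \<Omega> z) * norm z powr (real CARD('n) - 1 / 2)"

lemma weight_tilde_measurable: "weight_tilde \<in> borel_measurable borel"
proof -
  have "conj_vec \<in> borel_measurable borel" by (rule borel_measurable_continuous_onI[OF conj_vec_cont])
  then have "(\<lambda>z. lap (conj_vec z)) \<in> borel_measurable borel" by (rule measurable_compose[OF _ lap_measurable])
  then show ?thesis unfolding weight_tilde_def[abs_def] L2_norm_exp by measurable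
qed

lemma inverse_weight_nu: "z \<noteq> 0 \<Longrightarrow> exp (2 * hsup (conj_vec z)) * (1 / sqrt (norm (conj_vec z))) ^ bdim = 1 / weight_nu z"
proof -
  assume z: "z \<noteq> 0"
  have "exp (2 * x) * (1 / p) = 1 / (exp (- 2 * x) * p)" for x p :: real
    unfolding mult_minus_left exp_minus by (simp add: divide_inverse)
  then show ?thesis using z by (simp only: weight_nu_def root_power support_function_pot pot_def conj_vec_simps zero_less_norm_iff not_False_eq_True)
qed

lemma weight_nu_pos: "z \<noteq> 0 \<Longrightarrow> weight_nu z > 0" by (simp add: weight_nu_def)

text \<open>The estimate comes from \<open>lap_upper\<close>, valid at every nonzero point. The
  lower bounds enter only to make the norm of the exponential positive: with a vanishing norm the
  quotient defining \<open>weight_tilde\<close> would be 0.\<close>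

lemma weight_nu_le_tilde: "\<exists>k>0. \<forall>z. z \<noteq> 0 \<longrightarrow> weight_nu z \<le> k * weight_tilde z"
proof -
  obtain k where k: "k > 0" "\<And>w. w \<noteq> 0 \<Longrightarrow> lap w \<le> ennreal (k * (exp (2 * hsup w) * (1 / sqrt (norm w)) ^ bdim))"
    using lap_upper[OF bdim_complex(2)] by blast
  obtain k1 k2 where k1: "k1 > 0" "\<And>w. norm w \<le> 1 \<Longrightarrow> ennreal k1 \<le> lap w" using lap_near_zero[OF bdim_complex(2)] by blast
  obtain k3 where k3: "k3 > 0" "\<And>w. 1 \<le> norm w \<Longrightarrow> ennreal (k3 * (exp (2 * hsup w) * (1 / sqrt (norm w)) ^ bdim)) \<le> lap w"
    using lap_lower[OF bdim_complex(2)] by blast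
  have "weight_nu z \<le> k * weight_tilde z" if z: "z \<noteq> 0" for z
  proof -
    have u: "lap (conj_vec z) \<le> ennreal (k * (1 / weight_nu z))" using k(2)[of "conj_vec z"] z unfolding inverse_weight_nu[OF z] by simp
    then have fin: "lap (conj_vec z) < top" by (rule le_less_trans) simp
    have "lap (conj_vec z) > 0"
    proof (cases "norm z \<le> 1")
      case True
      then have "ennreal k1 \<le> lap (conj_vec z)" using k1(2)[of "conj_vec z"] by simp
      moreover have "ennreal k1 > 0" using k1(1) by simp
      ultimately show ?thesis by (rule less_le_trans[rotated])
    next
      case False
      then have "ennreal (k3 * (1 / weight_nu z)) \<le> lap (conj_vec z)" using k3(2)[of "conj_vec z"] unfolding inverse_weight_nu[OF z] by simp
      moreover have "ennreal (k3 * (1 / weight_nu z)) > 0" using k3(1) weight_nu_pos[OF z] by simp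
      ultimately show ?thesis by (rule less_le_trans[rotated])
    qed
    then have p: "enn2real (lap (conj_vec z)) > 0" using fin by (simp add: enn2real_positive_iff)
    have "enn2real (lap (conj_vec z)) \<le> k * (1 / weight_nu z)" using enn2real_mono[OF u] k(1) weight_nu_pos[OF z] by simp
    then show ?thesis using p weight_nu_pos[OF z] unfolding weight_tilde_def L2_norm_exp by (simp add: field_simps)
  qed
  then show ?thesis using k(1) by blast
qed

text \<open>The estimate comes from \<open>lap_lower\<close>, hence the restriction to |z| at least
  1. The upper bound enters only for finiteness, because \<open>enn2real\<close> sends infinity to
  0.\<close>

lemma weight_tilde_le_nu: "\<exists>k>0. \<forall>z. norm z \<ge> 1 \<longrightarrow> weight_tilde z \<le> k * weight_nu z"
proof -
  obtain k where k: "k > 0" "\<And>w. w \<noteq> 0 \<Longrightarrow> lap w \<le> ennreal (k * (exp (2 * hsup w) * (1 / sqrt (norm w)) ^ bdim))"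
    using lap_upper[OF bdim_complex(2)] by blast
  obtain k3 where k3: "k3 > 0" "\<And>w. 1 \<le> norm w \<Longrightarrow> ennreal (k3 * (exp (2 * hsup w) * (1 / sqrt (norm w)) ^ bdim)) \<le> lap w"
    using lap_lower[OF bdim_complex(2)] by blast
  have "weight_tilde z \<le> (1 / k3) * weight_nu z" if z: "norm z \<ge> 1" for z
  proof -
    have z0: "z \<noteq> 0" using z by auto
    have "lap (conj_vec z) \<le> ennreal (k * (1 / weight_nu z))" using k(2)[of "conj_vec z"] z0 unfolding inverse_weight_nu[OF z0] by simp
    then have fin: "lap (conj_vec z) < top" by (rule le_less_trans) simp
    have "ennreal (k3 * (1 / weight_nu z)) \<le> lap (conj_vec z)" using k3(2)[of "conj_vec z"] z unfolding inverse_weight_nu[OF z0] by simp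
    from enn2real_mono[OF this] have l: "k3 * (1 / weight_nu z) \<le> enn2real (lap (conj_vec z))"
      using fin k3(1) weight_nu_pos[OF z0] by simp
    moreover have "k3 * (1 / weight_nu z) > 0" using k3(1) weight_nu_pos[OF z0] by simp
    ultimately have "enn2real (lap (conj_vec z)) > 0" by linarith
    then show ?thesis using l k3(1) weight_nu_pos[OF z0] unfolding weight_tilde_def L2_norm_exp by (simp add: field_simps)
  qed
  then show ?thesis using k3(1) by (meson divide_pos_pos zero_less_one)
qed

lemma weight_tilde_near_zero: "\<exists>k>0. \<forall>z. norm z \<le> 1 \<longrightarrow> weight_tilde z \<le> k"
proof -
  obtain k1 k2 where k1: "k1 > 0" "\<And>w. norm w \<le> 1 \<Longrightarrow> ennreal k1 \<le> lap w" "\<And>w. norm w \<le> 1 \<Longrightarrow> lap w \<le> ennreal k2"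
    using lap_near_zero[OF bdim_complex(2)] by blast
  have "weight_tilde z \<le> 1 / k1" if z: "norm z \<le> 1" for z
  proof -
    have "lap (conj_vec z) < top" using k1(3)[of "conj_vec z"] z by (auto intro: le_less_trans)
    then have "k1 \<le> enn2real (lap (conj_vec z))" using enn2real_mono[OF k1(2)[of "conj_vec z"]] z k1(1) by simp
    then show ?thesis using k1(1) unfolding weight_tilde_def L2_norm_exp by (intro divide_left_mono) auto
  qed
  then show ?thesis using k1(1) by (intro exI[of _ "1 / k1"]) auto
qed

lemma omega_tilde_nu_isomorphic: "identity_isomorphism (omega_tilde \<Omega>) (nu \<Omega>)"
proof -
  obtain m where mu: "monge_ampere (support_function \<Omega>) = density lborel (\<lambda>z. ennreal (m z))"
    and m: "m \<in> borel_measurable borel" "continuous_on (- {0}) m" "\<And>z. z \<noteq> 0 \<Longrightarrow> m z > 0"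
    and ti: "\<And>f :: complex^'n \<Rightarrow> complex. f \<in> test_functions \<Longrightarrow> integrable (monge_ampere (support_function \<Omega>)) f"
    and hc: "continuous_on UNIV (support_function \<Omega>)" by (rule monge_ampere_density) blast
  define \<mu> where "\<mu> = density lborel (\<lambda>z. ennreal (m z))"
  have fin: "emeasure \<mu> (cball 0 1) < \<infinity>"
  proof -
    \<comment> \<open>A test function that is at least 1 on the unit ball, so that its integrability
      bounds the mass there.\<close>
    define f where "f z = complex_of_real (max 0 (2 - norm z))" for z :: "complex^'n"
    have "continuous_on UNIV f" unfolding f_def by (intro continuous_intros)
    moreover have "\<forall>z. z \<notin> cball 0 2 \<longrightarrow> f z = 0" by (auto simp: f_def)
    moreover have "compact (cball 0 2 :: (complex^'n) set)" by (rule compact_cball)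
    ultimately have "f \<in> test_functions" unfolding test_functions_def mem_Collect_eq by (intro conjI exI[of _ "cball 0 2"])
    then have "integrable \<mu> f" using ti mu by (simp add: \<mu>_def)
    then have f: "(\<integral>\<^sup>+z. ennreal (norm (f z)) \<partial>\<mu>) < \<infinity>" by (simp add: integrable_iff_bounded)
    have "emeasure \<mu> (cball 0 1) = (\<integral>\<^sup>+z. indicator (cball 0 1) z \<partial>\<mu>)" by (simp add: \<mu>_def)
    also have "\<dots> \<le> (\<integral>\<^sup>+z. ennreal (norm (f z)) \<partial>\<mu>)"
      by (intro nn_integral_mono) (auto simp: f_def indicator_def ennreal_1[symmetric] simp del: ennreal_1 intro!: ennreal_leI)
    finally show ?thesis using f by simp
  qed
  have wbm: "weight_nu \<in> borel_measurable borel"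
    unfolding weight_nu_def[abs_def] using borel_measurable_continuous_onI[OF hc] by measurable
  obtain k1 where k1: "k1 > 0" "\<And>z. z \<noteq> 0 \<Longrightarrow> weight_nu z \<le> k1 * weight_tilde z" using weight_nu_le_tilde by blast
  obtain k2 where k2: "k2 > 0" "\<And>z. norm z \<ge> 1 \<Longrightarrow> weight_tilde z \<le> k2 * weight_nu z" using weight_tilde_le_nu by blast
  obtain k3 where k3: "k3 > 0" "\<And>z. norm z \<le> 1 \<Longrightarrow> weight_tilde z \<le> k3" using weight_tilde_near_zero by blast
  define K where "K = k1 + k2 + k3"
  have K: "K > 0" "k1 \<le> K" "k2 \<le> K" "k3 \<le> K" using k1 k2 k3 by (auto simp: K_def)
  have wa0: "weight_tilde z \<ge> 0" and wb0: "weight_nu z \<ge> 0" for z by (auto simp: weight_tilde_def weight_nu_def)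
  have "\<exists>k>0. \<forall>z. 3 \<le> norm z \<longrightarrow> norm z \<le> 7 \<longrightarrow> k \<le> weight_nu z * m z"
  proof -
    define S where "S = cball 0 7 \<inter> {z :: complex^'n. 3 \<le> norm z}"
    have "closed {z :: complex^'n. 3 \<le> norm z}" by (intro closed_Collect_le continuous_intros)
    then have S: "compact S" unfolding S_def by (intro compact_Int_closed compact_cball)
    have sub: "S \<subseteq> - {0}" by (auto simp: S_def)
    have "continuous_on S (\<lambda>z. weight_nu z * m z)" unfolding weight_nu_def
      by (intro continuous_intros continuous_on_subset[OF m(2) sub] continuous_on_subset[OF hc]) (use sub in auto)
    moreover obtain x :: "complex^'n" where "norm x = 5" using vector_choose_size[of 5] by auto
    then have "x \<in> S" by (simp add: S_def)
    then have "S \<noteq> {}" by blast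
    ultimately obtain x where x: "x \<in> S" "\<And>z. z \<in> S \<Longrightarrow> weight_nu x * m x \<le> weight_nu z * m z" using continuous_attains_inf[OF S] by blast
    have "x \<noteq> 0" using x(1) sub by auto
    then have "weight_nu x * m x > 0" by (intro mult_pos_pos weight_nu_pos m(3))
    then show ?thesis using x(2) by (intro exI[of _ "weight_nu x * m x"]) (auto simp: S_def)
  qed
  then obtain k where k: "k > 0" "\<And>z. 3 \<le> norm z \<Longrightarrow> norm z \<le> 7 \<Longrightarrow> k \<le> weight_nu z * m z" by blast
  have "identity_isomorphism (density \<mu> (\<lambda>z. ennreal (weight_tilde z))) (density \<mu> (\<lambda>z. ennreal (weight_nu z)))"
    unfolding \<mu>_def
  proof (rule comparable_weights_isomorphism[OF m(1) weight_tilde_measurable wbm wb0 K(1)])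
    show "weight_nu z \<le> K * weight_tilde z" for z
    proof (cases "z = 0")
      case True
      then show ?thesis using wa0[of z] K(1) by (simp add: weight_nu_def)
    next
      case False
      then show ?thesis using k1(2)[OF False] mult_right_mono[OF K(2) wa0[of z]] by linarith
    qed
    show "weight_tilde z \<le> K * weight_nu z" if "norm z \<ge> 1" for z using k2(2)[OF that] mult_right_mono[OF K(3) wb0[of z]] by linarith
    show "weight_tilde z \<le> K" if "norm z \<le> 1" for z using k3(2)[OF that] K(4) by linarith
    show "k \<le> weight_nu z * m z \<and> m z > 0" if "3 \<le> norm z" "norm z \<le> 7" for z
    proof -
      have "z \<noteq> 0" using that by auto
      then show ?thesis using k(2)[OF that] m(3) by blast
    qed
  qed (use k fin \<mu>_def in auto)
  then show ?thesis unfolding omega_tilde_def nu_def mu \<mu>_def weight_tilde_def weight_nu_def .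
qed

end

theorem proposition7p2:
  fixes \<Omega> :: "(complex^'n::finite) set"
  assumes "bounded \<Omega>" and "strongly_convex_domain \<Omega>"
  shows "identity_isomorphism (omega_tilde \<Omega>) (nu \<Omega>)"
proof -
  obtain nv c C e where "smooth_convex_body \<Omega> nv c C e" using strongly_convex_imp_body[OF assms] by blast
  then interpret smooth_convex_body_complex \<Omega> nv c C e by (simp add: smooth_convex_body_complex_def)
  show ?thesis by (rule omega_tilde_nu_isomorphic)
qed

end
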